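(* For every $\varepsilon>0$ and every $\Delta\in\mathbb{N}$ there exist $\alpha_0>0$ and $d_0$ such that the following holds for all $0<\alpha<\alpha_0$ and all $d\geq d_0$. If $H$ is an $\alpha$-separable bipartite graph with at most $(1-\varepsilon)d$ vertices and maximum degree $\Delta(H)\leq\Delta$, and $G$ is a graph with average degree at least $d$, then $G$ contains a subdivision of $H$.
   Context: All graphs are finite and simple. The average degree of $G$ is $d(G)=2e(G)/|G|$. A graph $H$ is $\alpha$-separable if there exists a set $S\subseteq V(H)$ of at most $\alpha|H|$ vertices such that every connected component of $H-S$ has at most $\alpha|H|$ vertices. A subdivision of $H$ is a graph obtained from $H$ by replacing its edges with pairwise internally vertex-disjoint paths (of length at least one) between the corresponding endpoints. *)

theory Defs
  imports Complex_Main "Graph_Theory.Graph_Theory"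
begin

text \<open>
  A finite simple graph is a \<^locale>\<open>pair_graph\<close>: a finite vertex set with a symmetric irreflexive
  set of arcs. An undirected edge \<open>uv\<close> is thus present as the two arcs \<open>(u, v)\<close> and \<open>(v, u)\<close>, so
  the degree of a vertex is its out-degree.
\<close>

definition edges :: "'a pair_pre_digraph \<Rightarrow> 'a set set" where
  "edges G = (\<lambda>(u, v). {u, v}) ` parcs G"

definition average_degree :: "'a pair_pre_digraph \<Rightarrow> real" where
  "average_degree G = 2 * real (card (edges G)) / real (card (pverts G))"

text \<open>The maximum degree of the graph without vertices is \<open>0\<close>.\<close>

definition max_degree :: "'a pair_pre_digraph \<Rightarrow> nat" where
  "max_degree G = Max (insert 0 (out_degree (with_proj G) ` pverts G))"

definition bipartite :: "'a pair_pre_digraph \<Rightarrow> bool" where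
  "bipartite G \<longleftrightarrow> (\<exists>A B. pverts G = A \<union> B \<and> A \<inter> B = {} \<and> parcs G \<subseteq> A \<times> B \<union> B \<times> A)"

text \<open>
  Since the arc set is symmetric, the strongly connected components are the connected components
  of the undirected graph.
\<close>

definition separable :: "real \<Rightarrow> 'a pair_pre_digraph \<Rightarrow> bool" where
  "separable \<alpha> H \<longleftrightarrow>
    (\<exists>S \<subseteq> pverts H.
       real (card S) \<le> \<alpha> * real (card (pverts H)) \<and>
       (\<forall>C \<in> pre_digraph.sccs (with_proj H \<restriction> (pverts H - S)).
          real (card (verts C)) \<le> \<alpha> * real (card (pverts H))))"

text \<open>
  \<open>K\<close> is a subdivision of \<open>H\<close>: the map \<open>f\<close> sends the vertices of \<open>H\<close> to the branch vertices, and
  \<open>P (u, v)\<close> is the path of \<open>K\<close> that replaces the edge \<open>uv\<close>, traversed from \<open>f u\<close> to \<open>f v\<close>; the arc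
  \<open>(v, u)\<close> gets the same path backwards. Each path has length at least one because \<open>f u \<noteq> f v\<close>.
  The last two conditions say that \<open>K\<close> has no other vertices and edges. The vertex types may differ,
  which the constant \<^const>\<open>subdivision\<close> (iterated subdivision of single edges) does not allow.
\<close>

definition is_subdivision_of :: "'b pair_pre_digraph \<Rightarrow> 'a pair_pre_digraph \<Rightarrow> bool" where
  "is_subdivision_of K H \<longleftrightarrow>
    pair_graph K \<and>
    (\<exists>(f :: 'a \<Rightarrow> 'b) (P :: 'a \<times> 'a \<Rightarrow> ('b \<times> 'b) awalk).
       inj_on f (pverts H) \<and>
       (\<forall>(u, v) \<in> parcs H.
          pre_digraph.apath (with_proj K) (f u) (P (u, v)) (f v) \<and>
          P (v, u) = rev_path (P (u, v)) \<and>
          set (pre_digraph.inner_verts (with_proj K) (P (u, v))) \<inter> f ` pverts H = {}) \<and>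
       (\<forall>(u, v) \<in> parcs H. \<forall>(x, y) \<in> parcs H. {u, v} \<noteq> {x, y} \<longrightarrow>
          set (pre_digraph.inner_verts (with_proj K) (P (u, v))) \<inter>
          set (pre_digraph.inner_verts (with_proj K) (P (x, y))) = {}) \<and>
       pverts K = f ` pverts H \<union>
         (\<Union>e \<in> parcs H. set (pre_digraph.inner_verts (with_proj K) (P e))) \<and>
       parcs K = (\<Union>e \<in> parcs H. set (P e)))"

definition contains_subdivision :: "'b pair_pre_digraph \<Rightarrow> 'a pair_pre_digraph \<Rightarrow> bool" where
  "contains_subdivision G H \<longleftrightarrow>
    (\<exists>K. subgraph (with_proj K) (with_proj G) \<and> is_subdivision_of K H)"

end

theory Submission
  imports Defs
begin

text \<open>
  Pass to a subgraph of \<open>G\<close> that is almost as dense and has no separation whose order is a small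
  multiple of \<open>d\<close> (Mader). Suppose first that some subgraph whose average degree is proportional to
  \<open>d\<close> contains no dense pair of vertex sets of size proportional to \<open>d\<close>. Contracting small stars
  then gives a much denser minor; its highly connected part is linked by the theorem of Thomas and
  Wollan, and every graph of bounded degree on \<open>d\<close> vertices is a topological subgraph.

  Otherwise dense pairs occur everywhere, and by density increment each contains a tile: a pair
  \<open>(A, B)\<close> in which any two large subsets are joined by many edges. Disjoint tiles can be made to
  cover almost \<open>d\<close> vertices, because counting degrees gives many edges between a smaller family of
  tiles and the uncovered vertices, so that some tile can be split and extended by uncovered vertices.
  The components of \<open>H - S\<close> are embedded one at a time into the tiles, keeping the two sides of each
  tile balanced by exchanging the colour classes; \<open>S\<close> goes into a single tile. The few edges at \<open>S\<close>
  become paths that Menger's theorem provides between reserved vertices of the tiles. Taking these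
  paths with as few vertices as possible makes them occupy little of each tile, since a path that
  visits a tile often could be rerouted through the reserve.
\<close>

section \<open>Connected sets and dense pairs\<close>

text \<open>The order of choices is the main obstacle: the routes at \<open>S\<close> have to be
  fixed before the components are embedded, because the embedding must avoid them, yet only the
  embedding reveals in which tile the far end of an edge at \<open>S\<close> lies. So a route is
  reserved for every pair of an arc at \<open>S\<close> and a tile. This costs about \<Delta> times
  \<open>card S\<close> times the number of tiles; hence tiles need linear size, so that their
  number is bounded, and \<alpha> is chosen after that number. In the sparse case a dense minor
  alone does not suffice: a branch vertex must be one vertex with up to \<Delta> disjoint exits, not
  a contracted set. Therefore every contracted set carries a few private neighbours, and by
  pigeonhole one of them sees enough other sets. Paths are handled as connected vertex sets, which
  compose by unions and survive contraction; \<open>conn_trim\<close> does the work of shortest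
  paths. Arc sets are symmetric, so \<open>card E / card V\<close> is the average degree
  itself.\<close>

definition conn :: "('a \<times> 'a) set => 'a set => bool" where
  "conn E C \<longleftrightarrow> C ~= {} & (\<forall>x\<in>C. \<forall>y\<in>C. (x, y) \<in> (E Int C \<times> C)\<^sup>*)"

lemma conn_single: "conn E {x}"
  by (simp add: conn_def)

lemma conn_mono: "conn E C ==> E Int C \<times> C \<subseteq> E' ==> conn E' C"
proof -
  assume a: "conn E C" "E Int C \<times> C \<subseteq> E'"
  then have "(E Int C \<times> C)\<^sup>* \<subseteq> (E' Int C \<times> C)\<^sup>*" by (intro rtrancl_mono) auto
  then show ?thesis using a unfolding conn_def by blast
qed

lemma sym_restrict: "sym E ==> sym (E Int C \<times> C)"
  by (auto simp: sym_def)

lemma conn_rootI: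
  assumes "sym E" "r \<in> C" "!!x. x \<in> C ==> (r, x) \<in> (E Int C \<times> C)\<^sup>*"
  shows "conn E C"
  unfolding conn_def
proof (intro conjI ballI)
  show "C ~= {}" using assms(2) by auto
  fix x y assume "x \<in> C" "y \<in> C"
  have "(x, r) \<in> (E Int C \<times> C)\<^sup>*"
    using assms(3)[OF \<open>x \<in> C\<close>] sym_rtrancl[OF sym_restrict[OF assms(1)]] by (meson symD)
  then show "(x, y) \<in> (E Int C \<times> C)\<^sup>*" using assms(3)[OF \<open>y \<in> C\<close>] by simp
qed

text \<open>Uncontraction: \<open>M\<close> is a relation between indices, for instance the
  adjacency of a minor with branch sets \<open>W l\<close>.\<close>

lemma conn_UN:
  assumes "sym E" "conn M C" "!!l. l \<in> C ==> conn E (W l)"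
    and "!!l l'. l \<in> C ==> l' \<in> C ==> (l, l') \<in> M ==> \<exists>u\<in>W l. \<exists>v\<in>W l'. (u, v) \<in> E"
  shows "conn E (\<Union>l\<in>C. W l)"
proof -
  let ?U = "\<Union>l\<in>C. W l"
  obtain l0 where l0: "l0 \<in> C" using assms(2) by (auto simp: conn_def)
  obtain r where r: "r \<in> W l0" using assms(3)[OF l0] by (auto simp: conn_def)
  have W: "(x, y) \<in> (E Int ?U \<times> ?U)\<^sup>*" if "l \<in> C" "x \<in> W l" "y \<in> W l" for l x y
  proof -
    have "(x, y) \<in> (E Int W l \<times> W l)\<^sup>*" using assms(3)[OF that(1)] that by (auto simp: conn_def)
    moreover have "E Int W l \<times> W l \<subseteq> E Int ?U \<times> ?U" using that by auto
    ultimately show ?thesis using rtrancl_mono by blast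
  qed
  have reach: "\<forall>x\<in>W l. (r, x) \<in> (E Int ?U \<times> ?U)\<^sup>*" if "(l0, l) \<in> (M Int C \<times> C)\<^sup>*" for l
    using that
  proof (induction rule: rtrancl_induct)
    case base then show ?case using W[OF l0 r] by auto
  next
    case (step l l')
    then obtain u v where uv: "u \<in> W l" "v \<in> W l'" "(u, v) \<in> E" using assms(4) by blast
    have "(u, v) \<in> E Int ?U \<times> ?U" using uv step by auto
    moreover have "(r, u) \<in> (E Int ?U \<times> ?U)\<^sup>*" using step uv by auto
    ultimately have "(r, v) \<in> (E Int ?U \<times> ?U)\<^sup>*" by (rule rtrancl.rtrancl_into_rtrancl[rotated])
    then show ?case using W[of l' v] step uv by (auto intro: rtrancl_trans)
  qed
  show ?thesis
  proof (rule conn_rootI[OF assms(1), of r])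
    show "r \<in> ?U" using l0 r by auto
    fix x assume "x \<in> ?U"
    then obtain l where "l \<in> C" "x \<in> W l" by auto
    then show "(r, x) \<in> (E Int ?U \<times> ?U)\<^sup>*" using reach[of l] assms(2) l0 by (auto simp: conn_def)
  qed
qed

lemma conn_Un_edge:
  assumes "sym E" "conn E C" "conn E D" "x \<in> C" "y \<in> D" "(x, y) \<in> E"
  shows "conn E (C Un D)"
proof -
  let ?R = "E Int (C Un D) \<times> (C Un D)"
  have a: "(E Int C \<times> C)\<^sup>* \<subseteq> ?R\<^sup>*" "(E Int D \<times> D)\<^sup>* \<subseteq> ?R\<^sup>*"
    by (rule rtrancl_mono; auto)+
  have xy: "(x, y) \<in> ?R" using assms by auto
  have 1: "(x, z) \<in> ?R\<^sup>*" if "z \<in> C" for z using assms a that by (auto simp: conn_def)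
  have 2: "(y, z) \<in> ?R\<^sup>*" if "z \<in> D" for z using assms a that unfolding conn_def by blast
  have 3: "(x, z) \<in> ?R\<^sup>*" if "z \<in> D" for z using 2[OF that] xy by (rule converse_rtrancl_into_rtrancl[rotated])
  show ?thesis by (rule conn_rootI[OF assms(1), of x]) (use 1 3 assms in auto)
qed

lemma conn_Un_int:
  assumes "sym E" "conn E C" "conn E D" "C Int D ~= {}"
  shows "conn E (C Un D)"
proof -
  obtain r where r: "r \<in> C" "r \<in> D" using assms(4) by auto
  have a: "(E Int C \<times> C)\<^sup>* \<subseteq> (E Int (C Un D) \<times> (C Un D))\<^sup>*" "(E Int D \<times> D)\<^sup>* \<subseteq> (E Int (C Un D) \<times> (C Un D))\<^sup>*"
    by (rule rtrancl_mono; auto)+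
  have "(r, z) \<in> (E Int (C Un D) \<times> (C Un D))\<^sup>*" if "z \<in> C Un D" for z
    using r a assms that unfolding conn_def by blast
  then show ?thesis using conn_rootI[OF assms(1), of r] r by blast
qed

lemma conn_insert:
  assumes "sym E" "conn E C" "x \<in> C" "(x, y) \<in> E"
  shows "conn E (insert y C)"
  using conn_Un_edge[OF assms(1,2) conn_single[of E y] assms(3) _ assms(4)] by simp

lemma conn_leaves:
  assumes "conn E C" "D \<subseteq> C" "D ~= {}" "D ~= C"
  shows "\<exists>x\<in>D. \<exists>y\<in>C - D. (x, y) \<in> E"
proof (rule ccontr)
  assume no: "~ ?thesis"
  obtain x where x: "x \<in> D" using assms by auto
  obtain y where y: "y \<in> C" "y \<notin> D" using assms by auto
  have "z \<in> D" if "(x, z) \<in> (E Int C \<times> C)\<^sup>*" for z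
    using that by (induction rule: rtrancl_induct) (use x no in auto)
  moreover have "(x, y) \<in> (E Int C \<times> C)\<^sup>*" using assms x y by (auto simp: conn_def)
  ultimately show False using y by auto
qed

definition reach :: "('a \<times> 'a) set => 'a set => 'a => 'a set" where
  "reach E S x = {y. (x, y) \<in> (E Int S \<times> S)\<^sup>*}"

lemma reach_self: "x \<in> reach E S x"
  by (simp add: reach_def)

lemma reach_subset: "x \<in> S ==> reach E S x \<subseteq> S"
proof
  fix y assume "x \<in> S" "y \<in> reach E S x"
  then have "(x, y) \<in> (E Int S \<times> S)\<^sup>*" by (simp add: reach_def)
  then show "y \<in> S" by (induction rule: rtrancl_induct) (use \<open>x \<in> S\<close> in auto)
qed

lemma reach_closed: "y \<in> reach E S x ==> x \<in> S ==> (y, z) \<in> E ==> z \<in> S ==> z \<in> reach E S x"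
proof -
  assume a: "y \<in> reach E S x" "x \<in> S" "(y, z) \<in> E" "z \<in> S"
  then have "y \<in> S" using reach_subset by fast
  then show ?thesis using a unfolding reach_def by (auto intro: rtrancl.rtrancl_into_rtrancl)
qed

lemma conn_reach:
  assumes "sym E" "x \<in> S" shows "conn E (reach E S x)"
proof (rule conn_rootI[OF assms(1) reach_self])
  fix y assume "y \<in> reach E S x"
  then have "(x, y) \<in> (E Int S \<times> S)\<^sup>*" by (simp add: reach_def)
  then show "(x, y) \<in> (E Int reach E S x \<times> reach E S x)\<^sup>*"
  proof (induction rule: rtrancl_induct)
    case (step y z)
    then have "y \<in> reach E S x" by (simp add: reach_def)
    moreover have "z \<in> reach E S x" using step reach_closed[OF \<open>y \<in> reach E S x\<close> assms(2), of z] by auto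
    ultimately show ?case using step by (meson IntD1 IntI SigmaI rtrancl.rtrancl_into_rtrancl)
  qed simp
qed

text \<open>A proper connected subset through \<open>r\<close> of maximum size misses exactly one
  vertex, since an edge leaving it could otherwise enlarge it.\<close>

lemma conn_noncut:
  assumes "sym E" "finite C" "conn E C" "r \<in> C" "C ~= {r}"
  shows "\<exists>v\<in>C - {r}. conn E (C - {v})"
proof -
  let ?S = "{D. D \<subseteq> C & D ~= C & r \<in> D & conn E D}"
  have "finite ?S" using assms(2) by simp
  moreover have "{r} \<in> ?S" using assms conn_single[of E r] by blast
  ultimately have "Max (card ` ?S) \<in> card ` ?S" by (intro Max_in) auto
  then obtain D where D1: "D \<in> ?S" "card D = Max (card ` ?S)" by (metis (no_types, lifting) imageE)
  have D2: "card D' <= card D" if "D' \<in> ?S" for D'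
    using D1(2) that \<open>finite ?S\<close> by (metis (no_types, lifting) Max_ge finite_imageI imageI)
  note D = D1(1) D2
  then obtain x v where v: "x \<in> D" "v \<in> C - D" "(x, v) \<in> E"
    using conn_leaves[OF assms(3), of D] by auto
  have c: "conn E (insert v D)" using conn_insert[OF assms(1) _ v(1,3)] D by auto
  have "insert v D = C"
  proof (rule ccontr)
    assume "insert v D ~= C"
    then have "insert v D \<in> ?S" using c D v by auto
    from D(2)[OF this] show False using v D1(1) assms(2) finite_subset[of D C] by auto
  qed
  then have "C - {v} = D" using v by auto
  then show ?thesis using v D by auto
qed

text \<open>Takes the place of a shortest path from \<open>A\<close> to \<open>B\<close>. A
  connected set with at least two vertices has two vertices whose deletion does not disconnect it.
  If neither may be deleted, each of them is the only vertex of the set in \<open>A\<close> or the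
  only one in \<open>B\<close>; being distinct, they settle one set each.\<close>

lemma conn_trim:
  assumes "sym E" "finite C" "conn E C" "C Int A ~= {}" "C Int B ~= {}"
  shows "\<exists>D a b. D \<subseteq> C & conn E D & D Int A = {a} & D Int B = {b}"
  using assms(2-)
proof (induction "card C" arbitrary: C rule: less_induct)
  case less
  show ?case
  proof (cases "\<exists>v\<in>C. conn E (C - {v}) & (C - {v}) Int A ~= {} & (C - {v}) Int B ~= {}")
    case True
    then obtain v where v: "v \<in> C" "conn E (C - {v})" "(C - {v}) Int A ~= {}" "(C - {v}) Int B ~= {}" by auto
    have "card (C - {v}) < card C" using v less by (meson card_Diff1_less)
    from less(1)[OF this _ v(2,3,4)] less(2) show ?thesis by (meson Diff_subset finite_Diff order_trans)
  next
    case False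
    have one: "C Int A = {v} | C Int B = {v}" if "v \<in> C" "conn E (C - {v})" for v
      using False that less by blast
    obtain r where r: "r \<in> C" using less by (auto simp: conn_def)
    show ?thesis
    proof (cases "C = {r}")
      case True then show ?thesis using less by blast
    next
      case False
      obtain v where v: "v \<in> C - {r}" "conn E (C - {v})" using conn_noncut[OF assms(1) less(2,3) r False] by auto
      then have "C ~= {v}" using r by auto
      \<comment> \<open>Taking \<open>v\<close> as the root of the second application makes the two
        deletable vertices distinct.\<close>
      then obtain w where w: "w \<in> C - {v}" "conn E (C - {w})" using conn_noncut[OF assms(1) less(2,3), of v] v by auto
      have "C Int A = {v} | C Int B = {v}" "C Int A = {w} | C Int B = {w}" "v ~= w" using one v w by auto
      then show ?thesis using less(3) by auto
    qed
  qed
qed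

text \<open>The first disjunct covers edges that are not subdivided.\<close>

definition lnk :: "('a \<times> 'a) set => 'a set => 'a => 'a => bool" where
  "lnk E I x y \<longleftrightarrow> (x, y) \<in> E |
     (\<exists>C\<subseteq>I. conn E C & (\<exists>u\<in>C. (x, u) \<in> E) & (\<exists>v\<in>C. (y, v) \<in> E))"

section \<open>Edge counts and averaging\<close>

definition ecard :: "('a \<times> 'a) set => 'a set => 'a set => nat" where
  "ecard E X Y = card (E Int X \<times> Y)"

lemma ecard_sum:
  assumes "finite X" "finite Y"
  shows "ecard E X Y = (\<Sum>x\<in>X. card (E `` {x} Int Y))"
proof -
  have "E Int X \<times> Y = Sigma X (%x. E `` {x} Int Y)" by auto
  then show ?thesis unfolding ecard_def using assms by (simp add: card_SigmaI)
qed

lemma ecard_commute: "sym E ==> ecard E X Y = ecard E Y X"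
proof -
  assume s: "sym E"
  have "bij_betw prod.swap (E Int X \<times> Y) (E Int Y \<times> X)"
    by (rule bij_betw_byWitness[where f' = prod.swap]) (use s in \<open>auto simp: sym_def\<close>)
  then show ?thesis unfolding ecard_def by (rule bij_betw_same_card)
qed

lemma ecard_le: "finite X ==> finite Y ==> ecard E X Y <= card X * card Y"
  unfolding ecard_def by (metis card_cartesian_product card_mono finite_cartesian_product Int_lower2)

lemma ecard_Un1: "finite X ==> finite X' ==> finite Y ==> X Int X' = {} ==> ecard E (X Un X') Y = ecard E X Y + ecard E X' Y"
  by (simp add: ecard_sum sum.union_disjoint)

lemma ecard_Un2: "finite X ==> finite Y ==> finite Y' ==> Y Int Y' = {} ==> ecard E X (Y Un Y') = ecard E X Y + ecard E X Y'"
proof -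
  assume a: "finite X" "finite Y" "finite Y'" "Y Int Y' = {}"
  have "E Int X \<times> (Y Un Y') = (E Int X \<times> Y) Un (E Int X \<times> Y')" by auto
  moreover have "(E Int X \<times> Y) Int (E Int X \<times> Y') = {}" using a by auto
  ultimately show ?thesis unfolding ecard_def using a by (simp add: card_Un_disjoint)
qed

lemma ecard_Un_le: "finite X ==> finite Y ==> finite Y' ==> ecard E X (Y Un Y') <= ecard E X Y + ecard E X Y'"
proof -
  have "E Int X \<times> (Y Un Y') = (E Int X \<times> Y) Un (E Int X \<times> Y')" by auto
  then show ?thesis unfolding ecard_def by (metis card_Un_le)
qed

text \<open>Discarding elements of at most average weight one at a time never lowers the average.
  Cross-multiplied to stay within the natural numbers.\<close>

lemma sum_subset_high:
  fixes g :: "'a => nat"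
  assumes "finite X" "a <= card X"
  shows "\<exists>X0\<subseteq>X. card X0 = a & a * sum g X <= card X * sum g X0"
  using assms
proof (induction "card X" arbitrary: X)
  case 0 then show ?case by (intro exI[of _ X]) auto
next
  case (Suc n)
  show ?case
  proof (cases "a = Suc n")
    case True then show ?thesis using Suc by (intro exI[of _ X]) auto
  next
    case False
    have "\<exists>x\<in>X. Suc n * g x <= sum g X"
    proof (rule ccontr)
      assume "~ ?thesis"
      then have "(\<Sum>x\<in>X. sum g X) < (\<Sum>x\<in>X. Suc n * g x)"
        using Suc.hyps(2) by (intro sum_strict_mono) (auto simp: Suc.prems)
      then show False using Suc.hyps(2) by (simp add: sum_distrib_left[symmetric] del: mult_Suc)
    qed
    then obtain x where x: "x \<in> X" "Suc n * g x <= sum g X" by auto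
    let ?X = "X - {x}"
    have cX: "card ?X = n" using x Suc by (simp add: card_Diff_singleton)
    then obtain X0 where X0: "X0 \<subseteq> ?X" "card X0 = a" "a * sum g ?X <= n * sum g X0"
      using Suc.hyps(1)[of ?X] Suc.prems False Suc.hyps(2) by (metis finite_Diff le_SucE)
    have s: "sum g X = g x + sum g ?X" using x Suc by (simp add: sum.remove)
    have "n * sum g X <= Suc n * sum g ?X" using x(2) s by (simp add: algebra_simps)
    then have "n * (a * sum g X) <= Suc n * (a * sum g ?X)" by (metis mult.left_commute mult_le_mono2)
    also have "\<dots> <= Suc n * (n * sum g X0)" using X0(3) by (rule mult_le_mono2)
    finally have "n * (a * sum g X) <= n * (Suc n * sum g X0)" by (simp only: mult.left_commute)
    moreover have "n > 0 | a = 0" using False Suc.prems(2) Suc.hyps(2) by auto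
    ultimately have "a * sum g X <= Suc n * sum g X0" by auto
    then show ?thesis using X0 Suc.hyps(2) by (metis Diff_subset order_trans)
  qed
qed

text \<open>The complement of a subset of at least average weight.\<close>

lemma sum_subset_low:
  fixes g :: "'a => nat"
  assumes "finite X" "a <= card X"
  shows "\<exists>X0\<subseteq>X. card X0 = a & card X * sum g X0 <= a * sum g X"
proof -
  obtain X1 where X1: "X1 \<subseteq> X" "card X1 = card X - a" "(card X - a) * sum g X <= card X * sum g X1"
    using sum_subset_high[OF assms(1), of "card X - a" g] by auto
  have f: "finite X1" using X1 assms finite_subset by auto
  have "card (X - X1) = a" using X1 assms f by (simp add: card_Diff_subset)
  moreover have s: "sum g X = sum g X1 + sum g (X - X1)" using X1 assms by (simp add: sum.subset_diff add.commute)
  have "int (card X) * int (sum g (X - X1)) <= int a * int (sum g X)"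
  proof -
    have "(int (card X) - int a) * int (sum g X) <= int (card X) * int (sum g X1)"
      using X1(3) assms(2) by (metis of_nat_diff of_nat_le_iff of_nat_mult)
    then show ?thesis using s by (simp add: algebra_simps)
  qed
  then have "card X * sum g (X - X1) <= a * sum g X" by (metis of_nat_le_iff of_nat_mult)
  ultimately show ?thesis by (intro exI[of _ "X - X1"]) auto
qed

text \<open>Averaging over one side and then over the other. Prescribed sizes are needed because the
  density increment moves along the fixed scale \<open>r * q ^ t\<close>.\<close>

lemma ecard_subset_high:
  assumes "sym E" "finite X" "finite Y" "a <= card X" "b <= card Y" "0 < a" "0 < b"
    and "\<theta> * real (card X) * real (card Y) <= real (ecard E X Y)"
  shows "\<exists>X0\<subseteq>X. \<exists>Y0\<subseteq>Y. card X0 = a & card Y0 = b & \<theta> * real a * real b <= real (ecard E X0 Y0)"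
proof -
  obtain X0 where X0: "X0 \<subseteq> X" "card X0 = a" "a * ecard E X Y <= card X * ecard E X0 Y"
    using sum_subset_high[OF assms(2,4), of "%x. card (E `` {x} Int Y)"] assms
    by (metis ecard_sum finite_subset)
  have fX0: "finite X0" using X0 assms finite_subset by auto
  obtain Y0 where Y0: "Y0 \<subseteq> Y" "card Y0 = b" "b * ecard E Y X0 <= card Y * ecard E Y0 X0"
    using sum_subset_high[OF assms(3,5), of "%x. card (E `` {x} Int X0)"] assms fX0
    by (metis ecard_sum finite_subset)
  have p: "0 < real (card X)" "0 < real (card Y)" using assms by auto
  have 1: "real a * real (ecard E X Y) <= real (card X) * real (ecard E X0 Y)"
    using X0(3) by (metis of_nat_le_iff of_nat_mult)
  have 2: "real b * real (ecard E X0 Y) <= real (card Y) * real (ecard E X0 Y0)"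
    using Y0(3) ecard_commute[OF assms(1)] by (metis of_nat_le_iff of_nat_mult)
  have "real (card X) * (\<theta> * real a * real (card Y)) = real a * (\<theta> * real (card X) * real (card Y))"
    by (simp add: algebra_simps)
  also have "\<dots> <= real a * real (ecard E X Y)" using assms(8) by (intro mult_left_mono) auto
  finally have "\<theta> * real a * real (card Y) <= real (ecard E X0 Y)" using 1 p
    by (meson mult_le_cancel_left_pos order_trans)
  then have "real b * (\<theta> * real a * real (card Y)) <= real b * real (ecard E X0 Y)" by (intro mult_left_mono) auto
  also note 2
  finally have "real (card Y) * (\<theta> * real a * real b) <= real (card Y) * real (ecard E X0 Y0)"
    by (simp add: algebra_simps)
  then have "\<theta> * real a * real b <= real (ecard E X0 Y0)" using p by (meson mult_le_cancel_left_pos)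
  then show ?thesis using X0 Y0 by blast
qed

lemma ecard_subset_low:
  assumes "sym E" "finite X" "finite Y" "a <= card X" "b <= card Y" "0 < a" "0 < b"
    and "real (ecard E X Y) < \<theta> * real (card X) * real (card Y)"
  shows "\<exists>X0\<subseteq>X. \<exists>Y0\<subseteq>Y. card X0 = a & card Y0 = b & real (ecard E X0 Y0) < \<theta> * real a * real b"
proof -
  obtain X0 where X0: "X0 \<subseteq> X" "card X0 = a" "card X * ecard E X0 Y <= a * ecard E X Y"
    using sum_subset_low[OF assms(2,4), of "%x. card (E `` {x} Int Y)"] assms
    by (metis ecard_sum finite_subset)
  have fX0: "finite X0" using X0 assms finite_subset by auto
  obtain Y0 where Y0: "Y0 \<subseteq> Y" "card Y0 = b" "card Y * ecard E Y0 X0 <= b * ecard E Y X0"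
    using sum_subset_low[OF assms(3,5), of "%x. card (E `` {x} Int X0)"] assms fX0
    by (metis ecard_sum finite_subset)
  have p: "0 < real (card X)" "0 < real (card Y)" using assms by auto
  have 1: "real (card X) * real (ecard E X0 Y) <= real a * real (ecard E X Y)"
    using X0(3) by (metis of_nat_le_iff of_nat_mult)
  have 2: "real (card Y) * real (ecard E X0 Y0) <= real b * real (ecard E X0 Y)"
    using Y0(3) ecard_commute[OF assms(1)] by (metis of_nat_le_iff of_nat_mult)
  have "real a * real (ecard E X Y) < real a * (\<theta> * real (card X) * real (card Y))" using assms(6,8) by simp
  then have "real (card X) * real (ecard E X0 Y) < real (card X) * (\<theta> * real a * real (card Y))"
    using 1 by (simp add: algebra_simps)
  then have "real (ecard E X0 Y) < \<theta> * real a * real (card Y)" using p by simp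
  then have "real b * real (ecard E X0 Y) < real b * (\<theta> * real a * real (card Y))" using assms by simp
  then have "real (card Y) * real (ecard E X0 Y0) < real (card Y) * (\<theta> * real a * real b)"
    using 2 by (simp add: algebra_simps)
  then have "real (ecard E X0 Y0) < \<theta> * real a * real b" using p by simp
  then show ?thesis using X0 Y0 by blast
qed

section \<open>Joined pairs by density increment\<close>

text \<open>A one-sided regularity condition: only lower bounds, only for subsets of size at least
  \<open>m\<close>. It passes to subsets with the same \<open>m\<close>, so a tile stays usable
  after part of it has been occupied.\<close>

definition joined :: "('a \<times> 'a) set => nat => real => 'a set => 'a set => bool" where
  "joined E m \<rho> A B \<longleftrightarrow> (\<forall>A'\<subseteq>A. \<forall>B'\<subseteq>B. m <= card A' --> m <= card B' -->
     \<rho> * real (card A') * real (card B') <= real (ecard E A' B'))"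

lemma joined_subset: "joined E m \<rho> A B ==> A' \<subseteq> A ==> B' \<subseteq> B ==> joined E m \<rho> A' B'"
  unfolding joined_def by blast

lemma joined_swap: "sym E ==> joined E m \<rho> A B ==> joined E m \<rho> B A"
  unfolding joined_def by (metis ecard_commute mult.assoc mult.commute)

text \<open>Density increment. A pair with sides \<open>q * m\<close> that is not joined contains an
  \<open>m\<close> by \<open>m\<close> block of less than half its density. The edges missing there
  make one of two rectangles covering the rest denser by the factor
  \<open>1 + 1 / (2 * real q ^ 2)\<close>, and this rectangle is cut back to sides \<open>m\<close>.
  A density above 1 being impossible, this ends within \<open>t\<close> steps. The threshold uses
  the fixed \<theta>0 and not the growing \<theta>, so the final constant does not depend on the
  step.\<close>

lemma pair_iter:
  assumes "sym E" "2 <= q" "0 < \<theta>0" "\<theta>0 <= \<theta>" "0 < r"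
    and "finite X" "finite Y" "card X = r * q ^ t" "card Y = r * q ^ t"
    and "\<theta> * real (card X) * real (card Y) <= real (ecard E X Y)"
    and "1 < \<theta> * (1 + 1 / (2 * real q ^ 2)) ^ t"
  shows "\<exists>X'\<subseteq>X. \<exists>Y'\<subseteq>Y. \<exists>m\<ge>r. card X' = q * m & card Y' = q * m & q * m <= r * q ^ t & joined E m (\<theta>0 / 2) X' Y'"
  using assms(4,6-)
proof (induction t arbitrary: \<theta> X Y)
  case 0
  have "real (ecard E X Y) <= real r * real r" using ecard_le[OF 0(2,3), of E] 0(4,5)
    by (metis mult.right_neutral of_nat_le_iff of_nat_mult power_0)
  moreover have "\<theta> * (real r * real r) > 1 * (real r * real r)" using 0(7) assms(5)
    by (intro mult_strict_right_mono) auto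
  ultimately show ?case using 0 by simp
next
  case (Suc t)
  define m where "m = r * q ^ t"
  have mr: "m >= r" "m > 0" unfolding m_def using assms(2,5) by auto
  have cX: "card X = q * m" "card Y = q * m" using Suc by (auto simp: m_def)
  show ?case
  proof (cases "joined E m (\<theta>0 / 2) X Y")
    case True then show ?thesis using cX mr by (intro exI[of _ X] exI[of _ Y] exI[of _ m] conjI) (auto simp: m_def)
  next
    case False
    then obtain A' B' where AB': "A' \<subseteq> X" "B' \<subseteq> Y" "m <= card A'" "m <= card B'"
      "real (ecard E A' B') < \<theta>0 / 2 * real (card A') * real (card B')"
      unfolding joined_def by (meson not_le)
    have fin: "finite A'" "finite B'" using AB' Suc finite_subset by auto
    obtain A0 B0 where AB0: "A0 \<subseteq> A'" "B0 \<subseteq> B'" "card A0 = m" "card B0 = m"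
      "real (ecard E A0 B0) < \<theta>0 / 2 * real m * real m"
      using ecard_subset_low[OF assms(1) fin AB'(3,4) mr(2) mr(2) AB'(5)] by auto
    have fin0: "finite A0" "finite B0" using AB0 fin finite_subset by auto
    let ?X = "X - A0" and ?Y = "Y - B0"
    have sub: "A0 \<subseteq> X" "B0 \<subseteq> Y" using AB0 AB' by auto
    have c: "card ?X = (q - 1) * m" "card ?Y = (q - 1) * m"
      using sub fin0 cX AB0 by (auto simp: card_Diff_subset algebra_simps)
    have qm: "m <= (q - 1) * m" "m <= q * m" using assms(2) by auto
    define \<theta>' where "\<theta>' = \<theta> * (1 + 1 / (2 * real q ^ 2))"
    have "ecard E X Y = ecard E ?X Y + ecard E A0 Y"
      using ecard_Un1[of ?X A0 Y E] sub Suc fin0 by (simp add: Diff_disjoint Int_commute Un_absorb2)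
    moreover have "ecard E A0 Y = ecard E A0 ?Y + ecard E A0 B0"
      using ecard_Un2[of A0 ?Y B0 E] sub Suc fin0 by (simp add: Diff_disjoint Int_commute Un_absorb2)
    ultimately have tot: "real (ecard E X Y) = real (ecard E ?X Y) + real (ecard E A0 ?Y) + real (ecard E A0 B0)" by simp
    have q1: "real (q - 1) = real q - 1" using assms(2) by simp
    \<comment> \<open>In units of \<open>m * m\<close> the two rectangles have area
      \<open>q^2 - 1\<close>, and the sparse block contributes at most half a unit times \<theta>.
      If both rectangles stayed below the new density, the total would be less than \<theta> times
      \<open>q^2 - 1 / (2 * q^2)\<close>.\<close>
    have big: "\<theta>' * real (card ?X) * real (card Y) <= real (ecard E ?X Y) | \<theta>' * real (card A0) * real (card ?Y) <= real (ecard E A0 ?Y)"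
    proof (rule ccontr)
      assume neg: "~ ?thesis"
      have "real (ecard E X Y) < \<theta>' * real (card ?X) * real (card Y) + \<theta>' * real (card A0) * real (card ?Y) + \<theta> / 2 * (real m * real m)"
      proof -
        have "\<theta>0 / 2 * real m * real m <= \<theta> / 2 * (real m * real m)"
          using mult_right_mono[OF Suc.prems(1), of "real m * real m"] by (simp add: mult.assoc)
        then show ?thesis using tot AB0(5) neg by linarith
      qed
      also have "\<dots> = (real m * real m) * \<theta> * ((1 + 1 / (2 * real q ^ 2)) * (real q ^ 2 - 1) + 1 / 2)"
      proof -
        have "\<theta> * z * ((real q - 1) * real m) * (real q * real m) + \<theta> * z * real m * ((real q - 1) * real m) + \<theta> / 2 * (real m * real m)
          = (real m * real m) * \<theta> * (z * (real q ^ 2 - 1) + 1 / 2)" for z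
          by (simp add: power2_eq_square algebra_simps)
        then show ?thesis by (simp only: of_nat_mult q1 c cX AB0(3,4) \<theta>'_def)
      qed
      also have "(1 + 1 / (2 * real q ^ 2)) * (real q ^ 2 - 1) + 1 / 2 = real q ^ 2 - 1 / (2 * real q ^ 2)"
        using assms(2) by (simp add: field_simps)
      also have "(real m * real m) * \<theta> * (real q ^ 2 - 1 / (2 * real q ^ 2)) <= (real m * real m) * \<theta> * real q ^ 2"
        using Suc.prems(1) assms(3) by (intro mult_left_mono) auto
      also have "\<dots> = \<theta> * real (card X) * real (card Y)" unfolding cX by (simp add: power2_eq_square)
      finally show False using Suc.prems by simp
    qed
    have "\<theta> * 1 <= \<theta>'" unfolding \<theta>'_def using Suc.prems(1) assms(3) by (intro mult_left_mono) auto
    then have \<theta>'0: "\<theta>0 <= \<theta>'" using Suc.prems(1) by linarith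
    have "\<exists>X0\<subseteq>X. \<exists>Y0\<subseteq>Y. card X0 = m & card Y0 = m & \<theta>' * real m * real m <= real (ecard E X0 Y0)"
      using big
    proof
      assume a: "\<theta>' * real (card ?X) * real (card Y) <= real (ecard E ?X Y)"
      have "\<exists>X0\<subseteq>?X. \<exists>Y0\<subseteq>Y. card X0 = m & card Y0 = m & \<theta>' * real m * real m <= real (ecard E X0 Y0)"
        by (rule ecard_subset_high[OF assms(1) _ _ _ _ mr(2) mr(2) a]) (use Suc qm c cX in auto)
      then show ?thesis by blast
    next
      assume a: "\<theta>' * real (card A0) * real (card ?Y) <= real (ecard E A0 ?Y)"
      have "\<exists>X0\<subseteq>A0. \<exists>Y0\<subseteq>?Y. card X0 = m & card Y0 = m & \<theta>' * real m * real m <= real (ecard E X0 Y0)"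
        by (rule ecard_subset_high[OF assms(1) _ _ _ _ mr(2) mr(2) a]) (use Suc qm c cX AB0 fin0 in auto)
      then show ?thesis using sub by blast
    qed
    then obtain X0 Y0 where XY0: "X0 \<subseteq> X" "Y0 \<subseteq> Y" "card X0 = m" "card Y0 = m" "\<theta>' * real m * real m <= real (ecard E X0 Y0)" by auto
    have "\<exists>X'\<subseteq>X0. \<exists>Y'\<subseteq>Y0. \<exists>m\<ge>r. card X' = q * m & card Y' = q * m & q * m <= r * q ^ t & joined E m (\<theta>0 / 2) X' Y'"
      by (rule Suc.IH[OF \<theta>'0]) (use XY0 Suc.prems finite_subset[OF XY0(1)] finite_subset[OF XY0(2)] in \<open>auto simp: m_def \<theta>'_def mult.assoc mult.commute\<close>)
    moreover have "r * q ^ t <= r * q ^ Suc t" using assms(2) by simp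
    ultimately show ?thesis using XY0 by (meson order_trans)
  qed
qed

text \<open>\<open>T\<close> depends only on \<open>q\<close> and \<theta>, so a dense pair of
  linear size yields a joined pair of linear size.\<close>

lemma dense_pair_joined:
  fixes \<theta> :: real
  assumes "2 <= q" "0 < \<theta>"
  obtains T where "!!(E :: ('a \<times> 'a) set) X Y r. sym E ==> 0 < r ==> finite X ==> finite Y ==> r * q ^ T <= card X ==> r * q ^ T <= card Y
    ==> \<theta> * real (card X) * real (card Y) <= real (ecard E X Y)
    ==> \<exists>X'\<subseteq>X. \<exists>Y'\<subseteq>Y. \<exists>m\<ge>r. card X' = q * m & card Y' = q * m & q * m <= r * q ^ T & joined E m (\<theta> / 2) X' Y'"
proof -
  have "1 + 1 / (2 * real q ^ 2) > 1" using assms by simp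
  then obtain T where "1 / \<theta> < (1 + 1 / (2 * real q ^ 2)) ^ T"
    using real_arch_pow by blast
  then have T: "1 < \<theta> * (1 + 1 / (2 * real q ^ 2)) ^ T" using assms(2) by (simp add: field_simps)
  show ?thesis
  proof (rule that[of T])
    fix E :: "('a \<times> 'a) set" and X Y and r :: nat
    assume a: "sym E" "0 < r" "finite X" "finite Y" "r * q ^ T <= card X" "r * q ^ T <= card Y"
      "\<theta> * real (card X) * real (card Y) <= real (ecard E X Y)"
    have pos: "0 < r * q ^ T" using a assms by simp
    obtain X0 Y0 where XY: "X0 \<subseteq> X" "Y0 \<subseteq> Y" "card X0 = r * q ^ T" "card Y0 = r * q ^ T"
      "\<theta> * real (r * q ^ T) * real (r * q ^ T) <= real (ecard E X0 Y0)"
      using ecard_subset_high[OF a(1,3,4,5,6) pos pos a(7)] by auto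
    have "\<exists>X'\<subseteq>X0. \<exists>Y'\<subseteq>Y0. \<exists>m\<ge>r. card X' = q * m & card Y' = q * m & q * m <= r * q ^ T & joined E m (\<theta> / 2) X' Y'"
      by (rule pair_iter[OF a(1) assms order.refl a(2) _ _ XY(3,4) _ T])
         (use XY a finite_subset[OF XY(1)] finite_subset[OF XY(2)] in auto)
    then show "\<exists>X'\<subseteq>X. \<exists>Y'\<subseteq>Y. \<exists>m\<ge>r. card X' = q * m & card Y' = q * m & q * m <= r * q ^ T & joined E m (\<theta> / 2) X' Y'"
      using XY(1,2) by (meson order_trans)
  qed
qed

section \<open>Embedding into joined pairs, and hubs\<close>

lemma joined_edge:
  assumes "joined E m \<rho> A B" "0 < \<rho>" "0 < m" "A' \<subseteq> A" "B' \<subseteq> B" "m <= card A'" "m <= card B'"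
  shows "\<exists>a\<in>A'. \<exists>b\<in>B'. (a, b) \<in> E"
proof (rule ccontr)
  assume "~ ?thesis"
  then have "E Int A' \<times> B' = {}" by auto
  then have "ecard E A' B' = 0" by (simp add: ecard_def)
  moreover have "0 < \<rho> * real (card A') * real (card B')" using assms by auto
  ultimately show False using assms unfolding joined_def by (metis not_le of_nat_0)
qed

text \<open>If there were \<open>m\<close> such vertices, they would form a pair of density below
  \<rho> with \<open>B'\<close>.\<close>

lemma joined_few_low:
  assumes "joined E m \<rho> A B" "finite A" "finite B" "0 < m" "B' \<subseteq> B" "m <= card B'"
  shows "card {a \<in> A. real (card (E `` {a} Int B')) < \<rho> * real (card B')} < m"
proof (rule ccontr)
  let ?A = "{a \<in> A. real (card (E `` {a} Int B')) < \<rho> * real (card B')}"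
  assume n: "~ card ?A < m"
  have fB: "finite B'" and fA: "finite ?A" using assms finite_subset by auto
  have "\<rho> * real (card ?A) * real (card B') <= real (ecard E ?A B')"
    using assms(1,5,6) n unfolding joined_def by auto
  also have "\<dots> = (\<Sum>a\<in>?A. real (card (E `` {a} Int B')))" using ecard_sum[OF fA fB, of E] by simp
  also have "\<dots> < (\<Sum>a\<in>?A. \<rho> * real (card B'))"
  proof (rule sum_strict_mono[OF fA])
    show "?A ~= {}" using n assms(4) by (metis card.empty)
  qed auto
  finally show False by (simp add: algebra_simps)
qed

text \<open>Greedy embedding with candidate sets. A vertex keeps at least a \<rho> fraction of its
  candidates per embedded neighbour, hence at least \<open>\<rho> ^ \<Delta>\<close> of its side.
  The next image must avoid at most \<open>m\<close> occupied vertices and, for each of at most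
  \<Delta> neighbours still to come, fewer than \<open>m\<close> vertices that would leave that
  neighbour too few candidates; \<open>(\<Delta> + 2) * m\<close> candidates leave room.\<close>

lemma bipartite_embed:
  fixes EF :: "('w \<times> 'w) set" and E :: "('a \<times> 'a) set"
  assumes E: "sym E" "finite A" "finite B" "A Int B = {}" "joined E m \<rho> A B" "0 < \<rho>" "\<rho> <= 1"
    and F: "finite W1" "finite W2" "W1 Int W2 = {}" "sym EF" "EF \<subseteq> W1 \<times> W2 Un W2 \<times> W1"
      "!!w. card (EF `` {w}) <= \<Delta>" "card (W1 Un W2) <= m"
    and big: "real ((\<Delta> + 2) * m) <= \<rho> ^ \<Delta> * real (card A)" "real ((\<Delta> + 2) * m) <= \<rho> ^ \<Delta> * real (card B)"
  shows "\<exists>\<phi>. inj_on \<phi> (W1 Un W2) & \<phi> ` W1 \<subseteq> A & \<phi> ` W2 \<subseteq> B & (\<forall>(u, v)\<in>EF. (\<phi> u, \<phi> v) \<in> E)"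
proof -
  define side where "side w = (if w \<in> W1 then A else B)" for w
  define cand where "cand \<phi> Z y = {a \<in> side y. \<forall>z\<in>Z Int EF `` {y}. (\<phi> z, a) \<in> E}" for \<phi> Z y
  let ?W = "W1 Un W2"
  have fEF: "finite (EF `` {w})" for w using F(1,2,5) by (rule_tac finite_subset[of _ ?W]) auto
  have fside: "finite (side w)" for w using E by (simp add: side_def)
  have bigs: "real ((\<Delta> + 2) * m) <= \<rho> ^ \<Delta> * real (card (side w))" for w using big by (simp add: side_def)
  have jn: "joined E m \<rho> (side x) (side y)" if "(x, y) \<in> EF" for x y
    using F(3,5) that E(5) joined_swap[OF E(1,5)] unfolding side_def by auto
  have "\<exists>\<phi>. inj_on \<phi> Z & (\<forall>z\<in>Z. \<phi> z \<in> side z) & (\<forall>u\<in>Z. \<forall>v\<in>Z. (u, v) \<in> EF --> (\<phi> u, \<phi> v) \<in> E) &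
      (\<forall>y\<in>?W - Z. \<rho> ^ card (Z Int EF `` {y}) * real (card (side y)) <= real (card (cand \<phi> Z y)))"
    if "finite Z" "Z \<subseteq> ?W" for Z
    using that
  proof (induction rule: finite_subset_induct')
    case empty
    show ?case by (auto simp: cand_def)
  next
    case ins: (insert x Z)
    then obtain \<phi> where \<phi>: "inj_on \<phi> Z" "\<forall>z\<in>Z. \<phi> z \<in> side z" "\<forall>u\<in>Z. \<forall>v\<in>Z. (u, v) \<in> EF --> (\<phi> u, \<phi> v) \<in> E"
      "\<forall>y\<in>?W - Z. \<rho> ^ card (Z Int EF `` {y}) * real (card (side y)) <= real (card (cand \<phi> Z y))" by auto
    have m0: "0 < m" using F(7) ins F(1,2) by (metis card_gt_0_iff empty_iff finite_UnI le_zero_eq neq0_conv)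
    have candbig: "(\<Delta> + 2) * m <= card (cand \<phi> Z y)" if "y \<in> ?W - Z" for y
    proof -
      have "card (Z Int EF `` {y}) <= \<Delta>" using F(6)[of y] fEF[of y] by (meson card_mono inf_le2 order_trans)
      then have "\<rho> ^ \<Delta> <= \<rho> ^ card (Z Int EF `` {y})" using E(6,7) by (intro power_decreasing) auto
      then have "\<rho> ^ \<Delta> * real (card (side y)) <= \<rho> ^ card (Z Int EF `` {y}) * real (card (side y))"
        by (intro mult_right_mono) auto
      then have "real ((\<Delta> + 2) * m) <= real (card (cand \<phi> Z y))" using bigs[of y] \<phi>(4) that by force
      then show ?thesis by (simp only: of_nat_le_iff)
    qed
    define N where "N = EF `` {x} - Z"
    define Bad where "Bad y = {a \<in> side x. real (card (E `` {a} Int cand \<phi> Z y)) < \<rho> * real (card (cand \<phi> Z y))}" for y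
    have NW: "N \<subseteq> ?W - Z" using F(5) by (auto simp: N_def)
    have bad: "card (Bad y) <= m" if "y \<in> N" for y
    proof -
      have "(x, y) \<in> EF" using that by (auto simp: N_def)
      moreover have "m <= card (cand \<phi> Z y)" using candbig[of y] NW that by (auto simp: algebra_simps)
      moreover have "cand \<phi> Z y \<subseteq> side y" by (auto simp: cand_def)
      ultimately show ?thesis unfolding Bad_def
        using joined_few_low[OF jn fside fside m0, of x y "cand \<phi> Z y"] by simp
    qed
    have "card (\<Union>y\<in>N. Bad y) <= (\<Sum>y\<in>N. card (Bad y))" by (rule card_UN_le) (use fEF in \<open>auto simp: N_def\<close>)
    also have "\<dots> <= (\<Sum>y\<in>N. m)" by (intro sum_mono bad)
    also have "\<dots> <= \<Delta> * m" using F(6)[of x] fEF[of x] card_mono[of "EF `` {x}" N] by (auto simp: N_def)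
    finally have b1: "card (\<Union>y\<in>N. Bad y) <= \<Delta> * m" .
    have "card (\<phi> ` Z) <= m" using F(7) card_image_le[OF ins(1), of \<phi>] card_mono[of ?W Z] ins F(1,2) by auto
    then have "card (\<phi> ` Z Un (\<Union>y\<in>N. Bad y)) <= m + \<Delta> * m" using b1 card_Un_le[of "\<phi> ` Z" "\<Union>y\<in>N. Bad y"] by linarith
    also have "\<dots> < card (cand \<phi> Z x)" using candbig[of x] ins m0 by (auto simp: algebra_simps)
    finally have lt: "card (\<phi> ` Z Un (\<Union>y\<in>N. Bad y)) < card (cand \<phi> Z x)" .
    have fN: "finite N" using fEF by (simp add: N_def)
    have fBad: "finite (Bad y)" for y using fside by (simp add: Bad_def)
    have "finite (\<phi> ` Z Un (\<Union>y\<in>N. Bad y))" by (intro finite_UnI finite_imageI finite_UN_I ins(1) fN fBad)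
    then have "~ cand \<phi> Z x \<subseteq> \<phi> ` Z Un (\<Union>y\<in>N. Bad y)" using lt by (meson card_mono not_le)
    then obtain a where a: "a \<in> cand \<phi> Z x" "a \<notin> \<phi> ` Z" "!!y. y \<in> N ==> a \<notin> Bad y" by auto
    let ?\<phi> = "\<phi>(x := a)"
    have aside: "a \<in> side x" using a by (auto simp: cand_def)
    have ne: "(x, x) \<notin> EF" using F(3,5) by auto
    have edges: "\<forall>u\<in>insert x Z. \<forall>v\<in>insert x Z. (u, v) \<in> EF --> (?\<phi> u, ?\<phi> v) \<in> E"
    proof (intro ballI impI)
      fix u v assume uv: "u \<in> insert x Z" "v \<in> insert x Z" "(u, v) \<in> EF"
      have ad: "(\<phi> z, a) \<in> E" if "z \<in> Z" "(x, z) \<in> EF" for z using a(1) that by (auto simp: cand_def)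
      have vu: "(v, u) \<in> EF" using F(4) uv(3) by (rule symD)
      consider "u = x" "v \<in> Z" "v ~= x" | "v = x" "u \<in> Z" "u ~= x" | "u \<in> Z" "v \<in> Z" "u ~= x" "v ~= x"
        using uv ne ins(4) by auto
      then show "(?\<phi> u, ?\<phi> v) \<in> E"
      proof cases
        case 1 then show ?thesis using ad[of v] uv(3) symD[OF E(1)] by simp
      next
        case 2 then show ?thesis using ad[of u] vu by simp
      next
        case 3 then show ?thesis using \<phi>(3) uv(3) by simp
      qed
    qed
    have cands: "\<rho> ^ card (insert x Z Int EF `` {y}) * real (card (side y)) <= real (card (cand ?\<phi> (insert x Z) y))"
      if y: "y \<in> ?W - insert x Z" for y
    proof (cases "(x, y) \<in> EF")
      case False
      then have "(y, x) \<notin> EF" using F(4) by (auto simp: sym_def)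
      then have "insert x Z Int EF `` {y} = Z Int EF `` {y}" by auto
      moreover from this have "cand ?\<phi> (insert x Z) y = cand \<phi> Z y" using ins by (auto simp: cand_def)
      ultimately show ?thesis using \<phi>(4) y by auto
    next
      case True
      then have yx: "(y, x) \<in> EF" using F(4) by (auto simp: sym_def)
      then have "insert x Z Int EF `` {y} = insert x (Z Int EF `` {y})" by auto
      then have c: "card (insert x Z Int EF `` {y}) = Suc (card (Z Int EF `` {y}))" using ins by simp
      have "cand ?\<phi> (insert x Z) y = E `` {a} Int cand \<phi> Z y" using ins yx by (auto simp: cand_def)
      moreover have "y \<in> N" using True y by (auto simp: N_def)
      then have "a \<notin> Bad y" using a(3) by blast
      then have "\<rho> * real (card (cand \<phi> Z y)) <= real (card (E `` {a} Int cand \<phi> Z y))"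
        using aside by (simp add: Bad_def not_less)
      moreover have "\<rho> * (\<rho> ^ card (Z Int EF `` {y}) * real (card (side y))) <= \<rho> * real (card (cand \<phi> Z y))"
        using \<phi>(4) y E(6) by (intro mult_left_mono) auto
      ultimately show ?thesis unfolding c by (simp add: mult.assoc)
    qed
    have "inj_on ?\<phi> (insert x Z)" using \<phi>(1) a(2) ins by (auto simp: inj_on_def)
    moreover have "\<forall>z\<in>insert x Z. ?\<phi> z \<in> side z" using \<phi>(2) aside by auto
    ultimately show ?case using edges cands by blast
  qed
  from this[of ?W] F(1,2) obtain \<phi> where \<phi>: "inj_on \<phi> ?W" "\<forall>z\<in>?W. \<phi> z \<in> side z"
    "\<forall>u\<in>?W. \<forall>v\<in>?W. (u, v) \<in> EF --> (\<phi> u, \<phi> v) \<in> E" by auto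
  have "\<phi> ` W1 \<subseteq> A" "\<phi> ` W2 \<subseteq> B" using \<phi>(2) F(3) by (auto simp: side_def split: if_splits)
  moreover have "\<forall>(u, v)\<in>EF. (\<phi> u, \<phi> v) \<in> E" using \<phi>(3) F(5) by blast
  ultimately show ?thesis using \<phi>(1) by blast
qed

section \<open>Hubs\<close>

text \<open>The robust form in which joined pairs provide connections: \<open>Q\<close> is a reserve
  and \<open>f\<close> the number of vertices that may be blocked. The ends \<open>a\<close> and
  \<open>b\<close> are kept out of the connector only if they are put into \<open>F\<close>, and
  \<open>a = b\<close> is allowed.\<close>

definition hub :: "('a \<times> 'a) set => 'a set => 'a set => nat => bool" where
  "hub E U Q f \<longleftrightarrow> (\<forall>a\<in>U. \<forall>b\<in>U. \<forall>F. finite F --> card F <= f -->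
     (\<exists>C\<subseteq>Q - F. finite C & conn E C & card C <= 3 & (\<exists>u\<in>C. (a, u) \<in> E) & (\<exists>v\<in>C. (b, v) \<in> E)))"

lemma card_Int_Diff_ge:
  assumes "finite F" "card F <= f" "m + f <= card S"
  shows "m <= card (S - F)"
  using diff_card_le_card_Diff[OF assms(1), of S] assms by linarith

text \<open>Ends on different sides are joined by an edge between their neighbourhoods in the
  reserve. For two ends in \<open>A\<close>, a neighbour of the first one takes over as the end in
  \<open>B\<close>; this is the third vertex.\<close>

lemma joined_hub_aux:
  assumes E: "sym E" "A0 \<subseteq> A" "B0 \<subseteq> B" "joined E m \<rho> A B" "0 < \<rho>" "0 < m"
    and "!!a. a \<in> A ==> m + f <= card (E `` {a} Int B0)" "!!b. b \<in> B ==> m + f <= card (E `` {b} Int A0)"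
    and "a \<in> A" "b \<in> A Un B" "finite F" "card F <= f"
  shows "\<exists>C\<subseteq>(A0 Un B0) - F. finite C & conn E C & card C <= 3 & (\<exists>u\<in>C. (a, u) \<in> E) & (\<exists>v\<in>C. (b, v) \<in> E)"
proof (cases "b \<in> B")
  case True
  have 1: "m <= card (E `` {a} Int B0 - F)" using card_Int_Diff_ge[OF assms(11,12) assms(7)[OF assms(9)]] .
  have 2: "m <= card (E `` {b} Int A0 - F)" using card_Int_Diff_ge[OF assms(11,12) assms(8)[OF True]] .
  obtain y x where xy: "y \<in> E `` {b} Int A0 - F" "x \<in> E `` {a} Int B0 - F" "(y, x) \<in> E"
    using joined_edge[OF E(4-6) _ _ 2 1] E(2,3) by blast
  have "conn E {x, y}" using conn_insert[OF E(1) conn_single[of E y], of y x] xy by auto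
  then show ?thesis using xy by (intro exI[of _ "{x, y}"]) (auto simp: card_insert_if)
next
  case False
  then have bA: "b \<in> A" using assms by auto
  have 1: "m <= card (E `` {a} Int B0 - F)" using card_Int_Diff_ge[OF assms(11,12) assms(7)[OF assms(9)]] .
  then obtain x where x: "x \<in> E `` {a} Int B0 - F" using E(6) by (metis card.empty ex_in_conv not_le)
  have 2: "m <= card (E `` {b} Int B0 - F)" using card_Int_Diff_ge[OF assms(11,12) assms(7)[OF bA]] .
  have "x \<in> B" using x E(3) by auto
  then have 3: "m <= card (E `` {x} Int A0 - F)" using card_Int_Diff_ge[OF assms(11,12) assms(8)] by auto
  obtain y z where yz: "y \<in> E `` {x} Int A0 - F" "z \<in> E `` {b} Int B0 - F" "(y, z) \<in> E"
    using joined_edge[OF E(4-6) _ _ 3 2] E(2,3) by blast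
  have "conn E (insert z (insert y {x}))"
    using conn_insert[OF E(1) conn_insert[OF E(1) conn_single[of E x], of x y], of y z] yz by auto
  then show ?thesis using x yz by (intro exI[of _ "{z, y, x}"]) (auto simp: card_insert_if)
qed

lemma joined_hub:
  fixes E :: "('a \<times> 'a) set"
  assumes "sym E" "A0 \<subseteq> A" "B0 \<subseteq> B" "joined E m \<rho> A B" "0 < \<rho>" "0 < m"
    and "!!a. a \<in> A ==> m + f <= card (E `` {a} Int B0)" "!!b. b \<in> B ==> m + f <= card (E `` {b} Int A0)"
  shows "hub E (A Un B) (A0 Un B0) f"
  unfolding hub_def
proof (intro ballI allI impI)
  fix a b :: 'a and F :: "'a set" assume a: "a \<in> A Un B" and b: "b \<in> A Un B" and F: "finite F" "card F <= f"
  show "\<exists>C\<subseteq>(A0 Un B0) - F. finite C & conn E C & card C <= 3 & (\<exists>u\<in>C. (a, u) \<in> E) & (\<exists>v\<in>C. (b, v) \<in> E)"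
  proof (cases "a \<in> A")
    case True then show ?thesis using joined_hub_aux[OF assms _ b F] by blast
  next
    case False
    then have "a \<in> B" "b \<in> B Un A" using a b by auto
    from joined_hub_aux[OF assms(1,3,2) joined_swap[OF assms(1,4)] assms(5,6,8,7) this F]
    show ?thesis by (simp add: Un_commute)
  qed
qed

text \<open>Reserves of size \<open>h\<close> are set aside; then the fewer than \<open>m\<close>
  vertices on each side with low degree into the opposite reserve are removed, also from the
  reserves. In \<open>2 * m + f\<close> one \<open>m\<close> pays for the vertices missing from the
  reserve, and the other guarantees an edge between two neighbourhoods after \<open>f\<close>
  vertices are blocked.\<close>

lemma joined_clean:
  assumes "sym E" "finite A" "finite B" "joined E m \<rho> A B" "0 < \<rho>" "0 < m"
    and h: "h <= card A" "h <= card B" "m <= h" "real (2 * m + f) <= \<rho> * real h"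
  shows "\<exists>A1 B1 A0 B0. A1 \<subseteq> A & B1 \<subseteq> B & A0 \<subseteq> A1 & B0 \<subseteq> B1 & card A0 <= h & card B0 <= h &
    h <= card A0 + m & card A <= card A1 + m & card B <= card B1 + m & hub E (A1 Un B1) (A0 Un B0) f"
proof -
  obtain A2 where A2: "A2 \<subseteq> A" "card A2 = h" using h(1) by (meson obtain_subset_with_card_n)
  obtain B2 where B2: "B2 \<subseteq> B" "card B2 = h" using h(2) by (meson obtain_subset_with_card_n)
  have f2: "finite A2" "finite B2" using A2 B2 assms finite_subset by auto
  define bA where "bA = {a \<in> A. real (card (E `` {a} Int B2)) < \<rho> * real (card B2)}"
  define bB where "bB = {b \<in> B. real (card (E `` {b} Int A2)) < \<rho> * real (card A2)}"
  have cA: "card bA < m" unfolding bA_def by (rule joined_few_low[OF assms(4,2,3,6) B2(1)]) (use B2 h in auto)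
  have cB: "card bB < m" unfolding bB_def
    by (rule joined_few_low[OF joined_swap[OF assms(1,4)] assms(3,2,6) A2(1)]) (use A2 h in auto)
  have fb: "finite bA" "finite bB" using assms by (auto simp: bA_def bB_def)
  have d: "m + f <= card (E `` {a} Int (B2 - bB))" if "a \<in> A - bA" for a
  proof -
    have "real (2 * m + f) <= real (card (E `` {a} Int B2))" using that h(4) B2 by (auto simp: bA_def not_less)
    then have "2 * m + f <= card (E `` {a} Int B2)" by (simp only: of_nat_le_iff)
    then have "m + f <= card (E `` {a} Int B2 - bB)" using card_Int_Diff_ge[OF fb(2), of m "m + f" "E `` {a} Int B2"] cB by simp
    then show ?thesis by (metis Int_Diff)
  qed
  have d': "m + f <= card (E `` {b} Int (A2 - bA))" if "b \<in> B - bB" for b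
  proof -
    have "real (2 * m + f) <= real (card (E `` {b} Int A2))" using that h(4) A2 by (auto simp: bB_def not_less)
    then have "2 * m + f <= card (E `` {b} Int A2)" by (simp only: of_nat_le_iff)
    then have "m + f <= card (E `` {b} Int A2 - bA)" using card_Int_Diff_ge[OF fb(1), of m "m + f" "E `` {b} Int A2"] cA by simp
    then show ?thesis by (metis Int_Diff)
  qed
  have "hub E ((A - bA) Un (B - bB)) ((A2 - bA) Un (B2 - bB)) f"
    by (rule joined_hub[OF assms(1) _ _ joined_subset[OF assms(4)] assms(5,6)]) (use A2 B2 d d' in auto)
  moreover have "card A <= card (A - bA) + m" "card B <= card (B - bB) + m" "h <= card (A2 - bA) + m"
    using diff_card_le_card_Diff[OF fb(1), of A] diff_card_le_card_Diff[OF fb(2), of B] diff_card_le_card_Diff[OF fb(1), of A2] cA cB A2 by linarith+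
  moreover have "card (A2 - bA) <= h" "card (B2 - bB) <= h" using A2 B2 f2 by (metis card_mono Diff_subset)+
  ultimately show ?thesis using A2 B2 by (intro exI[of _ "A - bA"] exI[of _ "B - bB"] exI[of _ "A2 - bA"] exI[of _ "B2 - bB"]) auto
qed

section \<open>Menger's theorem\<close>

definition sepn :: "'a set => ('a \<times> 'a) set => 'a set => 'a set => bool" where
  "sepn V E P Q \<longleftrightarrow> P Un Q = V & E Int (P - Q) \<times> (Q - P) = {}"

text \<open>Stands for \<open>k\<close> disjoint paths from \<open>A\<close> to \<open>B\<close>;
  \<open>linkage_trim\<close> restores the property that each of them meets both sets only
  once.\<close>

definition linkage :: "'a set => ('a \<times> 'a) set => 'a set => 'a set => nat => bool" where
  "linkage V E A B k \<longleftrightarrow> (\<exists>C :: nat => 'a set.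
     (\<forall>i<k. C i \<subseteq> V & conn E (C i) & C i Int A ~= {} & C i Int B ~= {}) &
     (\<forall>i<k. \<forall>j<k. i ~= j --> C i Int C j = {}))"

definition contr :: "'a => 'a => 'a => 'a" where
  "contr x y z = (if z = y then x else z)"

definition cedges :: "'a => 'a => ('a \<times> 'a) set => ('a \<times> 'a) set" where
  "cedges x y E = map_prod (contr x y) (contr x y) ` E - Id"

lemma cedges_iff: "(l, l') \<in> cedges x y E \<longleftrightarrow> l ~= l' & (\<exists>a b. (a, b) \<in> E & contr x y a = l & contr x y b = l')"
  unfolding cedges_def by force

lemma sym_cedges: "sym E ==> sym (cedges x y E)"
  unfolding sym_def cedges_iff by metis

lemma cedges_subset: "E \<subseteq> V \<times> V ==> x \<in> V ==> x ~= y ==> cedges x y E \<subseteq> (V - {y}) \<times> (V - {y})"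
  unfolding cedges_def contr_def by (auto split: if_splits)

lemma card_cedges:
  assumes "finite E" "(x, y) \<in> E"
  shows "card (cedges x y E) < card E"
proof -
  have "cedges x y E \<subseteq> map_prod (contr x y) (contr x y) ` (E - {(x, y)})"
    unfolding cedges_def contr_def by auto
  then have "card (cedges x y E) <= card (E - {(x, y)})"
    using assms by (meson card_image_le card_mono finite_Diff finite_imageI order_trans)
  also have "\<dots> < card E" using assms by (meson card_Diff1_less)
  finally show ?thesis .
qed

lemma conn_contr:
  assumes "sym E" "(x, y) \<in> E" "x \<in> V" "y \<in> V" "conn (cedges x y E) C" "C \<subseteq> V - {y}"
  shows "conn E {z \<in> V. contr x y z \<in> C}"
proof -
  have "{z \<in> V. contr x y z \<in> C} = (\<Union>l\<in>C. {z \<in> V. contr x y z = l})" by auto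
  moreover have "conn E (\<Union>l\<in>C. if l = x then {x, y} else {l})"
  proof (rule conn_UN[OF assms(1,5)])
    show "conn E (if l = x then {x, y} else {l})" for l
      using conn_insert[OF assms(1) conn_single[of E y], of y x] assms(1,2) conn_single[of E l]
      by (auto simp: sym_def)
    fix l l' assume "l \<in> C" "l' \<in> C" "(l, l') \<in> cedges x y E"
    then obtain a b where "(a, b) \<in> E" "contr x y a = l" "contr x y b = l'" unfolding cedges_iff by auto
    then have "a \<in> (if l = x then {x, y} else {l})" "b \<in> (if l' = x then {x, y} else {l'})" "(a, b) \<in> E"
      by (auto simp: contr_def split: if_splits)
    then show "\<exists>u\<in>if l = x then {x, y} else {l}. \<exists>v\<in>if l' = x then {x, y} else {l'}. (u, v) \<in> E" by blast
  qed
  moreover have "(\<Union>l\<in>C. {z \<in> V. contr x y z = l}) = (\<Union>l\<in>C. if l = x then {x, y} else {l})"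
    using assms(3,4,6) by (auto simp: contr_def split: if_splits)
  ultimately show ?thesis by simp
qed

lemma sepn_contr:
  assumes "sepn (V - {y}) (cedges x y E) P Q" "x \<in> V" "E \<subseteq> V \<times> V" "x ~= y"
  shows "sepn V E {z \<in> V. contr x y z \<in> P} {z \<in> V. contr x y z \<in> Q}"
  unfolding sepn_def
proof (intro conjI equals0I)
  have PQ: "P Un Q = V - {y}" "cedges x y E Int (P - Q) \<times> (Q - P) = {}" using assms(1) by (auto simp: sepn_def)
  show "{z \<in> V. contr x y z \<in> P} Un {z \<in> V. contr x y z \<in> Q} = V"
    using PQ(1) assms(2,4) by (auto simp: contr_def)
  fix e assume "e \<in> E Int ({z \<in> V. contr x y z \<in> P} - {z \<in> V. contr x y z \<in> Q}) \<times> ({z \<in> V. contr x y z \<in> Q} - {z \<in> V. contr x y z \<in> P})"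
  then obtain a b where e: "(a, b) \<in> E" "a \<in> V" "b \<in> V" "contr x y a \<in> P - Q" "contr x y b \<in> Q - P" by auto
  then have "(contr x y a, contr x y b) \<in> cedges x y E" unfolding cedges_iff by (metis DiffE)
  then show False using PQ(2) e by blast
qed

lemma linkage_trim:
  assumes "linkage V E A B k" "sym E" "finite V"
  obtains C a b where "!!i. i < k ==> C i \<subseteq> V & conn E (C i) & C i Int A = {a i} & C i Int B = {b i}"
    "!!i j. i < k ==> j < k ==> i ~= j ==> C i Int C j = {}" "inj_on a {..<k}" "inj_on b {..<k}"
proof -
  obtain D where D: "!!i. i < k ==> D i \<subseteq> V & conn E (D i) & D i Int A ~= {} & D i Int B ~= {}"
    "!!i j. i < k ==> j < k ==> i ~= j ==> D i Int D j = {}"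
  proof -
    obtain D where "(\<forall>i<k. D i \<subseteq> V & conn E (D i) & D i Int A ~= {} & D i Int B ~= {}) &
       (\<forall>i<k. \<forall>j<k. i ~= j --> D i Int D j = {})" using assms(1) unfolding linkage_def ..
    then show thesis by (intro that[of D]) simp_all
  qed
  have "\<forall>i. \<exists>C a b. i < k --> C \<subseteq> D i & conn E C & C Int A = {a} & C Int B = {b}"
  proof
    fix i
    show "\<exists>C a b. i < k --> C \<subseteq> D i & conn E C & C Int A = {a} & C Int B = {b}"
    proof (cases "i < k")
      case True
      have "finite (D i)" using D(1)[OF True] assms(3) finite_subset by auto
      then show ?thesis using conn_trim[OF assms(2), of "D i" A B] D(1)[OF True] by blast
    qed simp
  qed
  then obtain C a b where C: "!!i. i < k ==> C i \<subseteq> D i & conn E (C i) & C i Int A = {a i} & C i Int B = {b i}" by metis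
  have dis: "C i Int C j = {}" if "i < k" "j < k" "i ~= j" for i j using C[OF that(1)] C[OF that(2)] D(2)[OF that] by auto
  have ab: "a i \<in> C i" "b i \<in> C i" if "i < k" for i using C[OF that] by blast+
  have "inj_on a {..<k}" "inj_on b {..<k}" unfolding inj_on_def using ab dis by (metis IntI empty_iff lessThan_iff)+
  then show thesis using that[of C a b] C D(1) dis by (metis order_trans)
qed

text \<open>Induction on the number of arcs, contracting an edge \<open>xy\<close>. If the
  contraction has no linkage, it has a separation of order below \<open>k\<close>. Lifted to the
  graph, its order grows by at most one, so it is exactly \<open>k\<close> and the boundary contains
  \<open>x\<close> and \<open>y\<close>. The edge \<open>xy\<close> can then be deleted on either
  side, and the linkages from \<open>A\<close> to the boundary and from the boundary to
  \<open>B\<close> are glued.\<close>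

theorem menger:
  assumes "finite V" "sym E" "irrefl E" "E \<subseteq> V \<times> V" "A \<subseteq> V" "B \<subseteq> V"
    and "!!P Q. sepn V E P Q ==> A \<subseteq> P ==> B \<subseteq> Q ==> k <= card (P Int Q)"
  shows "linkage V E A B k"
  using assms
proof (induction "card E" arbitrary: V E A B rule: less_induct)
  case less
  note V = less.prems
  show ?case
  proof (cases "E = {}")
    case True
    \<comment> \<open>Without edges any two sets covering \<open>V\<close> form a separation; this
      one has boundary exactly \<open>A Int B\<close>.\<close>
    have "sepn V E A (B Un (V - A))" unfolding sepn_def True using V by auto
    moreover have "A Int (B Un (V - A)) = A Int B" by auto
    ultimately have "k <= card (A Int B)" using V(7)[of A "B Un (V - A)"] by auto
    then obtain S where S: "S \<subseteq> A Int B" "card S = k" by (meson obtain_subset_with_card_n)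
    have "finite S" using S V by (meson finite_subset inf.coboundedI1 order_trans)
    then obtain g where g: "bij_betw g {..<k} S" using S(2) by (metis atLeast0LessThan ex_bij_betw_nat_finite)
    have gS: "g i \<in> S" if "i < k" for i using g that by (auto simp: bij_betw_def)
    have ginj: "inj_on g {..<k}" using g by (simp add: bij_betw_def)
    have "{g i} Int {g j} = {}" if "i < k" "j < k" "i ~= j" for i j
      using inj_onD[OF ginj, of i j] that by auto
    moreover have "{g i} \<subseteq> V & conn E {g i} & {g i} Int A ~= {} & {g i} Int B ~= {}" if "i < k" for i
      using gS[OF that] S(1) V(5) conn_single[of E "g i"] by auto
    ultimately show ?thesis unfolding linkage_def by (intro exI[of _ "%i. {g i}"] conjI allI impI) simp_all
  next
    case False
    then obtain x y where xy: "(x, y) \<in> E" by auto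
    have yx: "(y, x) \<in> E" and ne: "x ~= y" and xyV: "x \<in> V" "y \<in> V" and fE: "finite E"
      using V xy by (auto simp: sym_def irrefl_def intro: finite_subset[of E "V \<times> V"])
    let ?V = "V - {y}" and ?E = "cedges x y E" and ?h = "contr x y"
    show ?thesis
    proof (cases "linkage ?V ?E (?h ` A) (?h ` B) k")
      case True
      then obtain C where C: "!!i. i < k ==> C i \<subseteq> ?V & conn ?E (C i) & C i Int ?h ` A ~= {} & C i Int ?h ` B ~= {}"
        "!!i j. i < k ==> j < k ==> i ~= j ==> C i Int C j = {}"
      proof -
        obtain C where "(\<forall>i<k. C i \<subseteq> ?V & conn ?E (C i) & C i Int ?h ` A ~= {} & C i Int ?h ` B ~= {}) &
           (\<forall>i<k. \<forall>j<k. i ~= j --> C i Int C j = {})" using True unfolding linkage_def ..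
        then show thesis by (intro that[of C]) simp_all
      qed
      let ?C = "%i. {z \<in> V. ?h z \<in> C i}"
      have "conn E (?C i)" if "i < k" for i using conn_contr[OF V(2) xy xyV] C(1)[OF that] by blast
      moreover have "?C i Int A ~= {}" "?C i Int B ~= {}" if "i < k" for i using C(1)[OF that] V(5,6) by blast+
      moreover have "?C i Int ?C j = {}" if "i < k" "j < k" "i ~= j" for i j using C(2)[OF that] by blast
      ultimately show ?thesis unfolding linkage_def by (intro exI[of _ ?C]) blast
    next
      case nolink: False
      have irr: "irrefl ?E" by (auto simp: irrefl_def cedges_def)
      have hV: "?h ` A \<subseteq> ?V" "?h ` B \<subseteq> ?V" using V(5,6) xyV ne by (auto simp: contr_def)
      obtain P' Q' where PQ': "sepn ?V ?E P' Q'" "?h ` A \<subseteq> P'" "?h ` B \<subseteq> Q'" "card (P' Int Q') < k"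
      proof -
        have "~ (\<forall>P Q. sepn ?V ?E P Q --> ?h ` A \<subseteq> P --> ?h ` B \<subseteq> Q --> k <= card (P Int Q))"
        proof
          assume a: "\<forall>P Q. sepn ?V ?E P Q --> ?h ` A \<subseteq> P --> ?h ` B \<subseteq> Q --> k <= card (P Int Q)"
          have "linkage ?V ?E (?h ` A) (?h ` B) k"
            by (rule less.hyps[OF card_cedges[OF fE xy] _ sym_cedges[OF V(2)] irr cedges_subset[OF V(4) xyV(1) ne] hV])
               (use V(1) a in auto)
          then show False using nolink by simp
        qed
        then show thesis using that by (auto simp: not_le)
      qed
      define P where "P = {z \<in> V. ?h z \<in> P'}"
      define Q where "Q = {z \<in> V. ?h z \<in> Q'}"
      have sep: "sepn V E P Q" unfolding P_def Q_def by (rule sepn_contr[OF PQ'(1) xyV(1) V(4) ne])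
      have AP: "A \<subseteq> P" "B \<subseteq> Q" using PQ'(2,3) V(5,6) by (auto simp: P_def Q_def)
      define X where "X = P Int Q"
      have kX: "k <= card X" unfolding X_def by (rule V(7)[OF sep AP])
      have PQV': "P' \<subseteq> ?V" "Q' \<subseteq> ?V" using PQ'(1) by (auto simp: sepn_def)
      have fPQ: "finite (P' Int Q')" using PQV' V(1) by (meson finite_Diff finite_Int finite_subset)
      have XI: "X \<subseteq> insert y (P' Int Q')" by (auto simp: X_def P_def Q_def contr_def split: if_splits)
      \<comment> \<open>If the contracted vertex were outside the boundary, lifting would not raise
        the order.\<close>
      have xin: "x \<in> P' Int Q'"
      proof (rule ccontr)
        assume "x \<notin> P' Int Q'"
        then have "X \<subseteq> P' Int Q'" by (auto simp: X_def P_def Q_def contr_def split: if_splits)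
        then have "card X <= card (P' Int Q')" using fPQ by (rule card_mono[rotated])
        then show False using kX PQ'(4) by simp
      qed
      have xyX: "x \<in> X" "y \<in> X" using xin xyV ne by (auto simp: X_def P_def Q_def contr_def)
      have "card X <= card (insert y (P' Int Q'))" using XI fPQ by (intro card_mono) auto
      then have "card X <= Suc (card (P' Int Q'))" using fPQ by (auto simp: card_insert_if split: if_splits)
      then have cX: "card X = k" using kX PQ'(4) by simp
      have fX: "finite X" using V(1) sep by (auto simp: X_def sepn_def intro: finite_subset)
      let ?E0 = "E - {(x, y), (y, x)}"
      have PQV: "P Un Q = V" "E Int (P - Q) \<times> (Q - P) = {}" using sep by (auto simp: sepn_def)
      have fPQ2: "finite P" "finite Q" using PQV(1) V(1) by (metis finite_Un)+
      have EQP: "E Int (Q - P) \<times> (P - Q) = {}" using PQV(2) V(2) by (auto simp: sym_def)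
      have cE0: "card (?E0 Int S \<times> S) < card E" for S
        using xy fE by (intro psubset_card_mono) auto
      have symS: "sym (?E0 Int S \<times> S)" "irrefl (?E0 Int S \<times> S)" for S using V(2,3) by (auto simp: sym_def irrefl_def)
      \<comment> \<open>A separation of \<open>P\<close> extends by \<open>Q\<close> to one of the
        whole graph. The deleted edge has both ends in \<open>X\<close> and therefore does not cross
        it.\<close>
      have L1: "linkage P (?E0 Int P \<times> P) A X k"
      proof (rule less.hyps[OF cE0 fPQ2(1) symS])
        show "?E0 Int P \<times> P \<subseteq> P \<times> P" "A \<subseteq> P" "X \<subseteq> P" using AP by (auto simp: X_def)
        fix P1 P2 assume s: "sepn P (?E0 Int P \<times> P) P1 P2" "A \<subseteq> P1" "X \<subseteq> P2"
        have "sepn V E P1 (P2 Un Q)" unfolding sepn_def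
        proof (intro conjI equals0I)
          show "P1 Un (P2 Un Q) = V" using s PQV by (auto simp: sepn_def)
          fix e assume e: "e \<in> E Int (P1 - (P2 Un Q)) \<times> ((P2 Un Q) - P1)"
          then obtain u v where uv: "e = (u, v)" "(u, v) \<in> E" "u \<in> P1" "u \<notin> P2" "u \<notin> Q" "v \<in> P2 Un Q" "v \<notin> P1" by auto
          have uP: "u \<in> P" using uv s by (auto simp: sepn_def)
          have "v \<in> P" using PQV(2) uv uP s(1) by (auto simp: sepn_def)
          moreover have "v \<in> P2" using \<open>v \<in> P\<close> uv s(1) by (auto simp: sepn_def)
          moreover have "(u, v) \<notin> {(x, y), (y, x)}" using uv xyX by (auto simp: X_def)
          ultimately show False using s(1) uv uP by (auto simp: sepn_def)
        qed
        then have "k <= card (P1 Int (P2 Un Q))" using V(7)[of P1 "P2 Un Q"] s(2) AP by auto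
        moreover have "P1 Int (P2 Un Q) = P1 Int P2" using s(1,3) by (auto simp: sepn_def X_def)
        ultimately show "k <= card (P1 Int P2)" by simp
      qed
      have L2: "linkage Q (?E0 Int Q \<times> Q) X B k"
      proof (rule less.hyps[OF cE0 fPQ2(2) symS])
        show "?E0 Int Q \<times> Q \<subseteq> Q \<times> Q" "B \<subseteq> Q" "X \<subseteq> Q" using AP by (auto simp: X_def)
        fix P1 P2 assume s: "sepn Q (?E0 Int Q \<times> Q) P1 P2" "X \<subseteq> P1" "B \<subseteq> P2"
        have "sepn V E (P1 Un P) P2" unfolding sepn_def
        proof (intro conjI equals0I)
          show "(P1 Un P) Un P2 = V" using s PQV by (auto simp: sepn_def)
          fix e assume e: "e \<in> E Int ((P1 Un P) - P2) \<times> (P2 - (P1 Un P))"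
          then obtain u v where uv: "e = (u, v)" "(u, v) \<in> E" "u \<in> P1 Un P" "u \<notin> P2" "v \<in> P2" "v \<notin> P1" "v \<notin> P" by auto
          have vQ: "v \<in> Q" using uv s by (auto simp: sepn_def)
          have "u \<in> Q" using PQV uv vQ s(1) by (auto simp: sepn_def)
          moreover have "u \<in> P1" using \<open>u \<in> Q\<close> uv s(1) by (auto simp: sepn_def)
          moreover have "(u, v) \<notin> {(x, y), (y, x)}" using uv xyX by (auto simp: X_def)
          ultimately show False using s(1) uv vQ by (auto simp: sepn_def)
        qed
        then have "k <= card ((P1 Un P) Int P2)" using V(7)[of "P1 Un P" P2] s(3) AP by auto
        moreover have "(P1 Un P) Int P2 = P1 Int P2" using s(1,2) by (auto simp: sepn_def X_def)
        ultimately show "k <= card (P1 Int P2)" by simp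
      qed
      obtain C a b where C: "!!i. i < k ==> C i \<subseteq> P & conn (?E0 Int P \<times> P) (C i) & C i Int A = {a i} & C i Int X = {b i}"
        "!!i j. i < k ==> j < k ==> i ~= j ==> C i Int C j = {}" "inj_on a {..<k}" "inj_on b {..<k}"
        using linkage_trim[OF L1 symS(1) fPQ2(1)] by metis
      obtain D a' b' where D: "!!i. i < k ==> D i \<subseteq> Q & conn (?E0 Int Q \<times> Q) (D i) & D i Int X = {a' i} & D i Int B = {b' i}"
        "!!i j. i < k ==> j < k ==> i ~= j ==> D i Int D j = {}" "inj_on a' {..<k}" "inj_on b' {..<k}"
        using linkage_trim[OF L2 symS(1) fPQ2(2)] by metis
      \<comment> \<open>Both trimmed linkages meet \<open>X\<close> in \<open>k\<close> distinct
        vertices and \<open>card X = k\<close>, so their ends can be matched by \<sigma>.\<close>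
      have "a' ` {..<k} = X" using D(1,3) cX fX by (intro card_subset_eq) (auto simp: card_image)
      then have "\<forall>i. \<exists>j. i < k --> j < k & a' j = b i" using C(1)
        by (metis IntD2 imageE insertI1 lessThan_iff)
      then obtain \<sigma> where \<sigma>: "!!i. i < k ==> \<sigma> i < k & a' (\<sigma> i) = b i" by metis
      have \<sigma>inj: "\<sigma> i ~= \<sigma> j" if "i < k" "j < k" "i ~= j" for i j
        using \<sigma>[OF that(1)] \<sigma>[OF that(2)] C(4) that by (metis inj_onD lessThan_iff)
      let ?F = "%i. C i Un D (\<sigma> i)"
      have F: "?F i \<subseteq> V & conn E (?F i) & ?F i Int A ~= {} & ?F i Int B ~= {}" if "i < k" for i
      proof -
        have "conn E (C i)" "conn E (D (\<sigma> i))" using C(1)[OF that] D(1)[of "\<sigma> i"] \<sigma>[OF that] by (auto intro: conn_mono)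
        moreover have "b i \<in> C i" using C(1)[OF that] by blast
        moreover have "a' (\<sigma> i) \<in> D (\<sigma> i)" using D(1)[OF conjunct1[OF \<sigma>[OF that]]] by blast
        then have "b i \<in> D (\<sigma> i)" using \<sigma>[OF that] by simp
        ultimately have "conn E (?F i)" using conn_Un_int[OF V(2)] by blast
        moreover have "?F i Int A ~= {}" "?F i Int B ~= {}"
          using C(1)[OF that] D(1)[OF conjunct1[OF \<sigma>[OF that]]] by blast+
        moreover have "?F i \<subseteq> V" using C(1)[OF that] D(1)[of "\<sigma> i"] \<sigma>[OF that] PQV by auto
        ultimately show ?thesis by blast
      qed
      have CD: "C i Int D (\<sigma> j) = {}" if "i < k" "j < k" "i ~= j" for i j
      proof -
        have "C i Int D (\<sigma> j) \<subseteq> C i Int X Int (D (\<sigma> j) Int X)" using C(1)[OF that(1)] D(1)[of "\<sigma> j"] \<sigma>[OF that(2)] by (auto simp: X_def)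
        also have "\<dots> = {b i} Int {b j}" using C(1)[OF that(1)] D(1)[of "\<sigma> j"] \<sigma>[OF that(2)] by simp
        also have "\<dots> = {}" using C(4) that by (auto simp: inj_on_def)
        finally show ?thesis by auto
      qed
      have "?F i Int ?F j = {}" if "i < k" "j < k" "i ~= j" for i j
      proof -
        have "D (\<sigma> i) Int D (\<sigma> j) = {}" using D(2) \<sigma>[OF that(1)] \<sigma>[OF that(2)] \<sigma>inj[OF that] by simp
        moreover have "C j Int D (\<sigma> i) = {}" using CD[of j i] that by simp
        ultimately show ?thesis using C(2)[OF that] CD[OF that] by blast
      qed
      then show ?thesis unfolding linkage_def using F by (intro exI[of _ ?F]) simp
    qed
  qed
qed

lemma menger_set:
  assumes "finite V" "sym E" "irrefl E" "E \<subseteq> V \<times> V" "X \<subseteq> V" "B \<subseteq> V"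
    and "!!P Q. sepn V E P Q ==> X \<subseteq> P ==> B \<subseteq> Q ==> card X <= card (P Int Q)"
  obtains C g where "!!x. x \<in> X ==> C x \<subseteq> V & conn E (C x) & C x Int X = {x} & C x Int B = {g x}"
    "!!x y. x \<in> X ==> y \<in> X ==> x ~= y ==> C x Int C y = {}" "inj_on g X"
proof -
  let ?k = "card X"
  obtain C a b where C: "!!i. i < ?k ==> C i \<subseteq> V & conn E (C i) & C i Int X = {a i} & C i Int B = {b i}"
    "!!i j. i < ?k ==> j < ?k ==> i ~= j ==> C i Int C j = {}" "inj_on a {..<?k}" "inj_on b {..<?k}"
    using linkage_trim[OF menger[OF assms(1-6), of ?k] assms(2,1)] assms(7) by metis
  have fX: "finite X" using assms(1,5) finite_subset by auto
  have "a ` {..<?k} = X" using C(1,3) fX by (intro card_subset_eq) (auto simp: card_image)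
  then have "\<forall>x. \<exists>i. x \<in> X --> i < ?k & a i = x" by (metis imageE lessThan_iff)
  then obtain \<sigma> where \<sigma>: "!!x. x \<in> X ==> \<sigma> x < ?k & a (\<sigma> x) = x" by metis
  have \<sigma>i: "\<sigma> x ~= \<sigma> y" if "x \<in> X" "y \<in> X" "x ~= y" for x y using \<sigma> that by metis
  have "inj_on (b \<circ> \<sigma>) X" unfolding inj_on_def using C(4) \<sigma> \<sigma>i by (metis comp_apply inj_onD lessThan_iff)
  then show thesis
    using that[of "%x. C (\<sigma> x)" "b \<circ> \<sigma>"] C(1,2) \<sigma> \<sigma>i by (metis comp_apply)
qed

section \<open>Linked sets\<close>

lemma obtain_min:
  fixes f :: "'b => nat"
  assumes "S ~= {}"
  shows "\<exists>y\<in>S. \<forall>z\<in>S. f y <= f z"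
proof -
  obtain x where "x \<in> S" using assms by auto
  from ex_has_least_nat[of "%x. x \<in> S", OF this] show ?thesis by blast
qed

definition sgr :: "'a set => ('a \<times> 'a) set => bool" where
  "sgr V E \<longleftrightarrow> finite V & sym E & irrefl E & E \<subseteq> V \<times> V"

lemma sgr_finite: "sgr V E ==> finite V" "sgr V E ==> finite E" "sgr V E ==> sym E"
  "sgr V E ==> irrefl E" "sgr V E ==> E \<subseteq> V \<times> V"
  by (auto simp: sgr_def intro: finite_subset)

lemma sgr_restrict: "sgr V E ==> S \<subseteq> V ==> sgr S (E Int S \<times> S)"
  unfolding sgr_def by (auto simp: sym_def irrefl_def intro: finite_subset)

definition pairing :: "('a \<times> 'a) set => 'a set => bool" where
  "pairing Q X \<longleftrightarrow> Q \<subseteq> X \<times> X & (\<forall>p\<in>Q. fst p ~= snd p) &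
     (\<forall>p\<in>Q. \<forall>q\<in>Q. p ~= q --> {fst p, snd p} Int {fst q, snd q} = {})"

lemma pairingD:
  assumes "pairing Q X" "p \<in> Q"
  shows "fst p \<in> X" "snd p \<in> X" "fst p ~= snd p" "q \<in> Q ==> p ~= q ==> {fst p, snd p} Int {fst q, snd q} = {}"
  using assms by (auto simp: pairing_def mem_Times_iff)

text \<open>Every vertex of \<open>X\<close>, paired or not, owns a set, so the connection of one
  pair avoids all other vertices of \<open>X\<close>. Letting the two sets of a pair touch by an
  edge, instead of merging them, keeps the sets disjoint and lets them be extended at their
  roots.\<close>

definition rooted :: "'a set => ('a \<times> 'a) set => 'a set => ('a \<times> 'a) set => ('a => 'a set) => bool" where
  "rooted V E X Q C \<longleftrightarrow> (\<forall>x\<in>X. x \<in> C x & C x \<subseteq> V & conn E (C x)) &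
     (\<forall>x\<in>X. \<forall>y\<in>X. x ~= y --> C x Int C y = {}) &
     (\<forall>p\<in>Q. \<exists>u\<in>C (fst p). \<exists>v\<in>C (snd p). (u, v) \<in> E)"

definition linked :: "'a set => ('a \<times> 'a) set => 'a set => bool" where
  "linked V E X \<longleftrightarrow> (\<forall>Q. pairing Q X --> (\<exists>C. rooted V E X Q C))"

lemma rootedD:
  assumes "rooted V E X Q C"
  shows "x \<in> X ==> x \<in> C x" "x \<in> X ==> C x \<subseteq> V" "x \<in> X ==> conn E (C x)"
    "x \<in> X ==> y \<in> X ==> x ~= y ==> C x Int C y = {}"
    "p \<in> Q ==> \<exists>u\<in>C (fst p). \<exists>v\<in>C (snd p). (u, v) \<in> E"
  using assms unfolding rooted_def by auto

lemma linked_mono: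
  assumes "linked V E X" "V \<subseteq> V'" "E \<subseteq> E'"
  shows "linked V' E' X"
  unfolding linked_def
proof (intro allI impI)
  fix Q assume "pairing Q X"
  then obtain C where C: "rooted V E X Q C" using assms(1) by (auto simp: linked_def)
  have "conn E' (C x)" if "x \<in> X" for x using rootedD(3)[OF C that] conn_mono assms(3) by blast
  then have "rooted V' E' X Q C" unfolding rooted_def
    using rootedD[OF C] assms(2,3) by (meson order_trans subsetD)
  then show "\<exists>C. rooted V' E' X Q C" by blast
qed

lemma linked_subset:
  assumes "linked V E X" "Y \<subseteq> X"
  shows "linked V E Y"
  unfolding linked_def
proof (intro allI impI)
  fix Q assume "pairing Q Y"
  then have "pairing Q X" using assms(2) by (auto simp: pairing_def)
  then obtain C where C: "rooted V E X Q C" using assms(1) by (auto simp: linked_def)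
  have "rooted V E Y Q C" unfolding rooted_def using rootedD[OF C] assms(2) by (meson subsetD)
  then show "\<exists>C. rooted V E Y Q C" by blast
qed

text \<open>Linkedness travels from \<open>Z\<close> back to \<open>X\<close> along disjoint
  connected sets that meet \<open>V2\<close> only in their ends in \<open>Z\<close>.\<close>

lemma linked_extend:
  assumes "sym E" "linked V2 E2 Z" "E2 \<subseteq> E" "V2 \<subseteq> V"
    and D: "!!x. x \<in> X ==> x \<in> D x & D x \<subseteq> V & conn E (D x) & D x Int V2 = {g x} & g x \<in> Z"
    and dis: "!!x y. x \<in> X ==> y \<in> X ==> x ~= y ==> D x Int D y = {}"
  shows "linked V E X"
  unfolding linked_def
proof (intro allI impI)
  fix Q assume Q: "pairing Q X"
  have gD: "g x \<in> D x" if "x \<in> X" for x using D[OF that] by blast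
  have inj: "g x ~= g y" if "x \<in> X" "y \<in> X" "x ~= y" for x y using gD[OF that(1)] gD[OF that(2)] dis[OF that] by auto
  have "pairing (map_prod g g ` Q) Z" unfolding pairing_def
  proof (intro conjI ballI impI)
    show "map_prod g g ` Q \<subseteq> Z \<times> Z" using Q D by (auto simp: pairing_def)
    fix p assume "p \<in> map_prod g g ` Q"
    then obtain p' where p': "p' \<in> Q" "p = map_prod g g p'" by auto
    then show "fst p ~= snd p" using pairingD(1-3)[OF Q p'(1)] inj by simp
    fix q assume "q \<in> map_prod g g ` Q" and ne: "p ~= q"
    then obtain q' where q': "q' \<in> Q" "q = map_prod g g q'" by auto
    have "p' ~= q'" using p' q' ne by auto
    then have "{fst p', snd p'} Int {fst q', snd q'} = {}" using pairingD(4)[OF Q p'(1) q'(1)] by simp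
    moreover have "fst p' \<in> X" "snd p' \<in> X" "fst q' \<in> X" "snd q' \<in> X"
      using pairingD(1,2)[OF Q p'(1)] pairingD(1,2)[OF Q q'(1)] by auto
    ultimately show "{fst p, snd p} Int {fst q, snd q} = {}" using inj p' q' by auto
  qed
  then obtain C where C: "rooted V2 E2 Z (map_prod g g ` Q) C" using assms(2) by (auto simp: linked_def)
  let ?C = "%x. D x Un C (g x)"
  have gZ: "g x \<in> Z" if "x \<in> X" for x using D[OF that] by blast
  have 1: "x \<in> ?C x & ?C x \<subseteq> V & conn E (?C x)" if "x \<in> X" for x
  proof -
    have "conn E (C (g x))" using rootedD(3)[OF C gZ[OF that]] assms(3) by (auto intro: conn_mono)
    moreover have "g x \<in> C (g x)" using rootedD(1)[OF C gZ[OF that]] .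
    ultimately have "conn E (?C x)" using conn_Un_int[OF assms(1)] D[OF that] gD[OF that] by blast
    then show ?thesis using D[OF that] rootedD(2)[OF C gZ[OF that]] assms(4) by auto
  qed
  have 2: "D x Int C (g y) = {}" if "x \<in> X" "y \<in> X" "x ~= y" for x y
  proof -
    have "D x Int C (g y) \<subseteq> {g x}" using D[OF that(1)] rootedD(2)[OF C gZ[OF that(2)]] by blast
    moreover have "g x \<notin> C (g y)"
      using rootedD(4)[OF C gZ[OF that(1)] gZ[OF that(2)] inj[OF that]] rootedD(1)[OF C gZ[OF that(1)]] by auto
    ultimately show ?thesis by auto
  qed
  have 3: "?C x Int ?C y = {}" if "x \<in> X" "y \<in> X" "x ~= y" for x y
    using 2[OF that] 2[of y x] that dis[OF that] rootedD(4)[OF C gZ[OF that(1)] gZ[OF that(2)] inj[OF that]] by auto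
  have 4: "\<exists>u\<in>?C (fst p). \<exists>v\<in>?C (snd p). (u, v) \<in> E" if "p \<in> Q" for p
  proof -
    have "map_prod g g p \<in> map_prod g g ` Q" using that by auto
    from rootedD(5)[OF C this] show ?thesis using assms(3) by (auto simp: fst_map_prod snd_map_prod)
  qed
  show "\<exists>C. rooted V E X Q C" unfolding rooted_def using 1 3 4 by (intro exI[of _ ?C]) simp
qed

text \<open>Connectors are chosen one after another; the earlier ones are blocked at a cost of three
  vertices each.\<close>

lemma hub_connectors:
  fixes a b :: "'j => 'a"
  assumes "hub E U Q f" "finite J" "finite F0" "card F0 + 3 * card J <= f"
    and "!!j. j \<in> J ==> a j \<in> U & b j \<in> U"
  shows "\<exists>K. (\<forall>j\<in>J. K j \<subseteq> Q - F0 & finite (K j) & card (K j) <= 3 & conn E (K j) & (\<exists>u\<in>K j. (a j, u) \<in> E) & (\<exists>v\<in>K j. (b j, v) \<in> E))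
    & (\<forall>i\<in>J. \<forall>j\<in>J. i ~= j --> K i Int K j = {})"
  using assms(2,4,5)
proof (induction J rule: finite_induct)
  case empty then show ?case by simp
next
  case (insert x J)
  then obtain K where K: "\<forall>j\<in>J. K j \<subseteq> Q - F0 & finite (K j) & card (K j) <= 3 & conn E (K j) & (\<exists>u\<in>K j. (a j, u) \<in> E) & (\<exists>v\<in>K j. (b j, v) \<in> E)"
    "\<forall>i\<in>J. \<forall>j\<in>J. i ~= j --> K i Int K j = {}" by auto
  let ?F = "F0 Un (\<Union>j\<in>J. K j)"
  have "card (\<Union>j\<in>J. K j) <= (\<Sum>j\<in>J. card (K j))" using insert(1) by (rule card_UN_le)
  also have "\<dots> <= (\<Sum>j\<in>J. 3)" using K(1) by (intro sum_mono) auto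
  finally have c: "card ?F <= f" using insert card_Un_le[of F0 "\<Union>j\<in>J. K j"] by (simp del: UN_simps)
  have fF: "finite ?F" using insert(1) K(1) assms(3) by auto
  obtain C where C: "C \<subseteq> Q - ?F" "conn E C" "card C <= 3" "\<exists>u\<in>C. (a x, u) \<in> E" "\<exists>v\<in>C. (b x, v) \<in> E" "finite C"
    using assms(1) insert(5)[of x] c fF unfolding hub_def by (metis insertI1)
  let ?K = "K(x := C)"
  have "\<forall>j\<in>insert x J. ?K j \<subseteq> Q - F0 & finite (?K j) & card (?K j) <= 3 & conn E (?K j) & (\<exists>u\<in>?K j. (a j, u) \<in> E) & (\<exists>v\<in>?K j. (b j, v) \<in> E)"
    using K(1) C by auto
  moreover have "\<forall>i\<in>insert x J. \<forall>j\<in>insert x J. i ~= j --> ?K i Int ?K j = {}"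
    using K(2) C(1) insert(2) by auto
  ultimately show ?case by blast
qed

text \<open>Each pair needs one connector, which is added to the set of its first vertex. Blocking
  \<open>Z\<close> and the earlier connectors costs at most \<open>4 * card Z\<close>.\<close>

lemma hub_linked:
  assumes "sym E" "hub E U Q f" "Q \<subseteq> V" "U \<subseteq> V" "finite Z" "Z \<subseteq> U" "4 * card Z <= f"
  shows "linked V E Z"
  unfolding linked_def
proof (intro allI impI)
  fix R assume R: "pairing R Z"
  have fR: "finite R" using R assms(5) by (auto simp: pairing_def intro: finite_subset)
  have injf: "inj_on fst R" unfolding inj_on_def using R by (auto simp: pairing_def)
  have "card R <= card Z" using card_inj_on_le[OF injf _ assms(5)] pairingD(1)[OF R] by blast
  then have "card Z + 3 * card R <= f" using assms(7) by simp
  from hub_connectors[OF assms(2) fR assms(5) this, of fst snd]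
  obtain K where K: "\<forall>p\<in>R. K p \<subseteq> Q - Z & finite (K p) & card (K p) <= 3 & conn E (K p) & (\<exists>u\<in>K p. (fst p, u) \<in> E) & (\<exists>v\<in>K p. (snd p, v) \<in> E)"
    "\<forall>p\<in>R. \<forall>q\<in>R. p ~= q --> K p Int K q = {}" using R assms(6) unfolding pairing_def by fastforce
  define C where "C x = insert x (\<Union>p\<in>{p\<in>R. fst p = x}. K p)" for x
  have one: "{p\<in>R. fst p = fst q} = {q}" if "q \<in> R" for q using injf that by (auto simp: inj_on_def)
  have Cx: "(\<exists>p\<in>R. fst p = x & C x = insert x (K p)) | C x = {x}" for x
  proof (cases "\<exists>p\<in>R. fst p = x")
    case True then show ?thesis using one by (fastforce simp: C_def)
  next
    case False then have "{p\<in>R. fst p = x} = {}" by auto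
    then show ?thesis unfolding C_def by (metis UN_empty)
  qed
  have 1: "x \<in> C x & C x \<subseteq> V & conn E (C x)" if "x \<in> Z" for x
  proof -
    have "conn E (C x)" "C x \<subseteq> V"
    proof -
      consider p where "p \<in> R" "fst p = x" "C x = insert x (K p)" | "C x = {x}" using Cx[of x] by blast
      then have "conn E (C x) & C x \<subseteq> V"
      proof cases
        case 1
        obtain u where "u \<in> K p" "(x, u) \<in> E" using K(1) 1 by auto
        then have "conn E (insert x (K p))" using conn_insert[OF assms(1), of "K p" u x] K(1) 1 symD[OF assms(1)] by blast
        then show ?thesis using 1 K(1) assms(3,4,6) that by auto
      next
        case 2 then show ?thesis using conn_single that assms(4,6) by auto
      qed
      then show "conn E (C x)" "C x \<subseteq> V" by auto
    qed
    then show ?thesis by (simp add: C_def)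
  qed
  have 2: "C x Int C y = {}" if "x \<in> Z" "y \<in> Z" "x ~= y" for x y
  proof -
    have a: False if "p \<in> R" "q \<in> R" "fst p = x" "fst q = y" "w \<in> K p" "w \<in> K q" for p q w
    proof -
      have "p ~= q" using that \<open>x ~= y\<close> by auto
      then have "K p Int K q = {}" using K(2) that by simp
      then show False using that by auto
    qed
    have b: "w \<notin> Z" if "p \<in> R" "w \<in> K p" for p w using K(1) that by auto
    show ?thesis unfolding C_def using that a b by blast
  qed
  have 3: "\<exists>u\<in>C (fst p). \<exists>v\<in>C (snd p). (u, v) \<in> E" if "p \<in> R" for p
  proof -
    have "\<exists>v\<in>K p. (snd p, v) \<in> E" using K(1) that by blast
    then obtain v where v: "v \<in> K p" "(snd p, v) \<in> E" by blast
    have "v \<in> C (fst p)" unfolding C_def using v(1) that by blast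
    moreover have "(v, snd p) \<in> E" "snd p \<in> C (snd p)" using v(2) symD[OF assms(1)] by (auto simp: C_def)
    ultimately show ?thesis by blast
  qed
  show "\<exists>C. rooted V E Z R C" unfolding rooted_def using 1 2 3 by (intro exI[of _ C]) simp
qed

text \<open>\<open>E'\<close> may contain virtual edges inside \<open>Z\<close>. If \<open>s\<close>
  and \<open>t\<close> are in the same component of \<open>E\<close> within \<open>D\<close>, no
  virtual edge is needed; otherwise both components must reach \<open>Z\<close>, and each is trimmed
  to meet it once. However many virtual edges \<open>D\<close> relies on, a single one between
  \<open>z\<close> and \<open>z'\<close> is enough.\<close>

lemma clique_route:
  assumes "sym E" "finite D" "conn E' D" "D \<subseteq> A" "s \<in> D" "t \<in> D" "s ~= t" "E' \<subseteq> E Un Z \<times> Z"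
  shows "\<exists>S T. S \<subseteq> D & T \<subseteq> D & s \<in> S & t \<in> T & conn E S & conn E T & S Int T = {} &
    ((\<exists>u\<in>S. \<exists>v\<in>T. (u, v) \<in> E) | (\<exists>z z'. z ~= z' & S Int Z = {z} & T Int Z = {z'}))"
proof (cases "t \<in> reach E D s")
  case True
  let ?W = "reach E D s"
  have W: "conn E ?W" "?W \<subseteq> D" "s \<in> ?W" using conn_reach[OF assms(1,5)] reach_subset[OF assms(5)] reach_self[of s E D] by auto
  \<comment> \<open>The part reachable from \<open>s\<close> without \<open>t\<close> can only be
    left by an edge that ends in \<open>t\<close>.\<close>
  let ?S = "reach E (?W - {t}) s"
  have sW: "s \<in> ?W - {t}" using W assms(7) by auto
  have S: "conn E ?S" "?S \<subseteq> ?W - {t}" "s \<in> ?S" using conn_reach[OF assms(1) sW] reach_subset[OF sW] reach_self[of s E] by auto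
  obtain u v where uv: "u \<in> ?S" "v \<in> ?W - ?S" "(u, v) \<in> E" using conn_leaves[OF W(1), of ?S] S True by auto
  have "v = t" using reach_closed[OF uv(1) sW uv(3)] uv(2) by auto
  then have "\<exists>u\<in>?S. \<exists>v\<in>{t}. (u, v) \<in> E" using uv by blast
  then show ?thesis using S W True conn_single[of E t] assms(6) by (intro exI[of _ ?S] exI[of _ "{t}"]) auto
next
  case False
  have tr: "\<exists>S z. S \<subseteq> reach E D x & conn E S & x \<in> S & S Int Z = {z}" if x: "x \<in> D" "y \<in> D" "y \<notin> reach E D x" for x y
  proof -
    have W: "conn E (reach E D x)" "reach E D x \<subseteq> D" "x \<in> reach E D x"
      using conn_reach[OF assms(1) x(1)] reach_subset[OF x(1)] reach_self[of x E D] by auto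
    obtain u v where uv: "u \<in> reach E D x" "v \<in> D - reach E D x" "(u, v) \<in> E'"
      using conn_leaves[OF assms(3) W(2)] W x by auto
    then have "(u, v) \<notin> E" using reach_closed[OF uv(1) x(1)] by auto
    then have "u \<in> Z" using uv assms(8) by auto
    then have "reach E D x Int Z ~= {}" using uv by auto
    moreover have "finite (reach E D x)" using W assms(2) finite_subset by auto
    moreover have "reach E D x Int {x} ~= {}" using W by auto
    ultimately obtain S a z where S: "S \<subseteq> reach E D x" "conn E S" "S Int {x} = {a}" "S Int Z = {z}"
      using conn_trim[OF assms(1) _ W(1), of "{x}" Z] by blast
    then have "x \<in> S" by auto
    then show ?thesis using S by blast
  qed
  have F2: "s \<notin> reach E D t"
  proof
    assume "s \<in> reach E D t"
    then have "(t, s) \<in> (E Int D \<times> D)\<^sup>*" by (simp add: reach_def)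
    then have "(s, t) \<in> (E Int D \<times> D)\<^sup>*" using sym_rtrancl[OF sym_restrict[OF assms(1)]] by (meson symD)
    then show False using False by (simp add: reach_def)
  qed
  have dis: "reach E D s Int reach E D t = {}"
  proof (rule ccontr)
    assume "reach E D s Int reach E D t ~= {}"
    then obtain w where "(s, w) \<in> (E Int D \<times> D)\<^sup>*" "(t, w) \<in> (E Int D \<times> D)\<^sup>*" by (auto simp: reach_def)
    then have "(s, t) \<in> (E Int D \<times> D)\<^sup>*" using sym_rtrancl[OF sym_restrict[OF assms(1)]] by (meson symD rtrancl_trans)
    then show False using False by (simp add: reach_def)
  qed
  obtain S z where S: "S \<subseteq> reach E D s" "conn E S" "s \<in> S" "S Int Z = {z}" using tr[OF assms(5,6) False] by auto
  obtain T z' where T: "T \<subseteq> reach E D t" "conn E T" "t \<in> T" "T Int Z = {z'}" using tr[OF assms(6,5) F2] by auto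
  have ST: "S Int T = {}" using S(1) T(1) dis by auto
  have zz: "z \<in> S" "z' \<in> T" using S(4) T(4) by auto
  then have ne: "z ~= z'" using ST by auto
  have sub: "S \<subseteq> D" "T \<subseteq> D" using S(1) T(1) reach_subset[OF assms(5), of E] reach_subset[OF assms(6), of E] by auto
  have ex: "\<exists>z z'. z ~= z' & S Int Z = {z} & T Int Z = {z'}"
    by (intro exI[of _ z] exI[of _ z'] conjI ne S(4) T(4))
  show ?thesis by (intro exI[of _ S] exI[of _ T] conjI sub S(2,3) T(2,3) ST disjI2 ex)
qed

text \<open>If \<open>Z\<close> is linked in \<open>B\<close>, its vertices may be treated as
  pairwise adjacent in \<open>A\<close>: routes are normalised by \<open>clique_route\<close>, and
  the pairs that still need a virtual edge induce a pairing of \<open>Z\<close>, which is realised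
  inside \<open>B\<close>.\<close>

lemma linked_clique:
  assumes "sym E" "finite A" "A Int B = Z" "linked B EB Z" "EB \<subseteq> E" "sym E'"
    and "linked A E' X" "E' \<subseteq> E Un Z \<times> Z"
  shows "linked (A Un B) E X"
  unfolding linked_def
proof (intro allI impI)
  fix Q assume Q: "pairing Q X"
  then obtain C' where C': "rooted A E' X Q C'" using assms(7) by (auto simp: linked_def)
  define D where "D p = C' (fst p) Un C' (snd p)" for p
  have CA: "C' x \<subseteq> A" "finite (C' x)" if "x \<in> X" for x
    using rootedD(2)[OF C' that] finite_subset[OF _ assms(2)] by auto
  have Dd: "D p Int D q = {}" if "p \<in> Q" "q \<in> Q" "p ~= q" for p q
  proof -
    have "C' x Int C' y = {}" if "x \<in> {fst p, snd p}" "y \<in> {fst q, snd q}" for x y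
      by (rule rootedD(4)[OF C'])
         (use that pairingD(1,2)[OF Q \<open>p \<in> Q\<close>] pairingD(1,2)[OF Q \<open>q \<in> Q\<close>] pairingD(4)[OF Q \<open>p \<in> Q\<close> \<open>q \<in> Q\<close> \<open>p ~= q\<close>] in auto)
    then show ?thesis unfolding D_def by auto
  qed
  have "\<forall>p\<in>Q. \<exists>ST. fst ST \<subseteq> D p & snd ST \<subseteq> D p & fst p \<in> fst ST & snd p \<in> snd ST & conn E (fst ST) & conn E (snd ST) & fst ST Int snd ST = {} &
    ((\<exists>u\<in>fst ST. \<exists>v\<in>snd ST. (u, v) \<in> E) | (\<exists>z z'. z ~= z' & fst ST Int Z = {z} & snd ST Int Z = {z'}))"
  proof
    fix p assume p: "p \<in> Q"
    note pX = pairingD(1-3)[OF Q p]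
    obtain u v where uv: "u \<in> C' (fst p)" "v \<in> C' (snd p)" "(u, v) \<in> E'" using rootedD(5)[OF C' p] by auto
    have "conn E' (D p)" unfolding D_def
      by (rule conn_Un_edge[OF assms(6) rootedD(3)[OF C' pX(1)] rootedD(3)[OF C' pX(2)] uv])
    moreover have "finite (D p)" "D p \<subseteq> A" "fst p \<in> D p" "snd p \<in> D p"
      using CA pX rootedD(1)[OF C'] by (auto simp: D_def)
    ultimately obtain S T where "S \<subseteq> D p & T \<subseteq> D p & fst p \<in> S & snd p \<in> T & conn E S & conn E T & S Int T = {} &
      ((\<exists>u\<in>S. \<exists>v\<in>T. (u, v) \<in> E) | (\<exists>z z'. z ~= z' & S Int Z = {z} & T Int Z = {z'}))"
      using clique_route[OF assms(1) _ _ _ _ _ pX(3) assms(8)] by metis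
    then show "\<exists>ST. fst ST \<subseteq> D p & snd ST \<subseteq> D p & fst p \<in> fst ST & snd p \<in> snd ST & conn E (fst ST) & conn E (snd ST) & fst ST Int snd ST = {} &
      ((\<exists>u\<in>fst ST. \<exists>v\<in>snd ST. (u, v) \<in> E) | (\<exists>z z'. z ~= z' & fst ST Int Z = {z} & snd ST Int Z = {z'}))"
      by (intro exI[of _ "(S, T)"]) simp
  qed
  from bchoice[OF this] obtain ST where ST0: "\<forall>p\<in>Q. fst (ST p) \<subseteq> D p & snd (ST p) \<subseteq> D p & fst p \<in> fst (ST p) & snd p \<in> snd (ST p) &
    conn E (fst (ST p)) & conn E (snd (ST p)) & fst (ST p) Int snd (ST p) = {} &
    ((\<exists>u\<in>fst (ST p). \<exists>v\<in>snd (ST p). (u, v) \<in> E) | (\<exists>z z'. z ~= z' & fst (ST p) Int Z = {z} & snd (ST p) Int Z = {z'}))" ..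
  then have ST: "!!p. p \<in> Q ==> fst (ST p) \<subseteq> D p" "!!p. p \<in> Q ==> snd (ST p) \<subseteq> D p"
    "!!p. p \<in> Q ==> fst p \<in> fst (ST p)" "!!p. p \<in> Q ==> snd p \<in> snd (ST p)"
    "!!p. p \<in> Q ==> conn E (fst (ST p))" "!!p. p \<in> Q ==> conn E (snd (ST p))"
    "!!p. p \<in> Q ==> fst (ST p) Int snd (ST p) = {}"
    "!!p. p \<in> Q ==> (\<exists>u\<in>fst (ST p). \<exists>v\<in>snd (ST p). (u, v) \<in> E) | (\<exists>z z'. z ~= z' & fst (ST p) Int Z = {z} & snd (ST p) Int Z = {z'})"
    by simp_all
  \<comment> \<open>\<open>ty p\<close>: the pair still needs a virtual edge. Each of its two routes
    then meets \<open>Z\<close> in exactly one vertex, called \<open>zt\<close> below.\<close>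
  define ty where "ty p \<longleftrightarrow> ~ (\<exists>u\<in>fst (ST p). \<exists>v\<in>snd (ST p). (u, v) \<in> E)" for p
  define own where "own x = (SOME p. p \<in> Q & x \<in> {fst p, snd p})" for x
  have own: "own x = p" if "p \<in> Q" "x \<in> {fst p, snd p}" for x p
    unfolding own_def
  proof (rule some_equality)
    show "p \<in> Q & x \<in> {fst p, snd p}" using that by simp
    show "q = p" if "q \<in> Q & x \<in> {fst q, snd q}" for q using pairingD(4)[OF Q \<open>p \<in> Q\<close>, of q] that \<open>x \<in> {fst p, snd p}\<close> by blast
  qed
  define ep where "ep x \<longleftrightarrow> (\<exists>p\<in>Q. x \<in> {fst p, snd p})" for x
  define P0 where "P0 x = (if ~ ep x then {x} else if fst (own x) = x then fst (ST (own x)) else snd (ST (own x)))" for x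
  define Mk where "Mk x \<longleftrightarrow> ep x & ty (own x)" for x
  define zt where "zt x = the_elem (P0 x Int Z)" for x
  have P0f: "P0 (fst p) = fst (ST p)" "P0 (snd p) = snd (ST p)" "Mk (fst p) = ty p" "Mk (snd p) = ty p" if "p \<in> Q" for p
    using own[OF that, of "fst p"] own[OF that, of "snd p"] that pairingD(3)[OF Q that] by (auto simp: P0_def ep_def Mk_def)
  have epE: "\<exists>p\<in>Q. x = fst p | x = snd p" if "ep x" for x using that by (auto simp: ep_def)
  have P1: "x \<in> P0 x & P0 x \<subseteq> A & conn E (P0 x)" if "x \<in> X" for x
  proof (cases "ep x")
    case False then show ?thesis using conn_single[of E x] rootedD(1)[OF C' that] CA(1)[OF that] by (auto simp: P0_def)
  next
    case True
    then obtain p where p: "p \<in> Q" "x = fst p | x = snd p" using epE by blast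
    have "D p \<subseteq> A" using CA(1) pairingD(1,2)[OF Q p(1)] by (auto simp: D_def)
    then show ?thesis using p(2) P0f[OF p(1)] ST(1-6)[OF p(1)] by auto
  qed
  have P2: "P0 x Int P0 y = {}" if "x \<in> X" "y \<in> X" "x ~= y" for x y
  proof -
    define R where "R x = (if ep x then D (own x) else C' x)" for x
    have PR: "P0 x \<subseteq> R x" if "x \<in> X" for x
    proof (cases "ep x")
      case False then show ?thesis using rootedD(1)[OF C' that] by (auto simp: P0_def R_def)
    next
      case True
      then obtain p where p: "p \<in> Q" "x = fst p | x = snd p" using epE by blast
      then have "own x = p" using own by blast
      then show ?thesis using p True P0f[OF p(1)] ST(1,2)[OF p(1)] by (auto simp: R_def)
    qed
    have mix: "D p Int C' z = {}" if "p \<in> Q" "z \<in> X" "~ ep z" for p z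
    proof -
      have "z ~= fst p" "z ~= snd p" using that by (auto simp: ep_def)
      then show ?thesis using rootedD(4)[OF C' pairingD(1)[OF Q that(1)] that(2)] rootedD(4)[OF C' pairingD(2)[OF Q that(1)] that(2)]
        by (auto simp: D_def)
    qed
    show ?thesis
    proof (cases "ep x & ep y & own x = own y")
      case True
      then obtain p where p: "p \<in> Q" "x = fst p | x = snd p" using epE by blast
      obtain q where q: "q \<in> Q" "y = fst q | y = snd q" using epE True by blast
      have "p = q" using own[OF p(1), of x] own[OF q(1), of y] p q True by auto
      then show ?thesis using p q that(3) P0f[OF p(1)] ST(7)[OF p(1)] by auto
    next
      case False
      have ow: "own z \<in> Q" if "ep z" for z using epE[OF that] own by auto
      have "R x Int R y = {}"
        using False Dd[OF ow ow, of x y] mix[OF ow, of x y] mix[OF ow, of y x] rootedD(4)[OF C' that] that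
        by (auto simp: R_def Int_commute)
      then show ?thesis using PR[OF that(1)] PR[OF that(2)] by auto
    qed
  qed
  have zt: "P0 x Int Z = {zt x}" if "Mk x" for x
  proof -
    have "ep x" using that by (simp add: Mk_def)
    then obtain p where p: "p \<in> Q" "x = fst p | x = snd p" using epE by blast
    have "ty p" using p that P0f(3,4)[OF p(1)] by auto
    then obtain z z' where "fst (ST p) Int Z = {z}" "snd (ST p) Int Z = {z'}" using ST(8)[OF p(1)] by (auto simp: ty_def)
    then show ?thesis using p P0f(1,2)[OF p(1)] unfolding zt_def by auto
  qed
  have ztP: "zt x \<in> P0 x" "zt x \<in> Z" if "Mk x" for x using zt[OF that] by blast+
  have MkX: "x \<in> X" if "Mk x" for x using that epE[of x] pairingD(1,2)[OF Q] by (auto simp: Mk_def)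
  have zti: "zt x ~= zt y" if "Mk x" "Mk y" "x ~= y" for x y
    using P2[OF MkX[OF that(1)] MkX[OF that(2)] that(3)] ztP(1)[OF that(1)] ztP(1)[OF that(2)] by auto
  define Q2 where "Q2 = (%p. (zt (fst p), zt (snd p))) ` {p\<in>Q. ty p}"
  have "pairing Q2 Z" unfolding pairing_def
  proof (intro conjI ballI impI)
    have Mf: "Mk (fst p)" "Mk (snd p)" if "p \<in> Q" "ty p" for p using P0f(3,4)[OF that(1)] that(2) by auto
    show "Q2 \<subseteq> Z \<times> Z" using ztP(2) Mf by (auto simp: Q2_def)
    fix p assume "p \<in> Q2"
    then obtain p' where p': "p' \<in> Q" "ty p'" "p = (zt (fst p'), zt (snd p'))" by (auto simp: Q2_def)
    show "fst p ~= snd p" using zti[OF Mf[OF p'(1,2)] pairingD(3)[OF Q p'(1)]] p'(3) by simp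
    fix q assume "q \<in> Q2" and ne: "p ~= q"
    then obtain q' where q': "q' \<in> Q" "ty q'" "q = (zt (fst q'), zt (snd q'))" by (auto simp: Q2_def)
    have "p' ~= q'" using p' q' ne by auto
    then have "{fst p', snd p'} Int {fst q', snd q'} = {}" using pairingD(4)[OF Q p'(1) q'(1)] by simp
    then show "{fst p, snd p} Int {fst q, snd q} = {}"
      using zti Mf[OF p'(1,2)] Mf[OF q'(1,2)] p'(3) q'(3) by auto
  qed
  then obtain C where C: "rooted B EB Z Q2 C" using assms(4) by (auto simp: linked_def)
  define M where "M x = (if Mk x then C (zt x) else {})" for x
  have M1: "M x \<subseteq> B" for x using rootedD(2)[OF C ztP(2)] by (auto simp: M_def)
  have PM: "P0 x Int M y = {}" if "x \<in> X" "y \<in> X" "x ~= y" for x y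
  proof (rule ccontr)
    assume "P0 x Int M y ~= {}"
    then obtain w where w: "w \<in> P0 x" "w \<in> M y" by auto
    have Mky: "Mk y" "w \<in> C (zt y)" using w(2) by (auto simp: M_def split: if_splits)
    have "w \<in> Z" using w P1[OF that(1)] M1[of y] assms(3) by auto
    then have "w = zt y" using rootedD(4)[OF C _ ztP(2)[OF Mky(1)], of w] rootedD(1)[OF C, of w] Mky(2) by auto
    then show False using ztP(1)[OF Mky(1)] w(1) P2[OF that] by auto
  qed
  have MM: "M x Int M y = {}" if "x ~= y" for x y
    using rootedD(4)[OF C ztP(2) ztP(2) zti[OF _ _ that]] by (auto simp: M_def)
  let ?C = "%x. P0 x Un M x"
  have 1: "x \<in> ?C x & ?C x \<subseteq> A Un B & conn E (?C x)" if "x \<in> X" for x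
  proof -
    have "conn E (?C x)"
    proof (cases "Mk x")
      case True
      have "conn E (C (zt x))" using rootedD(3)[OF C ztP(2)[OF True]] assms(5) by (auto intro: conn_mono)
      then show ?thesis using conn_Un_int[OF assms(1)] P1[OF that] ztP(1)[OF True] rootedD(1)[OF C ztP(2)[OF True]] True
        by (auto simp: M_def)
    qed (use P1[OF that] in \<open>simp add: M_def\<close>)
    then show ?thesis using P1[OF that] M1[of x] by auto
  qed
  have 2: "?C x Int ?C y = {}" if "x \<in> X" "y \<in> X" "x ~= y" for x y
    using P2[OF that] PM[OF that] PM[OF that(2,1)] MM[OF that(3)] that(3) by auto
  have 3: "\<exists>u\<in>?C (fst p). \<exists>v\<in>?C (snd p). (u, v) \<in> E" if "p \<in> Q" for p
  proof (cases "ty p")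
    case False then show ?thesis using P0f(1,2)[OF that] by (auto simp: ty_def)
  next
    case True
    then have "(zt (fst p), zt (snd p)) \<in> Q2" using that by (auto simp: Q2_def)
    from rootedD(5)[OF C this] show ?thesis using assms(5) P0f(3,4)[OF that] True by (auto simp: M_def)
  qed
  show "\<exists>C. rooted (A Un B) E X Q C" unfolding rooted_def using 1 2 3 by (intro exI[of _ ?C]) simp
qed

section \<open>Rigid separations\<close>

text \<open>Known as a rigid separation: the far side links its own boundary, so by
  \<open>linked_clique\<close> the boundary may be replaced by a clique.\<close>

definition lsep :: "'a set => ('a \<times> 'a) set => 'a set => 'a set => 'a set => bool" where
  "lsep V E X A B \<longleftrightarrow> sepn V E A B & X \<subseteq> A & card (A Int B) < card X &
     linked B (E Int B \<times> B) (A Int B) & B - A ~= {}"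

text \<open>By Menger, either disjoint connections from \<open>X\<close> to \<open>A Int B\<close>
  carry linkedness back to \<open>X\<close>, or some separation inside \<open>A\<close> has order
  below \<open>card X\<close>. For one of least order, Menger applies again between its boundary and
  \<open>A Int B\<close>, so its boundary is linked on the far side.\<close>

lemma link_or_lsep:
  assumes G: "sgr V E" and AB: "sepn V E A B" and X: "X \<subseteq> A" "card X <= card (A Int B)"
    and L: "!!Z. Z \<subseteq> A Int B ==> card Z <= card X ==> linked B (E Int B \<times> B) Z"
  shows "linked V E X | (\<exists>P Q. lsep V E X P Q)"
proof -
  let ?T = "A Int B"
  have V: "A Un B = V" "E Int (A - B) \<times> (B - A) = {}" using AB by (auto simp: sepn_def)
  have fV: "finite V" "sym E" using sgr_finite[OF G] by auto
  have fin: "finite A" "finite B" using V(1) fV by (metis finite_Un)+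
  have GA: "sgr A (E Int A \<times> A)" using sgr_restrict[OF G] V by auto
  define S where "S = {(P, Q). sepn A (E Int A \<times> A) P Q & X \<subseteq> P & ?T \<subseteq> Q & card (P Int Q) < card X}"
  show ?thesis
  proof (cases "S = {}")
    case True
    have sep: "card X <= card (P Int Q)" if "sepn A (E Int A \<times> A) P Q" "X \<subseteq> P" "?T \<subseteq> Q" for P Q
      using True that by (auto simp: S_def not_less)
    obtain C g where C: "!!x. x \<in> X ==> C x \<subseteq> A & conn (E Int A \<times> A) (C x) & C x Int X = {x} & C x Int ?T = {g x}"
      "!!x y. x \<in> X ==> y \<in> X ==> x ~= y ==> C x Int C y = {}" "inj_on g X"
      by (rule menger_set[OF sgr_finite(1,3,4,5)[OF GA] X(1), of ?T]) (use sep in auto)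
    have gT: "g x \<in> ?T" if "x \<in> X" for x using C(1)[OF that] by blast
    have fX: "finite X" using X fin finite_subset by auto
    have LZ: "linked B (E Int B \<times> B) (g ` X)" using L[of "g ` X"] gT card_image_le[OF fX, of g] by auto
    have "linked V E X"
    proof (rule linked_extend[OF fV(2) LZ, where D = C and g = g])
      show "x \<in> C x & C x \<subseteq> V & conn E (C x) & C x Int B = {g x} & g x \<in> g ` X" if "x \<in> X" for x
      proof -
        have "conn E (C x)" using C(1)[OF that] by (auto intro: conn_mono)
        moreover have "x \<in> C x" "C x \<subseteq> A" using C(1)[OF that] by blast+
        moreover have "C x Int B = C x Int ?T" using C(1)[OF that] by blast
        ultimately show ?thesis using C(1)[OF that] V that by auto
      qed
    qed (use C(2) V in auto)
    then show ?thesis by simp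
  next
    case False
    obtain P Q where PQ: "(P, Q) \<in> S" "!!P' Q'. (P', Q') \<in> S ==> card (P Int Q) <= card (P' Int Q')"
    proof -
      obtain pq where "pq \<in> S" "!!pq'. pq' \<in> S ==> card (fst pq Int snd pq) <= card (fst pq' Int snd pq')"
        using obtain_min[OF False, of "%pq. card (fst pq Int snd pq)"] by blast
      then show thesis by (intro that[of "fst pq" "snd pq"]) force+
    qed
    have P: "P Un Q = A" "E Int A \<times> A Int (P - Q) \<times> (Q - P) = {}" "X \<subseteq> P" "?T \<subseteq> Q" "card (P Int Q) < card X"
      using PQ(1) by (auto simp: S_def sepn_def)
    let ?Y = "P Int Q"
    have GQ: "sgr Q (E Int Q \<times> Q)" using sgr_restrict[OF G, of Q] P V by auto
    \<comment> \<open>A separation of \<open>Q\<close> with smaller order would combine with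
      \<open>P\<close> to contradict the choice of least order.\<close>
    have sep: "card ?Y <= card (P1 Int Q1)" if s: "sepn Q (E Int Q \<times> Q) P1 Q1" "?Y \<subseteq> P1" "?T \<subseteq> Q1" for P1 Q1
    proof -
      have s1: "P1 Un Q1 = Q" "E Int Q \<times> Q Int (P1 - Q1) \<times> (Q1 - P1) = {}" using s by (auto simp: sepn_def)
      have i: "(P Un P1) Int Q1 = P1 Int Q1" using s1 s(2) by blast
      have "sepn A (E Int A \<times> A) (P Un P1) Q1" unfolding sepn_def
      proof (intro conjI equals0I)
        show "(P Un P1) Un Q1 = A" using s1 P(1) by blast
        fix e assume "e \<in> E Int A \<times> A Int ((P Un P1) - Q1) \<times> (Q1 - (P Un P1))"
        then obtain u v where uv: "(u, v) \<in> E" "u \<in> A" "v \<in> A" "u \<in> P Un P1" "u \<notin> Q1" "v \<in> Q1" "v \<notin> P" "v \<notin> P1" by auto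
        have vQ: "v \<in> Q" using uv s1 by auto
        have uQ: "u \<in> Q" using P(2) uv vQ s1 by blast
        have "u \<in> P1" using uQ uv s1 by auto
        then show False using s1(2) uv uQ vQ by blast
      qed
      moreover have "X \<subseteq> P Un P1" using P(3) by auto
      ultimately show ?thesis
        using PQ(2)[of "P Un P1" Q1] i s(3) P(5) by (cases "card (P1 Int Q1) < card X") (auto simp: S_def)
    qed
    have TQ: "?T \<subseteq> Q" using P by auto
    obtain C g where C: "!!x. x \<in> ?Y ==> C x \<subseteq> Q & conn (E Int Q \<times> Q) (C x) & C x Int ?Y = {x} & C x Int ?T = {g x}"
      "!!x y. x \<in> ?Y ==> y \<in> ?Y ==> x ~= y ==> C x Int C y = {}" "inj_on g ?Y"
      by (rule menger_set[OF sgr_finite(1,3,4,5)[OF GQ] _ TQ, of ?Y]) (use sep in auto)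
    let ?B = "Q Un B"
    have gT: "g x \<in> ?T" if "x \<in> ?Y" for x using C(1)[OF that] by blast
    have fY: "finite ?Y" using P(1) fin by (metis finite_Int finite_Un)
    have LZ: "linked B (E Int B \<times> B) (g ` ?Y)" using L[of "g ` ?Y"] gT card_image_le[OF fY, of g] P(5) by force
    have LY: "linked ?B (E Int ?B \<times> ?B) ?Y"
    proof (rule linked_extend[OF sym_restrict[OF fV(2)] LZ, where D = C and g = g])
      show "x \<in> C x & C x \<subseteq> ?B & conn (E Int ?B \<times> ?B) (C x) & C x Int B = {g x} & g x \<in> g ` ?Y" if "x \<in> ?Y" for x
      proof -
        have "conn (E Int ?B \<times> ?B) (C x)" using C(1)[OF that] by (auto intro: conn_mono)
        moreover have "x \<in> C x" "C x \<subseteq> Q" using C(1)[OF that] by blast+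
        moreover have "C x Int B = C x Int ?T" using C(1)[OF that] P(1) by blast
        ultimately show ?thesis using C(1)[OF that] that by auto
      qed
    qed (use C(2) in auto)
    have PB: "P Int ?B = ?Y" using P(1,4) by blast
    have "sepn V E P ?B" unfolding sepn_def
    proof (intro conjI equals0I)
      show "P Un ?B = V" using P V by auto
      fix e assume "e \<in> E Int (P - ?B) \<times> (?B - P)"
      then obtain u v where uv: "(u, v) \<in> E" "u \<in> P" "u \<notin> Q" "u \<notin> B" "v \<in> Q Un B" "v \<notin> P" by auto
      have uA: "u \<in> A" using uv P(1) by auto
      have vA: "v \<in> A" using V(2) uv uA P(1) by blast
      then have "v \<in> Q" using uv P(1) by auto
      then show False using P(2) uv uA vA by blast
    qed
    moreover have "?B - P ~= {}"
    proof
      assume "?B - P = {}"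
      then have "?T \<subseteq> ?Y" using P(4) by auto
      then have "card ?T <= card ?Y" using fY by (rule card_mono[rotated])
      then show False using P(5) X(2) by simp
    qed
    ultimately have "lsep V E X P ?B" unfolding lsep_def using LY PB P(3,5) by simp
    then show ?thesis by blast
  qed
qed

section \<open>Massed graphs are linked\<close>

lemma obtain_min_pair:
  fixes f :: "'b => 'c => nat"
  assumes "S ~= {}"
  shows "\<exists>A B. (A, B) \<in> S & (\<forall>A2 B2. (A2, B2) \<in> S --> f A B <= f A2 B2)"
proof -
  obtain p where p: "p \<in> S" "\<forall>z\<in>S. f (fst p) (snd p) <= f (fst z) (snd z)"
    using obtain_min[OF assms, of "%p. f (fst p) (snd p)"] by blast
  have "(fst p, snd p) \<in> S" using p(1) by simp
  moreover have "f (fst p) (snd p) <= f A2 B2" if "(A2, B2) \<in> S" for A2 B2 using p(2) that by force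
  ultimately show ?thesis by blast
qed

text \<open>Arcs are counted, so every edge meeting \<open>W\<close> counts twice.\<close>

definition inc :: "('a \<times> 'a) set => 'a set => nat" where
  "inc E W = card {e \<in> E. fst e \<in> W | snd e \<in> W}"

lemma inc_le:
  assumes "finite E'" "!!a b. (a, b) \<in> E ==> a \<in> W | b \<in> W ==> (a, b) \<in> E' & (a \<in> W' | b \<in> W')"
  shows "inc E W <= inc E' W'"
proof -
  have "{e \<in> E. fst e \<in> W | snd e \<in> W} \<subseteq> {e \<in> E'. fst e \<in> W' | snd e \<in> W'}"
  proof
    fix e assume "e \<in> {e \<in> E. fst e \<in> W | snd e \<in> W}"
    then show "e \<in> {e \<in> E'. fst e \<in> W' | snd e \<in> W'}" using assms(2)[of "fst e" "snd e"] by simp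
  qed
  then show ?thesis unfolding inc_def by (rule card_mono[rotated]) (use assms(1) in simp)
qed

lemma inc_empty: "inc E {} = 0"
  by (simp add: inc_def)

text \<open>The mass condition of Thomas and Wollan, where \<open>c\<close> is twice their density
  since arcs are counted. The second half forbids that the excess sits behind a boundary too small
  to be reached from \<open>X\<close>; this is what makes the condition usable in an induction by
  deletion, contraction and passing to a side.\<close>

definition massed :: "nat => 'a set => ('a \<times> 'a) set => 'a set => bool" where
  "massed c V E X \<longleftrightarrow> c * card (V - X) < inc E (V - X) &
     (\<forall>A B. sepn V E A B --> X \<subseteq> A --> card (A Int B) < card X --> inc E (B - A) <= c * card (B - A))"

text \<open>A separation of \<open>B\<close> extends by \<open>A\<close> to one of the whole graph,
  so the dense side of a separation inherits the condition relative to its boundary if no separation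
  of smaller order has a dense side.\<close>

lemma massed_sub:
  assumes G: "sgr V E" and AB: "sepn V E A B" and X: "X \<subseteq> A" and d: "c * card (B - A) < inc E (B - A)"
    and m: "!!A' B'. sepn V E A' B' ==> X \<subseteq> A' ==> card (A' Int B') < card (A Int B) ==> inc E (B' - A') <= c * card (B' - A')"
  shows "massed c B (E Int B \<times> B) (A Int B)"
  unfolding massed_def
proof (intro conjI allI impI)
  have V: "A Un B = V" "E Int (A - B) \<times> (B - A) = {}" using AB by (auto simp: sepn_def)
  have V2: "E Int (B - A) \<times> (A - B) = {}" using V(2) sgr_finite(3)[OF G] by (auto simp: sym_def)
  have fE: "finite E" "E \<subseteq> V \<times> V" using sgr_finite[OF G] by auto
  have BA: "B - A Int B = B - A" by auto
  have "inc E (B - A) <= inc (E Int B \<times> B) (B - A)"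
    by (rule inc_le) (use fE V V2 in auto)
  then show "c * card (B - A Int B) < inc (E Int B \<times> B) (B - A Int B)" using d unfolding BA by simp
  fix A2 B2 assume s: "sepn B (E Int B \<times> B) A2 B2" "A Int B \<subseteq> A2" "card (A2 Int B2) < card (A Int B)"
  have s1: "A2 Un B2 = B" "E Int B \<times> B Int (A2 - B2) \<times> (B2 - A2) = {}" using s by (auto simp: sepn_def)
  have eq: "(A Un A2) Int B2 = A2 Int B2" "B2 - (A Un A2) = B2 - A2" using s1 s(2) by blast+
  have "sepn V E (A Un A2) B2" unfolding sepn_def
  proof (intro conjI equals0I)
    show "(A Un A2) Un B2 = V" using s1 V by blast
    fix e assume "e \<in> E Int ((A Un A2) - B2) \<times> (B2 - (A Un A2))"
    then obtain u v where uv: "(u, v) \<in> E" "u \<in> A Un A2" "u \<notin> B2" "v \<in> B2" "v \<notin> A" "v \<notin> A2" by auto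
    have vB: "v \<in> B" using uv s1 by auto
    have uB: "u \<in> B" using uv vB V(2) s1 by blast
    then have "u \<in> A2" using uv s1 by auto
    then show False using s1(2) uv uB vB by blast
  qed
  then have "inc E (B2 - A2) <= c * card (B2 - A2)" using m[of "A Un A2" B2] X s(3) eq by auto
  moreover have "inc (E Int B \<times> B) (B2 - A2) <= inc E (B2 - A2)" by (rule inc_le) (use fE in auto)
  ultimately show "inc (E Int B \<times> B) (B2 - A2) <= c * card (B2 - A2)" by simp
qed

text \<open>Degrees of about \<open>c / 2\<close> inside a set of at most \<open>c + 2\<close>
  vertices give density at least 1/6, with both sides of the pair equal to \<open>J\<close>, hence a
  joined pair with parameter 1/12. Sides of \<open>40 * m\<close> leave room for a reserve of
  \<open>36 * m\<close>, and \<open>36 * m / 12 = 3 * m\<close> covers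
  \<open>2 * m + 4 * \<kappa>\<close>.\<close>

lemma dense_hub_const:
  obtains K :: nat where "24 <= K" "!!\<kappa> c (E :: ('a \<times> 'a) set) J. sym E ==> finite J ==> K * (\<kappa> + 1) <= c ==> card J <= c + 2 ==> J ~= {} ==>
    (!!w. w \<in> J ==> c <= 2 * card (E `` {w} Int J) + 2 * \<kappa> + 4) ==>
    \<exists>U Q. U \<subseteq> J & Q \<subseteq> U & hub E U Q (4 * \<kappa>) & \<kappa> < card U"
proof -
  obtain T where T: "!!(E :: ('a \<times> 'a) set) X Y r. sym E ==> 0 < r ==> finite X ==> finite Y ==> r * 40 ^ T <= card X ==> r * 40 ^ T <= card Y
    ==> 1 / 6 * real (card X) * real (card Y) <= real (ecard E X Y)
    ==> \<exists>X'\<subseteq>X. \<exists>Y'\<subseteq>Y. \<exists>m\<ge>r. card X' = 40 * m & card Y' = 40 * m & 40 * m <= r * 40 ^ T & joined E m (1 / 6 / 2) X' Y'"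
  proof (rule dense_pair_joined[of 40 "1 / 6"])
    show "2 <= (40 :: nat)" "0 < (1 / 6 :: real)" by auto
  qed (rule that)
  show thesis
  \<comment> \<open>The summand 24 absorbs the loss \<open>2 * \<kappa> + 4\<close> in the degrees;
    \<open>12 * 40 ^ T\<close> makes \<open>J\<close> large enough for a pair with
    \<open>m > 4 * \<kappa>\<close>.\<close>
  proof (rule that[of "12 * 40 ^ T + 24"])
    show "24 <= 12 * 40 ^ T + (24 :: nat)" by simp
    fix \<kappa> c :: nat and E :: "('a \<times> 'a) set" and J
    assume E: "sym E" "finite J" and K: "(12 * 40 ^ T + 24) * (\<kappa> + 1) <= c" and J: "card J <= c + 2" "J ~= {}"
      and deg: "!!w. w \<in> J ==> c <= 2 * card (E `` {w} Int J) + 2 * \<kappa> + 4"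
    have "24 * (\<kappa> + 1) <= (12 * 40 ^ T + 24) * (\<kappa> + 1)" by (rule mult_right_mono) auto
    then have c24: "24 * (\<kappa> + 1) <= c" using K by simp
    have d3: "c <= 3 * card (E `` {w} Int J)" if "w \<in> J" for w using deg[OF that] c24 by simp
    obtain w0 where "w0 \<in> J" using J by auto
    then have J3: "c <= 3 * card J" using d3[of w0] card_mono[OF E(2), of "E `` {w0} Int J"] by auto
    define r where "r = 4 * \<kappa> + 1"
    have "3 * (r * 40 ^ T) <= (12 * 40 ^ T) * (\<kappa> + 1)" unfolding r_def by (simp add: algebra_simps)
    also have "\<dots> <= c" using K by (simp add: algebra_simps)
    finally have rJ: "r * 40 ^ T <= card J" using J3 by simp
    have "1 / 6 * real (card J) * real (card J) <= real (ecard E J J)"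
    proof -
      have "(\<Sum>w\<in>J. real c / 3) <= (\<Sum>w\<in>J. real (card (E `` {w} Int J)))"
      proof (rule sum_mono)
        show "real c / 3 <= real (card (E `` {w} Int J))" if "w \<in> J" for w using of_nat_mono[OF d3[OF that], where 'a = real] by simp
      qed
      also have "\<dots> = real (ecard E J J)" using ecard_sum[OF E(2) E(2), of E] by simp
      finally have 1: "real (card J) * (real c / 3) <= real (ecard E J J)" by simp
      have "real (card J) <= 2 * real c" using J(1) c24 by simp
      then have "real (card J) * (real (card J) / 6) <= real (card J) * (real c / 3)" by (intro mult_left_mono) auto
      then show ?thesis using 1 by (simp add: field_simps)
    qed
    then obtain X' Y' m where XY: "X' \<subseteq> J" "Y' \<subseteq> J" "r <= m" "card X' = 40 * m" "card Y' = 40 * m" "joined E m (1 / 6 / 2) X' Y'"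
      using T[OF E(1) _ E(2) E(2) rJ rJ] by (auto simp: r_def)
    have fin: "finite X'" "finite Y'" using XY E finite_subset by auto
    have m0: "0 < m" "4 * \<kappa> <= m" "\<kappa> < m" using XY(3) by (auto simp: r_def)
    have h4: "real (2 * m + 4 * \<kappa>) <= 1 / 6 / 2 * real (36 * m)" using m0 by simp
    obtain A1 B1 A0 B0 where H: "A1 \<subseteq> X'" "B1 \<subseteq> Y'" "A0 \<subseteq> A1" "B0 \<subseteq> B1" "card X' <= card A1 + m" "hub E (A1 Un B1) (A0 Un B0) (4 * \<kappa>)"
      using joined_clean[OF E(1) fin XY(6) _ m0(1) _ _ _ h4] XY m0 by auto
    have "card A1 <= card (A1 Un B1)" using H fin by (intro card_mono) (auto intro: finite_subset)
    then have "\<kappa> < card (A1 Un B1)" using H(5) XY(4) m0 by simp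
    then show "\<exists>U Q. U \<subseteq> J & Q \<subseteq> U & hub E U Q (4 * \<kappa>) & \<kappa> < card U"
      using H XY by (intro exI[of _ "A1 Un B1"] exI[of _ "A0 Un B0"]) auto
  qed
qed

text \<open>Preimages of connected sets under the contraction are connected, and \<open>y\<close> is
  not in \<open>X\<close>, so the roots stay in place.\<close>

lemma linked_contr:
  assumes G: "sgr V E" and xy: "(x, y) \<in> E" and L: "linked W (cedges x y E Int W \<times> W) X"
    and W: "W \<subseteq> V - {y}" and X: "X \<subseteq> W"
  shows "linked {z \<in> V. contr x y z \<in> W} (E Int {z \<in> V. contr x y z \<in> W} \<times> {z \<in> V. contr x y z \<in> W}) X"
  unfolding linked_def
proof (intro allI impI)
  let ?W = "{z \<in> V. contr x y z \<in> W}"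
  fix Q assume Q: "pairing Q X"
  then obtain C where C: "rooted W (cedges x y E Int W \<times> W) X Q C" using L by (auto simp: linked_def)
  have xyV: "x \<in> V" "y \<in> V" "sym E" "E \<subseteq> V \<times> V" using sgr_finite[OF G] xy by auto
  let ?C = "%x'. {z \<in> V. contr x y z \<in> C x'}"
  have 1: "x' \<in> ?C x' & ?C x' \<subseteq> ?W & conn (E Int ?W \<times> ?W) (?C x')" if "x' \<in> X" for x'
  proof -
    have CW: "C x' \<subseteq> W" using rootedD(2)[OF C that] .
    have "conn (cedges x y E) (C x')" using rootedD(3)[OF C that] by (auto intro: conn_mono)
    then have "conn E (?C x')" using conn_contr[OF xyV(3) xy xyV(1,2)] CW W by blast
    then have "conn (E Int ?W \<times> ?W) (?C x')" by (rule conn_mono) (use CW in auto)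
    moreover have "x' ~= y" "x' \<in> V" using that X W by auto
    then have "x' \<in> ?C x'" using rootedD(1)[OF C that] by (auto simp: contr_def)
    ultimately show ?thesis using CW by auto
  qed
  have 2: "?C a Int ?C b = {}" if "a \<in> X" "b \<in> X" "a ~= b" for a b using rootedD(4)[OF C that] by auto
  have 3: "\<exists>u\<in>?C (fst p). \<exists>v\<in>?C (snd p). (u, v) \<in> E Int ?W \<times> ?W" if p: "p \<in> Q" for p
  proof -
    obtain u v where uv: "u \<in> C (fst p)" "v \<in> C (snd p)" "(u, v) \<in> cedges x y E" "u \<in> W" "v \<in> W" using rootedD(5)[OF C p] by auto
    then obtain a b where ab: "(a, b) \<in> E" "contr x y a = u" "contr x y b = v" using cedges_iff[of u v x y E] by auto
    have "a \<in> V" "b \<in> V" using ab xyV(4) by auto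
    then show ?thesis using uv ab by (intro bexI[of _ a] bexI[of _ b]) auto
  qed
  show "\<exists>C. rooted ?W (E Int ?W \<times> ?W) X Q C" unfolding rooted_def using 1 2 3 by (intro exI[of _ ?C]) simp
qed

section \<open>The minimal counterexample\<close>

context
  fixes V :: "'a set" and E :: "('a \<times> 'a) set" and X :: "'a set" and c \<kappa> :: nat
  assumes G: "sgr V E" and XV: "X \<subseteq> V" and cX: "card X <= \<kappa>" and M: "massed c V E X"
    and IH1: "!!(V' :: 'a set) E' X'. card V' < card V ==> sgr V' E' ==> X' \<subseteq> V' ==> card X' <= \<kappa> ==> massed c V' E' X' ==> linked V' E' X'"
begin

lemma M1: "c * card (V - X) < inc E (V - X)" using M by (simp add: massed_def)

lemma M2: "sepn V E A B ==> X \<subseteq> A ==> card (A Int B) < card X ==> inc E (B - A) <= c * card (B - A)"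
  using M by (simp add: massed_def)

text \<open>Take a rigid separation with smallest \<open>A\<close> and complete its boundary to a
  clique on the side \<open>A\<close>. By \<open>linked_clique\<close> it suffices that this smaller
  graph is massed. Otherwise a separation of least order violates the condition there, and the
  clique lies on one of its sides. If it is in \<open>A'\<close>, the separation violates the mass
  condition of the whole graph; if it is in \<open>B'\<close>, the dense side is linked by induction
  and yields a rigid separation with a smaller \<open>A\<close>.\<close>

lemma lsep_imp_linked:
  assumes "lsep V E X A0 B0"
  shows "linked V E X"
proof -
  have fV: "finite V" "finite E" "sym E" "irrefl E" "E \<subseteq> V \<times> V" using sgr_finite[OF G] by auto
  have "{(A, B). lsep V E X A B} ~= {}" using assms by auto
  from obtain_min_pair[OF this, of "%A B. card A"] obtain A B where
    AB: "lsep V E X A B" and min: "!!A' B'. lsep V E X A' B' ==> card A <= card A'" by auto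
  define Z where "Z = A Int B"
  have s: "sepn V E A B" "X \<subseteq> A" "card Z < card X" "linked B (E Int B \<times> B) Z" "B - A ~= {}"
    using AB by (auto simp: lsep_def Z_def)
  have V: "A Un B = V" "E Int (A - B) \<times> (B - A) = {}" using s by (auto simp: sepn_def)
  have V2: "E Int (B - A) \<times> (A - B) = {}" using V(2) fV(3) by (auto simp: sym_def)
  have fin: "finite A" "finite B" "finite Z" using V(1) fV unfolding Z_def by (metis finite_Un finite_Int)+
  define E' where "E' = E Int A \<times> A Un (Z \<times> Z - Id)"
  have G': "sgr A E'" unfolding sgr_def E'_def using fin fV by (auto simp: sym_def irrefl_def Z_def)
  have fE': "finite E'" using sgr_finite(2)[OF G'] .
  have cA: "card A < card V" using s(5) V fV by (intro psubset_card_mono) auto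
  have "massed c A E' X" unfolding massed_def
  proof (intro conjI allI impI)
    \<comment> \<open>The arcs meeting \<open>B - A\<close> are bounded by the mass condition for
      this separation, so the excess must be found on the side \<open>A\<close>.\<close>
    have "inc E (V - X) <= inc E (B - A) + inc E' (A - X)"
    proof -
      have "{e \<in> E. fst e \<in> V - X | snd e \<in> V - X} \<subseteq> {e \<in> E. fst e \<in> B - A | snd e \<in> B - A} Un {e \<in> E'. fst e \<in> A - X | snd e \<in> A - X}"
        using fV(5) V(1) by (auto simp: E'_def)
      then have "inc E (V - X) <= card ({e \<in> E. fst e \<in> B - A | snd e \<in> B - A} Un {e \<in> E'. fst e \<in> A - X | snd e \<in> A - X})"
        unfolding inc_def using fV fE' by (intro card_mono) auto
      also have "\<dots> <= inc E (B - A) + inc E' (A - X)" unfolding inc_def by (rule card_Un_le)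
      finally show ?thesis .
    qed
    moreover have "inc E (B - A) <= c * card (B - A)" using M2[OF s(1,2)] s(3) by (simp add: Z_def)
    moreover have "card (V - X) = card (A - X) + card (B - A)"
    proof -
      have "V - X = (A - X) Un (B - A)" using V s(2) by auto
      moreover have "(A - X) Int (B - A) = {}" by auto
      ultimately show ?thesis using fin by (simp add: card_Un_disjoint)
    qed
    ultimately show "c * card (A - X) < inc E' (A - X)" using M1 by (simp add: algebra_simps)
  next
    fix A1 B1 assume v1: "sepn A E' A1 B1" "X \<subseteq> A1" "card (A1 Int B1) < card X"
    show "inc E' (B1 - A1) <= c * card (B1 - A1)"
    proof (rule ccontr)
      assume v1': "~ ?thesis"
      define S where "S = {(A', B'). sepn A E' A' B' & X \<subseteq> A' & card (A' Int B') < card X & c * card (B' - A') < inc E' (B' - A')}"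
      have "(A1, B1) \<in> S" using v1 v1' by (auto simp: S_def)
      then have "S ~= {}" by auto
      from obtain_min_pair[OF this, of "%A B. card (A Int B)"] obtain A' B' where
        in_S: "(A', B') \<in> S" and minS: "!!A2 B2. (A2, B2) \<in> S ==> card (A' Int B') <= card (A2 Int B2)" by auto
      have s': "sepn A E' A' B'" "X \<subseteq> A'" "card (A' Int B') < card X" "c * card (B' - A') < inc E' (B' - A')"
        using in_S by (auto simp: S_def)
      have A': "A' Un B' = A" "E' Int (A' - B') \<times> (B' - A') = {}" using s'(1) by (auto simp: sepn_def)
      have ne: "B' - A' ~= {}" using s'(4) inc_empty[of E'] by force
      have "Z \<subseteq> A' | Z \<subseteq> B'"
      proof (rule ccontr)
        assume "~ ?thesis"
        then obtain z z' where z: "z \<in> Z" "z \<notin> A'" "z' \<in> Z" "z' \<notin> B'" by auto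
        then have "z \<in> B'" "z' \<in> A'" using A'(1) by (auto simp: Z_def)
        moreover from this have "(z', z) \<in> E'" using z by (auto simp: E'_def)
        ultimately show False using A'(2) z by blast
      qed
      then show False
      proof
        assume ZA: "Z \<subseteq> A'"
        have "sepn V E (A' Un B) B'" unfolding sepn_def
        proof (intro conjI equals0I)
          show "(A' Un B) Un B' = V" using A' V by auto
          fix e assume "e \<in> E Int ((A' Un B) - B') \<times> (B' - (A' Un B))"
          then obtain u v where uv: "(u, v) \<in> E" "u \<in> A' Un B" "u \<notin> B'" "v \<in> B'" "v \<notin> A'" "v \<notin> B" by auto
          have vA: "v \<in> A" using uv A' by auto
          have uA: "u \<in> A" using V2 uv vA A' by blast
          have "u \<in> A'" using uA uv A' by auto
          moreover have "(u, v) \<in> E'" using uv uA vA by (auto simp: E'_def)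
          ultimately show False using A'(2) uv by blast
        qed
        moreover have i: "(A' Un B) Int B' = A' Int B'" "B' - (A' Un B) = B' - A'" using ZA A'(1) by (auto simp: Z_def)
        ultimately have "inc E (B' - A') <= c * card (B' - A')" using M2[of "A' Un B" B'] s'(2,3) by auto
        moreover have "inc E' (B' - A') <= inc E (B' - A')" by (rule inc_le) (use fV ZA in \<open>auto simp: E'_def\<close>)
        ultimately show False using s'(4) by simp
      next
        assume ZB: "Z \<subseteq> B'"
        have mB: "massed c B' (E' Int B' \<times> B') (A' Int B')"
        proof (rule massed_sub[OF G' s'(1,2,4)])
          fix A2 B2 assume a: "sepn A E' A2 B2" "X \<subseteq> A2" "card (A2 Int B2) < card (A' Int B')"
          show "inc E' (B2 - A2) <= c * card (B2 - A2)"
          proof (rule ccontr)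
            assume "~ ?thesis"
            then have "(A2, B2) \<in> S" using a s'(3) by (auto simp: S_def)
            then show False using minS[of A2 B2] a(3) by simp
          qed
        qed
        have "card B' <= card A" using A'(1) fin(1) by (intro card_mono) auto
        then have cB: "card B' < card V" using cA by simp
        have L1: "linked B' (E' Int B' \<times> B') (A' Int B')"
          by (rule IH1[OF cB sgr_restrict[OF G'] _ _ mB]) (use s'(3) cX A' in auto)
        have BZ: "B' Int B = Z" using ZB A'(1) by (auto simp: Z_def)
        let ?B = "B' Un B"
        have L2: "linked ?B (E Int ?B \<times> ?B) (A' Int B')"
        proof (rule linked_clique[OF sym_restrict[OF fV(3)] _ BZ s(4) _ _ L1])
          show "finite B'" using A'(1) fin by (metis finite_Un)
          show "sym (E' Int B' \<times> B')" using sgr_finite(3)[OF G'] by (rule sym_restrict)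
          show "E' Int B' \<times> B' \<subseteq> E Int ?B \<times> ?B Un Z \<times> Z" by (auto simp: E'_def)
        qed auto
        have "sepn V E A' ?B" unfolding sepn_def
        proof (intro conjI equals0I)
          show "A' Un ?B = V" using A' V by auto
          fix e assume "e \<in> E Int (A' - ?B) \<times> (?B - A')"
          then obtain u v where uv: "(u, v) \<in> E" "u \<in> A'" "u \<notin> B'" "u \<notin> B" "v \<in> B' Un B" "v \<notin> A'" by auto
          have uA: "u \<in> A" using uv A' by auto
          have vA: "v \<in> A" using V(2) uv uA A'(1) by blast
          have "v \<in> B'" using vA uv A' by auto
          moreover have "(u, v) \<in> E'" using uv uA vA by (auto simp: E'_def)
          ultimately show False using A'(2) uv by blast
        qed
        moreover have "A' Int ?B = A' Int B'" using ZB A'(1) by (auto simp: Z_def)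
        moreover have "?B - A' ~= {}" using ne by auto
        ultimately have "lsep V E X A' ?B" unfolding lsep_def using s' L2 by simp
        from min[OF this] have "card A <= card A'" .
        moreover have "card A' < card A" using A'(1) ne fin by (intro psubset_card_mono) auto
        ultimately show False by simp
      qed
    qed
  qed
  then have L: "linked A E' X" using IH1[OF cA G' s(2) cX] by simp
  have "linked (A Un B) E X"
    by (rule linked_clique[OF fV(3) fin(1) _ s(4) _ sgr_finite(3)[OF G'] L]) (auto simp: E'_def Z_def)
  then show ?thesis using V by simp
qed

text \<open>Order exactly \<open>card X\<close> is not covered by the mass condition. A dense side
  is then massed itself and has fewer vertices, so its boundary is linked by induction and
  \<open>link_or_lsep\<close> finishes.\<close>

lemma tight_sep_imp_linked:
  assumes s: "sepn V E A B" "X \<subseteq> A" "card (A Int B) = card X" "B ~= V" "c * card (B - A) < inc E (B - A)"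
  shows "linked V E X"
proof -
  have fV: "finite V" using sgr_finite[OF G] by auto
  have mB: "massed c B (E Int B \<times> B) (A Int B)"
    by (rule massed_sub[OF G s(1,2,5)]) (use M2 s(3) in auto)
  have BV: "B \<subseteq> V" using s(1) by (auto simp: sepn_def)
  then have cB: "card B < card V" using s(4) fV by (intro psubset_card_mono) auto
  have "linked B (E Int B \<times> B) (A Int B)" by (rule IH1[OF cB sgr_restrict[OF G BV] _ _ mB]) (use s(3) cX in auto)
  then have "linked V E X | (\<exists>P Q. lsep V E X P Q)"
    by (intro link_or_lsep[OF G s(1,2)]) (use s(3) in \<open>auto intro: linked_subset[of B _ "A Int B"]\<close>)
  then show ?thesis using lsep_imp_linked by blast
qed

text \<open>In a minimal counterexample, deleting a vertex, contracting an edge and deleting an edge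
  must each destroy the mass condition. This gives degrees above \<open>c / 2\<close>, almost
  \<open>c / 2\<close> common neighbours for each edge outside \<open>X\<close>, and an almost exact
  arc count, hence a vertex of degree at most \<open>c + 2\<close>. Its neighbourhood is small and
  dense and contains a hub, to which \<open>X\<close> can be linked unless a rigid separation
  appears.\<close>

lemma dense_case_linked:
  assumes IH2: "!!E'. card E' < card E ==> sgr V E' ==> massed c V E' X ==> linked V E' X"
    and K: "24 <= K" "K * (\<kappa> + 1) <= c"
    and hubK: "!!J. finite J ==> card J <= c + 2 ==> J ~= {} ==>
      (!!w. w \<in> J ==> c <= 2 * card (E `` {w} Int J) + 2 * \<kappa> + 4) ==>
      \<exists>U Q. U \<subseteq> J & Q \<subseteq> U & hub E U Q (4 * \<kappa>) & \<kappa> < card U"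
  shows "linked V E X"
proof (rule ccontr)
  assume nl: "~ linked V E X"
  have fV: "finite V" "finite E" "sym E" "irrefl E" "E \<subseteq> V \<times> V" using sgr_finite[OF G] by auto
  have fX: "finite X" using XV fV finite_subset by auto
  have "24 * (\<kappa> + 1) <= K * (\<kappa> + 1)" using K(1) by (rule mult_le_mono1)
  then have c24: "24 * (\<kappa> + 1) <= c" using K(2) by simp
  have fN: "finite (E `` {v})" for v using fV(2) by (rule finite_Image)
  \<comment> \<open>The mass condition extended to order \<open>card X\<close>. The case
    \<open>B = V\<close> is excluded because the side must be smaller than the whole graph for the
    induction.\<close>
  have star: "inc E (B - A) <= c * card (B - A)" if "sepn V E A B" "X \<subseteq> A" "card (A Int B) <= card X" "B ~= V" for A B
  proof (cases "card (A Int B) < card X")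
    case True then show ?thesis using M2[OF that(1,2)] by simp
  next
    case False
    then show ?thesis using tight_sep_imp_linked[OF that(1,2) _ that(4)] nl that(3) by (meson le_neq_implies_less not_le)
  qed
  have nolsep: "~ lsep V E X A B" for A B using lsep_imp_linked nl by blast
  have deg: "c < 2 * card (E `` {v})" if v: "v \<in> V" "v \<notin> X" for v
  proof (rule ccontr)
    assume small: "~ ?thesis"
    let ?V = "V - {v}"
    let ?E = "E Int ?V \<times> ?V"
    have XV': "X \<subseteq> ?V" using XV v by auto
    have G': "sgr ?V ?E" by (rule sgr_restrict[OF G]) auto
    have fE': "finite ?E" using fV by auto
    have "massed c ?V ?E X" unfolding massed_def
    proof (intro conjI allI impI)
      have "{e \<in> E. fst e \<in> V - X | snd e \<in> V - X} \<subseteq> {e \<in> ?E. fst e \<in> ?V - X | snd e \<in> ?V - X} Un ({v} \<times> E `` {v} Un E `` {v} \<times> {v})"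
        using fV(5) by (auto dest: symD[OF fV(3)])
      then have "inc E (V - X) <= card ({e \<in> ?E. fst e \<in> ?V - X | snd e \<in> ?V - X} Un ({v} \<times> E `` {v} Un E `` {v} \<times> {v}))"
        unfolding inc_def using fV(2) fN by (intro card_mono) auto
      also have "\<dots> <= inc ?E (?V - X) + card ({v} \<times> E `` {v} Un E `` {v} \<times> {v})" unfolding inc_def by (rule card_Un_le)
      also have "card ({v} \<times> E `` {v} Un E `` {v} \<times> {v}) <= card ({v} \<times> E `` {v}) + card (E `` {v} \<times> {v})" by (rule card_Un_le)
      also have "\<dots> = 2 * card (E `` {v})" by (simp add: card_cartesian_product)
      finally have 1: "inc E (V - X) <= inc ?E (?V - X) + 2 * card (E `` {v})" by simp
      have "V - X = insert v (?V - X)" using v by auto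
      then have "card (V - X) = Suc (card (?V - X))" using fV(1) by (metis DiffE card_insert_disjoint finite_Diff singletonI)
      then show "c * card (?V - X) < inc ?E (?V - X)" using M1 1 small by simp
      fix A B assume s: "sepn ?V ?E A B" "X \<subseteq> A" "card (A Int B) < card X"
      have AB: "A Un B = ?V" "?E Int (A - B) \<times> (B - A) = {}" using s(1) by (auto simp: sepn_def)
      have fAB: "finite A" "finite B" using AB(1) fV(1) by (metis finite_Diff finite_Un)+
      have vAB: "v \<notin> A" "v \<notin> B" using AB(1) by auto
      \<comment> \<open>Putting the deleted vertex on both sides raises the order by one, which
        \<open>star\<close> still permits.\<close>
      have "sepn V E (insert v A) (insert v B)" unfolding sepn_def
      proof (intro conjI equals0I)
        show "insert v A Un insert v B = V" using AB(1) v by auto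
        fix e assume "e \<in> E Int (insert v A - insert v B) \<times> (insert v B - insert v A)"
        then obtain a b where "(a, b) \<in> E" "a \<in> A - B" "b \<in> B - A" "a ~= v" "b ~= v" by auto
        then show False using AB by blast
      qed
      moreover have "insert v A Int insert v B = insert v (A Int B)" by auto
      moreover have "insert v B - insert v A = B - A" using vAB by auto
      moreover have "insert v B ~= V"
      proof
        assume "insert v B = V"
        then have "A Int B = A" using AB(1) by auto
        then show False using s(2,3) card_mono[OF fAB(1) s(2)] by simp
      qed
      ultimately have "inc E (B - A) <= c * card (B - A)"
        using star[of "insert v A" "insert v B"] s(2,3) vAB fAB by auto
      moreover have "inc ?E (B - A) <= inc E (B - A)" by (rule inc_le) (use fV in auto)
      ultimately show "inc ?E (B - A) <= c * card (B - A)" by simp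
    qed
    moreover have "card ?V < card V" using v fV(1) by (meson card_Diff1_less)
    ultimately have "linked ?V ?E X" using IH1[OF _ G' XV' cX] by simp
    then show False using linked_mono[of ?V ?E X V E] nl by auto
  qed
  have common: "c < 2 + 2 * card (E `` {x} Int E `` {y})" if xy: "(x, y) \<in> E" "x \<notin> X" "y \<notin> X" for x y
  proof (rule ccontr)
    assume small: "~ ?thesis"
    have xyV: "x \<in> V" "y \<in> V" "x ~= y" and yx: "(y, x) \<in> E" using fV xy by (auto simp: irrefl_def sym_def)
    let ?V = "V - {y}" and ?E = "cedges x y E" and ?h = "contr x y"
    have G': "sgr ?V ?E" unfolding sgr_def
      using fV(1) sym_cedges[OF fV(3)] cedges_subset[OF fV(5) xyV(1,3)] by (auto simp: irrefl_def cedges_def)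
    have fE': "finite ?E" using sgr_finite(2)[OF G'] .
    have cV: "card ?V < card V" using xyV(2) fV(1) by (meson card_Diff1_less)
    have XV': "X \<subseteq> ?V" using XV xy by auto
    have "massed c ?V ?E X" unfolding massed_def
    proof (intro conjI allI impI)
      let ?N = "E `` {x} Int E `` {y}"
      \<comment> \<open>The arcs lost by the contraction: the two arcs of \<open>xy\<close>, and for
        each common neighbour one of two parallel arcs in each direction.\<close>
      let ?R = "{(x, y), (y, x)} Un ({y} \<times> ?N Un ?N \<times> {y})"
      let ?I = "{e \<in> E. fst e \<in> V - X | snd e \<in> V - X}"
      have fI: "finite ?I" using fV(2) by auto
      have "inj_on (map_prod ?h ?h) (?I - ?R)"
      proof (rule inj_onI)
        fix e e' assume ee: "e \<in> ?I - ?R" "e' \<in> ?I - ?R" "map_prod ?h ?h e = map_prod ?h ?h e'"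
        obtain a b where e: "e = (a, b)" by (cases e)
        obtain a' b' where e': "e' = (a', b')" by (cases e')
        have h: "(a, b) \<in> E" "(a', b') \<in> E" "(a, b) \<notin> ?R" "(a', b') \<notin> ?R" "map_prod ?h ?h (a, b) = map_prod ?h ?h (a', b')"
          using ee unfolding e e' by blast+
        have ne: "a ~= b" "a' ~= b'" using h(1,2) fV(4) by (auto simp: irrefl_def)
        have hh: "?h a = ?h a'" "?h b = ?h b'" using h(5) by auto
        have s1: "(b, a) \<in> E" "(b', a') \<in> E" using h(1,2) symD[OF fV(3)] by auto
        have r: "a = x ==> b ~= y" "a = y ==> b ~= x" "a' = x ==> b' ~= y" "a' = y ==> b' ~= x"
          "a = y ==> b \<notin> ?N" "b = y ==> a \<notin> ?N" "a' = y ==> b' \<notin> ?N" "b' = y ==> a' \<notin> ?N"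
          using h(3,4) by auto
        have A: "a = a'"
        proof (rule ccontr)
          assume aa: "a ~= a'"
          then have "(a = x & a' = y) | (a = y & a' = x)" using hh(1) by (auto simp: contr_def split: if_splits)
          moreover from this have "b = b'" using hh(2) ne r(1-4) by (auto simp: contr_def split: if_splits)
          ultimately have "b \<in> ?N" "a = y | a' = y" using h(1,2) by auto
          then show False using r \<open>b = b'\<close> by auto
        qed
        moreover have "b = b'"
        proof (rule ccontr)
          assume bb: "b ~= b'"
          then have "(b = x & b' = y) | (b = y & b' = x)" using hh(2) by (auto simp: contr_def split: if_splits)
          then have "a \<in> ?N" "b = y | b' = y" using s1 A by auto
          then show False using r A by auto
        qed
        ultimately show "e = e'" using e e' by simp
      qed
      moreover have "map_prod ?h ?h ` (?I - ?R) \<subseteq> {e \<in> ?E. fst e \<in> ?V - X | snd e \<in> ?V - X}"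
      proof (rule image_subsetI)
        fix e assume e: "e \<in> ?I - ?R"
        obtain a b where ab: "e = (a, b)" by (cases e)
        have "(a, b) \<in> E" "(a, b) \<notin> {(x, y), (y, x)}" "a \<in> V - X | b \<in> V - X" using e ab by auto
        moreover from this have "a ~= b" "a \<in> V" "b \<in> V" using fV(4,5) by (auto simp: irrefl_def)
        moreover have "?h a ~= ?h b" using \<open>a ~= b\<close> \<open>(a, b) \<notin> {(x, y), (y, x)}\<close> by (auto simp: contr_def split: if_splits)
        moreover have hV: "?h z \<in> ?V - X" if "z \<in> V - X" for z using that xyV xy by (auto simp: contr_def)
        ultimately have "?h a ~= ?h b" "?h a \<in> ?V - X | ?h b \<in> ?V - X" "(a, b) \<in> E" by auto
        then show "map_prod ?h ?h e \<in> {e \<in> ?E. fst e \<in> ?V - X | snd e \<in> ?V - X}"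
          unfolding ab using cedges_iff[of "?h a" "?h b" x y E] by auto
      qed
      ultimately have 1: "card (?I - ?R) <= inc ?E (?V - X)" unfolding inc_def
        using fE' by (intro card_inj_on_le[where f = "map_prod ?h ?h"]) auto
      have fR: "finite ?R" using fN by auto
      have "card ({y} \<times> ?N Un ?N \<times> {y}) <= card ({y} \<times> ?N) + card (?N \<times> {y})" by (rule card_Un_le)
      moreover have "card ?R <= card {(x, y), (y, x)} + card ({y} \<times> ?N Un ?N \<times> {y})" by (rule card_Un_le)
      moreover have "card {(x, y), (y, x)} <= 2" using card_length[of "[(x, y), (y, x)]"] by simp
      ultimately have "card ?R <= 2 + 2 * card ?N" by (simp add: card_cartesian_product)
      moreover have "inc E (V - X) <= card (?I - ?R) + card ?R"
        using diff_card_le_card_Diff[OF fR, of ?I] unfolding inc_def by simp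
      ultimately have 2: "inc E (V - X) <= inc ?E (?V - X) + c" using 1 small by linarith
      have "V - X = insert y (?V - X)" using xyV xy by auto
      then have "card (V - X) = Suc (card (?V - X))" using fV(1) by (metis DiffE card_insert_disjoint finite_Diff singletonI)
      then show "c * card (?V - X) < inc ?E (?V - X)" using M1 2 by simp
    next
      fix A1 B1 assume v1: "sepn ?V ?E A1 B1" "X \<subseteq> A1" "card (A1 Int B1) < card X"
      show "inc ?E (B1 - A1) <= c * card (B1 - A1)"
      proof (rule ccontr)
        assume v1': "~ ?thesis"
        define S where "S = {(A', B'). sepn ?V ?E A' B' & X \<subseteq> A' & card (A' Int B') < card X & c * card (B' - A') < inc ?E (B' - A')}"
        have "(A1, B1) \<in> S" using v1 v1' by (auto simp: S_def)
        then have "S ~= {}" by auto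
        from obtain_min_pair[OF this, of "%A B. card (A Int B)"] obtain A B where
          in_S: "(A, B) \<in> S" and minS: "!!A2 B2. (A2, B2) \<in> S ==> card (A Int B) <= card (A2 Int B2)" by auto
        have s: "sepn ?V ?E A B" "X \<subseteq> A" "card (A Int B) < card X" "c * card (B - A) < inc ?E (B - A)"
          using in_S by (auto simp: S_def)
        have AB: "A Un B = ?V" using s(1) by (auto simp: sepn_def)
        have fAB: "finite A" "finite B" using AB(1) fV(1) by (metis finite_Diff finite_Un)+
        have ne: "B - A ~= {}" using s(4) inc_empty[of ?E] by force
        define A' where "A' = {z \<in> V. ?h z \<in> A}"
        define B' where "B' = {z \<in> V. ?h z \<in> B}"
        have sep: "sepn V E A' B'" unfolding A'_def B'_def by (rule sepn_contr[OF s(1) xyV(1) fV(5) xyV(3)])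
        have XA': "X \<subseteq> A'" using s(2) XV xy by (auto simp: A'_def contr_def)
        \<comment> \<open>The contracted vertex splits into \<open>x\<close> and \<open>y\<close>.
          In the boundary this raises the order by one and \<open>star\<close> applies; elsewhere
          the order is unchanged and the dense side yields a rigid separation.\<close>
        show False
        proof (cases "x \<in> A Int B")
          case True
          have I: "A' Int B' = insert y (A Int B)" "B' - A' = B - A"
            using True AB xyV by (auto simp: A'_def B'_def contr_def split: if_splits)
          have "B' ~= V"
          proof
            assume "B' = V"
            then have "A Int B = A" using AB by (auto simp: B'_def contr_def split: if_splits)
            then show False using s(2,3) card_mono[OF fAB(1) s(2)] by simp
          qed
          moreover have "card (A' Int B') <= card X" unfolding I(1) using s(3) fAB by (simp add: card_insert_if)
          ultimately have "inc E (B - A) <= c * card (B - A)" using star[OF sep XA'] I(2) by simp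
          moreover have "inc ?E (B - A) <= inc E (B - A)"
          proof -
            have "{e \<in> ?E. fst e \<in> B - A | snd e \<in> B - A} \<subseteq> map_prod ?h ?h ` {e \<in> E. fst e \<in> B - A | snd e \<in> B - A}"
            proof
              fix e assume e: "e \<in> {e \<in> ?E. fst e \<in> B - A | snd e \<in> B - A}"
              obtain l l' where l: "e = (l, l')" by (cases e)
              obtain a b where ab: "(a, b) \<in> E" "?h a = l" "?h b = l'" using e l cedges_iff[of l l' x y E] by auto
              have "a \<in> B - A | b \<in> B - A" using e l ab True AB by (auto simp: contr_def split: if_splits)
              then show "e \<in> map_prod ?h ?h ` {e \<in> E. fst e \<in> B - A | snd e \<in> B - A}"
                using ab l by (intro image_eqI[of _ _ "(a, b)"]) auto
            qed
            then have "inc ?E (B - A) <= card (map_prod ?h ?h ` {e \<in> E. fst e \<in> B - A | snd e \<in> B - A})"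
              unfolding inc_def using fV(2) by (intro card_mono) auto
            also have "\<dots> <= inc E (B - A)" unfolding inc_def using fV(2) by (intro card_image_le) auto
            finally show ?thesis .
          qed
          ultimately show False using s(4) by simp
        next
          case False
          have mB: "massed c B (?E Int B \<times> B) (A Int B)"
          proof (rule massed_sub[OF G' s(1,2,4)])
            fix A2 B2 assume a: "sepn ?V ?E A2 B2" "X \<subseteq> A2" "card (A2 Int B2) < card (A Int B)"
            show "inc ?E (B2 - A2) <= c * card (B2 - A2)"
            proof (rule ccontr)
              assume "~ ?thesis"
              then have "(A2, B2) \<in> S" using a s(3) by (auto simp: S_def)
              then show False using minS[of A2 B2] a(3) by simp
            qed
          qed
          have BV: "B \<subseteq> ?V" using AB by auto
          have "card B <= card ?V" using BV fV(1) by (intro card_mono) auto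
          then have "card B < card V" using cV by simp
          then have L1: "linked B (?E Int B \<times> B) (A Int B)"
            by (rule IH1[OF _ sgr_restrict[OF G' BV] _ _ mB]) (use s(3) cX in auto)
          have L2: "linked B' (E Int B' \<times> B') (A Int B)" unfolding B'_def
            by (rule linked_contr[OF G xy(1) L1 BV]) (use False AB in auto)
          have I: "A' Int B' = A Int B" using False AB xyV by (auto simp: A'_def B'_def contr_def split: if_splits)
          obtain b where "b \<in> B - A" using ne by auto
          then have "b \<in> B' - A'" using AB by (auto simp: A'_def B'_def contr_def split: if_splits)
          then have "lsep V E X A' B'" unfolding lsep_def using sep XA' I s(3) L2 by auto
          then show False using nolsep by simp
        qed
      qed
    qed
    then have L: "linked ?V ?E X" using IH1[OF cV G' XV' cX] by simp
    have "linked {z \<in> V. ?h z \<in> ?V} (E Int {z \<in> V. ?h z \<in> ?V} \<times> {z \<in> V. ?h z \<in> ?V}) X"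
    proof (rule linked_contr[OF G xy(1) _ order.refl])
      have "?E Int ?V \<times> ?V = ?E" using sgr_finite(5)[OF G'] by auto
      then show "linked ?V (?E Int ?V \<times> ?V) X" using L by simp
    qed (use xy XV' in auto)
    then have "linked V E X" by (rule linked_mono) auto
    then show False using nl by simp
  qed
  have outside: "\<exists>w. (v, w) \<in> E & w \<notin> X" if "v \<in> V" "v \<notin> X" for v
  proof (rule ccontr)
    assume "~ ?thesis"
    then have "E `` {v} \<subseteq> X" by auto
    then have "card (E `` {v}) <= card X" using fX by (rule card_mono[rotated])
    then show False using deg[OF that] cX c24 by simp
  qed
  have "V - X ~= {}" using M1 inc_empty[of E] by force
  then obtain x where x: "x \<in> V" "x \<notin> X" by auto
  then obtain y where y: "(x, y) \<in> E" "y \<notin> X" using outside by auto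
  have xy: "x ~= y" "(y, x) \<in> E" using y fV by (auto simp: irrefl_def sym_def)
  \<comment> \<open>A larger excess would survive the deletion of \<open>xy\<close>, which removes
    two arcs.\<close>
  have upper: "inc E (V - X) <= c * card (V - X) + 2"
  proof (rule ccontr)
    assume big: "~ ?thesis"
    let ?E = "E - {(x, y), (y, x)}"
    have G': "sgr V ?E" using G by (auto simp: sgr_def sym_def irrefl_def)
    have "massed c V ?E X" unfolding massed_def
    proof (intro conjI allI impI)
      have "{e \<in> E. fst e \<in> V - X | snd e \<in> V - X} \<subseteq> {e \<in> ?E. fst e \<in> V - X | snd e \<in> V - X} Un {(x, y), (y, x)}" by auto
      then have "inc E (V - X) <= card ({e \<in> ?E. fst e \<in> V - X | snd e \<in> V - X} Un {(x, y), (y, x)})"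
        unfolding inc_def using fV(2) by (intro card_mono) auto
      also have "\<dots> <= inc ?E (V - X) + card {(x, y), (y, x)}" unfolding inc_def by (rule card_Un_le)
      also have "card {(x, y), (y, x)} <= 2" using card_length[of "[(x, y), (y, x)]"] by simp
      finally have "inc E (V - X) <= inc ?E (V - X) + 2" by simp
      then show "c * card (V - X) < inc ?E (V - X)" using big by simp
      fix A B assume s: "sepn V ?E A B" "X \<subseteq> A" "card (A Int B) < card X"
      have AB: "A Un B = V" "?E Int (A - B) \<times> (B - A) = {}" using s(1) by (auto simp: sepn_def)
      have fAB: "finite A" "finite B" using AB(1) fV(1) by (metis finite_Un)+
      have le: "inc ?E (B - A) <= inc E (B - A)" by (rule inc_le) (use fV in auto)
      have "inc E (B - A) <= c * card (B - A)"
      proof (cases "sepn V E A B")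
        case True then show ?thesis using M2 s by simp
      next
        case False
        \<comment> \<open>A separation that exists only after the deletion is crossed by
          \<open>xy\<close>; the end of \<open>xy\<close> in \<open>A - B\<close> is moved into the
          boundary.\<close>
        then obtain a where a: "a \<in> A - B" "a \<in> {x, y}" using AB by (auto simp: sepn_def)
        have e1: "E Int (A - insert a B) \<times> (insert a B - A) = {}"
        proof (rule equals0I)
          fix e assume e: "e \<in> E Int (A - insert a B) \<times> (insert a B - A)"
          then obtain u v where uv: "e = (u, v)" "(u, v) \<in> E" "u \<in> A" "u ~= a" "u \<notin> B" "v \<in> B" "v \<notin> A" using a by auto
          then have "(u, v) \<in> {(x, y), (y, x)}" using AB(2) by blast
          then show False using uv a by auto
        qed
        have "sepn V E A (insert a B)" unfolding sepn_def using e1 AB(1) a by auto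
        moreover have "A Int insert a B = insert a (A Int B)" "insert a B - A = B - A" using a by auto
        moreover have "insert a B ~= V"
        proof
          assume "insert a B = V"
          then have "A \<subseteq> insert a (A Int B)" using AB(1) by auto
          then have "card A <= card (insert a (A Int B))" using fAB by (intro card_mono) auto
          also have "\<dots> <= card X" using s(3) fAB by (simp add: card_insert_if)
          finally have "A = X" using s(2) fAB(1) by (metis card_seteq)
          then show False using a x y by auto
        qed
        ultimately show ?thesis using star[of A "insert a B"] s(2,3) fAB a by auto
      qed
      then show "inc ?E (B - A) <= c * card (B - A)" using le by simp
    qed
    moreover have "card ?E < card E" using y fV(2) by (intro psubset_card_mono) auto
    ultimately have "linked V ?E X" using IH2 G' by simp
    then have "linked V E X" by (rule linked_mono) auto
    then show False using nl by simp
  qed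
  have "\<exists>v\<in>V - X. card (E `` {v}) <= c + 2"
  proof (rule ccontr)
    assume no: "~ ?thesis"
    have "(\<Sum>v\<in>V - X. c + 3) <= (\<Sum>v\<in>V - X. card (E `` {v}))"
    proof (rule sum_mono)
      fix v assume "v \<in> V - X"
      then have "~ card (E `` {v}) <= c + 2" using no by blast
      then show "c + 3 <= card (E `` {v})" by simp
    qed
    also have "\<dots> = card (Sigma (V - X) (%v. E `` {v}))" using fV(1) fN by (simp add: card_SigmaI)
    also have "\<dots> <= inc E (V - X)" unfolding inc_def using fV(2) by (intro card_mono) auto
    finally have "card (V - X) * (c + 3) <= c * card (V - X) + 2" using upper by simp
    moreover have "0 < card (V - X)" using x fV(1) by (auto simp: card_gt_0_iff)
    ultimately show False by (simp add: algebra_simps)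
  qed
  then obtain v where v: "v \<in> V" "v \<notin> X" "card (E `` {v}) <= c + 2" by auto
  define J where "J = E `` {v} - X"
  have fJ: "finite J" "card J <= c + 2" using fN[of v] v(3) card_mono[of "E `` {v}" J] by (auto simp: J_def)
  have "J ~= {}" using outside[OF v(1,2)] by (auto simp: J_def)
  moreover have "c <= 2 * card (E `` {w} Int J) + 2 * \<kappa> + 4" if "w \<in> J" for w
  proof -
    have "c < 2 + 2 * card (E `` {v} Int E `` {w})" using common[of v w] that v by (auto simp: J_def)
    moreover have "E `` {v} Int E `` {w} \<subseteq> (E `` {w} Int J) Un X" by (auto simp: J_def)
    then have "card (E `` {v} Int E `` {w}) <= card ((E `` {w} Int J) Un X)" using fN fX by (intro card_mono) auto
    then have "card (E `` {v} Int E `` {w}) <= card (E `` {w} Int J) + \<kappa>" using card_Un_le[of "E `` {w} Int J" X] cX by linarith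
    ultimately show ?thesis by simp
  qed
  ultimately obtain U Q where U: "U \<subseteq> J" "Q \<subseteq> U" "hub E U Q (4 * \<kappa>)" "\<kappa> < card U" using hubK[OF fJ] by blast
  have UV: "U \<subseteq> V" using U(1) fV(5) by (auto simp: J_def)
  have hub': "hub (E Int U \<times> U) U Q (4 * \<kappa>)" unfolding hub_def
  proof (intro ballI allI impI)
    fix a b :: 'a and F :: "'a set" assume ab: "a \<in> U" "b \<in> U" "finite F" "card F <= 4 * \<kappa>"
    then obtain C where C: "C \<subseteq> Q - F" "finite C" "conn E C" "card C <= 3" "\<exists>u\<in>C. (a, u) \<in> E" "\<exists>v\<in>C. (b, v) \<in> E"
      using U(3) unfolding hub_def by metis
    have "conn (E Int U \<times> U) C" using C(1,3) U(2) by (auto intro: conn_mono)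
    then show "\<exists>C\<subseteq>Q - F. finite C & conn (E Int U \<times> U) C & card C <= 3 & (\<exists>u\<in>C. (a, u) \<in> E Int U \<times> U) & (\<exists>v\<in>C. (b, v) \<in> E Int U \<times> U)"
      using C ab U(2) by (intro exI[of _ C]) auto
  qed
  \<comment> \<open>\<open>(V, U)\<close> is a separation with boundary \<open>U\<close>, which is
    large enough to receive all of \<open>X\<close> and is linked through the hub.\<close>
  have "linked V E X | (\<exists>P Q. lsep V E X P Q)"
  proof (rule link_or_lsep[OF G, of V U])
    show "sepn V E V U" using UV by (auto simp: sepn_def)
    have VU: "V Int U = U" using UV by auto
    show "card X <= card (V Int U)" using U(4) cX VU by simp
    fix Z assume Z: "Z \<subseteq> V Int U" "card Z <= card X"
    have "finite Z" using Z fV(1) finite_subset by blast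
    then show "linked U (E Int U \<times> U) Z"
      by (intro hub_linked[OF sym_restrict[OF fV(3)] hub' U(2) order.refl]) (use Z cX in auto)
  qed (rule XV)
  then show False using nl nolsep by blast
qed

end

text \<open>That \<open>c\<close> is linear in \<kappa> matters: later both are proportional to
  \<open>d\<close>.\<close>

theorem massed_linked:
  obtains K :: nat where "!!\<kappa> c V (E :: ('a \<times> 'a) set) X. sgr V E ==> X \<subseteq> V ==> card X <= \<kappa> ==> K * (\<kappa> + 1) <= c ==> massed c V E X ==> linked V E X"
proof (rule dense_hub_const)
  fix K :: nat
  assume K: "24 <= K" "!!\<kappa> c (E :: ('a \<times> 'a) set) J. sym E ==> finite J ==> K * (\<kappa> + 1) <= c ==> card J <= c + 2 ==> J ~= {} ==>
    (!!w. w \<in> J ==> c <= 2 * card (E `` {w} Int J) + 2 * \<kappa> + 4) ==>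
    \<exists>U Q. U \<subseteq> J & Q \<subseteq> U & hub E U Q (4 * \<kappa>) & \<kappa> < card U"
  have main: "linked V E X" if "sgr V E" "X \<subseteq> V" "card X <= \<kappa>" "K * (\<kappa> + 1) <= c" "massed c V E X"
    for \<kappa> c V and E :: "('a \<times> 'a) set" and X
    using that
  proof (induction "card V" arbitrary: V E X rule: less_induct)
    case outer: less
    from outer.prems show ?case
    proof (induction "card E" arbitrary: E rule: less_induct)
      case inner: less
      show ?case
      proof (rule dense_case_linked[OF inner.prems(1,2,3,5)])
        show "linked V' E' X'" if "card V' < card V" "sgr V' E'" "X' \<subseteq> V'" "card X' <= \<kappa>" "massed c V' E' X'" for V' :: "'a set" and E' X'
          using outer.hyps[OF that(1-4) inner.prems(4) that(5)] .
        show "linked V E' X" if "card E' < card E" "sgr V E'" "massed c V E' X" for E'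
          using inner.hyps[OF that(1,2) inner.prems(2-4) that(3)] .
      qed (use K inner.prems(4) sgr_finite(3)[OF inner.prems(1)] in auto)
    qed
  qed
  show thesis by (rule that[OF main])
qed

section \<open>Highly connected subgraphs and dense minors\<close>

lemma sgr_deg_sum:
  assumes "sgr V E" shows "card E = (\<Sum>v\<in>V. card (E `` {v}))"
proof -
  have "E = Sigma V (%v. E `` {v})" using sgr_finite(5)[OF assms] by auto
  moreover have "card (Sigma V (%v. E `` {v})) = (\<Sum>v\<in>V. card (E `` {v}))"
    using sgr_finite(1,2)[OF assms] by (intro card_SigmaI) (auto intro: finite_Image)
  ultimately show ?thesis by simp
qed

text \<open>A smallest set of at least \<open>2 * k\<close> vertices with more than
  \<open>a * (card W - k)\<close> arcs. Because of the subtracted \<open>k\<close>, two sides of a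
  separation of order at most \<open>k\<close> that both miss the bound cannot add up to
  \<open>W\<close>. Only a fraction \<open>k / card W\<close> of the average degree is given
  up.\<close>

lemma mader:
  fixes a :: real and k :: nat
  assumes G: "sgr V E" and ne: "V ~= {}" and k: "1 <= k" "4 * real k <= a" and dens: "a * real (card V) <= real (card E)"
  obtains W where "W \<subseteq> V" "W ~= {}" "!!v. v \<in> W ==> a / 2 < real (card (E `` {v} Int W))"
    "!!P Q. sepn W (E Int W \<times> W) P Q ==> card (P Int Q) <= k ==> P - Q = {} | Q - P = {}"
    "a * real (card W) < real (card (E Int W \<times> W)) + a * real k"
proof -
  have fV: "finite V" "finite E" "sym E" "irrefl E" "E \<subseteq> V \<times> V" using sgr_finite[OF G] by auto
  have a0: "0 < a" using k by linarith
  define \<Phi> where "\<Phi> W \<longleftrightarrow> W \<subseteq> V & 2 * k <= card W & a * real (card W) < real (card (E Int W \<times> W)) + a * real k" for W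
  have cE: "card (E Int W \<times> W) <= card W * card W" if "finite W" for W
    using ecard_le[OF that that, of E] by (simp add: ecard_def)
  have "\<Phi> V"
  proof -
    have EV: "E Int V \<times> V = E" using fV(5) by auto
    have n0: "0 < real (card V)" using ne fV(1) by (simp add: card_gt_0_iff)
    have "a * real (card V) <= real (card V) * real (card V)"
      using dens cE[OF fV(1)] EV by (metis of_nat_le_iff of_nat_mult order_trans)
    then have "a <= real (card V)" using n0 by simp
    then have "2 * k <= card V" using k(2) by simp
    moreover have "0 < a * real k" using a0 k by simp
    ultimately show ?thesis using dens EV by (simp add: \<Phi>_def)
  qed
  then have "{W. \<Phi> W} ~= {}" by auto
  from obtain_min[OF this, of card] obtain W where W: "\<Phi> W" and min: "!!W'. \<Phi> W' ==> card W <= card W'" by auto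
  have WV: "W \<subseteq> V" "2 * k <= card W" "a * real (card W) < real (card (E Int W \<times> W)) + a * real k" using W by (auto simp: \<Phi>_def)
  have fW: "finite W" using WV fV finite_subset by auto
  \<comment> \<open>On exactly \<open>2 * k\<close> vertices there are at most
    \<open>4 * k * k\<close> arcs, too few as \<open>4 * real k <= a\<close>.\<close>
  have big: "2 * k < card W"
  proof (rule ccontr)
    assume "~ ?thesis"
    then have e: "card W = 2 * k" using WV by simp
    have "a * real k < real (card (E Int W \<times> W))" using WV(3) unfolding e by (simp add: algebra_simps)
    also have "\<dots> <= real (2 * k * (2 * k))" using cE[OF fW] unfolding e by (simp only: of_nat_le_iff)
    finally have "a * real k < (4 * real k) * real k" by simp
    then show False using mult_right_mono[OF k(2), of "real k"] by simp
  qed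
  have mindeg: "a / 2 < real (card (E `` {v} Int W))" if v: "v \<in> W" for v
  proof (rule ccontr)
    assume small: "~ ?thesis"
    let ?W = "W - {v}" and ?N = "E `` {v} Int W"
    have "E Int W \<times> W \<subseteq> (E Int ?W \<times> ?W) Un ({v} \<times> ?N Un ?N \<times> {v})" by (auto dest: symD[OF fV(3)])
    then have "card (E Int W \<times> W) <= card ((E Int ?W \<times> ?W) Un ({v} \<times> ?N Un ?N \<times> {v}))" using fW fV(2) by (intro card_mono) auto
    also have "\<dots> <= card (E Int ?W \<times> ?W) + card ({v} \<times> ?N Un ?N \<times> {v})" by (rule card_Un_le)
    also have "card ({v} \<times> ?N Un ?N \<times> {v}) <= card ({v} \<times> ?N) + card (?N \<times> {v})" by (rule card_Un_le)
    finally have "card (E Int W \<times> W) <= card (E Int ?W \<times> ?W) + 2 * card ?N" by (simp add: card_cartesian_product)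
    then have "real (card (E Int W \<times> W)) <= real (card (E Int ?W \<times> ?W)) + a" using small by linarith
    moreover have "real (card ?W) = real (card W) - 1" using v fW big by (simp add: card_Diff_singleton of_nat_diff)
    then have "a * real (card ?W) = a * real (card W) - a" by (simp add: right_diff_distrib)
    ultimately have "a * real (card ?W) < real (card (E Int ?W \<times> ?W)) + a * real k" using WV(3) by linarith
    then have "\<Phi> ?W" using big WV(1) v fW by (auto simp: \<Phi>_def card_Diff_singleton)
    from min[OF this] show False using v fW by (metis card_Diff1_less leD)
  qed
  have sep: "P - Q = {} | Q - P = {}" if s: "sepn W (E Int W \<times> W) P Q" "card (P Int Q) <= k" for P Q
  proof (rule ccontr)
    assume n: "~ ?thesis"
    have PQ: "P Un Q = W" "E Int W \<times> W Int (P - Q) \<times> (Q - P) = {}" using s(1) by (auto simp: sepn_def)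
    have QP: "E Int W \<times> W Int (Q - P) \<times> (P - Q) = {}" using PQ(2) by (auto dest: symD[OF fV(3)])
    have fin: "finite P" "finite Q" using PQ(1) fW by (metis finite_Un)+
    \<comment> \<open>All neighbours of \<open>v\<close> in \<open>W\<close> lie in
      \<open>P'\<close>, so the minimum degree already gives \<open>P'\<close> the size required of
      a competitor.\<close>
    have side: "real (card (E Int P' \<times> P')) + a * real k <= a * real (card P')"
      if "P' \<subseteq> W" "v \<in> P'" "E `` {v} Int W \<subseteq> P'" "P' ~= W" for P' v
    proof -
      have f: "finite P'" using that fW finite_subset by auto
      have "card (E `` {v} Int W) <= card P'" using that(3) f by (rule card_mono[rotated])
      then have "2 * k <= card P'" using mindeg[of v] that k(2) by force
      moreover have "card P' < card W" using that fW by (intro psubset_card_mono) auto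
      moreover have "P' \<subseteq> V" using that WV(1) by auto
      ultimately have "~ \<Phi> P'" "2 * k <= card P' & P' \<subseteq> V" using min[of P'] by auto
      then show ?thesis by (simp add: \<Phi>_def not_less)
    qed
    obtain v where v: "v \<in> P - Q" using n by auto
    obtain w where w: "w \<in> Q - P" using n by auto
    have 1: "real (card (E Int P \<times> P)) + a * real k <= a * real (card P)" using side[of P v] v w PQ by blast
    have 2: "real (card (E Int Q \<times> Q)) + a * real k <= a * real (card Q)" using side[of Q w] v w PQ(1) QP by blast
    have "E Int W \<times> W \<subseteq> (E Int P \<times> P) Un (E Int Q \<times> Q)"
    proof
      fix e assume e: "e \<in> E Int W \<times> W"
      obtain x y where xy: "e = (x, y)" by (cases e)
      show "e \<in> (E Int P \<times> P) Un (E Int Q \<times> Q)" using e PQ QP unfolding xy by blast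
    qed
    then have "card (E Int W \<times> W) <= card (E Int P \<times> P) + card (E Int Q \<times> Q)"
      using fV(2) by (meson card_Un_le card_mono finite_Int finite_UnI order_trans)
    then have "real (card (E Int W \<times> W)) <= real (card (E Int P \<times> P)) + real (card (E Int Q \<times> Q))" by linarith
    also have "\<dots> <= a * (real (card P) + real (card Q)) - 2 * (a * real k)" using 1 2 by (simp add: distrib_left)
    also have "real (card P) + real (card Q) = real (card W) + real (card (P Int Q))"
      using card_Un_Int[OF fin] PQ(1) by (metis of_nat_add)
    also have "a * (real (card W) + real (card (P Int Q))) <= a * (real (card W) + real k)" using s(2) a0 by simp
    finally show False using WV(3) by (simp add: algebra_simps)
  qed
  show thesis by (rule that[OF WV(1) _ mindeg sep WV(3)]) (use big in auto)
qed

text \<open>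
  \<open>I {u, v}\<close> contains the interior of the path that replaces the edge \<open>uv\<close>; the path itself is
  extracted from a connected set only at the end.
\<close>

definition topo :: "'a set => ('a \<times> 'a) set => 'w set => ('w \<times> 'w) set => bool" where
  "topo V E VH EH \<longleftrightarrow> (\<exists>f I. inj_on f VH & f ` VH \<subseteq> V &
     (\<forall>u v. (u, v) \<in> EH --> I {u, v} \<subseteq> V - f ` VH & lnk E (I {u, v}) (f u) (f v)) &
     (\<forall>u v x y. (u, v) \<in> EH --> (x, y) \<in> EH --> {u, v} ~= {x, y} --> I {u, v} Int I {x, y} = {}))"

lemma lnk_mono: "lnk E I x y ==> E \<subseteq> E' ==> lnk E' I x y"
  unfolding lnk_def by (meson conn_mono inf.coboundedI1 subsetD)

lemma topo_mono:
  assumes "topo V E VH EH" "V \<subseteq> V'" "E \<subseteq> E'"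
  shows "topo V' E' VH EH"
proof -
  obtain f I where fI: "inj_on f VH" "f ` VH \<subseteq> V"
    "\<forall>u v. (u, v) \<in> EH --> I {u, v} \<subseteq> V - f ` VH & lnk E (I {u, v}) (f u) (f v)"
    "\<forall>u v x y. (u, v) \<in> EH --> (x, y) \<in> EH --> {u, v} ~= {x, y} --> I {u, v} Int I {x, y} = {}"
    using assms(1) unfolding topo_def by (elim exE conjE) (rule that)
  show ?thesis unfolding topo_def
  proof (intro exI[of _ f] exI[of _ I] conjI allI impI)
    show "f ` VH \<subseteq> V'" using fI(2) assms(2) by auto
    fix u v assume uv: "(u, v) \<in> EH"
    have "I {u, v} \<subseteq> V - f ` VH & lnk E (I {u, v}) (f u) (f v)" using fI(3) uv by simp
    then show "I {u, v} \<subseteq> V' - f ` VH" "lnk E' (I {u, v}) (f u) (f v)" using assms(2) lnk_mono[OF _ assms(3)] by auto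
  qed (use fI(1,4) in simp_all)
qed

text \<open>The second half of the mass condition becomes void: a separation of order below
  \<open>card X\<close> has nothing beyond its boundary.\<close>

lemma massed_of_connected:
  assumes G: "sgr V E" and X: "X \<subseteq> V" "X ~= V"
    and deg: "!!v. v \<in> V ==> c < card (E `` {v})"
    and con: "!!P Q. sepn V E P Q ==> card (P Int Q) < card X ==> P - Q = {} | Q - P = {}"
  shows "massed c V E X"
  unfolding massed_def
proof (intro conjI allI impI)
  have fV: "finite V" "finite E" "sym E" "irrefl E" "E \<subseteq> V \<times> V" using sgr_finite[OF G] by auto
  have "(\<Sum>v\<in>V - X. c) < (\<Sum>v\<in>V - X. card (E `` {v}))"
    using X fV(1) deg by (intro sum_strict_mono) auto
  also have "\<dots> = card (Sigma (V - X) (%v. E `` {v}))" using fV(1,2) by (intro card_SigmaI[symmetric]) (auto intro: finite_Image)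
  also have "\<dots> <= inc E (V - X)" unfolding inc_def using fV(2) by (intro card_mono) auto
  finally show "c * card (V - X) < inc E (V - X)" by (simp add: mult.commute)
  fix A B assume s: "sepn V E A B" "X \<subseteq> A" "card (A Int B) < card X"
  have AB: "A Un B = V" using s(1) by (auto simp: sepn_def)
  have "A - B ~= {}"
  proof
    assume "A - B = {}"
    then have "A Int B = A" by auto
    moreover have "card X <= card A" using s(2) AB fV(1) by (intro card_mono) (metis finite_Un, auto)
    ultimately show False using s(3) by simp
  qed
  then have "B - A = {}" using con[OF s(1,3)] by auto
  then have "inc E (B - A) = 0" by (metis inc_empty)
  then show "inc E (B - A) <= c * card (B - A)" by simp
qed

lemma dense_minor_topo:
  fixes E :: "('a \<times> 'a) set" and VH :: "'w set" and P F S :: "'a => 'a set" and K d \<Delta> q n1 k a :: nat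
  assumes TW: "!!V (E :: ('a \<times> 'a) set) X c \<kappa>. sgr V E ==> X \<subseteq> V ==> card X <= \<kappa> ==> K * (\<kappa> + 1) <= c ==> massed c V E X ==> linked V E X"
    and G: "sgr V E" and L: "finite L" "L ~= {}"
    and P: "!!l. l \<in> L ==> conn E (P l) & P l \<subseteq> V" "!!l l'. l \<in> L ==> l' \<in> L ==> l ~= l' ==> P l Int P l' = {}"
    and F: "!!l u. l \<in> L ==> u \<in> F l ==> u \<in> V & (\<exists>w\<in>P l. (w, u) \<in> E)" "!!l l'. l \<in> L ==> l' \<in> L ==> l ~= l' ==> F l Int F l' = {}"
      "!!l l'. l \<in> L ==> l' \<in> L ==> F l Int P l' = {}" "!!l. l \<in> L ==> finite (F l) & card (F l) <= q"
    and S: "!!l u x. l \<in> L ==> u \<in> F l ==> x \<in> S u ==> x \<in> L & (\<exists>w\<in>P x. (w, u) \<in> E)" "!!l u. l \<in> L ==> u \<in> F l ==> card (S u) <= n1"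
    and dens: "a * card L <= (\<Sum>l\<in>L. card ((\<Union>u\<in>F l. S u) - {l}))"
    and H: "sgr VH EH" "card VH <= d" "!!h. card (EH `` {h}) <= \<Delta>"
    and num: "1 <= d" "(\<Delta> + 1) * d + 1 <= k" "4 * k <= a" "2 * (K * (\<Delta> * d + 1) + d + 1) <= a" "8 * ((\<Delta> + 1) * d + q * \<Delta> + 1) <= a"
      "16 * (q * n1) * d <= a * a"
  shows "topo V E VH EH"
proof -
  have fV: "finite V" "finite E" "sym E" "irrefl E" "E \<subseteq> V \<times> V" using sgr_finite[OF G] by auto
  have fH: "finite VH" "finite EH" "sym EH" "irrefl EH" "EH \<subseteq> VH \<times> VH" using sgr_finite[OF H(1)] by auto
  define Out where "Out l = (\<Union>u\<in>F l. S u) - {l}" for l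
  have OutL: "Out l \<subseteq> L" if "l \<in> L" for l using S(1)[OF that] by (auto simp: Out_def)
  have fOut: "finite (Out l)" if "l \<in> L" for l using OutL[OF that] L(1) finite_subset by auto
  define M where "M = {(l, l'). l \<in> L & l' \<in> L & (l' \<in> Out l | l \<in> Out l')}"
  have MG: "sgr L M" unfolding sgr_def M_def using L(1) by (auto simp: sym_def irrefl_def Out_def)
  have fM: "finite M" "sym M" using sgr_finite[OF MG] by auto
  have "card (Sigma L Out) <= card M" using fM OutL by (intro card_mono) (auto simp: M_def)
  then have "a * card L <= card M" using dens fOut L(1) by (simp add: card_SigmaI Out_def)
  then have dM: "real a * real (card L) <= real (card M)" by (metis of_nat_le_iff of_nat_mult)
  have k1: "1 <= k" "4 * real k <= real a" using num by simp_all
  \<comment> \<open>The connectivity \<open>k\<close> exceeds the number of cores that will be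
    removed, at most \<open>d\<close>, plus the number of exits, at most
    \<open>\<Delta> * d\<close>.\<close>
  obtain W where W: "W \<subseteq> L" "W ~= {}" "!!v. v \<in> W ==> real a / 2 < real (card (M `` {v} Int W))"
    "!!P Q. sepn W (M Int W \<times> W) P Q ==> card (P Int Q) <= k ==> P - Q = {} | Q - P = {}"
    "real a * real (card W) < real (card (M Int W \<times> W)) + real a * real k"
    by (rule mader[OF MG L(2) k1 dM]) blast
  have fW: "finite W" using W(1) L(1) finite_subset by auto
  have Wdeg: "a < 2 * card (M `` {v} Int W)" if "v \<in> W" for v using W(3)[OF that] by linarith
  have Wa: "a < 2 * card W"
  proof -
    obtain v where v: "v \<in> W" using W(2) by auto
    have "card (M `` {v} Int W) <= card W" using fW by (intro card_mono) auto
    then show ?thesis using Wdeg[OF v] by simp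
  qed
  \<comment> \<open>Adjacency in the minor is symmetric, but only the fringe of \<open>l\<close>
    itself can supply its branch vertex, so out-neighbours are counted.\<close>
  define good where "good = {l \<in> W. a < 8 * card (Out l Int W)}"
  \<comment> \<open>Fewer than \<open>d\<close> good indices contribute at most
    \<open>d * (q * n1)\<close> pairs, all others at most \<open>a / 8\<close> each; this is too
    little for an average degree close to \<open>a\<close>.\<close>
  have "card VH <= card good"
  proof (rule ccontr)
    assume "~ ?thesis"
    then have gd: "card good < d" using H(2) by simp
    have fg: "finite good" using fW by (simp add: good_def)
    have "M Int W \<times> W \<subseteq> (Sigma W (%l. Out l Int W)) Un prod.swap ` (Sigma W (%l. Out l Int W))" by (auto simp: M_def image_iff)
    moreover have fS: "finite (Sigma W (%l. Out l Int W))" using fW by auto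
    ultimately have "card (M Int W \<times> W) <= card ((Sigma W (%l. Out l Int W)) Un prod.swap ` (Sigma W (%l. Out l Int W)))" by (intro card_mono) auto
    also have "\<dots> <= card (Sigma W (%l. Out l Int W)) + card (Sigma W (%l. Out l Int W))"
      using card_Un_le[of "Sigma W (%l. Out l Int W)" "prod.swap ` (Sigma W (%l. Out l Int W))"] card_image_le[OF fS, of prod.swap] by linarith
    also have "card (Sigma W (%l. Out l Int W)) = (\<Sum>l\<in>W. card (Out l Int W))" using fW by (intro card_SigmaI) auto
    finally have 1: "card (M Int W \<times> W) <= 2 * (\<Sum>l\<in>W. card (Out l Int W))" by simp
    have out_le: "card (Out l Int W) <= q * n1" if "l \<in> W" for l
    proof -
      have lL: "l \<in> L" using that W(1) by auto
      have fS: "finite (S u)" if "u \<in> F l" for u using S(1)[OF lL that] L(1) by (meson finite_subset subsetI)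
      have "card (Out l Int W) <= card (\<Union>u\<in>F l. S u)" using F(4)[OF lL] fS by (intro card_mono) (auto simp: Out_def)
      also have "\<dots> <= (\<Sum>u\<in>F l. card (S u))" using F(4)[OF lL] by (intro card_UN_le) auto
      also have "\<dots> <= (\<Sum>u\<in>F l. n1)" using S(2)[OF lL] by (intro sum_mono) auto
      also have "\<dots> <= q * n1" using F(4)[OF lL] by simp
      finally show ?thesis .
    qed
    have "(\<Sum>l\<in>W. card (Out l Int W)) = (\<Sum>l\<in>good. card (Out l Int W)) + (\<Sum>l\<in>W - good. card (Out l Int W))"
      using fW by (metis (no_types, lifting) add.commute good_def mem_Collect_eq subsetI sum.subset_diff)
    moreover have "(\<Sum>l\<in>good. card (Out l Int W)) <= (\<Sum>l\<in>good. q * n1)" using out_le by (intro sum_mono) (auto simp: good_def)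
    moreover have "(\<Sum>l\<in>good. q * n1) <= d * (q * n1)" using gd by simp
    moreover have "8 * (\<Sum>l\<in>W - good. card (Out l Int W)) <= (\<Sum>l\<in>W - good. a)"
      unfolding sum_distrib_left by (intro sum_mono) (auto simp: good_def)
    moreover have "(\<Sum>l\<in>W - good. a) <= card W * a" using fW by (simp add: card_mono)
    ultimately have 2: "8 * (\<Sum>l\<in>W. card (Out l Int W)) <= 8 * (d * (q * n1)) + card W * a" by linarith
    have 3: "a * card W < card (M Int W \<times> W) + a * k"
    proof -
      have "real (a * card W) < real (card (M Int W \<times> W) + a * k)" using W(5) by simp
      then show ?thesis by (simp only: of_nat_less_iff)
    qed
    have "4 * (a * card W) < 8 * (\<Sum>l\<in>W. card (Out l Int W)) + 4 * (a * k)" using 1 3 by linarith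
    then have "3 * (a * card W) < 8 * (d * (q * n1)) + 4 * (a * k)" using 2 by (simp add: mult.commute)
    moreover have "4 * (a * k) <= a * a" using num(3) by (metis mult.left_commute mult_le_mono2)
    moreover have "8 * (d * (q * n1)) <= a * a" using num(6) by (simp add: algebra_simps)
    moreover have "a * a <= 2 * (a * card W)" using Wa by (metis less_imp_le mult.left_commute mult_le_mono2)
    moreover have "2 * (8 * (d * (q * n1))) <= a * a" using num(6) by (simp add: algebra_simps)
    ultimately show False by linarith
  qed
  then obtain J0 where J0: "J0 \<subseteq> good" "card J0 = card VH" by (meson obtain_subset_with_card_n)
  have fJ: "finite J0" using J0(1) fW by (auto simp: good_def intro: finite_subset)
  obtain lh where lh: "bij_betw lh VH J0" using finite_same_card_bij[OF fH(1) fJ] J0(2) by auto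
  have lhJ: "lh h \<in> J0" if "h \<in> VH" for h using lh that by (auto simp: bij_betw_def)
  have lhW: "lh h \<in> W" "lh h \<in> L" "a < 8 * card (Out (lh h) Int W)" if "h \<in> VH" for h using lhJ[OF that] J0(1) W(1) by (auto simp: good_def)
  have lhi: "lh h ~= lh h'" if "h \<in> VH" "h' \<in> VH" "h ~= h'" for h h' using lh that by (auto simp: bij_betw_def inj_on_def)
  have fEH: "finite (EH `` {h})" for h using fH(2) by (rule finite_Image)
  have "\<exists>u T. (\<forall>h\<in>Z. u h \<in> F (lh h) & T h \<subseteq> S (u h) Int W - J0 & finite (T h) & card (T h) = card (EH `` {h})) & (\<forall>h\<in>Z. \<forall>h'\<in>Z. h ~= h' --> T h Int T h' = {})"
    if "finite Z" "Z \<subseteq> VH" for Z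
    using that
  proof (induction rule: finite_subset_induct')
    case empty then show ?case by simp
  next
    case (insert h Z)
    then obtain u T where uT: "\<forall>h\<in>Z. u h \<in> F (lh h) & T h \<subseteq> S (u h) Int W - J0 & finite (T h) & card (T h) = card (EH `` {h})"
      "\<forall>h\<in>Z. \<forall>h'\<in>Z. h ~= h' --> T h Int T h' = {}" by auto
    let ?Y = "J0 Un (\<Union>h\<in>Z. T h)"
    have fY: "finite ?Y" using fJ insert(1) uT(1) by auto
    have "card (\<Union>h\<in>Z. T h) <= (\<Sum>h\<in>Z. card (T h))" using insert(1) by (rule card_UN_le)
    also have "\<dots> <= (\<Sum>h\<in>Z. \<Delta>)" using uT(1) H(3) by (intro sum_mono) auto
    also have "\<dots> <= d * \<Delta>" using card_mono[OF fH(1) insert(3)] H(2) by simp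
    finally have cY: "card ?Y <= (\<Delta> + 1) * d" using card_Un_le[of J0 "\<Union>h\<in>Z. T h"] J0(2) H(2) by (simp add: algebra_simps)
    have lL: "lh h \<in> L" using lhW insert by auto
    have "\<exists>u\<in>F (lh h). \<Delta> <= card (S u Int W - ?Y)"
    proof (rule ccontr)
      assume no: "~ ?thesis"
      have "card (Out (lh h) Int W - ?Y) <= card (\<Union>u\<in>F (lh h). S u Int W - ?Y)"
        using F(4)[OF lL] fW by (intro card_mono) (auto simp: Out_def)
      also have "\<dots> <= (\<Sum>u\<in>F (lh h). card (S u Int W - ?Y))" using F(4)[OF lL] by (intro card_UN_le) auto
      also have "\<dots> <= (\<Sum>u\<in>F (lh h). \<Delta>)" using no by (intro sum_mono) (meson nat_le_linear)
      also have "\<dots> <= q * \<Delta>" using F(4)[OF lL] by simp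
      finally have "card (Out (lh h) Int W) <= q * \<Delta> + (\<Delta> + 1) * d" using diff_card_le_card_Diff[OF fY, of "Out (lh h) Int W"] cY by linarith
      then show False using lhW(3)[of h] insert(2) num(5) by auto
    qed
    then obtain u0 where u0: "u0 \<in> F (lh h)" "\<Delta> <= card (S u0 Int W - ?Y)" by auto
    have "card (EH `` {h}) <= card (S u0 Int W - ?Y)" using H(3)[of h] u0(2) by simp
    then obtain T0 where T0: "T0 \<subseteq> S u0 Int W - ?Y" "card T0 = card (EH `` {h})" by (meson obtain_subset_with_card_n)
    have "finite T0" using T0(1) fW by (meson finite_subset le_infE Diff_subset subset_trans)
    let ?u = "u(h := u0)" and ?T = "T(h := T0)"
    have "\<forall>x\<in>insert h Z. ?u x \<in> F (lh x) & ?T x \<subseteq> S (?u x) Int W - J0 & finite (?T x) & card (?T x) = card (EH `` {x})"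
      using uT(1) u0 T0 \<open>finite T0\<close> by auto
    moreover have "\<forall>x\<in>insert h Z. \<forall>y\<in>insert h Z. x ~= y --> ?T x Int ?T y = {}"
    proof (intro ballI impI)
      fix x y assume xy: "x \<in> insert h Z" "y \<in> insert h Z" "x ~= y"
      have t: "T0 Int T z = {}" if "z \<in> Z" for z using T0(1) that by auto
      show "?T x Int ?T y = {}" using xy uT(2) t insert(4) by (cases "x = h"; cases "y = h") auto
    qed
    ultimately show ?case by blast
  qed
  from this[OF fH(1) order.refl] obtain u T where
    uT: "!!h. h \<in> VH ==> u h \<in> F (lh h) & T h \<subseteq> S (u h) Int W - J0 & finite (T h) & card (T h) = card (EH `` {h})"
    "!!h h'. h \<in> VH ==> h' \<in> VH ==> h ~= h' ==> T h Int T h' = {}" by metis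
  have "\<forall>h. \<exists>x. h \<in> VH --> bij_betw x (EH `` {h}) (T h)"
    using finite_same_card_bij[OF fEH] uT(1) by metis
  then obtain x where x: "!!h. h \<in> VH ==> bij_betw (x h) (EH `` {h}) (T h)" by metis
  have xT: "x h h' \<in> T h" if "(h, h') \<in> EH" for h h'
    using x[of h] that fH(5) by (auto simp: bij_betw_def)
  have xinj: "x h1 h1' ~= x h2 h2'" if "(h1, h1') \<in> EH" "(h2, h2') \<in> EH" "(h1, h1') ~= (h2, h2')" for h1 h1' h2 h2'
  proof (cases "h1 = h2")
    case True
    have "inj_on (x h1) (EH `` {h1})" using x[of h1] that(1) fH(5) by (auto simp: bij_betw_def)
    then show ?thesis using True that by (auto simp: inj_on_def)
  next
    case False
    moreover have "h1 \<in> VH" "h2 \<in> VH" using that fH(5) by auto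
    ultimately have "T h1 Int T h2 = {}" using uT(2) by simp
    then show ?thesis using xT[OF that(1)] xT[OF that(2)] by auto
  qed
  define X where "X = (%(h, h'). x h h') ` EH"
  \<comment> \<open>Indices that own a branch vertex are removed, so no route can run through a
    branch vertex.\<close>
  define V2 where "V2 = W - J0"
  let ?M = "M Int V2 \<times> V2"
  have G2: "sgr V2 ?M" by (rule sgr_restrict[OF MG]) (use W(1) in \<open>auto simp: V2_def\<close>)
  have XV2: "X \<subseteq> V2" using xT uT(1) fH(5) by (force simp: X_def V2_def)
  have cX: "card X <= \<Delta> * d"
  proof -
    have "card X <= card EH" unfolding X_def using fH(2) by (rule card_image_le)
    also have "\<dots> = (\<Sum>h\<in>VH. card (EH `` {h}))" by (rule sgr_deg_sum[OF H(1)])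
    also have "\<dots> <= (\<Sum>h\<in>VH. \<Delta>)" using H(3) by (intro sum_mono) auto
    also have "\<dots> <= \<Delta> * d" using H(2) by (simp add: mult.commute)
    finally show ?thesis .
  qed
  have cJ: "card J0 <= d" using J0(2) H(2) by simp
  have deg2: "K * (\<Delta> * d + 1) < card (?M `` {v})" if "v \<in> V2" for v
  proof -
    have "M `` {v} Int W \<subseteq> ?M `` {v} Un J0" using that by (auto simp: V2_def)
    then have "card (M `` {v} Int W) <= card (?M `` {v} Un J0)" using fM(1) fJ by (intro card_mono) (auto intro: finite_Image)
    also have "\<dots> <= card (?M `` {v}) + d" using card_Un_le[of "?M `` {v}" J0] cJ by linarith
    finally show ?thesis using Wdeg[of v] that num(4) by (auto simp: V2_def)
  qed
  have XV2': "X ~= V2"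
  proof
    assume "X = V2"
    then have "card W - card J0 <= \<Delta> * d" using cX diff_card_le_card_Diff[OF fJ, of W] by (simp add: V2_def)
    then have "card W <= (\<Delta> + 1) * d" using cJ by (simp add: algebra_simps)
    then have "card W + 1 <= k" using num(2) by (metis add_le_mono1 order_trans)
    then show False using Wa num(3) by simp
  qed
  have "massed (K * (\<Delta> * d + 1)) V2 ?M X"
  proof (rule massed_of_connected[OF G2 XV2 XV2' deg2])
    fix P Q assume s: "sepn V2 ?M P Q" "card (P Int Q) < card X"
    have PQ: "P Un Q = V2" "?M Int (P - Q) \<times> (Q - P) = {}" using s(1) by (auto simp: sepn_def)
    have JW: "J0 \<subseteq> W" using J0(1) by (auto simp: good_def)
    have "sepn W (M Int W \<times> W) (P Un J0) (Q Un J0)" unfolding sepn_def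
      using PQ JW by (auto simp: V2_def)
    moreover have "card ((P Un J0) Int (Q Un J0)) <= k"
    proof -
      have "(P Un J0) Int (Q Un J0) = (P Int Q) Un J0" by auto
      then have "card ((P Un J0) Int (Q Un J0)) <= card (P Int Q) + card J0" by (metis card_Un_le)
      then show ?thesis using s(2) cX cJ num(2) by simp
    qed
    ultimately have "(P Un J0) - (Q Un J0) = {} | (Q Un J0) - (P Un J0) = {}" by (rule W(4))
    moreover have "P Int J0 = {}" "Q Int J0 = {}" using PQ(1) by (auto simp: V2_def)
    ultimately show "P - Q = {} | Q - P = {}" by blast
  qed auto
  then have lnkd: "linked V2 ?M X" using TW[OF G2 XV2 cX order.refl] by simp
  \<comment> \<open>An arbitrary numbering, used to list each edge of \<open>H\<close> in one
    direction only.\<close>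
  obtain idx :: "'w => nat" where idx: "inj_on idx VH" using finite_imp_inj_to_nat_seg[OF fH(1)] by auto
  define Q where "Q = {(x h h', x h' h) | h h'. (h, h') \<in> EH & idx h < idx h'}"
  have EHs: "(h', h) \<in> EH" if "(h, h') \<in> EH" for h h' using that symD[OF fH(3)] by auto
  have "pairing Q X" unfolding pairing_def
  proof (intro conjI ballI impI)
    show "Q \<subseteq> X \<times> X" using EHs by (force simp: Q_def X_def)
    fix p assume "p \<in> Q"
    then obtain h h' where p: "p = (x h h', x h' h)" "(h, h') \<in> EH" "idx h < idx h'" by (auto simp: Q_def)
    show "fst p ~= snd p" using xinj[OF p(2) EHs[OF p(2)]] p fH(4) by (auto simp: irrefl_def)
    fix p' assume "p' \<in> Q" and ne: "p ~= p'"
    then obtain g g' where p': "p' = (x g g', x g' g)" "(g, g') \<in> EH" "idx g < idx g'" by (auto simp: Q_def)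
    have n1: "(h, h') ~= (g, g')" using ne p p' by auto
    have n2: "(h, h') ~= (g', g)" using p p' by auto
    show "{fst p, snd p} Int {fst p', snd p'} = {}"
      using xinj[OF p(2) p'(2) n1] xinj[OF p(2) EHs[OF p'(2)] n2] xinj[OF EHs[OF p(2)] p'(2)] xinj[OF EHs[OF p(2)] EHs[OF p'(2)]] n1 n2
      unfolding p(1) p'(1) by auto
  qed
  then obtain C where C: "rooted V2 ?M X Q C" using lnkd by (auto simp: linked_def)
  \<comment> \<open>Uncontraction includes the fringe, because edges of the minor run from a fringe
    vertex to a core.\<close>
  define Wl where "Wl l = P l Un F l" for l
  define I where "I e = \<Union> {\<Union> (Wl ` C (x h h')) | h h'. (h, h') \<in> EH & {h, h'} = e}" for e
  have xX: "x h h' \<in> X" if "(h, h') \<in> EH" for h h' using that by (force simp: X_def)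
  have CV2: "C (x h h') \<subseteq> V2" if "(h, h') \<in> EH" for h h' using rootedD(2)[OF C xX[OF that]] .
  have V2L: "V2 \<subseteq> L" using W(1) by (auto simp: V2_def)
  have Wld: "Wl l Int Wl l' = {}" if "l \<in> L" "l' \<in> L" "l ~= l'" for l l'
    using P(2)[OF that] F(2)[OF that] F(3)[OF that(1,2)] F(3)[OF that(2,1)] by (auto simp: Wl_def)
  have conW: "conn E (Wl l)" if l: "l \<in> L" for l
  proof -
    have "conn E (P l Un F')" if "finite F'" "F' \<subseteq> F l" for F'
      using that
    proof (induction rule: finite_subset_induct')
      case empty then show ?case using P(1)[OF l] by simp
    next
      case (insert v F')
      obtain w where "w \<in> P l" "(w, v) \<in> E" using F(1)[OF l insert(2)] by auto
      then show ?case using conn_insert[OF fV(3) insert(5), of w v] by auto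
    qed
    then show ?thesis unfolding Wl_def using F(4)[OF l] by auto
  qed
  have adjW: "\<exists>u\<in>Wl l. \<exists>v\<in>Wl l'. (u, v) \<in> E" if "(l, l') \<in> M" for l l'
  proof -
    have dir: "\<exists>u\<in>F l. \<exists>v\<in>P l'. (u, v) \<in> E & (v, u) \<in> E" if o: "l' \<in> Out l" "l \<in> L" for l l'
    proof -
      obtain v where v: "v \<in> F l" "l' \<in> S v" using o(1) by (auto simp: Out_def)
      then show ?thesis using S(1)[OF o(2) v] symD[OF fV(3)] by blast
    qed
    show ?thesis using that dir unfolding M_def Wl_def by blast
  qed
  have conC: "conn E (\<Union> (Wl ` C (x h h')))" if "(h, h') \<in> EH" for h h'
  proof (rule conn_UN[OF fV(3) rootedD(3)[OF C xX[OF that]]])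
    show "conn E (Wl l)" if "l \<in> C (x h h')" for l using conW CV2[OF \<open>(h, h') \<in> EH\<close>] V2L that by auto
    show "\<exists>u\<in>Wl l. \<exists>v\<in>Wl l'. (u, v) \<in> E" if "(l, l') \<in> ?M" for l l' using adjW that by auto
  qed
  have Iun: "I {h, h'} = \<Union> (Wl ` C (x h h')) Un \<Union> (Wl ` C (x h' h))" if "(h, h') \<in> EH" for h h'
  proof
    show "I {h, h'} \<subseteq> \<Union> (Wl ` C (x h h')) Un \<Union> (Wl ` C (x h' h))" unfolding I_def by (auto simp: doubleton_eq_iff)
    show "\<Union> (Wl ` C (x h h')) Un \<Union> (Wl ` C (x h' h)) \<subseteq> I {h, h'}"
      unfolding I_def using that EHs[OF that] by (intro Un_least Union_upper) (auto simp: insert_commute)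
  qed
  have uR: "u h \<in> F (lh h)" "lh h \<in> L" if "h \<in> VH" for h using uT(1)[OF that] lhW(2)[OF that] by auto
  have uW: "u h \<notin> Wl l" if "h \<in> VH" "l \<in> V2" for h l
  proof -
    have "lh h ~= l" using lhJ[OF that(1)] that(2) by (auto simp: V2_def)
    then have "Wl (lh h) Int Wl l = {}" using Wld uR(2)[OF that(1)] that(2) V2L by auto
    then show ?thesis using uR(1)[OF that(1)] by (auto simp: Wl_def)
  qed
  have WlV: "Wl l \<subseteq> V" if "l \<in> L" for l using P(1)[OF that] F(1)[OF that] by (auto simp: Wl_def)
  have lnk1: "lnk E (I {h, h'}) (u h) (u h')" if hh: "(h, h') \<in> EH" for h h'
  proof -
    have hV: "h \<in> VH" "h' \<in> VH" using hh fH(5) by auto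
    have att: "\<exists>w\<in>\<Union> (Wl ` C (x g g')). (u g, w) \<in> E" if "(g, g') \<in> EH" for g g'
    proof -
      have g: "g \<in> VH" using that fH(5) by auto
      have "x g g' \<in> S (u g)" using xT[OF that] uT(1)[OF g] by auto
      then obtain w where "w \<in> P (x g g')" "(w, u g) \<in> E" using S(1)[OF uR(2)[OF g] uR(1)[OF g]] by auto
      moreover have "x g g' \<in> C (x g g')" using rootedD(1)[OF C xX[OF that]] .
      ultimately show ?thesis using symD[OF fV(3)] by (auto simp: Wl_def)
    qed
    have touch: "\<exists>a\<in>\<Union> (Wl ` C (x h h')). \<exists>b\<in>\<Union> (Wl ` C (x h' h)). (a, b) \<in> E"
    proof -
      have ne: "idx h ~= idx h'" using hV hh fH(4) idx by (auto simp: inj_on_def irrefl_def)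
      have main: "\<exists>a\<in>\<Union> (Wl ` C (x g g')). \<exists>b\<in>\<Union> (Wl ` C (x g' g)). (a, b) \<in> E & (b, a) \<in> E" if "(g, g') \<in> EH" "idx g < idx g'" for g g'
      proof -
        have "(x g g', x g' g) \<in> Q" using that by (auto simp: Q_def)
        from rootedD(5)[OF C this] obtain l l' where l: "l \<in> C (x g g')" "l' \<in> C (x g' g)" "(l, l') \<in> M" by auto
        obtain a b where "a \<in> Wl l" "b \<in> Wl l'" "(a, b) \<in> E" using adjW[OF l(3)] by blast
        then show ?thesis using l(1,2) symD[OF fV(3)] by blast
      qed
      show ?thesis
      proof (cases "idx h < idx h'")
        case True then show ?thesis using main[OF hh] by blast
      next
        case False then show ?thesis using main[OF EHs[OF hh]] ne by fastforce
      qed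
    qed
    then obtain p0 q0 where pq: "p0 \<in> \<Union> (Wl ` C (x h h'))" "q0 \<in> \<Union> (Wl ` C (x h' h))" "(p0, q0) \<in> E" by blast
    have "conn E (I {h, h'})" unfolding Iun[OF hh]
      by (rule conn_Un_edge[OF fV(3) conC[OF hh] conC[OF EHs[OF hh]] pq])
    moreover have "\<exists>w\<in>I {h, h'}. (u h, w) \<in> E" "\<exists>w\<in>I {h, h'}. (u h', w) \<in> E"
      using att[OF hh] att[OF EHs[OF hh]] unfolding Iun[OF hh] by blast+
    ultimately show ?thesis unfolding lnk_def by blast
  qed
  show ?thesis unfolding topo_def
  proof (intro exI[of _ u] exI[of _ I] conjI allI impI)
    show "inj_on u VH"
    proof (rule inj_onI)
      fix h h' assume h: "h \<in> VH" "h' \<in> VH" "u h = u h'"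
      show "h = h'"
      proof (rule ccontr)
        assume "h ~= h'"
        then have "F (lh h) Int F (lh h') = {}" using F(2)[OF uR(2)[OF h(1)] uR(2)[OF h(2)]] lhi h by auto
        then show False using uR(1)[OF h(1)] uR(1)[OF h(2)] h(3) by auto
      qed
    qed
    show "u ` VH \<subseteq> V" using F(1) uR by auto
    fix h h' assume hh: "(h, h') \<in> EH"
    show "lnk E (I {h, h'}) (u h) (u h')" by (rule lnk1[OF hh])
    show "I {h, h'} \<subseteq> V - u ` VH"
    proof
      fix w assume "w \<in> I {h, h'}"
      then obtain l where l: "l \<in> V2" "w \<in> Wl l" unfolding Iun[OF hh] using CV2[OF hh] CV2[OF EHs[OF hh]] by blast
      then show "w \<in> V - u ` VH" using WlV[of l] V2L uW[OF _ l(1)] by auto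
    qed
    fix g g' assume gg: "(g, g') \<in> EH" and ne: "{h, h'} ~= {g, g'}"
    have dj: "\<Union> (Wl ` C (x a a')) Int \<Union> (Wl ` C (x b b')) = {}" if ab: "(a, a') \<in> EH" "(b, b') \<in> EH" "(a, a') ~= (b, b')" for a a' b b'
    proof -
      have "C (x a a') Int C (x b b') = {}" by (rule rootedD(4)[OF C xX[OF ab(1)] xX[OF ab(2)] xinj[OF ab]])
      then have "Wl l Int Wl l' = {}" if "l \<in> C (x a a')" "l' \<in> C (x b b')" for l l'
        using Wld[of l l'] that CV2[OF ab(1)] CV2[OF ab(2)] V2L by blast
      then show ?thesis by blast
    qed
    have n: "(h, h') ~= (g, g')" "(h, h') ~= (g', g)" "(h', h) ~= (g, g')" "(h', h) ~= (g', g)" using ne by (auto simp: insert_commute)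
    show "I {h, h'} Int I {g, g'} = {}" unfolding Iun[OF hh] Iun[OF gg] Int_Un_distrib Int_Un_distrib2
      using dj[OF hh gg n(1)] dj[OF hh EHs[OF gg] n(2)] dj[OF EHs[OF hh] gg n(3)] dj[OF EHs[OF hh] EHs[OF gg] n(4)] by simp
  qed
qed

section \<open>Locally sparse graphs\<close>

lemma card_split: "finite A ==> card A = card (A Int B) + card (A - B)"
  by (metis Int_Diff_Un Int_Diff_disjoint card_Un_disjoint finite_Diff finite_Int)

text \<open>A maximal family of disjoint fringes. By dispersion, while fewer than \<open>y0\<close>
  vertices of \<open>L\<close> are seen, more than half of any admissible choice for the next
  \<open>r\<close> brings new ones, or at least one choice does; it gains \<open>n0 / 2\<close>, so
  \<open>q\<close> choices reach \<open>y0\<close>. If fewer than half of \<open>L\<close> were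
  served, each remaining \<open>l\<close> would have more than \<open>n2 / 4\<close> neighbours in
  use, but only \<open>q * card L1\<close> vertices are in use, each with at most \<open>n1\<close>
  neighbours.\<close>

lemma absorb:
  fixes B :: "('l \<times> 'r) set" and n0 n1 n2 y0 q :: nat
  assumes fin: "finite L" "finite R" "B \<subseteq> L \<times> R"
    and n2: "!!l. l \<in> L ==> n2 <= card (B `` {l})" "0 < n2"
    and n01: "!!r. r \<in> R ==> n0 <= card (B\<inverse> `` {r})" "!!r. r \<in> R ==> card (B\<inverse> `` {r}) <= n1"
    and disp: "!!l Y. l \<in> L ==> Y \<subseteq> L ==> card Y < y0 ==> 2 * card {r \<in> B `` {l}. card (B\<inverse> `` {r}) <= 2 * card (B\<inverse> `` {r} Int Y)} <= n2"
    and num: "4 * q * n1 <= n2" "2 * y0 <= q * n0"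
  shows "\<exists>F L1. L1 \<subseteq> L & card L <= 2 * card L1 &
    (\<forall>l\<in>L1. F l \<subseteq> B `` {l} & finite (F l) & card (F l) <= q & y0 <= card (\<Union>r\<in>F l. B\<inverse> `` {r})) &
    (\<forall>l\<in>L1. \<forall>l'\<in>L1. l ~= l' --> F l Int F l' = {})"
proof -
  let ?S = "%r. B\<inverse> `` {r}"
  have fS: "finite (?S r)" for r using fin by (intro finite_subset[OF _ fin(1)]) auto
  have fN: "finite (B `` {l})" for l using fin by (intro finite_subset[OF _ fin(2)]) auto
  have pick: "\<exists>F\<subseteq>A. finite F & card F <= j & (y0 <= card (\<Union>r\<in>F. ?S r) | j * n0 <= 2 * card (\<Union>r\<in>F. ?S r))"
    if l: "l \<in> L" and A: "A \<subseteq> B `` {l}" "n2 < 2 * card A" for l A j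
  proof (induction j)
    case 0 show ?case by (intro exI[of _ "{}"]) simp
  next
    case (Suc j)
    then obtain F where F: "F \<subseteq> A" "finite F" "card F <= j" "y0 <= card (\<Union>r\<in>F. ?S r) | j * n0 <= 2 * card (\<Union>r\<in>F. ?S r)" by auto
    let ?Y = "\<Union>r\<in>F. ?S r"
    show ?case
    proof (cases "y0 <= card ?Y")
      case True then show ?thesis using F by (intro exI[of _ F]) auto
    next
      case False
      have YL: "?Y \<subseteq> L" using fin(3) by auto
      let ?bad = "{r \<in> B `` {l}. card (?S r) <= 2 * card (?S r Int ?Y)}"
      have fbad: "finite ?bad" by (rule finite_subset[OF _ fN[of l]]) auto
      have "2 * card ?bad <= n2" using disp[OF l YL] False by simp
      then have "card ?bad < card A" using A(2) by simp
      then have "~ A \<subseteq> ?bad" using fbad by (meson card_mono not_le)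
      then obtain r where r: "r \<in> A" "r \<notin> ?bad" by auto
      then have "2 * card (?S r Int ?Y) < card (?S r)" using A(1) by auto
      moreover have "card (?S r) = card (?S r Int ?Y) + card (?S r - ?Y)" using fS by (rule card_split)
      moreover have "n0 <= card (?S r)" using n01(1) r(1) A(1) fin(3) by blast
      ultimately have h: "n0 <= 2 * card (?S r - ?Y)" by simp
      have fY: "finite ?Y" using F(2) fS by auto
      have "(\<Union>r\<in>insert r F. ?S r) = ?Y Un (?S r - ?Y)" by auto
      then have "card (\<Union>r\<in>insert r F. ?S r) = card ?Y + card (?S r - ?Y)"
        using fY fS[of r] by (metis Diff_disjoint card_Un_disjoint finite_Diff)
      then have "Suc j * n0 <= 2 * card (\<Union>r\<in>insert r F. ?S r)" using h F(4) False by simp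
      moreover have "card (insert r F) <= Suc j" using F(2,3) by (simp add: card_insert_if)
      ultimately show ?thesis using F r by (intro exI[of _ "insert r F"]) auto
    qed
  qed
  define ok where "ok L1 F \<longleftrightarrow> L1 \<subseteq> L & (\<forall>l\<in>L1. F l \<subseteq> B `` {l} & finite (F l) & card (F l) <= q & y0 <= card (\<Union>r\<in>F l. ?S r)) &
    (\<forall>l\<in>L1. \<forall>l'\<in>L1. l ~= l' --> F l Int F l' = {})" for L1 F
  have "ok {} (%_. {})" by (simp add: ok_def)
  then have "{(L1, F). ok L1 F} ~= {}" by blast
  from obtain_min_pair[OF this, of "%L1 F. card L - card L1"] obtain L1 F where
    ok1: "ok L1 F" and max: "!!L2 F2. ok L2 F2 ==> card L - card L1 <= card L - card L2" by auto
  have L1: "L1 \<subseteq> L" "!!l. l \<in> L1 ==> F l \<subseteq> B `` {l} & finite (F l) & card (F l) <= q & y0 <= card (\<Union>r\<in>F l. ?S r)"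
    "!!l l'. l \<in> L1 ==> l' \<in> L1 ==> l ~= l' ==> F l Int F l' = {}" using ok1 by (auto simp: ok_def)
  have fL1: "finite L1" using L1(1) fin(1) finite_subset by auto
  have "card L <= 2 * card L1"
  proof (rule ccontr)
    assume small: "~ ?thesis"
    let ?Z = "\<Union>l\<in>L1. F l"
    have ZR: "?Z \<subseteq> R" using L1(2) fin(3) by blast
    have fZ: "finite ?Z" using ZR fin(2) finite_subset by auto
    have "card ?Z <= (\<Sum>l\<in>L1. card (F l))" using fL1 by (rule card_UN_le)
    also have "\<dots> <= (\<Sum>l\<in>L1. q)" using L1(2) by (intro sum_mono) auto
    finally have cZ: "card ?Z <= card L1 * q" by simp
    have used: "n2 < 4 * card (B `` {l} Int ?Z)" if l: "l \<in> L - L1" for l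
    proof (rule ccontr)
      assume n: "~ ?thesis"
      let ?A = "B `` {l} - ?Z"
      have "card (B `` {l}) = card (B `` {l} Int ?Z) + card ?A" using fN by (rule card_split)
      then have "n2 < 2 * card ?A" using n n2(1)[of l] n2(2) l by auto
      then obtain F0 where F0: "F0 \<subseteq> ?A" "finite F0" "card F0 <= q" "y0 <= card (\<Union>r\<in>F0. ?S r) | q * n0 <= 2 * card (\<Union>r\<in>F0. ?S r)"
        using pick[of l ?A q] l by auto
      have y: "y0 <= card (\<Union>r\<in>F0. ?S r)" using F0(4) num(2) by linarith
      have "ok (insert l L1) (F(l := F0))" unfolding ok_def
      proof (intro conjI ballI impI)
        show "insert l L1 \<subseteq> L" using l L1(1) by auto
        fix x assume x: "x \<in> insert l L1"
        show "(F(l := F0)) x \<subseteq> B `` {x}" "finite ((F(l := F0)) x)" "card ((F(l := F0)) x) <= q" "y0 <= card (\<Union>r\<in>(F(l := F0)) x. ?S r)"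
          using x L1(2)[of x] F0 y l by auto
        fix x' assume x': "x' \<in> insert l L1" "x ~= x'"
        have "F0 Int F z = {}" if "z \<in> L1" for z using F0(1) that by blast
        then show "(F(l := F0)) x Int (F(l := F0)) x' = {}" using x x' L1(3)[of x x'] l
          by (cases "x = l"; cases "x' = l") (auto simp: Int_commute)
      qed
      from max[OF this] have "card L - card L1 <= card L - card (insert l L1)" .
      moreover have "card (insert l L1) = Suc (card L1)" using l fL1 by simp
      moreover have "card (insert l L1) <= card L" using l L1(1) fin(1) by (intro card_mono) auto
      ultimately show False by simp
    qed
    have "(\<Sum>l\<in>L - L1. n2) <= (\<Sum>l\<in>L - L1. 4 * card (B `` {l} Int ?Z))" using used by (intro sum_mono) (meson less_imp_le)
    also have "\<dots> = 4 * card (Sigma (L - L1) (%l. B `` {l} Int ?Z))" using fin(1) fN by (simp add: card_SigmaI sum_distrib_left)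
    also have "card (Sigma (L - L1) (%l. B `` {l} Int ?Z)) <= card (Sigma ?Z ?S)"
    proof (rule card_inj_on_le[where f = prod.swap])
      show "prod.swap ` (Sigma (L - L1) (%l. B `` {l} Int ?Z)) \<subseteq> Sigma ?Z ?S" by auto
    qed (use fZ fS in auto)
    also have "card (Sigma ?Z ?S) = (\<Sum>r\<in>?Z. card (?S r))" using fZ fS by (intro card_SigmaI) auto
    also have "\<dots> <= (\<Sum>r\<in>?Z. n1)" using n01(2) ZR by (intro sum_mono) auto
    finally have "card (L - L1) * n2 <= 4 * (card ?Z * n1)" by simp
    also have "\<dots> <= 4 * (card L1 * q * n1)" using cZ by simp
    also have "\<dots> <= card L1 * n2" using mult_le_mono2[OF num(1), of "card L1"] by (simp add: algebra_simps)
    finally have "card (L - L1) <= card L1" using n2(2) by simp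
    moreover have "card (L - L1) = card L - card L1" using L1(1) fin(1) by (simp add: card_Diff_subset finite_subset)
    ultimately show False using small by simp
  qed
  then show ?thesis using L1 by (intro exI[of _ F] exI[of _ L1]) auto
qed

text \<open>Its failure supplies the dense pairs from which tiles are cut; there the disjointness of
  \<open>X\<close> and \<open>Y\<close> makes the sides of the tile disjoint.\<close>

definition no_dense :: "('a \<times> 'a) set => 'a set => real => real => bool" where
  "no_dense E V a \<eta> \<longleftrightarrow> (\<forall>X Y. X \<subseteq> V --> Y \<subseteq> V --> X Int Y = {} --> a <= real (card X) --> a <= real (card Y) -->
     real (ecard E X Y) < \<eta> * real (card X) * real (card Y))"

lemma no_denseD:
  assumes "no_dense E V a \<eta>" "finite V" "X \<subseteq> V" "Y \<subseteq> V" "X Int Y = {}" "a <= real (card X)" "a <= real (card Y)"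
    and "!!x. x \<in> X ==> \<eta> * real (card Y) <= real (card (E `` {x} Int Y))"
  shows False
proof -
  have f: "finite X" "finite Y" using assms(2,3,4) by (auto intro: finite_subset)
  have "(\<Sum>x\<in>X. \<eta> * real (card Y)) <= (\<Sum>x\<in>X. real (card (E `` {x} Int Y)))" by (intro sum_mono assms(8))
  also have "\<dots> = real (ecard E X Y)" using ecard_sum[OF f, of E] by simp
  also have "\<dots> < \<eta> * real (card X) * real (card Y)" using assms by (simp add: no_dense_def)
  finally show False by (simp add: algebra_simps)
qed

text \<open>Average degree of the minor in units of \<open>d\<close>. The summands are the demands
  of \<open>dense_minor_topo\<close>: connectivity, minimum degree for linking, choice of exits, and
  enough good indices.\<close>

definition cY :: "nat => nat => nat => nat => nat" where
  "cY K \<Delta> b K1 = 4 * (\<Delta> + 2) + 2 * (K * (\<Delta> + 1) + 2) + 8 * (\<Delta> + 2) + 96 * b * K1"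

text \<open>A fringe vertex adds at least \<open>d / (2 * b)\<close> new cores and
  \<open>(2 * cY + 1) * d\<close> are wanted: only half of the indices are sure to get a fringe, and
  the own core does not count.\<close>

definition qY :: "nat => nat => nat => nat => nat" where
  "qY K \<Delta> b K1 = 2 * (2 * cY K \<Delta> b K1 + 1) * b"

text \<open>Dominates the number of cores, in units of \<open>d\<close>, that a fringe must see; as
  a lower bound for \<open>d\<close> it also makes the term with \<open>q * \<Delta>\<close> in the
  choice of exits harmless.\<close>

definition CY :: "nat => nat => nat => nat => nat" where
  "CY K \<Delta> b K1 = (2 * cY K \<Delta> b K1 + 1) + qY K \<Delta> b K1 * \<Delta> + 1"

text \<open>Local sparsity provides the dispersion for \<open>absorb\<close>. If many neighbours
  \<open>r\<close> of a core had half of their adjacent cores in a family of fewer than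
  \<open>(2 * cY + 1) * d\<close> cores, each of these \<open>r\<close> would have
  \<open>d / (2 * b)\<close> neighbours in the union of the family, a set of at most
  \<open>(2 * cY + 1) * d * s\<close> vertices, and such a pair is excluded by
  \<open>no_dense\<close>.\<close>

lemma bip_minor_topo:
  fixes K \<Delta> b K1 :: nat and d s :: nat and E :: "('a \<times> 'a) set" and P :: "'a => 'a set" and VH :: "'w set"
  assumes TW: "!!V (E :: ('a \<times> 'a) set) X c \<kappa>. sgr V E ==> X \<subseteq> V ==> card X <= \<kappa> ==> K * (\<kappa> + 1) <= c ==> massed c V E X ==> linked V E X"
    and b: "1 <= b" "1 <= K1"
    and G: "sgr V E" and L: "finite L" "L ~= {}"
    and P: "!!l. l \<in> L ==> conn E (P l) & P l \<subseteq> V & card (P l) <= s" "!!l l'. l \<in> L ==> l' \<in> L ==> l ~= l' ==> P l Int P l' = {}"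
    and R: "R \<subseteq> V" "!!l. l \<in> L ==> P l Int R = {}"
    and n2: "!!l. l \<in> L ==> 4 * qY K \<Delta> b K1 * K1 * d <= card {r \<in> R. \<exists>w\<in>P l. (w, r) \<in> E}"
    and n01: "!!r. r \<in> R ==> d <= b * card {l \<in> L. \<exists>w\<in>P l. (w, r) \<in> E} & card {l \<in> L. \<exists>w\<in>P l. (w, r) \<in> E} <= K1 * d"
    and nd: "no_dense E V (real d / (2 * real b)) (1 / (2 * real b * real s * real (CY K \<Delta> b K1)))"
    and H: "sgr VH EH" "card VH <= d" "!!h. card (EH `` {h}) <= \<Delta>" and d: "CY K \<Delta> b K1 <= d" and s: "1 <= s"
  shows "topo V E VH EH"
proof -
  define c1 where "c1 = cY K \<Delta> b K1"
  define Y where "Y = 2 * c1 + 1"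
  define q where "q = qY K \<Delta> b K1"
  define C where "C = CY K \<Delta> b K1"
  define Q where "Q = 4 * q * K1"
  have q_def': "q = 2 * Y * b" by (simp add: q_def qY_def Y_def c1_def)
  have C_def': "C = Y + q * \<Delta> + 1" by (simp add: C_def CY_def Y_def c1_def q_def)
  have c1_def': "c1 = 4 * (\<Delta> + 2) + 2 * (K * (\<Delta> + 1) + 2) + 8 * (\<Delta> + 2) + 96 * b * K1" by (simp add: c1_def cY_def)
  have q1: "1 <= q" "1 <= Y" using b by (auto simp: q_def' Y_def)
  note n2 = n2[folded q_def, folded Q_def] and nd = nd[folded C_def] and d = d[folded C_def]
  show ?thesis
  proof -
    have fV: "finite V" "finite E" "sym E" using sgr_finite[OF G] by auto
    have fR: "finite R" using R(1) fV(1) finite_subset by auto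
    have d1: "1 <= d" "q * \<Delta> + 1 <= d" using d by (auto simp: C_def')
    define B where "B = {(l, r). l \<in> L & r \<in> R & (\<exists>w\<in>P l. (w, r) \<in> E)}"
    have Bl: "B `` {l} = {r \<in> R. \<exists>w\<in>P l. (w, r) \<in> E}" if "l \<in> L" for l using that by (auto simp: B_def)
    have Br: "B\<inverse> `` {r} = {l \<in> L. \<exists>w\<in>P l. (w, r) \<in> E}" if "r \<in> R" for r using that by (auto simp: B_def)
    define n0 where "n0 = nat \<lceil>real d / real b\<rceil>"
    have n0d: "d <= b * n0"
    proof -
      have "real d / real b <= real n0" unfolding n0_def by linarith
      then have "real d <= real (b * n0)" using b by (simp add: divide_le_eq mult.commute)
      then show ?thesis by (simp only: of_nat_le_iff)
    qed
    have n0le: "n0 <= x" if "d <= b * x" for x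
    proof -
      have "real d <= real (b * x)" using that by (simp only: of_nat_le_iff)
      then have "real d / real b <= real x" using b by (simp add: divide_le_eq mult.commute)
      then show ?thesis unfolding n0_def by linarith
    qed
    have n0R: "real d / real b <= real n0" unfolding n0_def by linarith
    have disp: "2 * card {r \<in> B `` {l}. card (B\<inverse> `` {r}) <= 2 * card (B\<inverse> `` {r} Int Z)} <= Q * d"
      if l: "l \<in> L" and Z: "Z \<subseteq> L" "card Z < Y * d" for l Z
    proof (rule ccontr)
      let ?X = "{r \<in> B `` {l}. card (B\<inverse> `` {r}) <= 2 * card (B\<inverse> `` {r} Int Z)}"
      let ?U = "\<Union>y\<in>Z. P y"
      assume n: "~ ?thesis"
      have XR: "?X \<subseteq> R" by (auto simp: B_def)
      have fZ: "finite Z" using Z(1) L(1) finite_subset by auto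
      have UV: "?U \<subseteq> V" using P(1) Z(1) by blast
      have fU: "finite ?U" using UV fV(1) finite_subset by auto
      have "card ?U <= (\<Sum>y\<in>Z. card (P y))" using fZ by (rule card_UN_le)
      also have "\<dots> <= (\<Sum>y\<in>Z. s)" using P(1) Z(1) by (intro sum_mono) auto
      also have "\<dots> = card Z * s" by simp
      also have "\<dots> <= (Y * d) * s" using Z(2) by (intro mult_le_mono1) simp
      finally have cU: "card ?U <= Y * d * s" .
      have deg: "real d / (2 * real b) <= real (card (E `` {r} Int ?U))" if r: "r \<in> ?X" for r
      proof -
        have rR: "r \<in> R" using r XR by auto
        let ?T = "B\<inverse> `` {r} Int Z"
        have "\<forall>y. \<exists>w. y \<in> ?T --> w \<in> P y & (w, r) \<in> E" by (auto simp: B_def)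
        then obtain w where w: "!!y. y \<in> ?T ==> w y \<in> P y & (w y, r) \<in> E" by metis
        have "card ?T <= card (E `` {r} Int ?U)"
        proof (rule card_inj_on_le[of w])
          show "inj_on w ?T"
          proof (rule inj_onI)
            fix y y' assume y: "y \<in> ?T" "y' \<in> ?T" "w y = w y'"
            show "y = y'"
            proof (rule ccontr)
              assume "y ~= y'"
              then have "P y Int P y' = {}" using P(2)[of y y'] y Z(1) by auto
              then show False using w[OF y(1)] w[OF y(2)] y(3) by auto
            qed
          qed
          show "w ` ?T \<subseteq> E `` {r} Int ?U" using w symD[OF fV(3)] by blast
        qed (use fU in auto)
        then have t2: "b * (2 * card ?T) <= b * (2 * card (E `` {r} Int ?U))" by simp
        have "d <= b * card (B\<inverse> `` {r})" using n01[OF rR] Br[OF rR] by simp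
        also have "\<dots> <= b * (2 * card ?T)" using r by (intro mult_le_mono2) simp
        also note t2
        finally have "d <= b * (2 * card (E `` {r} Int ?U))" .
        then have "real d <= real (b * (2 * card (E `` {r} Int ?U)))" by (simp only: of_nat_le_iff)
        then show ?thesis using b by (simp add: field_simps)
      qed
      have "Q * d < 2 * card ?X" using n by simp
      moreover have "1 * d <= Q * d" using b q1 by (intro mult_le_mono1) (simp add: Q_def)
      ultimately have "real d < 2 * real (card ?X)" by linarith
      moreover have "real d / (2 * real b) <= real d / 2" using b by (intro divide_left_mono) auto
      ultimately have cX: "real d / (2 * real b) <= real (card ?X)" by linarith
      have "?X ~= {}" using n by (metis card.empty mult_0_right le0)
      then obtain r0 where r0: "r0 \<in> ?X" by blast
      have "card (E `` {r0} Int ?U) <= card ?U" using fU by (intro card_mono) auto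
      then have cU2: "real d / (2 * real b) <= real (card ?U)" using deg[OF r0] by linarith
      show False
      proof (rule no_denseD[OF nd fV(1) _ UV _ cX cU2])
        show "?X \<subseteq> V" using XR R(1) by auto
        show "?X Int ?U = {}" using XR R(2) Z(1) by blast
        fix r assume r: "r \<in> ?X"
        have "real (card ?U) <= real (Y * d * s)" using cU by (simp only: of_nat_le_iff)
        also have "\<dots> <= real C * real d * real s" unfolding C_def' by (simp add: mult_right_mono)
        finally have "1 / (2 * real b * real s * real C) * real (card ?U) <= 1 / (2 * real b * real s * real C) * (real C * real d * real s)"
          by (intro mult_left_mono) auto
        also have "\<dots> = real d / (2 * real b)"
        proof -
          have "0 < C" by (simp add: C_def')
          then have "0 < real C" by simp
          then show ?thesis using b s by (simp add: field_simps)
        qed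
        also have "\<dots> <= real (card (E `` {r} Int ?U))" by (rule deg[OF r])
        finally show "1 / (2 * real b * real s * real C) * real (card ?U) <= real (card (E `` {r} Int ?U))" .
      qed
    qed
    have "\<exists>F L1. L1 \<subseteq> L & card L <= 2 * card L1 &
      (\<forall>l\<in>L1. F l \<subseteq> B `` {l} & finite (F l) & card (F l) <= q & Y * d <= card (\<Union>r\<in>F l. B\<inverse> `` {r})) &
      (\<forall>l\<in>L1. \<forall>l'\<in>L1. l ~= l' --> F l Int F l' = {})"
    proof (rule absorb[OF L(1) fR, where ?n0.0 = n0 and ?n1.0 = "K1 * d" and ?n2.0 = "Q * d"])
      show "B \<subseteq> L \<times> R" by (auto simp: B_def)
      show "Q * d <= card (B `` {l})" if "l \<in> L" for l using n2[OF that] Bl[OF that] by simp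
      show "0 < Q * d" using d1 b q1 by (simp add: Q_def)
      show "n0 <= card (B\<inverse> `` {r})" if "r \<in> R" for r using n0le n01[OF that] Br[OF that] by simp
      show "card (B\<inverse> `` {r}) <= K1 * d" if "r \<in> R" for r using n01[OF that] Br[OF that] by simp
      show "4 * q * (K1 * d) <= Q * d" by (simp add: Q_def)
      have "2 * (Y * d) <= 2 * Y * (b * n0)" using n0d by simp
      then show "2 * (Y * d) <= q * n0" by (simp add: q_def' algebra_simps)
    qed (use disp in auto)
    then obtain F0 L1 where F0: "L1 \<subseteq> L" "card L <= 2 * card L1"
      "\<forall>l\<in>L1. F0 l \<subseteq> B `` {l} & finite (F0 l) & card (F0 l) <= q & Y * d <= card (\<Union>r\<in>F0 l. B\<inverse> `` {r})"
      "\<forall>l\<in>L1. \<forall>l'\<in>L1. l ~= l' --> F0 l Int F0 l' = {}" by blast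
    define F where "F l = (if l \<in> L1 then F0 l else {})" for l
    have FB: "u \<in> R & (\<exists>w\<in>P l. (w, u) \<in> E)" if "l \<in> L" "u \<in> F l" for l u
      using that F0(3) by (auto simp: F_def B_def split: if_splits)
    show ?thesis
    proof (rule dense_minor_topo[OF TW G L, where P = P and F = F and S = "%r. B\<inverse> `` {r}" and q = q and ?n1.0 = "K1 * d" and a = "c1 * d" and k = "(\<Delta> + 2) * d" and d = d and \<Delta> = \<Delta>])
      show "conn E (P l) & P l \<subseteq> V" if "l \<in> L" for l using P(1)[OF that] by simp
      show "P l Int P l' = {}" if "l \<in> L" "l' \<in> L" "l ~= l'" for l l' using P(2)[OF that] .
      show "u \<in> V & (\<exists>w\<in>P l. (w, u) \<in> E)" if "l \<in> L" "u \<in> F l" for l u using FB[OF that] R(1) by auto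
      show "F l Int F l' = {}" if "l \<in> L" "l' \<in> L" "l ~= l'" for l l' using F0(4) that by (auto simp: F_def)
      show "F l Int P l' = {}" if "l \<in> L" "l' \<in> L" for l l' using FB[OF that(1)] R(2)[OF that(2)] by blast
      show "finite (F l) & card (F l) <= q" if "l \<in> L" for l using F0(3) by (auto simp: F_def)
      show "x \<in> L & (\<exists>w\<in>P x. (w, u) \<in> E)" if "l \<in> L" "u \<in> F l" "x \<in> B\<inverse> `` {u}" for l u x using that(3) by (auto simp: B_def)
      show "card (B\<inverse> `` {u}) <= K1 * d" if "l \<in> L" "u \<in> F l" for l u using n01[of u] Br[of u] FB[OF that] by simp
      show "c1 * d * card L <= (\<Sum>l\<in>L. card ((\<Union>u\<in>F l. B\<inverse> `` {u}) - {l}))"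
      proof -
        have "c1 * d * card L <= c1 * d * (2 * card L1)" using F0(2) by (rule mult_le_mono2)
        also have "\<dots> = (\<Sum>l\<in>L1. 2 * c1 * d)" by simp
        also have "\<dots> <= (\<Sum>l\<in>L1. card ((\<Union>u\<in>F l. B\<inverse> `` {u}) - {l}))"
        proof (rule sum_mono)
          fix l assume l: "l \<in> L1"
          have "Y * d <= card (\<Union>u\<in>F l. B\<inverse> `` {u})" using F0(3) l by (simp add: F_def)
          moreover have "card (\<Union>u\<in>F l. B\<inverse> `` {u}) - 1 <= card ((\<Union>u\<in>F l. B\<inverse> `` {u}) - {l})"
            using diff_card_le_card_Diff[of "{l}" "\<Union>u\<in>F l. B\<inverse> `` {u}"] by simp
          ultimately show "2 * c1 * d <= card ((\<Union>u\<in>F l. B\<inverse> `` {u}) - {l})" using d1 by (simp add: Y_def)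
        qed
        also have "\<dots> <= (\<Sum>l\<in>L. card ((\<Union>u\<in>F l. B\<inverse> `` {u}) - {l}))" using F0(1) L(1) by (intro sum_mono2) auto
        finally show ?thesis .
      qed
      show "(\<Delta> + 1) * d + 1 <= (\<Delta> + 2) * d" using d1 by simp
      show "4 * ((\<Delta> + 2) * d) <= c1 * d" unfolding c1_def' by (simp add: algebra_simps)
      have "2 * (K * (\<Delta> * d + 1) + d + 1) <= 2 * (K * ((\<Delta> + 1) * d) + d + d)"
        using d1 by (intro mult_le_mono2 add_mono) auto
      also have "\<dots> = (2 * (K * (\<Delta> + 1) + 2)) * d" by (simp add: algebra_simps)
      also have "\<dots> <= c1 * d" unfolding c1_def' by (intro mult_le_mono1) simp
      finally show "2 * (K * (\<Delta> * d + 1) + d + 1) <= c1 * d" .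
      have "8 * ((\<Delta> + 1) * d + q * \<Delta> + 1) <= (8 * (\<Delta> + 2)) * d" using d1(2) by (simp add: algebra_simps)
      also have "\<dots> <= c1 * d" unfolding c1_def' by (intro mult_le_mono1) simp
      finally show "8 * ((\<Delta> + 1) * d + q * \<Delta> + 1) <= c1 * d" .
      have c1: "96 * b * K1 <= c1" "1 <= c1" unfolding c1_def' by auto
      have "16 * q * K1 = 32 * (b * K1) * (2 * c1 + 1)" by (simp add: q_def' Y_def algebra_simps)
      also have "\<dots> <= 32 * (b * K1) * (3 * c1)" using c1(2) by (intro mult_le_mono2) simp
      also have "\<dots> = (96 * b * K1) * c1" by simp
      also have "\<dots> <= c1 * c1" using c1(1) by (rule mult_le_mono1)
      finally have "16 * q * K1 * (d * d) <= c1 * c1 * (d * d)" by (rule mult_le_mono1)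
      then show "16 * (q * (K1 * d)) * d <= c1 * d * (c1 * d)" by (simp add: algebra_simps)
    qed (use H d1 in auto)
  qed
qed

text \<open>Maximise a weight: arcs, scaled by \<open>4 * card L * card R\<close>, minus a price for
  every vertex. In a maximiser no vertex costs more than its arcs are worth, which is the claimed
  minimum degree on each side.\<close>

lemma bip_clean:
  fixes B :: "('l \<times> 'r) set"
  assumes fin: "finite L" "finite R" "B \<subseteq> L \<times> R" "B ~= {}"
  obtains L' R' where "L' \<subseteq> L" "R' \<subseteq> R" "L' ~= {}" "R' ~= {}"
    "!!l. l \<in> L' ==> card B <= 4 * card L * card (B `` {l} Int R')"
    "!!r. r \<in> R' ==> card B <= 4 * card R * card (B\<inverse> `` {r} Int L')"
proof -
  define w where "w L' R' = int (card (B Int L' \<times> R')) * (4 * int (card L) * int (card R)) - int (card B) * (int (card R) * int (card L') + int (card L) * int (card R'))" for L' R'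
  have fB: "finite B" using fin finite_subset by auto
  have p: "0 < int (card L)" "0 < int (card R)" "0 < int (card B)" using fin fB by (auto simp: card_gt_0_iff)
  let ?S = "(%(x, y). w x y) ` (Pow L \<times> Pow R)"
  have "finite ?S" using fin by auto
  moreover have "w L R \<in> ?S" by auto
  ultimately have mx: "Max ?S \<in> ?S" "!!z. z \<in> ?S ==> z <= Max ?S" by (auto intro!: Max_in)
  then obtain L' R' where LR: "L' \<subseteq> L" "R' \<subseteq> R" "w L' R' = Max ?S" by auto
  have max: "w L2 R2 <= w L' R'" if "L2 \<subseteq> L" "R2 \<subseteq> R" for L2 R2 using mx(2)[of "w L2 R2"] that LR(3) by auto
  have fLR: "finite L'" "finite R'" using finite_subset[OF LR(1) fin(1)] finite_subset[OF LR(2) fin(2)] by auto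
  have "B Int L \<times> R = B" using fin by auto
  \<comment> \<open>For the whole graph the prices amount to half of the arc term, so a maximiser
    has arcs.\<close>
  then have "0 < w L R" unfolding w_def using p by (simp add: algebra_simps)
  then have pos: "0 < w L' R'" using max[of L R] by simp
  have "B Int L' \<times> R' ~= {}"
  proof
    assume "B Int L' \<times> R' = {}"
    then have "w L' R' <= 0" unfolding w_def by simp
    then show False using pos by simp
  qed
  then have ne: "L' ~= {}" "R' ~= {}" by auto
  show thesis
  proof (rule that[OF LR(1,2) ne])
    fix l assume l: "l \<in> L'"
    have "B Int L' \<times> R' = B Int (L' - {l}) \<times> R' Un {l} \<times> (B `` {l} Int R')" using l by auto
    moreover have "(B Int (L' - {l}) \<times> R') Int ({l} \<times> (B `` {l} Int R')) = {}" by auto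
    ultimately have c: "card (B Int L' \<times> R') = card (B Int (L' - {l}) \<times> R') + card (B `` {l} Int R')"
      using fB fLR by (simp add: card_Un_disjoint card_cartesian_product)
    have cl: "int (card (L' - {l})) = int (card L') - 1" using card_Suc_Diff1[OF fLR(1) l] by linarith
    have "w (L' - {l}) R' <= w L' R'" using LR by (intro max) auto
    then have "int (card B) * int (card R) <= int (card (B `` {l} Int R')) * (4 * int (card L) * int (card R))"
      unfolding w_def c cl by (simp add: algebra_simps)
    then have "int (card B) * int (card R) <= (4 * int (card L) * int (card (B `` {l} Int R'))) * int (card R)" by (simp add: algebra_simps)
    then have "int (card B) <= 4 * int (card L) * int (card (B `` {l} Int R'))" using p(2) by (metis mult_le_cancel_right_pos)
    then have "int (card B) <= int (4 * card L * card (B `` {l} Int R'))" by simp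
    then show "card B <= 4 * card L * card (B `` {l} Int R')" by (simp only: of_nat_le_iff)
  next
    fix r assume r: "r \<in> R'"
    have "B Int L' \<times> R' = B Int L' \<times> (R' - {r}) Un (B\<inverse> `` {r} Int L') \<times> {r}" using r by auto
    moreover have "(B Int L' \<times> (R' - {r})) Int ((B\<inverse> `` {r} Int L') \<times> {r}) = {}" by auto
    ultimately have c: "card (B Int L' \<times> R') = card (B Int L' \<times> (R' - {r})) + card (B\<inverse> `` {r} Int L')"
      using fB fLR by (simp add: card_Un_disjoint card_cartesian_product)
    have cl: "int (card (R' - {r})) = int (card R') - 1" using card_Suc_Diff1[OF fLR(2) r] by linarith
    have "w L' (R' - {r}) <= w L' R'" using LR by (intro max) auto
    then have "int (card B) * int (card L) <= int (card (B\<inverse> `` {r} Int L')) * (4 * int (card L) * int (card R))"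
      unfolding w_def c cl by (simp add: algebra_simps)
    then have "int (card B) * int (card L) <= (4 * int (card R) * int (card (B\<inverse> `` {r} Int L'))) * int (card L)" by (simp add: algebra_simps)
    then have "int (card B) <= 4 * int (card R) * int (card (B\<inverse> `` {r} Int L'))" using p(1) by (metis mult_le_cancel_right_pos)
    then have "int (card B) <= int (4 * card R * card (B\<inverse> `` {r} Int L'))" by simp
    then show "card B <= 4 * card R * card (B\<inverse> `` {r} Int L')" by (simp only: of_nat_le_iff)
  qed
qed

text \<open>Each vertex joins the side that contains fewer of its neighbours. The factor is 4
  because \<open>ecard E R R\<close> counts every edge twice and the cut counts it once.\<close>

lemma half_cut:
  assumes "finite R" "sym E" "irrefl E"
  shows "\<exists>A\<subseteq>R. ecard E R R <= 4 * ecard E A (R - A)"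
  using assms(1)
proof (induction R rule: finite_induct)
  case empty then show ?case by (simp add: ecard_def)
next
  case (insert v R)
  then obtain A where A: "A \<subseteq> R" "ecard E R R <= 4 * ecard E A (R - A)" by auto
  have fA: "finite A" using A insert finite_subset by auto
  have vv: "ecard E {v} {v} = 0" using assms(3) by (auto simp: ecard_def irrefl_def)
  have "ecard E (insert v R) (insert v R) = ecard E {v} (insert v R) + ecard E R (insert v R)"
    using ecard_Un1[of "{v}" R "insert v R" E] insert by simp
  also have "ecard E {v} (insert v R) = ecard E {v} {v} + ecard E {v} R" using ecard_Un2[of "{v}" "{v}" R E] insert by simp
  also have "ecard E R (insert v R) = ecard E R {v} + ecard E R R" using ecard_Un2[of R "{v}" R E] insert by simp
  also have "ecard E R {v} = ecard E {v} R" by (rule ecard_commute[OF assms(2)])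
  finally have tot: "ecard E (insert v R) (insert v R) = 2 * ecard E {v} R + ecard E R R" using vv by simp
  have sp: "ecard E {v} R = ecard E {v} A + ecard E {v} (R - A)"
    using ecard_Un2[of "{v}" A "R - A" E] fA insert(1) A(1) by (simp add: Un_absorb1)
  show ?case
  proof (cases "ecard E {v} A <= ecard E {v} (R - A)")
    case True
    have "insert v R - insert v A = R - A" using insert(2) by auto
    moreover have "ecard E (insert v A) (R - A) = ecard E {v} (R - A) + ecard E A (R - A)"
      using ecard_Un1[of "{v}" A "R - A" E] fA insert A by auto
    ultimately have "ecard E (insert v R) (insert v R) <= 4 * ecard E (insert v A) (insert v R - insert v A)"
      using True tot sp A(2) by simp
    then show ?thesis using A(1) by (intro exI[of _ "insert v A"]) auto
  next
    case False
    have vA: "v \<notin> A" using A(1) insert(2) by auto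
    then have "insert v R - A = insert v (R - A)" by auto
    moreover have "ecard E A (insert v (R - A)) = ecard E A {v} + ecard E A (R - A)"
      using ecard_Un2[of A "{v}" "R - A" E] fA insert by auto
    ultimately have "ecard E (insert v R) (insert v R) <= 4 * ecard E A (insert v R - A)"
      using False tot sp A(2) ecard_commute[OF assms(2), of A "{v}"] by simp
    then show ?thesis using A(1) by (intro exI[of _ A]) auto
  qed
qed

lemma no_dense_mono:
  assumes "no_dense E V a \<eta>" "a <= a'" "\<eta> <= \<eta>'" "E' \<subseteq> E" "V' \<subseteq> V" "finite V"
  shows "no_dense E' V' a' \<eta>'"
  unfolding no_dense_def
proof (intro allI impI)
  fix X Y assume h: "X \<subseteq> V'" "Y \<subseteq> V'" "X Int Y = {}" "a' <= real (card X)" "a' <= real (card Y)"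
  have f: "finite X" "finite Y" using h(1,2) assms(5,6) by (meson finite_subset)+
  have "ecard E' X Y <= ecard E X Y" unfolding ecard_def using f assms(4) by (intro card_mono) auto
  then have "real (ecard E' X Y) <= real (ecard E X Y)" by simp
  also have "\<dots> < \<eta> * real (card X) * real (card Y)" using assms(1,2,5) h unfolding no_dense_def by auto
  also have "\<dots> <= \<eta>' * real (card X) * real (card Y)" using assms(3) by (intro mult_right_mono) auto
  finally show "real (ecard E' X Y) < \<eta>' * real (card X) * real (card Y)" .
qed

section \<open>Bipartite graphs with all degrees of order \<open>d\<close>\<close>

text \<open>\<open>16 * b1\<close> is lost in counting the arcs that leave the stars and in
  \<open>bip_clean\<close>; \<open>1 + 2 * b1 * K1\<close> compares the vertices of
  \<open>V2\<close> outside the stars with the leaves.\<close>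

definition bA :: "nat => nat => nat" where "bA b1 K1 = 16 * b1 * (1 + 2 * b1 * K1)"

text \<open>Number of leaves of a star: the first summand gives the degree that
  \<open>bip_minor_topo\<close> demands after cleaning, the second ensures that at most half of the
  count is lost to other centres.\<close>

definition qA :: "nat => nat => nat => nat => nat" where
  "qA K \<Delta> b1 K1 = 16 * b1 * (4 * qY K \<Delta> (bA b1 K1) K1 * K1) + 4 * b1 * K1"

definition aA :: "nat => nat => real" where "aA b1 K1 = 1 / (2 * real (bA b1 K1))"

text \<open>The first bound keeps the neighbourhoods of the leaves of a star apart, the second is
  what \<open>bip_minor_topo\<close> requires for cores of \<open>qA + 1\<close> vertices.\<close>

definition \<eta>A :: "nat => nat => nat => nat => real" where
  "\<eta>A K \<Delta> b1 K1 = min (1 / (2 * real b1 * real (qA K \<Delta> b1 K1) * real K1))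
     (1 / (2 * real (bA b1 K1) * real (qA K \<Delta> b1 K1 + 1) * real (CY K \<Delta> (bA b1 K1) K1)))"

text \<open>Single vertices have too small a degree to serve as cores. A star with centre in
  \<open>V2\<close> and \<open>q\<close> leaves in \<open>V1\<close> sees of the order of
  \<open>q * d\<close> vertices of \<open>V2\<close>, since local sparsity prevents heavy overlap of
  the neighbourhoods. A maximal family of disjoint stars gives the cores, the rest of
  \<open>V2\<close> the fringe.\<close>

lemma bounded_case:
  fixes K \<Delta> b1 K1 d :: nat and E :: "('a \<times> 'a) set" and VH :: "'w set"
  assumes TW: "!!V (E :: ('a \<times> 'a) set) X c \<kappa>. sgr V E ==> X \<subseteq> V ==> card X <= \<kappa> ==> K * (\<kappa> + 1) <= c ==> massed c V E X ==> linked V E X"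
    and b: "1 <= b1" "1 <= K1"
    and G: "sgr (V1 Un V2) E" and V12: "V1 Int V2 = {}" "V2 ~= {}" "E \<subseteq> V1 \<times> V2 Un V2 \<times> V1"
    and deg1: "!!x. x \<in> V1 ==> d <= b1 * card (E `` {x}) & card (E `` {x}) <= K1 * d"
    and deg2: "!!x. x \<in> V2 ==> d <= b1 * card (E `` {x}) & card (E `` {x}) <= K1 * d"
    and nd: "no_dense E (V1 Un V2) (aA b1 K1 * real d) (\<eta>A K \<Delta> b1 K1)"
    and H: "sgr VH EH" "card VH <= d" "!!h. card (EH `` {h}) <= \<Delta>" and d: "CY K \<Delta> (bA b1 K1) K1 <= d"
  shows "topo (V1 Un V2) E VH EH"
proof -
  define b2 where "b2 = bA b1 K1"
  define q where "q = qA K \<Delta> b1 K1"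
  define Q where "Q = 4 * qY K \<Delta> b2 K1 * K1"
  define C where "C = CY K \<Delta> b2 K1"
  have q_def': "q = 16 * b1 * Q + 4 * b1 * K1" by (simp add: q_def qA_def Q_def b2_def)
  have C1: "1 <= C" by (simp add: C_def CY_def)
  have d1: "1 <= d" using d C1 by (simp add: C_def b2_def)
  have "1 * 1 <= b1 * K1" using b by (intro mult_le_mono)
  then have q1: "1 <= q" unfolding q_def' by linarith
  have b2: "b1 <= b2" "1 <= b2" using b by (auto simp: b2_def bA_def)
  have fV: "finite (V1 Un V2)" "finite E" "sym E" "irrefl E" using sgr_finite[OF G] by auto
  have fV12: "finite V1" "finite V2" using fV(1) by auto
  have fN: "finite (E `` {x})" for x using fV(2) by (rule finite_Image)
  have N1: "E `` {x} \<subseteq> V2" if "x \<in> V1" for x using V12 that by auto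
  have N2: "E `` {x} \<subseteq> V1" if "x \<in> V2" for x using V12 that by auto
  have \<eta>q: "\<eta>A K \<Delta> b1 K1 <= 1 / (2 * real b1 * real q * real K1)" by (simp add: \<eta>A_def q_def)
  have small_a: "aA b1 K1 * real d <= real n" if "d <= 2 * b1 * n" for n
  proof -
    have "real d <= real (2 * b1 * n)" using that by (simp only: of_nat_le_iff)
    also have "\<dots> <= real (2 * b2 * n)" using b2 by (simp add: mult_right_mono)
    finally show ?thesis using b2 by (simp add: aA_def b2_def field_simps)
  qed
  \<comment> \<open>If every available leaf had half of the guaranteed degree inside the union seen
    so far, the available leaves and this union would be a dense pair.\<close>
  have pick: "\<exists>A\<subseteq>av. finite A & card A = j & j * d <= 2 * b1 * card (\<Union>y\<in>A. E `` {y})"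
    if x: "x \<in> V2" and av: "av \<subseteq> E `` {x}" "d <= 2 * b1 * card av" and j: "j <= q" for x av j
    using j
  proof (induction j)
    case 0 then show ?case by (intro exI[of _ "{}"]) simp
  next
    case (Suc j)
    then obtain A where A: "A \<subseteq> av" "finite A" "card A = j" "j * d <= 2 * b1 * card (\<Union>y\<in>A. E `` {y})" by auto
    let ?Y = "\<Union>y\<in>A. E `` {y}"
    have avV: "av \<subseteq> V1" using av(1) N2[OF x] by auto
    have YV: "?Y \<subseteq> V2" using A(1) avV N1 by blast
    have fY: "finite ?Y" using A(2) fN by auto
    have "card ?Y <= (\<Sum>y\<in>A. card (E `` {y}))" using A(2) by (rule card_UN_le)
    also have "\<dots> <= (\<Sum>y\<in>A. K1 * d)" using A(1) avV deg1 by (intro sum_mono) auto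
    also have "\<dots> = j * (K1 * d)" using A(3) by simp
    also have "\<dots> <= q * (K1 * d)" using Suc.prems by (intro mult_le_mono1) simp
    finally have cY: "card ?Y <= q * (K1 * d)" .
    have "\<exists>z\<in>av. d <= 2 * b1 * card (E `` {z} - ?Y)"
    proof (rule ccontr)
      assume no: "~ ?thesis"
      have many: "d <= 2 * b1 * card (E `` {z} Int ?Y)" if z: "z \<in> av" for z
      proof -
        have 1: "2 * b1 * card (E `` {z} - ?Y) < d" using no z by (meson not_le)
        have 2: "d <= b1 * card (E `` {z})" using deg1 z avV by auto
        have "card (E `` {z}) = card (E `` {z} Int ?Y) + card (E `` {z} - ?Y)" using fN by (rule card_split)
        then have "2 * d <= 2 * b1 * card (E `` {z} Int ?Y) + 2 * b1 * card (E `` {z} - ?Y)"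
          using 2 by (metis add_mult_distrib2 mult.assoc mult_le_mono2)
        then show ?thesis using 1 by linarith
      qed
      have "av ~= {}" using av(2) d1 by auto
      then obtain z0 where z0: "z0 \<in> av" by auto
      have "card (E `` {z0} Int ?Y) <= card ?Y" using fY by (intro card_mono) auto
      then have "2 * b1 * card (E `` {z0} Int ?Y) <= 2 * b1 * card ?Y" by simp
      then have Yb: "d <= 2 * b1 * card ?Y" using many[OF z0] by linarith
      show False
      proof (rule no_denseD[OF nd fV(1), of av ?Y])
        show "av \<subseteq> V1 Un V2" "?Y \<subseteq> V1 Un V2" "av Int ?Y = {}" using avV YV V12 by auto
        show "aA b1 K1 * real d <= real (card av)" "aA b1 K1 * real d <= real (card ?Y)" using small_a av(2) Yb by auto
        fix z assume z: "z \<in> av"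
        have "real d <= real (2 * b1 * card (E `` {z} Int ?Y))" using many[OF z] by (simp only: of_nat_le_iff)
        then have m: "real d / (2 * real b1) <= real (card (E `` {z} Int ?Y))" using b by (simp add: field_simps)
        have "real (card ?Y) <= real (q * (K1 * d))" using cY by (simp only: of_nat_le_iff)
        then have "1 / (2 * real b1 * real q * real K1) * real (card ?Y) <= 1 / (2 * real b1 * real q * real K1) * real (q * (K1 * d))"
          by (intro mult_left_mono) auto
        also have "\<dots> = real d / (2 * real b1)" using b q1 by (simp add: field_simps)
        finally have "1 / (2 * real b1 * real q * real K1) * real (card ?Y) <= real (card (E `` {z} Int ?Y))" using m by linarith
        moreover have "\<eta>A K \<Delta> b1 K1 * real (card ?Y) <= 1 / (2 * real b1 * real q * real K1) * real (card ?Y)"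
          using \<eta>q by (intro mult_right_mono) auto
        ultimately show "\<eta>A K \<Delta> b1 K1 * real (card ?Y) <= real (card (E `` {z} Int ?Y))" by linarith
      qed
    qed
    then obtain z where z: "z \<in> av" "d <= 2 * b1 * card (E `` {z} - ?Y)" by auto
    have zA: "z \<notin> A"
    proof
      assume "z \<in> A"
      then have "E `` {z} - ?Y = {}" by auto
      then have "card (E `` {z} - ?Y) = 0" by (metis card.empty)
      then show False using z(2) d1 by simp
    qed
    have "(\<Union>y\<in>insert z A. E `` {y}) = ?Y Un (E `` {z} - ?Y)" by auto
    then have "card (\<Union>y\<in>insert z A. E `` {y}) = card ?Y + card (E `` {z} - ?Y)"
      using fY fN[of z] by (metis Diff_disjoint card_Un_disjoint finite_Diff)
    then have "Suc j * d <= 2 * b1 * card (\<Union>y\<in>insert z A. E `` {y})" using A(4) z(2) by (simp add: add_mult_distrib2)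
    then show ?case using A z zA by (intro exI[of _ "insert z A"]) auto
  qed
  define ok where "ok Xc Lf \<longleftrightarrow> Xc \<subseteq> V2 & (\<forall>x\<in>Xc. Lf x \<subseteq> E `` {x} & finite (Lf x) & card (Lf x) = q & q * d <= 2 * b1 * card (\<Union>y\<in>Lf x. E `` {y})) &
    (\<forall>x\<in>Xc. \<forall>x'\<in>Xc. x ~= x' --> Lf x Int Lf x' = {})" for Xc Lf
  have "ok {} (%_. {})" by (simp add: ok_def)
  then have "{(X, F). ok X F} ~= {}" by blast
  from obtain_min_pair[OF this, of "%X F. card V2 - card X"] obtain Xc Lf where
    ok1: "ok Xc Lf" and max: "!!X F. ok X F ==> card V2 - card Xc <= card V2 - card X" by auto
  have X: "Xc \<subseteq> V2" "!!x. x \<in> Xc ==> Lf x \<subseteq> E `` {x} & finite (Lf x) & card (Lf x) = q & q * d <= 2 * b1 * card (\<Union>y\<in>Lf x. E `` {y})"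
    "!!x x'. x \<in> Xc ==> x' \<in> Xc ==> x ~= x' ==> Lf x Int Lf x' = {}" using ok1 by (auto simp: ok_def)
  have fX: "finite Xc" using X(1) fV12 finite_subset by auto
  define Z where "Z = (\<Union>x\<in>Xc. Lf x)"
  have ZV: "Z \<subseteq> V1" using X(1,2) N2 unfolding Z_def by blast
  have fZ: "finite Z" using ZV fV12 finite_subset by auto
  have LfV: "Lf x \<subseteq> V1" if "x \<in> Xc" for x using ZV that by (auto simp: Z_def)
  \<comment> \<open>By maximality a vertex of \<open>V2\<close> that is not a centre has at least
    \<open>d / (2 * b1)\<close> neighbours among the leaves; this bounds the number of such
    vertices.\<close>
  have used: "d <= 2 * b1 * card (E `` {x} Int Z)" if x: "x \<in> V2 - Xc" for x
  proof (rule ccontr)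
    assume n: "~ ?thesis"
    have "card (E `` {x}) = card (E `` {x} Int Z) + card (E `` {x} - Z)" using fN by (rule card_split)
    then have "2 * d <= 2 * b1 * card (E `` {x} Int Z) + 2 * b1 * card (E `` {x} - Z)"
      using deg2[of x] x by (metis DiffD1 add_mult_distrib2 mult.assoc mult_le_mono2)
    then have "d <= 2 * b1 * card (E `` {x} - Z)" using n by linarith
    then obtain A where A: "A \<subseteq> E `` {x} - Z" "finite A" "card A = q" "q * d <= 2 * b1 * card (\<Union>y\<in>A. E `` {y})"
      using pick[of x "E `` {x} - Z" q] x by auto
    have "ok (insert x Xc) (Lf(x := A))" unfolding ok_def
    proof (intro conjI ballI impI)
      show "insert x Xc \<subseteq> V2" using x X(1) by auto
      fix y assume y: "y \<in> insert x Xc"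
      show "(Lf(x := A)) y \<subseteq> E `` {y}" "finite ((Lf(x := A)) y)" "card ((Lf(x := A)) y) = q" "q * d <= 2 * b1 * card (\<Union>z\<in>(Lf(x := A)) y. E `` {z})"
        using y X(2)[of y] A x by auto
      fix y' assume y': "y' \<in> insert x Xc" "y ~= y'"
      have "A Int Lf z = {}" if "z \<in> Xc" for z using A(1) that by (auto simp: Z_def)
      then show "(Lf(x := A)) y Int (Lf(x := A)) y' = {}" using y y' X(3)[of y y'] x
        by (cases "y = x"; cases "y' = x") (auto simp: Int_commute)
    qed
    from max[OF this] have "card V2 - card Xc <= card V2 - card (insert x Xc)" .
    moreover have "card (insert x Xc) = Suc (card Xc)" using x fX by simp
    moreover have "card (insert x Xc) <= card V2" using x X(1) fV12 by (intro card_mono) auto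
    ultimately show False by simp
  qed
  let ?N = "card Xc"
  have cZ: "card Z <= ?N * q"
  proof -
    have "card Z <= (\<Sum>x\<in>Xc. card (Lf x))" unfolding Z_def using fX by (rule card_UN_le)
    also have "\<dots> = ?N * q" using X(2) by simp
    finally show ?thesis .
  qed
  have "(\<Sum>x\<in>V2 - Xc. d) <= (\<Sum>x\<in>V2 - Xc. 2 * b1 * card (E `` {x} Int Z))" using used by (intro sum_mono) auto
  also have "\<dots> = 2 * b1 * ecard E (V2 - Xc) Z" using ecard_sum[of "V2 - Xc" Z E] fV12 fZ by (simp add: sum_distrib_left)
  also have "ecard E (V2 - Xc) Z = ecard E Z (V2 - Xc)" by (rule ecard_commute[OF fV(3)])
  also have "\<dots> = (\<Sum>z\<in>Z. card (E `` {z} Int (V2 - Xc)))" using fZ fV12 by (intro ecard_sum) auto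
  also have "\<dots> <= (\<Sum>z\<in>Z. K1 * d)"
  proof (rule sum_mono)
    fix z assume z: "z \<in> Z"
    have "card (E `` {z} Int (V2 - Xc)) <= card (E `` {z})" using fN by (intro card_mono) auto
    then show "card (E `` {z} Int (V2 - Xc)) <= K1 * d" using deg1[of z] z ZV by force
  qed
  also have "\<dots> <= (?N * q) * (K1 * d)" using cZ by simp
  finally have "card (V2 - Xc) * d <= (2 * b1 * (?N * q * K1)) * d" by (simp add: algebra_simps)
  then have cR: "card (V2 - Xc) <= 2 * b1 * (?N * q * K1)" using d1 by simp
  have XcNe: "Xc ~= {}"
  proof
    assume "Xc = {}"
    then have "card V2 <= 0" using cR by simp
    then show False using V12(2) fV12 by simp
  qed
  have N0: "0 < ?N" using XcNe fX by (simp add: card_gt_0_iff)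
  define P where "P l = insert l (Lf l)" for l
  define B where "B = {(l, r). l \<in> Xc & r \<in> V2 - Xc & (\<exists>w\<in>P l. (w, r) \<in> E)}"
  have adjP: "(\<exists>w\<in>P l. (w, r) \<in> E) \<longleftrightarrow> (\<exists>w\<in>Lf l. (w, r) \<in> E)" if "l \<in> Xc" "r \<in> V2" for l r
  proof -
    have "l \<in> V2" using that(1) X(1) by auto
    then have "(l, r) \<notin> E" using N2 that(2) V12(1) by blast
    then show ?thesis by (auto simp: P_def)
  qed
  have Bl: "B `` {l} = (\<Union>y\<in>Lf l. E `` {y}) - Xc" if l: "l \<in> Xc" for l
  proof -
    have sub: "(\<Union>y\<in>Lf l. E `` {y}) \<subseteq> V2" using LfV[OF l] N1 by blast
    have "B `` {l} = {r \<in> V2 - Xc. \<exists>w\<in>P l. (w, r) \<in> E}" using l by (auto simp: B_def)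
    also have "\<dots> = {r \<in> V2 - Xc. \<exists>w\<in>Lf l. (w, r) \<in> E}" using adjP[OF l] by (intro Collect_cong) (meson DiffD1)
    also have "\<dots> = (\<Union>y\<in>Lf l. E `` {y}) - Xc" using sub by blast
    finally show ?thesis .
  qed
  have fB: "finite B" by (rule finite_subset[of _ "Xc \<times> V2"]) (use fX fV12 in \<open>auto simp: B_def\<close>)
  have cBsum: "card B = (\<Sum>l\<in>Xc. card (B `` {l}))"
  proof -
    have "B = Sigma Xc (%l. B `` {l})" by (auto simp: B_def)
    moreover have "card (Sigma Xc (%l. B `` {l})) = (\<Sum>l\<in>Xc. card (B `` {l}))" using fX fB by (intro card_SigmaI) (auto intro: finite_Image)
    ultimately show ?thesis by simp
  qed
  \<comment> \<open>Centres seen by a star cannot be in the fringe. Counted from the centres, whose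
    degrees are bounded, this loses at most \<open>K1 * d\<close> per centre.\<close>
  have "(\<Sum>l\<in>Xc. card ((\<Union>y\<in>Lf l. E `` {y}) Int Xc)) <= (\<Sum>l\<in>Xc. \<Sum>y\<in>Lf l. card (E `` {y} Int Xc))"
  proof (rule sum_mono)
    fix l assume l: "l \<in> Xc"
    have "(\<Union>y\<in>Lf l. E `` {y}) Int Xc = (\<Union>y\<in>Lf l. E `` {y} Int Xc)" by auto
    then show "card ((\<Union>y\<in>Lf l. E `` {y}) Int Xc) <= (\<Sum>y\<in>Lf l. card (E `` {y} Int Xc))"
      using card_UN_le[of "Lf l" "%y. E `` {y} Int Xc"] X(2)[OF l] by simp
  qed
  also have "\<dots> = (\<Sum>y\<in>Z. card (E `` {y} Int Xc))" unfolding Z_def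
    by (rule sum.UNION_disjoint[symmetric]) (use fX X(2,3) in auto)
  also have "\<dots> = ecard E Z Xc" using ecard_sum[OF fZ fX, of E] by simp
  also have "\<dots> = ecard E Xc Z" by (rule ecard_commute[OF fV(3)])
  also have "\<dots> = (\<Sum>x\<in>Xc. card (E `` {x} Int Z))" by (rule ecard_sum[OF fX fZ])
  also have "\<dots> <= (\<Sum>x\<in>Xc. K1 * d)"
  proof (rule sum_mono)
    fix x assume x: "x \<in> Xc"
    have "card (E `` {x} Int Z) <= card (E `` {x})" using fN by (intro card_mono) auto
    then show "card (E `` {x} Int Z) <= K1 * d" using deg2[of x] x X(1) by force
  qed
  finally have lost: "(\<Sum>l\<in>Xc. card ((\<Union>y\<in>Lf l. E `` {y}) Int Xc)) <= ?N * (K1 * d)" by simp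
  have "?N * (q * d) = (\<Sum>l\<in>Xc. q * d)" by simp
  also have "\<dots> <= (\<Sum>l\<in>Xc. 2 * b1 * (card ((\<Union>y\<in>Lf l. E `` {y}) Int Xc) + card (B `` {l})))"
  proof (rule sum_mono)
    fix l assume l: "l \<in> Xc"
    have "finite (\<Union>y\<in>Lf l. E `` {y})" using X(2)[OF l] fN by auto
    then have "card (\<Union>y\<in>Lf l. E `` {y}) = card ((\<Union>y\<in>Lf l. E `` {y}) Int Xc) + card (B `` {l})" unfolding Bl[OF l] by (rule card_split)
    then show "q * d <= 2 * b1 * (card ((\<Union>y\<in>Lf l. E `` {y}) Int Xc) + card (B `` {l}))" using X(2)[OF l] by simp
  qed
  also have "\<dots> = 2 * b1 * (\<Sum>l\<in>Xc. card ((\<Union>y\<in>Lf l. E `` {y}) Int Xc)) + 2 * b1 * card B"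
    unfolding cBsum sum_distrib_left by (simp add: sum.distrib add_mult_distrib2)
  also have "\<dots> <= 2 * b1 * (?N * (K1 * d)) + 2 * b1 * card B" using lost by simp
  finally have main: "?N * (q * d) <= 2 * b1 * (?N * (K1 * d)) + 2 * b1 * card B" .
  have "4 * b1 * K1 <= q" by (simp add: q_def')
  then have "(4 * b1 * K1) * (?N * d) <= q * (?N * d)" by (rule mult_le_mono1)
  then have "2 * (2 * b1 * (?N * (K1 * d))) <= ?N * (q * d)" by (simp add: algebra_simps)
  then have eB: "?N * (q * d) <= 4 * b1 * card B" using main by linarith
  have "B ~= {}" using eB N0 q1 d1 by auto
  moreover have "B \<subseteq> Xc \<times> (V2 - Xc)" by (auto simp: B_def)
  ultimately obtain L' R' where LR: "L' \<subseteq> Xc" "R' \<subseteq> V2 - Xc" "L' ~= {}" "R' ~= {}"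
    "!!l. l \<in> L' ==> card B <= 4 * ?N * card (B `` {l} Int R')"
    "!!r. r \<in> R' ==> card B <= 4 * card (V2 - Xc) * card (B\<inverse> `` {r} Int L')"
    using bip_clean[of Xc "V2 - Xc" B] fX fV12 by (metis finite_Diff)
  show ?thesis
  proof (rule bip_minor_topo[OF TW b2(2) b(2) G, where L = L' and P = P and R = R' and s = "q + 1" and d = d])
    show "finite L'" using LR(1) fX finite_subset by auto
    show "conn E (P l) & P l \<subseteq> V1 Un V2 & card (P l) <= q + 1" if "l \<in> L'" for l
    proof -
      have l: "l \<in> Xc" using that LR by auto
      have "conn E (insert l A)" if "finite A" "A \<subseteq> Lf l" for A
        using that
      proof (induction rule: finite_subset_induct')
        case empty then show ?case by (simp add: conn_single)
      next
        case (insert a F)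
        have "(l, a) \<in> E" using insert(2) X(2)[OF l] by auto
        then show ?case using conn_insert[OF fV(3) insert(5), of l a] by (simp add: insert_commute)
      qed
      then have "conn E (P l)" using X(2)[OF l] by (simp add: P_def)
      moreover have "card (P l) <= q + 1" using X(2)[OF l] by (simp add: P_def card_insert_if)
      ultimately show ?thesis using LfV[OF l] l X(1) by (auto simp: P_def)
    qed
    show "P l Int P l' = {}" if "l \<in> L'" "l' \<in> L'" "l ~= l'" for l l'
    proof -
      have l: "l \<in> Xc" "l' \<in> Xc" using that LR by auto
      then show ?thesis using X(3)[OF l that(3)] LfV[OF l(1)] LfV[OF l(2)] X(1) V12(1) that(3) by (auto simp: P_def)
    qed
    show "R' \<subseteq> V1 Un V2" using LR(2) by auto
    show "P l Int R' = {}" if "l \<in> L'" for l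
    proof -
      have l: "l \<in> Xc" using that LR by auto
      then show ?thesis using LfV[OF l] LR(2) V12(1) by (auto simp: P_def)
    qed
    show "4 * qY K \<Delta> b2 K1 * K1 * d <= card {r \<in> R'. \<exists>w\<in>P l. (w, r) \<in> E}" if l: "l \<in> L'" for l
    proof -
      have eq: "{r \<in> R'. \<exists>w\<in>P l. (w, r) \<in> E} = B `` {l} Int R'" using l LR(1,2) by (auto simp: B_def)
      have "?N * (q * d) <= 4 * b1 * (4 * ?N * card (B `` {l} Int R'))" using eB LR(5)[OF l] by (meson mult_le_mono2 order_trans)
      then have "?N * (q * d) <= ?N * (16 * b1 * card (B `` {l} Int R'))" by (simp add: algebra_simps)
      then have 1: "q * d <= 16 * b1 * card (B `` {l} Int R')" using N0 by simp
      have "16 * b1 * (Q * d) = (16 * b1 * Q) * d" by (simp only: mult.assoc)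
      also have "\<dots> <= q * d" unfolding q_def' by (intro mult_le_mono1) simp
      also note 1
      finally have "16 * b1 * (Q * d) <= 16 * b1 * card (B `` {l} Int R')" .
      then have "Q * d <= card (B `` {l} Int R')" using b by simp
      then show ?thesis unfolding eq by (simp add: Q_def)
    qed
    show "d <= b2 * card {l \<in> L'. \<exists>w\<in>P l. (w, r) \<in> E} & card {l \<in> L'. \<exists>w\<in>P l. (w, r) \<in> E} <= K1 * d" if r: "r \<in> R'" for r
    proof
      have eq: "{l \<in> L'. \<exists>w\<in>P l. (w, r) \<in> E} = B\<inverse> `` {r} Int L'" using r LR(1,2) by (auto simp: B_def)
      let ?c = "card (B\<inverse> `` {r} Int L')"
      have "card (V2 - Xc) <= ?N * (2 * b1 * q * K1)" using cR by (simp add: algebra_simps)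
      also have "\<dots> <= ?N * (q * (1 + 2 * b1 * K1))" by (simp add: algebra_simps)
      finally have cR2: "card (V2 - Xc) <= ?N * (q * (1 + 2 * b1 * K1))" .
      have "?N * (q * d) <= 4 * b1 * (4 * card (V2 - Xc) * ?c)" using eB LR(6)[OF r] by (meson mult_le_mono2 order_trans)
      also have "\<dots> <= 4 * b1 * (4 * (?N * (q * (1 + 2 * b1 * K1))) * ?c)" using cR2 by simp
      also have "\<dots> = ?N * (q * (b2 * ?c))" by (simp add: b2_def bA_def algebra_simps)
      finally show "d <= b2 * card {l \<in> L'. \<exists>w\<in>P l. (w, r) \<in> E}" unfolding eq using N0 q1 by simp
      have "\<exists>w. w \<in> Lf l & (w, r) \<in> E" if "l \<in> B\<inverse> `` {r} Int L'" for l
      proof -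
        have "l \<in> Xc" "r \<in> V2" "\<exists>w\<in>P l. (w, r) \<in> E" using that by (auto simp: B_def)
        then show ?thesis using adjP[of l r] by blast
      qed
      then have "\<forall>l. \<exists>w. l \<in> B\<inverse> `` {r} Int L' --> w \<in> Lf l & (w, r) \<in> E" by blast
      then obtain w where w: "!!l. l \<in> B\<inverse> `` {r} Int L' ==> w l \<in> Lf l & (w l, r) \<in> E" by metis
      have "?c <= card (E `` {r})"
      proof (rule card_inj_on_le[of w])
        show "inj_on w (B\<inverse> `` {r} Int L')"
        proof (rule inj_onI)
          fix y y' assume y: "y \<in> B\<inverse> `` {r} Int L'" "y' \<in> B\<inverse> `` {r} Int L'" "w y = w y'"
          show "y = y'"
          proof (rule ccontr)
            assume "y ~= y'"
            then have "Lf y Int Lf y' = {}" using X(3)[of y y'] y LR(1) by auto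
            then show False using w[OF y(1)] w[OF y(2)] y(3) by auto
          qed
        qed
        show "w ` (B\<inverse> `` {r} Int L') \<subseteq> E `` {r}" using w symD[OF fV(3)] by blast
      qed (rule fN)
      also have "\<dots> <= K1 * d" using deg2[of r] r LR(2) by auto
      finally show "card {l \<in> L'. \<exists>w\<in>P l. (w, r) \<in> E} <= K1 * d" unfolding eq .
    qed
    show "no_dense E (V1 Un V2) (real d / (2 * real b2)) (1 / (2 * real b2 * real (q + 1) * real (CY K \<Delta> b2 K1)))"
      by (rule no_dense_mono[OF nd]) (auto simp: aA_def b2_def \<eta>A_def q_def fV12)
    show "CY K \<Delta> b2 K1 <= d" using d by (simp add: b2_def)
  qed (use H LR in auto)
qed

text \<open>
  Degree thresholds: among eight consecutive levels one carries few edges, and deleting it leaves a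
  large gap between low and high degrees.
\<close>

fun kk :: "nat => nat => nat => nat => nat" where
  "kk K \<Delta> b0 0 = 16"
| "kk K \<Delta> b0 (Suc i) = 32 * (4 * qY K \<Delta> (32 * b0) (kk K \<Delta> b0 i) * kk K \<Delta> b0 i) + kk K \<Delta> b0 i"

lemma kk_ge: "16 <= kk K \<Delta> b0 i"
  by (induction i) auto

declare kk.simps(2) [simp del]

text \<open>A smallest set of the given density has fewer than \<open>2 * d\<close> arcs per vertex,
  and all its proper subsets are sparser. The vertices above the deleted level are too few to carry
  many arcs among themselves. So either many arcs run from high to low degrees, and single high
  vertices serve as cores, or many arcs join low vertices, and \<open>bounded_case\<close>
  applies.\<close>

theorem sparse_topo:
  fixes \<Delta> b0 K :: nat
  assumes TW: "!!V (E :: ('a \<times> 'a) set) X c \<kappa>. sgr V E ==> X \<subseteq> V ==> card X <= \<kappa> ==> K * (\<kappa> + 1) <= c ==> massed c V E X ==> linked V E X"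
    and b0: "1 <= b0"
  obtains a \<eta> :: real and d0 :: nat where "0 < a" "0 < \<eta>"
    "!!d V (E :: ('a \<times> 'a) set) (VH :: 'w set) EH. sgr V E ==> V ~= {} ==> d * card V <= b0 * card E ==> no_dense E V (a * real d) \<eta> ==>
      sgr VH EH ==> card VH <= d ==> (!!h. card (EH `` {h}) <= \<Delta>) ==> d0 <= d ==> topo V E VH EH"
proof -
  let ?k = "kk K \<Delta> b0"
  define bb where "bb = 64 * b0"
  \<comment> \<open>The level is known only after the graph is given, so the constants are minima
    over all eight levels.\<close>
  define Sa where "Sa = insert (1 / (2 * real (32 * b0))) ((%i. aA bb (?k i)) ` {..<8})"
  define Se where "Se = (%i. 1 / (2 * real (32 * b0) * real 1 * real (CY K \<Delta> (32 * b0) (?k i)))) ` {..<8} Un (%i. \<eta>A K \<Delta> bb (?k i)) ` {..<8}"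
  define d0 where "d0 = 4 * b0 + (\<Sum>i<8. CY K \<Delta> (32 * b0) (?k i) + CY K \<Delta> (bA bb (?k i)) (?k i))"
  have k1: "1 <= ?k i" for i using kk_ge[of K \<Delta> b0 i] by simp
  have bb1: "1 <= bb" using b0 by (simp add: bb_def)
  have CYpos: "0 < CY K \<Delta> x y" for x y by (simp add: CY_def)
  have bApos: "0 < bA bb y" for y using bb1 by (simp add: bA_def)
  have qApos: "0 < qA K \<Delta> bb (?k i)" for i using bb1 k1[of i] by (simp add: qA_def)
  have fin: "finite Sa" "finite Se" "Sa ~= {}" "Se ~= {}" by (auto simp: Sa_def Se_def lessThan_empty_iff)
  have Sa0: "0 < x" if "x \<in> Sa" for x using that b0 bApos by (auto simp: Sa_def aA_def)
  have Se0: "0 < x" if "x \<in> Se" for x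
  proof -
    have "0 < \<eta>A K \<Delta> bb (?k i)" for i using bb1 k1[of i] bApos[of "?k i"] qApos[of i] CYpos[of "bA bb (?k i)" "?k i"] by (simp add: \<eta>A_def)
    then show ?thesis using that b0 CYpos by (auto simp: Se_def)
  qed
  show thesis
  proof (rule that[of "Min Sa" "Min Se" d0])
    show "0 < Min Sa" "0 < Min Se" using fin Sa0 Se0 by (auto simp: Min_gr_iff)
    fix d and V and E :: "('a \<times> 'a) set" and VH :: "'w set" and EH
    assume G: "sgr V E" and Vne: "V ~= {}" and dens: "d * card V <= b0 * card E" and nd: "no_dense E V (Min Sa * real d) (Min Se)"
      and H: "sgr VH EH" "card VH <= d" "!!h. card (EH `` {h}) <= \<Delta>" and d0: "d0 <= d"
    have fV: "finite V" "finite E" "sym E" "irrefl E" "E \<subseteq> V \<times> V" using sgr_finite[OF G] by auto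
    have d4: "4 * b0 <= d" and dC: "!!i. i < 8 ==> CY K \<Delta> (32 * b0) (?k i) <= d" "!!i. i < 8 ==> CY K \<Delta> (bA bb (?k i)) (?k i) <= d"
    proof -
      show "4 * b0 <= d" using d0 by (simp add: d0_def)
      fix i :: nat assume "i < 8"
      then have "CY K \<Delta> (32 * b0) (?k i) + CY K \<Delta> (bA bb (?k i)) (?k i) <= (\<Sum>i<8. CY K \<Delta> (32 * b0) (?k i) + CY K \<Delta> (bA bb (?k i)) (?k i))"
        by (intro member_le_sum) auto
      then show "CY K \<Delta> (32 * b0) (?k i) <= d" "CY K \<Delta> (bA bb (?k i)) (?k i) <= d" using d0 unfolding d0_def by linarith+
    qed
    have dpos: "0 < d" using d4 b0 by simp
    have "V \<in> {W. W \<subseteq> V & W ~= {} & d * card W <= b0 * card (E Int W \<times> W)}"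
      using Vne dens fV(5) by (auto simp: Int_absorb2)
    then have "{W. W \<subseteq> V & W ~= {} & d * card W <= b0 * card (E Int W \<times> W)} ~= {}" by blast
    from obtain_min[OF this, of card] obtain W where W: "W \<subseteq> V" "W ~= {}" "d * card W <= b0 * card (E Int W \<times> W)"
      and Wmin: "!!W'. W' \<subseteq> V ==> W' ~= {} ==> d * card W' <= b0 * card (E Int W' \<times> W') ==> card W <= card W'" by blast
    have fW: "finite W" using W(1) fV(1) finite_subset by auto
    define E1 where "E1 = E Int W \<times> W"
    define n where "n = card W"
    define m where "m = card E1"
    have G1: "sgr W E1" unfolding E1_def by (rule sgr_restrict[OF G W(1)])
    have s1: "sym E1" "irrefl E1" "finite E1" "E1 \<subseteq> W \<times> W" using sgr_finite[OF G1] by auto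
    have small: "b0 * ecard E1 X X < d * card X" if "X \<subseteq> W" "X ~= {}" "X ~= W" for X
    proof -
      have eq: "E1 Int X \<times> X = E Int X \<times> X" using that(1) by (auto simp: E1_def)
      have "card X < card W" using that fW by (intro psubset_card_mono) auto
      then have "~ d * card X <= b0 * card (E Int X \<times> X)" using Wmin[of X] that W(1) by (meson leD order_trans)
      then show ?thesis unfolding ecard_def eq by simp
    qed
    have dm: "d * n <= b0 * m" using W(3) by (simp add: n_def m_def E1_def)
    have n0: "0 < n" using W(2) fW by (simp add: n_def card_gt_0_iff)
    have mn: "m <= n * n" using ecard_le[OF fW fW, of E] by (simp add: m_def n_def E1_def ecard_def)
    have n4: "4 <= n"
    proof -
      have "d * n <= b0 * (n * n)" using dm mn by (meson mult_le_mono2 order_trans)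
      then have "d * n <= (b0 * n) * n" by (simp add: algebra_simps)
      then have "d <= b0 * n" using n0 by simp
      then have "b0 * 4 <= b0 * n" using d4 by linarith
      then show ?thesis using b0 by simp
    qed
    define deg where "deg v = card (E1 `` {v})" for v
    have msum: "m = (\<Sum>v\<in>W. deg v)" unfolding m_def deg_def by (rule sgr_deg_sum[OF G1])
    have fN: "finite (E1 `` {v})" for v using s1(3) by (rule finite_Image)
    \<comment> \<open>Removing a vertex of at most average degree loses at most half of the arcs,
      and what remains spans a proper, hence sparse, subset.\<close>
    have m2: "m < 2 * d * n"
    proof -
      have "\<exists>v\<in>W. n * deg v <= m"
      proof (rule ccontr)
        assume "~ ?thesis"
        then have "(\<Sum>v\<in>W. m) < (\<Sum>v\<in>W. n * deg v)" using fW W(2) by (intro sum_strict_mono) auto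
        then show False unfolding sum_distrib_left[symmetric] msum[symmetric] by (simp add: n_def)
      qed
      then obtain v where v: "v \<in> W" "n * deg v <= m" by auto
      have "4 * deg v <= n * deg v" using n4 by (rule mult_le_mono1)
      then have dv: "4 * deg v <= m" using v(2) by linarith
      let ?W = "W - {v}"
      have "E1 \<subseteq> (E1 Int ?W \<times> ?W) Un ({v} \<times> E1 `` {v} Un E1 `` {v} \<times> {v})" using s1(4) by (auto dest: symD[OF s1(1)])
      then have "m <= card ((E1 Int ?W \<times> ?W) Un ({v} \<times> E1 `` {v} Un E1 `` {v} \<times> {v}))" unfolding m_def using s1(3) fN by (intro card_mono) auto
      also have "\<dots> <= card (E1 Int ?W \<times> ?W) + card ({v} \<times> E1 `` {v} Un E1 `` {v} \<times> {v})" by (rule card_Un_le)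
      also have "card ({v} \<times> E1 `` {v} Un E1 `` {v} \<times> {v}) <= card ({v} \<times> E1 `` {v}) + card (E1 `` {v} \<times> {v})" by (rule card_Un_le)
      finally have "m <= ecard E1 ?W ?W + 2 * deg v" by (simp add: card_cartesian_product ecard_def deg_def)
      then have "m <= 2 * ecard E1 ?W ?W" using dv by linarith
      then have "b0 * m <= b0 * (2 * ecard E1 ?W ?W)" by (rule mult_le_mono2)
      also have "\<dots> = 2 * (b0 * ecard E1 ?W ?W)" by (rule mult.left_commute)
      finally have "b0 * m <= 2 * (b0 * ecard E1 ?W ?W)" .
      moreover have c1: "card ?W = n - 1" using v(1) fW by (simp add: n_def)
      have "0 < card ?W" using c1 n4 by linarith
      then have cW: "card ?W < n" "?W ~= {}" using c1 n4 by (linarith, metis card.empty less_irrefl)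
      then have "b0 * ecard E1 ?W ?W < d * card ?W" using small[of ?W] v by auto
      moreover have "d * card ?W <= d * n" using cW by simp
      ultimately have "b0 * m < 2 * (d * n)" by linarith
      moreover have "1 * m <= b0 * m" using b0 by (rule mult_le_mono1)
      ultimately have "m < 2 * (d * n)" by linarith
      then show ?thesis by (simp only: mult.assoc)
    qed
    define lev where "lev i = {v \<in> W. ?k i * d <= deg v & deg v < ?k (Suc i) * d}" for i
    have kmono: "?k i <= ?k j" if "i <= j" for i j by (rule lift_Suc_mono_le[OF _ that]) (simp add: kk.simps(2))
    have "\<exists>i<8. 8 * (\<Sum>v\<in>lev i. deg v) <= m"
    proof (rule ccontr)
      assume no: "~ ?thesis"
      have "(\<Sum>i<(8::nat). m) < (\<Sum>i<8. 8 * (\<Sum>v\<in>lev i. deg v))" using no by (intro sum_strict_mono) (auto simp: lessThan_empty_iff)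
      also have "\<dots> = 8 * (\<Sum>i<8. \<Sum>v\<in>lev i. deg v)" by (rule sum_distrib_left[symmetric])
      also have "(\<Sum>i<8. \<Sum>v\<in>lev i. deg v) = (\<Sum>v\<in>(\<Union>i\<in>{..<8}. lev i). deg v)"
      proof (rule sum.UNION_disjoint[symmetric])
        show "\<forall>i\<in>{..<8}. \<forall>j\<in>{..<8}. i ~= j --> lev i Int lev j = {}"
        proof (intro ballI impI)
          fix i j :: nat assume ij: "i ~= j"
          have aux: "lev i Int lev j = {}" if "i < j" for i j
          proof -
            have "?k (Suc i) * d <= ?k j * d" using kmono[of "Suc i" j] that by (intro mult_le_mono1) auto
            then have False if "x \<in> lev i" "x \<in> lev j" for x using that unfolding lev_def mem_Collect_eq by linarith
            then show ?thesis by blast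
          qed
          show "lev i Int lev j = {}" using ij aux[of i j] aux[of j i] by (cases "i < j") auto
        qed
      qed (use fW in \<open>auto simp: lev_def\<close>)
      also have "\<dots> <= m" unfolding msum using fW by (intro sum_mono2) (auto simp: lev_def)
      finally show False by simp
    qed
    then obtain i where i: "i < 8" "8 * (\<Sum>v\<in>lev i. deg v) <= m" by auto
    define L where "L = {v \<in> W. ?k (Suc i) * d <= deg v}"
    define R where "R = {v \<in> W. deg v < ?k i * d}"
    have kSuc: "?k i <= ?k (Suc i)" by (simp add: kk.simps(2))
    have fLR: "finite L" "finite R" "finite (lev i)" using fW by (auto simp: L_def R_def lev_def)
    have kd: "?k i * d <= ?k (Suc i) * d" using kSuc by (rule mult_le_mono1)
    have Wun: "W = (L Un R) Un lev i" by (auto simp: L_def R_def lev_def)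
    have LRd: "L Int R = {}"
    proof -
      have False if "x \<in> L" "x \<in> R" for x using that kd unfolding L_def R_def mem_Collect_eq by linarith
      then show ?thesis by blast
    qed
    have degsum: "ecard E1 X W <= (\<Sum>v\<in>X. deg v)" if "X \<subseteq> W" for X
    proof -
      have fX: "finite X" using that fW finite_subset by auto
      have "ecard E1 X W = (\<Sum>v\<in>X. card (E1 `` {v} Int W))" by (rule ecard_sum[OF fX fW])
      also have "\<dots> <= (\<Sum>v\<in>X. deg v)" unfolding deg_def using fN by (intro sum_mono card_mono) auto
      finally show ?thesis .
    qed
    have cL: "card L * (?k (Suc i) * d) <= m"
    proof -
      have "card L * (?k (Suc i) * d) = (\<Sum>v\<in>L. ?k (Suc i) * d)" by simp
      also have "\<dots> <= (\<Sum>v\<in>L. deg v)" by (intro sum_mono) (auto simp: L_def)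
      also have "\<dots> <= m" unfolding msum using fW by (intro sum_mono2) (auto simp: L_def)
      finally show ?thesis .
    qed
    have cL16: "16 * (d * card L) <= m"
    proof -
      have "16 * (d * card L) <= ?k (Suc i) * (d * card L)" using kk_ge[of K \<Delta> b0 "Suc i"] by (rule mult_le_mono1)
      also have "\<dots> = card L * (?k (Suc i) * d)" by (simp add: algebra_simps)
      finally show ?thesis using cL by linarith
    qed
    \<comment> \<open>As a proper subset, \<open>L\<close> spans fewer than
      \<open>d * card L\<close> arcs, and \<open>cL16\<close> bounds its size.\<close>
    have eLL: "16 * ecard E1 L L <= m"
    proof (cases "L = {}")
      case True then show ?thesis by (simp add: ecard_def)
    next
      case False
      have "L ~= W"
      proof
        assume "L = W"
        then have "16 * (d * n) <= m" using cL16 by (simp add: n_def)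
        then show False using m2 by simp
      qed
      then have "b0 * ecard E1 L L < d * card L" using small[of L] False by (auto simp: L_def)
      moreover have "1 * ecard E1 L L <= b0 * ecard E1 L L" using b0 by (rule mult_le_mono1)
      ultimately have "ecard E1 L L <= d * card L" by linarith
      then show ?thesis using cL16 by linarith
    qed
    have tot: "m <= ecard E1 R R + 2 * ecard E1 L R + ecard E1 L L + 2 * (\<Sum>v\<in>lev i. deg v)"
    proof -
      have "E1 \<subseteq> (E1 Int R \<times> R Un E1 Int L \<times> R) Un (E1 Int R \<times> L Un E1 Int L \<times> L) Un (E1 Int lev i \<times> W Un E1 Int W \<times> lev i)"
      proof
        fix e assume e: "e \<in> E1"
        obtain x y where xy: "e = (x, y)" by (cases e)
        have "x \<in> (L Un R) Un lev i" "y \<in> (L Un R) Un lev i" "x \<in> W" "y \<in> W" using e s1(4) Wun xy by auto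
        then show "e \<in> (E1 Int R \<times> R Un E1 Int L \<times> R) Un (E1 Int R \<times> L Un E1 Int L \<times> L) Un (E1 Int lev i \<times> W Un E1 Int W \<times> lev i)" using e xy by auto
      qed
      then have "m <= card ((E1 Int R \<times> R Un E1 Int L \<times> R) Un (E1 Int R \<times> L Un E1 Int L \<times> L) Un (E1 Int lev i \<times> W Un E1 Int W \<times> lev i))"
        unfolding m_def using s1(3) by (intro card_mono) auto
      also have "\<dots> <= card ((E1 Int R \<times> R Un E1 Int L \<times> R) Un (E1 Int R \<times> L Un E1 Int L \<times> L)) + card (E1 Int lev i \<times> W Un E1 Int W \<times> lev i)" by (rule card_Un_le)
      also have "\<dots> <= (ecard E1 R R + ecard E1 L R) + (ecard E1 R L + ecard E1 L L) + (ecard E1 (lev i) W + ecard E1 W (lev i))"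
        unfolding ecard_def by (intro add_mono card_Un_le order_trans[OF card_Un_le])
      also have "ecard E1 R L = ecard E1 L R" by (rule ecard_commute[OF s1(1)])
      also have "ecard E1 W (lev i) = ecard E1 (lev i) W" by (rule ecard_commute[OF s1(1)])
      finally show ?thesis using degsum[of "lev i"] by (auto simp: lev_def)
    qed
    have tt: "topo V E VH EH" if "topo W' E' VH EH" "W' \<subseteq> V" "E' \<subseteq> E" for W' E' by (rule topo_mono[OF that])
    \<comment> \<open>The deleted level accounts for at most \<open>m / 4\<close> and the arcs
      within \<open>L\<close> for at most \<open>m / 16\<close>.\<close>
    have "m <= 8 * ecard E1 L R | m <= 4 * ecard E1 R R" using tot eLL i(2) by linarith
    then show "topo V E VH EH"
    proof
      assume big: "m <= 8 * ecard E1 L R"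
      define B where "B = E1 Int L \<times> R"
      have mB: "m <= 8 * card B" using big by (simp add: B_def ecard_def)
      have mpos: "0 < m" using dm dpos n0 by (metis mult_is_0 neq0_conv not_gr_zero le_zero_eq)
      have "B ~= {}" using mB mpos by auto
      moreover have "B \<subseteq> L \<times> R" by (auto simp: B_def)
      ultimately obtain L' R' where LR: "L' \<subseteq> L" "R' \<subseteq> R" "L' ~= {}" "R' ~= {}"
        "!!l. l \<in> L' ==> card B <= 4 * card L * card (B `` {l} Int R')"
        "!!r. r \<in> R' ==> card B <= 4 * card R * card (B\<inverse> `` {r} Int L')"
        using bip_clean[of L R B] fLR by metis
      \<comment> \<open>In \<open>32 * b0\<close> the factor 8 comes from the share of arcs between
        \<open>L\<close> and \<open>R\<close>, the factor 4 from \<open>bip_clean\<close>.\<close>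
      have "topo W E1 VH EH"
      proof (rule bip_minor_topo[OF TW _ k1[of i] G1, where L = L' and P = "%l. {l}" and R = R' and s = 1 and d = d and b = "32 * b0"])
        show "1 <= 32 * b0" using b0 by simp
        show "finite L'" using LR(1) fLR finite_subset by auto
        show "conn E1 {l} & {l} \<subseteq> W & card {l} <= 1" if "l \<in> L'" for l using that LR(1) conn_single[of E1 l] by (auto simp: L_def)
        show "R' \<subseteq> W" using LR(2) by (auto simp: R_def)
        show "{l} Int R' = {}" if "l \<in> L'" for l using that LR LRd by auto
        show "4 * qY K \<Delta> (32 * b0) (?k i) * ?k i * d <= card {r \<in> R'. \<exists>w\<in>{l}. (w, r) \<in> E1}" if l: "l \<in> L'" for l
        proof -
          have eq: "{r \<in> R'. \<exists>w\<in>{l}. (w, r) \<in> E1} = B `` {l} Int R'" using l LR(1,2) by (auto simp: B_def)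
          let ?c = "card (B `` {l} Int R')"
          have "m <= 8 * (4 * card L * ?c)" using mB LR(5)[OF l] by linarith
          moreover have "8 * (4 * card L * ?c) = card L * (32 * ?c)" by simp
          ultimately have "card L * (?k (Suc i) * d) <= card L * (32 * ?c)" using cL by linarith
          moreover have "0 < card L" using LR(1,3) fLR by (auto simp: card_gt_0_iff)
          ultimately have "?k (Suc i) * d <= 32 * ?c" by simp
          moreover have "32 * (4 * qY K \<Delta> (32 * b0) (?k i) * ?k i) * d <= ?k (Suc i) * d" by (intro mult_le_mono1) (simp add: kk.simps(2))
          ultimately have "32 * (4 * qY K \<Delta> (32 * b0) (?k i) * ?k i * d) <= 32 * ?c" by linarith
          then show ?thesis unfolding eq by linarith
        qed
        show "d <= 32 * b0 * card {l \<in> L'. \<exists>w\<in>{l}. (w, r) \<in> E1} & card {l \<in> L'. \<exists>w\<in>{l}. (w, r) \<in> E1} <= ?k i * d" if r: "r \<in> R'" for r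
        proof
          have eq: "{l \<in> L'. \<exists>w\<in>{l}. (w, r) \<in> E1} = B\<inverse> `` {r} Int L'" using r LR(1,2) by (auto simp: B_def)
          let ?c = "card (B\<inverse> `` {r} Int L')"
          have "card R <= n" unfolding n_def using fW by (intro card_mono) (auto simp: R_def)
          then have "4 * card R * ?c <= 4 * n * ?c" by simp
          then have "m <= 8 * (4 * n * ?c)" using mB LR(6)[OF r] by linarith
          then have "d * n <= b0 * (8 * (4 * n * ?c))" using dm by (meson mult_le_mono2 order_trans)
          then have "n * d <= n * (32 * b0 * ?c)" by (simp add: algebra_simps)
          then show "d <= 32 * b0 * card {l \<in> L'. \<exists>w\<in>{l}. (w, r) \<in> E1}" unfolding eq using n0 by simp
          have "?c <= deg r" unfolding deg_def using fN by (intro card_mono) (auto simp: B_def dest: symD[OF s1(1)])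
          then show "card {l \<in> L'. \<exists>w\<in>{l}. (w, r) \<in> E1} <= ?k i * d" unfolding eq using r LR(2) by (auto simp: R_def)
        qed
        show "no_dense E1 W (real d / (2 * real (32 * b0))) (1 / (2 * real (32 * b0) * real 1 * real (CY K \<Delta> (32 * b0) (?k i))))"
        proof (rule no_dense_mono[OF nd])
          have "Min Sa <= 1 / (2 * real (32 * b0))" using fin by (intro Min_le) (auto simp: Sa_def)
          then have "Min Sa * real d <= 1 / (2 * real (32 * b0)) * real d" by (intro mult_right_mono) auto
          then show "Min Sa * real d <= real d / (2 * real (32 * b0))" by simp
          show "Min Se <= 1 / (2 * real (32 * b0) * real 1 * real (CY K \<Delta> (32 * b0) (?k i)))" using fin i(1) by (intro Min_le) (auto simp: Se_def)
        qed (use W(1) fV in \<open>auto simp: E1_def\<close>)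
        show "CY K \<Delta> (32 * b0) (?k i) <= d" using dC i by auto
      qed (use H LR in auto)
      then show ?thesis using tt[of W E1] W(1) by (auto simp: E1_def)
    next
      assume big: "m <= 4 * ecard E1 R R"
      obtain A where A: "A \<subseteq> R" "ecard E1 R R <= 4 * ecard E1 A (R - A)" using half_cut[OF fLR(2) s1(1,2)] by auto
      define B where "B = E1 Int A \<times> (R - A)"
      have mB: "m <= 16 * card B" using big A(2) by (simp add: B_def ecard_def)
      have mpos: "0 < m" using dm dpos n0 by (metis mult_is_0 neq0_conv not_gr_zero le_zero_eq)
      have fA: "finite A" "finite (R - A)" using A(1) fLR finite_subset by auto
      have "B ~= {}" using mB mpos by auto
      moreover have "B \<subseteq> A \<times> (R - A)" by (auto simp: B_def)
      ultimately obtain V1 V2 where LR: "V1 \<subseteq> A" "V2 \<subseteq> R - A" "V1 ~= {}" "V2 ~= {}"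
        "!!l. l \<in> V1 ==> card B <= 4 * card A * card (B `` {l} Int V2)"
        "!!r. r \<in> V2 ==> card B <= 4 * card (R - A) * card (B\<inverse> `` {r} Int V1)"
        using bip_clean[of A "R - A" B] fA by metis
      define E2 where "E2 = E1 Int (V1 \<times> V2 Un V2 \<times> V1)"
      have RW: "R \<subseteq> W" by (auto simp: R_def)
      have V12: "V1 Int V2 = {}" "V1 Un V2 \<subseteq> W" using LR(1,2) A(1) RW by auto
      have degr: "deg x <= ?k i * d" if "x \<in> V1 Un V2" for x using that LR(1,2) A(1) by (auto simp: R_def)
      have e1: "E2 `` {x} = B `` {x} Int V2" if "x \<in> V1" for x using that V12(1) LR(1,2) by (auto simp: E2_def B_def)
      have e2: "E2 `` {x} = B\<inverse> `` {x} Int V1" if "x \<in> V2" for x using that V12(1) LR(1,2) by (auto simp: E2_def B_def dest: symD[OF s1(1)])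
      have dd: "d <= bb * c" if "card B <= 4 * N * c" "N <= n" for N c
      proof -
        have "4 * N * c <= 4 * n * c" using that(2) by simp
        then have "m <= 16 * (4 * n * c)" using mB that(1) by linarith
        then have "d * n <= b0 * (16 * (4 * n * c))" using dm by (meson mult_le_mono2 order_trans)
        then have "n * d <= n * (bb * c)" by (simp add: bb_def algebra_simps)
        then show ?thesis using n0 by simp
      qed
      have cAn: "card A <= n" "card (R - A) <= n" unfolding n_def using fW A(1) RW by (auto intro!: card_mono)
      have up: "card (E2 `` {x}) <= ?k i * d" if "x \<in> V1 Un V2" for x
      proof -
        have "card (E2 `` {x}) <= deg x" unfolding deg_def using fN by (intro card_mono) (auto simp: E2_def)
        then show ?thesis using degr[OF that] by simp
      qed
      have "topo (V1 Un V2) E2 VH EH"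
      proof (rule bounded_case[OF TW bb1 k1[of i], where d = d])
        show "sgr (V1 Un V2) E2" unfolding sgr_def
          using finite_subset[OF V12(2) fW] s1(2) by (auto simp: E2_def irrefl_def sym_def dest: symD[OF s1(1)])
        show "E2 \<subseteq> V1 \<times> V2 Un V2 \<times> V1" by (auto simp: E2_def)
        show "d <= bb * card (E2 `` {x}) & card (E2 `` {x}) <= ?k i * d" if "x \<in> V1" for x
          using dd[OF LR(5)[OF that] cAn(1)] e1[OF that] up[of x] that by auto
        show "d <= bb * card (E2 `` {x}) & card (E2 `` {x}) <= ?k i * d" if "x \<in> V2" for x
          using dd[OF LR(6)[OF that] cAn(2)] e2[OF that] up[of x] that by auto
        show "no_dense E2 (V1 Un V2) (aA bb (?k i) * real d) (\<eta>A K \<Delta> bb (?k i))"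
        proof (rule no_dense_mono[OF nd])
          have "Min Sa <= aA bb (?k i)" using fin i(1) by (intro Min_le) (auto simp: Sa_def)
          then show "Min Sa * real d <= aA bb (?k i) * real d" by (intro mult_right_mono) auto
          show "Min Se <= \<eta>A K \<Delta> bb (?k i)" using fin i(1) by (intro Min_le) (auto simp: Se_def)
        qed (use W(1) V12 fV in \<open>auto simp: E1_def E2_def\<close>)
        show "CY K \<Delta> (bA bb (?k i)) (?k i) <= d" using dC i by auto
      qed (use H LR V12 in auto)
      then show ?thesis using tt[of "V1 Un V2" E2] W(1) V12(2) by (auto simp: E2_def E1_def)
    qed
  qed
qed

section \<open>Tilings by joined pairs\<close>

type_synonym 'a tile = "'a set \<times> 'a set \<times> nat"

text \<open>The third component is the scale at which the pair is joined; it is kept when the sides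
  are trimmed. The sides are at least \<open>q\<close> times the scale, and \<open>g\<close> is a
  lower bound for the scale common to a family.\<close>

definition istile :: "('a \<times> 'a) set => 'a set => real => nat => real => 'a tile => bool" where
  "istile E V \<rho> q g t \<longleftrightarrow> (case t of (A, B, m) => A \<subseteq> V & B \<subseteq> V & A Int B = {} & card A = card B & q * m <= card A &
     1 <= m & g <= real m & joined E m \<rho> A B)"

definition tsup :: "'a tile => 'a set" where
  "tsup t = fst t Un fst (snd t)"

definition tfam :: "('a \<times> 'a) set => 'a set => real => nat => real => 'a tile set => bool" where
  "tfam E V \<rho> q g T \<longleftrightarrow> finite T & (\<forall>t\<in>T. istile E V \<rho> q g t) & (\<forall>t\<in>T. \<forall>t'\<in>T. t ~= t' --> tsup t Int tsup t' = {})"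

text \<open>Only one side per tile, so \<open>2 * cov T\<close> vertices are covered.\<close>

definition cov :: "'a tile set => nat" where
  "cov T = (\<Sum>t\<in>T. card (fst t))"

lemma istileD:
  assumes "istile E V \<rho> q g t"
  shows "fst t \<subseteq> V" "fst (snd t) \<subseteq> V" "fst t Int fst (snd t) = {}" "card (fst t) = card (fst (snd t))"
    "q * snd (snd t) <= card (fst t)" "1 <= snd (snd t)" "g <= real (snd (snd t))"
    "joined E (snd (snd t)) \<rho> (fst t) (fst (snd t))" "tsup t \<subseteq> V"
  using assms by (auto simp: istile_def tsup_def split: prod.splits)

lemma tfam_mono: "tfam E V \<rho> q g T ==> q' <= q ==> g' <= g ==> tfam E V \<rho> q' g' T"
  unfolding tfam_def istile_def by (fastforce intro: order_trans[OF mult_le_mono1])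

lemma istile_ne: "istile E V \<rho> q g t ==> 1 <= q ==> fst t ~= {}"
proof
  assume t: "istile E V \<rho> q g t" "1 <= q" "fst t = {}"
  have "1 * 1 <= q * snd (snd t)" using istileD(6)[OF t(1)] t(2) by (intro mult_le_mono)
  then show False using istileD(5)[OF t(1)] t(3) by simp
qed

lemma cov_bound:
  assumes "tfam E V \<rho> q g T" "finite V"
  shows "card (\<Union>t\<in>T. tsup t) = 2 * cov T"
proof -
  have T: "finite T" "!!t. t \<in> T ==> istile E V \<rho> q g t" "!!t t'. t \<in> T ==> t' \<in> T ==> t ~= t' ==> tsup t Int tsup t' = {}"
    using assms(1) by (auto simp: tfam_def)
  have f: "finite (tsup t)" if "t \<in> T" for t using istileD(9)[OF T(2)[OF that]] assms(2) finite_subset by auto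
  have c: "card (tsup t) = 2 * card (fst t)" if "t \<in> T" for t
  proof -
    have "finite (fst t)" "finite (fst (snd t))" using f[OF that] by (auto simp: tsup_def)
    then show ?thesis using istileD(3,4)[OF T(2)[OF that]] by (simp add: tsup_def card_Un_disjoint)
  qed
  have "card (\<Union>t\<in>T. tsup t) = (\<Sum>t\<in>T. card (tsup t))" by (rule card_UN_disjoint) (use T f in auto)
  also have "\<dots> = (\<Sum>t\<in>T. 2 * card (fst t))" using c by (intro sum.cong) auto
  finally show ?thesis by (simp add: cov_def sum_distrib_left)
qed

lemma tfam_image:
  assumes "finite J" "!!j. j \<in> J ==> istile E V \<rho> q g (u j)" "!!i j. i \<in> J ==> j \<in> J ==> i ~= j ==> tsup (u i) Int tsup (u j) = {}" "1 <= q"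
  shows "tfam E V \<rho> q g (u ` J)" "cov (u ` J) = (\<Sum>j\<in>J. card (fst (u j)))"
proof -
  show "tfam E V \<rho> q g (u ` J)" unfolding tfam_def
  proof (intro conjI ballI impI)
    fix t t' assume "t \<in> u ` J" "t' \<in> u ` J" "t ~= t'"
    then obtain i j where "i \<in> J" "j \<in> J" "t = u i" "t' = u j" "i ~= j" by auto
    then show "tsup t Int tsup t' = {}" using assms(3) by simp
  qed (use assms in auto)
  have "inj_on u J"
  proof (rule inj_onI, rule ccontr)
    fix i j assume h: "i \<in> J" "j \<in> J" "u i = u j" "i ~= j"
    then have "tsup (u i) = {}" using assms(3)[of i j] by simp
    then show False using istile_ne[OF assms(2)[OF h(1)] assms(4)] by (simp add: tsup_def)
  qed
  then show "cov (u ` J) = (\<Sum>j\<in>J. card (fst (u j)))" by (simp add: cov_def sum.reindex)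
qed

text \<open>Old tiles are trimmed and new tiles added, such that the number of vertices cut is at
  most \<open>cov N\<close> while the new tiles cover \<open>2 * cov N\<close>. If this cannot be
  continued, the uncovered vertices span few edges and see at most about half of the covered
  vertices on average, because an unsaturated tile has only one side with many edges to them. This
  contradicts the average degree.\<close>

lemma tile_round:
  fixes E :: "('a \<times> 'a) set" and e \<theta> a \<eta> \<rho> g0 d :: real and q r T0 :: nat
  assumes G: "sgr V E" and Vne: "V ~= {}" and e: "0 < e" "e < 1"
    and \<theta>: "0 < \<theta>" "\<theta> <= e / 32" "\<theta> <= \<eta>" "\<rho> = \<theta> / 2"
    and q: "2 <= q" and r: "0 < r"
    and pair: "!!X Y. finite X ==> finite Y ==> r * q ^ T0 <= card X ==> r * q ^ T0 <= card Y ==>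
      \<theta> * real (card X) * real (card Y) <= real (ecard E X Y) ==>
      \<exists>X'\<subseteq>X. \<exists>Y'\<subseteq>Y. \<exists>m\<ge>r. card X' = q * m & card Y' = q * m & q * m <= r * q ^ T0 & joined E m (\<theta> / 2) X' Y'"
    and dens: "(1 - e / 8) * d * real (card V) <= real (card E)" and d: "0 < d"
    and ndp: "!!U. U \<subseteq> V ==> U ~= {} ==> e / 8 * d * real (card U) <= real (card (E Int U \<times> U)) ==> ~ no_dense E U (a * d) \<eta>"
    and F0: "tfam E V \<rho> (2 * q) g0 F0" "2 * real (cov F0) < (1 - e) * d"
    and sz: "real (r * q ^ T0) <= a * d" "real (r * q ^ T0) <= e / 64 * d" "0 < g0" "real (r * q ^ T0) <= e / 32 * g0"
      "d * real (r * q ^ T0) <= e ^ 2 / 256 * d * g0"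
  shows "\<exists>F1. tfam E V \<rho> q (min g0 (real r)) F1 & real (cov F0) + e ^ 2 / 512 * d <= real (cov F1)"
proof -
  define M where "M = r * q ^ T0"
  define x where "x = e ^ 2 / 256"
  have x0: "0 < x" using e by (simp add: x_def)
  have fV: "finite V" "finite E" "sym E" "irrefl E" "E \<subseteq> V \<times> V" using sgr_finite[OF G] by auto
  have F: "finite F0" "!!t. t \<in> F0 ==> istile E V \<rho> (2 * q) g0 t" "!!t t'. t \<in> F0 ==> t' \<in> F0 ==> t ~= t' ==> tsup t Int tsup t' = {}"
    using F0(1) by (auto simp: tfam_def)
  define cA where "cA s t = card (fst t) - card (fst (s t))" for s :: "'a tile => 'a set \<times> 'a set" and t
  define cB where "cB s t = card (fst t) - card (snd (s t))" for s :: "'a tile => 'a set \<times> 'a set" and t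
  define osup where "osup s t = fst (s t) Un snd (s t)" for s :: "'a tile => 'a set \<times> 'a set" and t
  \<comment> \<open>The amounts cut from the two sides of a tile differ by at most \<open>M\<close>,
    the maximum side of a new tile, so that equalising the sides later loses little. At most an
    \<open>e / 8\<close> part of a side is cut, so a tile of ratio \<open>2 * q\<close> keeps ratio
    \<open>q\<close>.\<close>
  define st where "st s N \<longleftrightarrow> (\<forall>t\<in>F0. fst (s t) \<subseteq> fst t & snd (s t) \<subseteq> fst (snd t) &
      8 * real (cA s t) <= e * real (card (fst t)) & 8 * real (cB s t) <= e * real (card (fst t)) &
      cA s t <= cB s t + M & cB s t <= cA s t + M) &
    tfam E V \<rho> q (real r) N & (\<forall>n\<in>N. \<forall>t\<in>F0. tsup n Int osup s t = {}) &
    (\<Sum>t\<in>F0. cA s t + cB s t) <= cov N" for s N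
  let ?init = "%t :: 'a tile. (fst t, fst (snd t))"
  have cc: "card (fst (snd t)) = card (fst t)" if "t \<in> F0" for t using istileD(4)[OF F(2)[OF that]] by simp
  have i1: "cA ?init t = 0" "cB ?init t = 0" if "t \<in> F0" for t using cc[OF that] by (auto simp: cA_def cB_def)
  have init: "st ?init {}" unfolding st_def
    using i1 e by (auto simp: tfam_def cov_def)
  \<comment> \<open>The cap leaves finitely many values of \<open>cov N\<close>, and a state below
    \<open>2 * x * d\<close> stays under it after one more tile.\<close>
  define lim where "lim = 2 * x * d + real M"
  have ex: "\<exists>k s N. st s N & cov N = k & real k <= lim"
    using init x0 d by (intro exI[of _ 0] exI[of _ ?init] exI[of _ "{}"]) (auto simp: cov_def lim_def)
  define ks where "ks = {k. \<exists>s N. st s N & cov N = k & real k <= lim}"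
  have "finite ks" by (rule finite_subset[of _ "{..nat \<lfloor>lim\<rfloor>}"]) (auto simp: ks_def le_nat_floor)
  moreover have "ks ~= {}" using ex by (auto simp: ks_def)
  ultimately have "Max ks \<in> ks" "!!k. k \<in> ks ==> k <= Max ks" by auto
  then obtain s N where sN: "st s N" "real (cov N) <= lim" and mx: "!!s' N'. st s' N' ==> real (cov N') <= lim ==> cov N' <= cov N"
  proof -
    assume M: "Max ks \<in> ks" "!!k. k \<in> ks ==> k <= Max ks"
    obtain s N where o: "st s N" "cov N = Max ks" "real (Max ks) <= lim" 
    proof -
      have "\<exists>s N. st s N & cov N = k & real k <= lim" if "k \<in> ks" for k using that by (simp only: ks_def mem_Collect_eq)
      from this[OF M(1)] show thesis by (elim exE conjE) (rule that)
    qed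
    have "cov N' <= cov N" if "st s' N'" "real (cov N') <= lim" for s' N'
      unfolding o(2) by (rule M(2)) (use that in \<open>auto simp only: ks_def mem_Collect_eq\<close>)
    then show thesis using that[OF o(1)] o(2,3) by simp
  qed
  have S: "!!t. t \<in> F0 ==> fst (s t) \<subseteq> fst t" "!!t. t \<in> F0 ==> snd (s t) \<subseteq> fst (snd t)"
    "!!t. t \<in> F0 ==> 8 * real (cA s t) <= e * real (card (fst t))" "!!t. t \<in> F0 ==> 8 * real (cB s t) <= e * real (card (fst t))"
    "!!t. t \<in> F0 ==> cA s t <= cB s t + M" "!!t. t \<in> F0 ==> cB s t <= cA s t + M"
    and NF: "tfam E V \<rho> q (real r) N" and Nd: "!!n t. n \<in> N ==> t \<in> F0 ==> tsup n Int osup s t = {}"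
    and cut: "(\<Sum>t\<in>F0. cA s t + cB s t) <= cov N"
    using sN(1) unfolding st_def by auto
  have Nf: "finite N" "!!n. n \<in> N ==> istile E V \<rho> q (real r) n" "!!n n'. n \<in> N ==> n' \<in> N ==> n ~= n' ==> tsup n Int tsup n' = {}"
    using NF by (auto simp: tfam_def)
  have osub: "osup s t \<subseteq> tsup t" "tsup t \<subseteq> V" if "t \<in> F0" for t
    using S(1,2)[OF that] istileD(9)[OF F(2)[OF that]] by (auto simp: osup_def tsup_def)
  have fins: "finite (fst t)" "finite (fst (snd t))" "finite (fst (s t))" "finite (snd (s t))" if "t \<in> F0" for t
    proof -
    have f: "finite (tsup t)" using osub(2)[OF that] fV(1) by (rule finite_subset)
    then show 1: "finite (fst t)" "finite (fst (snd t))" by (auto simp: tsup_def)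
    show "finite (fst (s t))" by (rule finite_subset[OF S(1)[OF that] 1(1)])
    show "finite (snd (s t))" by (rule finite_subset[OF S(2)[OF that] 1(2)])
  qed
  have cle: "card (fst (s t)) <= card (fst t)" "card (snd (s t)) <= card (fst t)" if "t \<in> F0" for t
    using card_mono[OF fins(1)[OF that] S(1)[OF that]] card_mono[OF fins(2)[OF that] S(2)[OF that]] cc[OF that] by auto
  have ceq: "card (fst (s t)) + cA s t = card (fst t)" "card (snd (s t)) + cB s t = card (fst t)" if "t \<in> F0" for t
    using cle[OF that] by (auto simp: cA_def cB_def)
  have add_new: False
    if s': "\<forall>t\<in>F0. fst (s' t) \<subseteq> fst (s t) & snd (s' t) \<subseteq> snd (s t) &
        8 * real (cA s' t) <= e * real (card (fst t)) & 8 * real (cB s' t) <= e * real (card (fst t)) &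
        cA s' t <= cB s' t + M & cB s' t <= cA s' t + M"
      and n: "istile E V \<rho> q (real r) n" "tsup n Int (\<Union>n\<in>N. tsup n) = {}" "!!t. t \<in> F0 ==> tsup n Int osup s' t = {}"
      and c: "(\<Sum>t\<in>F0. cA s' t + cB s' t) <= (\<Sum>t\<in>F0. cA s t + cB s t) + card (fst n)"
      and le: "card (fst n) <= M" and lt: "real (cov N) < 2 * x * d" for s' n
  proof -
    have nN: "n \<notin> N"
    proof
      assume "n \<in> N"
      then have "tsup n = {}" using n(2) by auto
      then show False using istile_ne[OF n(1)] q by (auto simp: tsup_def)
    qed
    have cv: "cov (insert n N) = card (fst n) + cov N" using nN Nf(1) by (simp add: cov_def)
    have "st s' (insert n N)" unfolding st_def
    proof (intro conjI)
      show "\<forall>t\<in>F0. fst (s' t) \<subseteq> fst t & snd (s' t) \<subseteq> fst (snd t) &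
        8 * real (cA s' t) <= e * real (card (fst t)) & 8 * real (cB s' t) <= e * real (card (fst t)) &
        cA s' t <= cB s' t + M & cB s' t <= cA s' t + M" using s' S(1,2) by (meson order_trans)
      show "tfam E V \<rho> q (real r) (insert n N)" unfolding tfam_def using Nf n(1,2) by (auto simp: Int_commute)
      show "\<forall>n'\<in>insert n N. \<forall>t\<in>F0. tsup n' Int osup s' t = {}"
      proof (intro ballI)
        fix n' t assume n': "n' \<in> insert n N" and t: "t \<in> F0"
        have "osup s' t \<subseteq> osup s t" using s' t by (auto simp: osup_def)
        then show "tsup n' Int osup s' t = {}" using n' n(3)[OF t] Nd[OF _ t] by blast
      qed
      show "(\<Sum>t\<in>F0. cA s' t + cB s' t) <= cov (insert n N)" using c cut cv by simp
    qed
    moreover have "real (cov (insert n N)) <= lim" using cv le lt by (simp add: lim_def)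
    ultimately have "cov (insert n N) <= cov N" by (rule mx)
    moreover have "0 < card (fst n)" using istileD(5,6)[OF n(1)] q by (metis card_gt_0_iff istile_ne[OF n(1)] fV(1) finite_subset istileD(1)[OF n(1)] le_trans one_le_numeral)
    ultimately show False using cv by simp
  qed
  have big: "2 * x * d <= real (cov N)"
  proof (rule ccontr)
    assume "~ ?thesis"
    then have lt: "real (cov N) < 2 * x * d" by simp
    define TT where "TT = (\<Union>t\<in>F0. osup s t) Un (\<Union>n\<in>N. tsup n)"
    define Lv where "Lv = V - TT"
    have NV: "(\<Union>n\<in>N. tsup n) \<subseteq> V" using istileD(9)[OF Nf(2)] by blast
    have TV: "TT \<subseteq> V" unfolding TT_def using NV by (intro Un_least UN_least) (use osub in \<open>blast intro: order_trans\<close>)+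
    have fT: "finite TT" "finite Lv" using TV fV(1) finite_subset by (auto simp: Lv_def)
    have cN: "card (\<Union>n\<in>N. tsup n) = 2 * cov N" by (rule cov_bound[OF NF fV(1)])
    have cO: "card (\<Union>t\<in>F0. osup s t) <= 2 * cov F0"
    proof -
      have "card (\<Union>t\<in>F0. osup s t) <= card (\<Union>t\<in>F0. tsup t)" proof (rule card_mono)
        have "(\<Union>t\<in>F0. tsup t) \<subseteq> V" using osub(2) by (rule UN_least)
        then show "finite (\<Union>t\<in>F0. tsup t)" using fV(1) by (rule finite_subset)
        show "(\<Union>t\<in>F0. osup s t) \<subseteq> (\<Union>t\<in>F0. tsup t)" by (rule UN_mono[OF subset_refl osub(1)])
      qed
      then show ?thesis using cov_bound[OF F0(1) fV(1)] by simp
    qed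
    have \<tau>: "real (card TT) <= (1 - e + 4 * x) * d"
    proof -
      have "card TT <= 2 * cov F0 + 2 * cov N" unfolding TT_def using card_Un_le[of "\<Union>t\<in>F0. osup s t" "\<Union>n\<in>N. tsup n"] cN cO by simp
      then have "real (card TT) <= 2 * real (cov F0) + 2 * real (cov N)" by linarith
      then show ?thesis using F0(2) lt by (simp add: algebra_simps)
    qed
    have x4: "4 * x <= e / 64" using e by (simp add: x_def power2_eq_square)
    have VLT: "real (card V) = real (card Lv) + real (card TT)"
    proof -
      have "card V = card Lv + card TT" unfolding Lv_def using TV fT fV(1) by (metis card_Diff_subset card_mono le_add_diff_inverse2)
      then show ?thesis by simp
    qed
    have nd: "(1 - e / 8) * d <= real (card V)"
    proof -
      have "card E <= card V * card V" using ecard_le[OF fV(1) fV(1), of E] fV(5) by (simp add: ecard_def Int_absorb2)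
      then have "real (card E) <= real (card V) * real (card V)" by (metis of_nat_le_iff of_nat_mult)
      then have "((1 - e / 8) * d) * real (card V) <= real (card V) * real (card V)" using dens by linarith
      moreover have "0 < real (card V)" using Vne fV(1) by (simp add: card_gt_0_iff)
      ultimately show ?thesis by (simp add: mult_le_cancel_right)
    qed
    have Lbig: "e / 64 * d <= real (card Lv)"
    proof -
      have "(4 * x) * d <= (e / 64) * d" using x4 d by (intro mult_right_mono) auto
      moreover have "0 <= e * d" using e d by simp
      ultimately show ?thesis using nd \<tau> VLT by (simp add: algebra_simps)
    qed
    have L0: "0 < real (card Lv)" using Lbig e d by (smt (verit) mult_pos_pos divide_pos_pos)
    have LM: "M <= card Lv" using Lbig sz(2) by (simp add: M_def[symmetric])
    have LvT: "Lv Int TT = {}" "Lv \<subseteq> V" by (auto simp: Lv_def)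
    have newt: "istile E V \<rho> q (real r) (X', Y', m)" if "X' \<subseteq> V" "Y' \<subseteq> V" "X' Int Y' = {}" "r <= m" "card X' = q * m" "card Y' = q * m" "joined E m (\<theta> / 2) X' Y'" for X' Y' m
      using that r unfolding \<theta>(4) by (simp add: istile_def)
    \<comment> \<open>A dense pair among uncovered vertices would give a new tile without any
      cutting.\<close>
    have LL: "real (ecard E Lv Lv) < e / 8 * d * real (card Lv)"
    proof (rule ccontr)
      assume "~ ?thesis"
      then have "e / 8 * d * real (card Lv) <= real (card (E Int Lv \<times> Lv))" by (simp add: ecard_def)
      then have "~ no_dense E Lv (a * d) \<eta>" using ndp[of Lv] L0 LvT(2) by (metis card.empty of_nat_0 less_irrefl)
      then obtain X Y where XY: "X \<subseteq> Lv" "Y \<subseteq> Lv" "X Int Y = {}" "a * d <= real (card X)" "a * d <= real (card Y)"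
        "\<eta> * real (card X) * real (card Y) <= real (ecard E X Y)" by (auto simp: no_dense_def not_less)
      have fXY: "finite X" "finite Y" using XY(1,2) fT(2) finite_subset by auto
      have "\<theta> * (real (card X) * real (card Y)) <= \<eta> * (real (card X) * real (card Y))" using \<theta>(3) by (intro mult_right_mono) auto
      then have "\<theta> * real (card X) * real (card Y) <= real (ecard E X Y)" using XY(6) by (simp add: mult.assoc)
      moreover have "real (r * q ^ T0) <= real (card X)" "real (r * q ^ T0) <= real (card Y)" using sz(1) XY(4,5) by linarith+
      ultimately have "\<exists>X'\<subseteq>X. \<exists>Y'\<subseteq>Y. \<exists>m\<ge>r. card X' = q * m & card Y' = q * m & q * m <= r * q ^ T0 & joined E m (\<theta> / 2) X' Y'"
        by (intro pair fXY) (simp_all only: of_nat_le_iff)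
      then obtain X' Y' m where X': "X' \<subseteq> X" "Y' \<subseteq> Y" "r <= m" "card X' = q * m" "card Y' = q * m" "q * m <= r * q ^ T0" "joined E m (\<theta> / 2) X' Y'"
        by (elim exE conjE) (rule that)
      have sub: "tsup (X', Y', m) \<subseteq> Lv" using X'(1,2) XY(1,2) by (auto simp: tsup_def)
      show False
      proof (rule add_new[of s "(X', Y', m)"])
        show "istile E V \<rho> q (real r) (X', Y', m)" using X' XY LvT(2) by (intro newt) auto
        show "tsup (X', Y', m) Int (\<Union>n\<in>N. tsup n) = {}" using sub LvT by (auto simp: TT_def)
        show "tsup (X', Y', m) Int osup s t = {}" if "t \<in> F0" for t using sub LvT(1) that by (auto simp: TT_def)
        show "card (fst (X', Y', m)) <= M" using X'(4,6) by (simp add: M_def)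
      qed (use S lt in auto)
    qed
    \<comment> \<open>Saturated tiles: one more cut could exceed the allowance of
      \<open>e / 8\<close>. They are few, because cuts are paid for by new tiles.\<close>
    define sat where "sat = {t \<in> F0. e * real (card (fst t)) < 8 * real (min (cA s t) (cB s t) + M)}"
    have tl: "2 * q * snd (snd t) <= card (fst t)" "g0 <= real (card (fst t))" if "t \<in> F0" for t
    proof -
      note I = istileD[OF F(2)[OF that]]
      show 1: "2 * q * snd (snd t) <= card (fst t)" by (rule I(5))
      have "1 * snd (snd t) <= 2 * q * snd (snd t)" using q by (intro mult_le_mono1) auto
      then have "snd (snd t) <= card (fst t)" using 1 by linarith
    then have "real (snd (snd t)) <= real (card (fst t))" by (simp only: of_nat_le_iff)
      then show "g0 <= real (card (fst t))" using I(7) by linarith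
    qed
    have Mt: "32 * real M <= e * real (card (fst t))" if "t \<in> F0" for t
    proof -
      have "e * g0 <= e * real (card (fst t))" using tl(2)[OF that] e by (intro mult_left_mono) auto
      then show ?thesis using sz(4) by (simp add: M_def)
    qed
    \<comment> \<open>Only the less trimmed side is offered for cutting, which keeps the imbalance
      at most \<open>M\<close>.\<close>
    have side: "real (ecard E X Lv) <= \<theta> * real (card X) * real (card Lv)"
      if t: "t \<in> F0" "t \<notin> sat" and X: "X = fst (s t) & cA s t <= cB s t | X = snd (s t) & cB s t <= cA s t" for t X
    proof (rule ccontr)
      assume "~ ?thesis"
      then have dn: "\<theta> * real (card X) * real (card Lv) <= real (ecard E X Lv)" by simp
      have fX: "finite X" using X fins[OF t(1)] by auto
      have XT: "X \<subseteq> osup s t" using X by (auto simp: osup_def)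
      have "real M <= real (card X)"
      proof -
        have "real (card (fst t)) <= real (card X) + real (max (cA s t) (cB s t))" using X ceq[OF t(1)] by auto
        moreover have "8 * real (max (cA s t) (cB s t)) <= e * real (card (fst t))" using S(3,4)[OF t(1)] by (simp add: max_def)
        moreover have "e * real (card (fst t)) <= 1 * real (card (fst t))" using e by (intro mult_right_mono) auto
        ultimately show ?thesis using Mt[OF t(1)] by linarith
      qed
      then have MX: "r * q ^ T0 <= card X" by (simp only: M_def of_nat_le_iff)
      obtain X' Y' m where X': "X' \<subseteq> X" "Y' \<subseteq> Lv" "r <= m" "card X' = q * m" "card Y' = q * m" "q * m <= r * q ^ T0" "joined E m (\<theta> / 2) X' Y'"
        using pair[OF fX fT(2) MX LM[unfolded M_def] dn] by (elim exE conjE) (rule that)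
      define s' where "s' = s(t := (fst (s t) - X', snd (s t) - X'))"
      have tO: "osup s t \<subseteq> TT" using t(1) by (auto simp: TT_def)
      have dAB: "fst (s t) Int snd (s t) = {}" using S(1,2)[OF t(1)] istileD(3)[OF F(2)[OF t(1)]] by blast
      have X'M: "card X' <= M" using X'(4,6) by (simp add: M_def)
      have fX': "finite X'" using X'(1) fX finite_subset by auto
      have ns: "8 * real (min (cA s t) (cB s t) + M) <= e * real (card (fst t))" using t by (auto simp: sat_def)
      have oth: "cA s' t' = cA s t'" "cB s' t' = cB s t'" "s' t' = s t'" if "t' ~= t" for t' using that by (auto simp: s'_def cA_def cB_def)
      have new: "8 * real (cA s' t) <= e * real (card (fst t)) & 8 * real (cB s' t) <= e * real (card (fst t)) &
        cA s' t <= cB s' t + M & cB s' t <= cA s' t + M & cA s' t + cB s' t = cA s t + cB s t + card X'"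
        using X
      proof
        assume x: "X = fst (s t) & cA s t <= cB s t"
        have "snd (s t) - X' = snd (s t)" using X'(1) x dAB by auto
        then have 1: "cB s' t = cB s t" by (simp add: s'_def cB_def)
        have "card (fst (s t) - X') = card (fst (s t)) - card X'" using x X'(1) fX' by (intro card_Diff_subset) auto
        moreover have "card X' <= card (fst (s t))" using x X'(1) fX by (intro card_mono) auto
        ultimately have 2: "cA s' t = cA s t + card X'" using ceq(1)[OF t(1)] by (simp add: s'_def cA_def)
        show ?thesis using 1 2 X'M x S(3-6)[OF t(1)] ns by auto
      next
        assume x: "X = snd (s t) & cB s t <= cA s t"
        have "fst (s t) - X' = fst (s t)" using X'(1) x dAB by auto
        then have 1: "cA s' t = cA s t" by (simp add: s'_def cA_def)
        have "card (snd (s t) - X') = card (snd (s t)) - card X'" using x X'(1) fX' by (intro card_Diff_subset) auto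
        moreover have "card X' <= card (snd (s t))" using x X'(1) fX by (intro card_mono) auto
        ultimately have 2: "cB s' t = cB s t + card X'" using ceq(2)[OF t(1)] by (simp add: s'_def cB_def)
        show ?thesis using 1 2 X'M x S(3-6)[OF t(1)] ns by auto
      qed
      have X'O: "X' \<subseteq> osup s t" using X'(1) XT by auto
      have s'sub: "osup s' t' \<subseteq> osup s t'" for t' by (auto simp: s'_def osup_def)
      have odis: "osup s t Int osup s t' = {}" if "t' \<in> F0" "t' ~= t" for t'
        using F(3)[OF t(1) that(1)] that(2) osub(1)[OF t(1)] osub(1)[OF that(1)] by blast
      show False
      proof (rule add_new[of s' "(X', Y', m)"])
        show "\<forall>t\<in>F0. fst (s' t) \<subseteq> fst (s t) & snd (s' t) \<subseteq> snd (s t) &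
          8 * real (cA s' t) <= e * real (card (fst t)) & 8 * real (cB s' t) <= e * real (card (fst t)) &
          cA s' t <= cB s' t + M & cB s' t <= cA s' t + M"
        proof
          fix t' assume t': "t' \<in> F0"
          show "fst (s' t') \<subseteq> fst (s t') & snd (s' t') \<subseteq> snd (s t') &
            8 * real (cA s' t') <= e * real (card (fst t')) & 8 * real (cB s' t') <= e * real (card (fst t')) &
            cA s' t' <= cB s' t' + M & cB s' t' <= cA s' t' + M"
          proof (cases "t' = t")
            case True
            have "fst (s' t) \<subseteq> fst (s t)" "snd (s' t) \<subseteq> snd (s t)" by (auto simp: s'_def)
            then show ?thesis using new True by auto
          next
            case False
            then show ?thesis using S(3-6)[OF t'] by (simp only: oth[OF False] subset_refl simp_thms)
          qed
        qed
        show "istile E V \<rho> q (real r) (X', Y', m)" proof (rule newt)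
          show "X' \<subseteq> V" "Y' \<subseteq> V" using X'(1,2) XT tO TV LvT(2) by auto
          show "X' Int Y' = {}" using X'(1,2) XT tO LvT(1) by blast
        qed (use X' in auto)
        show "tsup (X', Y', m) Int (\<Union>n\<in>N. tsup n) = {}"
        proof -
          have "X' Int (\<Union>n\<in>N. tsup n) = {}" using X'O Nd[OF _ t(1)] by blast
          moreover have "Y' Int (\<Union>n\<in>N. tsup n) = {}" using X'(2) LvT(1) by (auto simp: TT_def)
          ultimately show ?thesis by (auto simp: tsup_def)
        qed
        show "tsup (X', Y', m) Int osup s' t' = {}" if t': "t' \<in> F0" for t'
        proof -
          have "osup s t' \<subseteq> TT" using t' by (auto simp: TT_def)
          then have "Y' Int osup s' t' = {}" using X'(2) LvT(1) s'sub[of t'] by blast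
          moreover have "X' Int osup s' t' = {}"
          proof (cases "t' = t")
            case True then show ?thesis by (auto simp: s'_def osup_def)
          next
            case False then show ?thesis using odis[OF t' False] X'O s'sub[of t'] by blast
          qed
          ultimately show ?thesis by (auto simp: tsup_def)
        qed
        show "(\<Sum>t\<in>F0. cA s' t + cB s' t) <= (\<Sum>t\<in>F0. cA s t + cB s t) + card (fst (X', Y', m))"
        proof -
          have "(\<Sum>t\<in>F0. cA s' t + cB s' t) = (cA s' t + cB s' t) + (\<Sum>t\<in>F0 - {t}. cA s' t + cB s' t)" using F(1) t(1) by (rule sum.remove)
          also have "(\<Sum>t\<in>F0 - {t}. cA s' t + cB s' t) = (\<Sum>t\<in>F0 - {t}. cA s t + cB s t)" using oth by (intro sum.cong) auto
          also have "(cA s' t + cB s' t) + \<dots> = (cA s t + cB s t) + (\<Sum>t\<in>F0 - {t}. cA s t + cB s t) + card X'" using new by linarith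
          also have "(cA s t + cB s t) + (\<Sum>t\<in>F0 - {t}. cA s t + cB s t) = (\<Sum>t\<in>F0. cA s t + cB s t)" using F(1) t(1) by (rule sum.remove[symmetric])
          finally show ?thesis by simp
        qed
        show "card (fst (X', Y', m)) <= M" using X'M by simp
      qed (rule lt)
    qed
    define L where "L = real (card Lv)"
    have tb: "real (ecard E (osup s t) Lv) <= L * ((1 + \<theta>) * real (card (fst t)) + (if t \<in> sat then real (card (fst t)) else 0))" if t: "t \<in> F0" for t
    proof -
      have dAB: "fst (s t) Int snd (s t) = {}" using S(1,2)[OF t] istileD(3)[OF F(2)[OF t]] by blast
      have "ecard E (osup s t) Lv = ecard E (fst (s t)) Lv + ecard E (snd (s t)) Lv" unfolding osup_def using fins[OF t] fT(2) dAB by (intro ecard_Un1)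
      then have sp: "real (ecard E (osup s t) Lv) = real (ecard E (fst (s t)) Lv) + real (ecard E (snd (s t)) Lv)" by simp
      have tr: "real (ecard E X Lv) <= L * real (card (fst t))" if "finite X" "card X <= card (fst t)" for X
      proof -
        have "ecard E X Lv <= card X * card Lv" by (rule ecard_le[OF that(1) fT(2)])
        also have "\<dots> <= card (fst t) * card Lv" using that(2) by (rule mult_le_mono1)
        finally have "real (ecard E X Lv) <= real (card (fst t) * card Lv)" by (simp only: of_nat_le_iff)
        then show ?thesis by (simp add: L_def mult.commute)
      qed
      note tA = tr[OF fins(3)[OF t] cle(1)[OF t]] and tB = tr[OF fins(4)[OF t] cle(2)[OF t]]
      have p: "0 <= \<theta> * (L * real (card (fst t)))" using \<theta>(1) by (simp add: L_def)
      show ?thesis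
      proof (cases "t \<in> sat")
        case True
        then show ?thesis using sp tA tB p by (simp add: algebra_simps)
      next
        case False
        have up: "\<theta> * real (card X) * real (card Lv) <= \<theta> * (L * real (card (fst t)))" if "card X <= card (fst t)" for X :: "'a set"
        proof -
          have "real (card X) * L <= real (card (fst t)) * L" using that by (intro mult_right_mono) (auto simp: L_def)
          then have "\<theta> * (real (card X) * L) <= \<theta> * (real (card (fst t)) * L)" using \<theta>(1) by (intro mult_left_mono) auto
          then show ?thesis by (simp only: L_def mult.assoc mult.commute[of "real (card (fst t))"])
        qed
        show ?thesis
        proof (cases "cA s t <= cB s t")
          case True
          then have "real (ecard E (fst (s t)) Lv) <= \<theta> * real (card (fst (s t))) * real (card Lv)" by (intro side[OF t False]) auto
          then show ?thesis using sp tB up[OF cle(1)[OF t]] False by (simp add: algebra_simps)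
        next
          case f: False
          then have "real (ecard E (snd (s t)) Lv) <= \<theta> * real (card (snd (s t))) * real (card Lv)" by (intro side[OF t False]) auto
          then show ?thesis using sp tA up[OF cle(2)[OF t]] False by (simp add: algebra_simps)
        qed
      qed
    qed
    have satb: "3 * e * (\<Sum>t\<in>sat. real (card (fst t))) <= 32 * (x * d)"
    proof -
      have "3 * e * (\<Sum>t\<in>sat. real (card (fst t))) = (\<Sum>t\<in>sat. 3 * e * real (card (fst t)))" by (simp add: sum_distrib_left)
      also have "\<dots> <= (\<Sum>t\<in>sat. 16 * (real (cA s t + cB s t)))"
      proof (rule sum_mono)
        fix t assume "t \<in> sat"
        then have t: "t \<in> F0" "e * real (card (fst t)) < 8 * real (min (cA s t) (cB s t) + M)" by (auto simp: sat_def)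
        have "2 * real (min (cA s t) (cB s t)) <= real (cA s t + cB s t)" by (simp add: min_def)
        then show "3 * e * real (card (fst t)) <= 16 * (real (cA s t + cB s t))" using t(2) Mt[OF t(1)] by (simp add: mult.assoc)
      qed
      also have "\<dots> = 16 * (\<Sum>t\<in>sat. (real (cA s t + cB s t)))" by (simp only: sum_distrib_left)
      also have "(\<Sum>t\<in>sat. (real (cA s t + cB s t))) <= (\<Sum>t\<in>F0. (real (cA s t + cB s t)))" using F(1) by (intro sum_mono2) (auto simp: sat_def)
      also have "\<dots> = real (\<Sum>t\<in>F0. cA s t + cB s t)" by simp
      also have "\<dots> <= real (cov N)" using cut by (simp only: of_nat_le_iff)
      finally show ?thesis using lt by linarith
    qed
    \<comment> \<open>The factor \<open>1 + \<theta>\<close> in place of 2 expresses that at most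
      one side of an unsaturated tile sends many edges to the uncovered part.\<close>
    have TL: "real (ecard E TT Lv) <= L * ((1 + \<theta>) * real (cov F0) + (\<Sum>t\<in>sat. real (card (fst t))) + 2 * real (cov N))"
    proof -
      have uni: "real (ecard E (\<Union>i\<in>I. f i) Lv) <= (\<Sum>i\<in>I. real (ecard E (f i) Lv))" if "finite I" "!!i. i \<in> I ==> finite (f i)" for I :: "'a tile set" and f
      proof -
        have eq: "E Int (\<Union>i\<in>I. f i) \<times> Lv = (\<Union>i\<in>I. E Int f i \<times> Lv)" by auto
        have "ecard E (\<Union>i\<in>I. f i) Lv <= (\<Sum>i\<in>I. ecard E (f i) Lv)" unfolding ecard_def eq by (rule card_UN_le[OF that(1)])
        then show ?thesis by (metis of_nat_le_iff of_nat_sum)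
      qed
      have fO: "finite (\<Union>t\<in>F0. osup s t)" "finite (\<Union>n\<in>N. tsup n)" using fT(1) by (auto simp: TT_def)
      have "ecard E TT Lv <= ecard E (\<Union>t\<in>F0. osup s t) Lv + ecard E (\<Union>n\<in>N. tsup n) Lv"
        unfolding TT_def ecard_commute[OF fV(3), of _ Lv] by (rule ecard_Un_le[OF fT(2) fO])
      then have 1: "real (ecard E TT Lv) <= real (ecard E (\<Union>t\<in>F0. osup s t) Lv) + real (ecard E (\<Union>n\<in>N. tsup n) Lv)" by linarith
      have "ecard E (\<Union>n\<in>N. tsup n) Lv <= card (\<Union>n\<in>N. tsup n) * card Lv" by (rule ecard_le[OF fO(2) fT(2)])
      then have "real (ecard E (\<Union>n\<in>N. tsup n) Lv) <= real (2 * cov N * card Lv)" unfolding cN by (simp only: of_nat_le_iff)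
      then have 2: "real (ecard E (\<Union>n\<in>N. tsup n) Lv) <= L * (2 * real (cov N))" by (simp add: L_def mult.commute)
      have "real (ecard E (\<Union>t\<in>F0. osup s t) Lv) <= (\<Sum>t\<in>F0. real (ecard E (osup s t) Lv))" by (rule uni) (use F(1) fins in \<open>auto simp: osup_def\<close>)
      also have "\<dots> <= (\<Sum>t\<in>F0. L * ((1 + \<theta>) * real (card (fst t)) + (if t \<in> sat then real (card (fst t)) else 0)))" by (rule sum_mono) (rule tb)
      also have "\<dots> = L * ((1 + \<theta>) * (\<Sum>t\<in>F0. real (card (fst t))) + (\<Sum>t\<in>F0. if t \<in> sat then real (card (fst t)) else 0))"
        by (simp only: sum_distrib_left sum.distrib distrib_left)
      also have "(\<Sum>t\<in>F0. if t \<in> sat then real (card (fst t)) else 0) = (\<Sum>t\<in>F0 Int {t. t \<in> sat}. real (card (fst t)))" using F(1) by (simp add: sum.If_cases)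
      also have "F0 Int {t. t \<in> sat} = sat" by (auto simp: sat_def)
      also have "(\<Sum>t\<in>F0. real (card (fst t))) = real (cov F0)" by (simp add: cov_def)
      finally show ?thesis using 1 2 unfolding distrib_left by linarith
    qed
    have tot: "real (card E) <= real (ecard E Lv Lv) + 2 * real (ecard E TT Lv) + real (card TT) * real (card TT)"
    proof -
      have VV: "V = Lv Un TT" using TV by (auto simp: Lv_def)
      have "card E = ecard E V V" using fV(5) by (simp add: ecard_def Int_absorb2)
      also have "\<dots> = ecard E Lv V + ecard E TT V" by (subst VV) (rule ecard_Un1[OF fT(2,1) fV(1) LvT(1)])
      also have "ecard E Lv V = ecard E Lv Lv + ecard E Lv TT" by (subst VV) (rule ecard_Un2[OF fT(2) fT(2,1) LvT(1)])
      also have "ecard E TT V = ecard E TT Lv + ecard E TT TT" by (subst VV) (rule ecard_Un2[OF fT(1) fT(2,1) LvT(1)])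
      also have "ecard E Lv TT = ecard E TT Lv" by (rule ecard_commute[OF fV(3)])
      finally have "real (card E) = real (ecard E Lv Lv) + 2 * real (ecard E TT Lv) + real (ecard E TT TT)" by simp
      moreover have "real (ecard E TT TT) <= real (card TT) * real (card TT)" using ecard_le[OF fT(1) fT(1), of E] by (metis of_nat_le_iff of_nat_mult)
      ultimately show ?thesis by simp
    qed
    define c where "c = (1 + \<theta>) * real (cov F0) + (\<Sum>t\<in>sat. real (card (fst t))) + 2 * real (cov N)"
    have TT2: "real (card TT) * real (card TT) <= (1 - e / 8) * d * real (card TT)"
    proof -
      have "(4 * x) * d <= (e / 64) * d" using x4 d by (intro mult_right_mono) auto
      moreover have "0 <= e * d" using e d by simp
      ultimately have "real (card TT) <= (1 - e / 8) * d" using \<tau> by (simp add: algebra_simps)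
      then show ?thesis by (intro mult_right_mono) auto
    qed
    \<comment> \<open>The covered vertices are too few to reach average degree
      \<open>(1 - e / 8) * d\<close> among themselves, so the deficit falls on the uncovered
      ones.\<close>
    have "(1 - e / 8) * d * L + (1 - e / 8) * d * real (card TT) <= e / 8 * d * L + 2 * (L * c) + (1 - e / 8) * d * real (card TT)"
      using dens tot LL TL TT2 unfolding VLT L_def[symmetric] c_def[symmetric] distrib_left by linarith
    then have "((1 - e / 8) * d) * L <= (e / 8 * d + 2 * c) * L" by (simp add: algebra_simps)
    then have "(1 - e / 8) * d <= e / 8 * d + 2 * c" using L0 unfolding L_def by (rule mult_right_le_imp_le)
    moreover have "2 * c <= (1 - e) * d + e / 32 * d + e / 12 * d + 8 * x * d"
    proof -
      have "2 * ((1 + \<theta>) * real (cov F0)) <= (1 - e) * d + e / 32 * d"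
      proof -
        have "2 * ((1 + \<theta>) * real (cov F0)) = (1 + \<theta>) * (2 * real (cov F0))" by simp
        also have "\<dots> <= (1 + e / 32) * ((1 - e) * d)"
          proof (rule mult_mono)
            show "2 * real (cov F0) <= (1 - e) * d" using F0(2) by simp
          qed (use \<theta>(1,2) e in auto)
        also have "\<dots> = (1 - e) * d + e / 32 * ((1 - e) * d)" by (simp add: algebra_simps)
        also have "e / 32 * ((1 - e) * d) <= e / 32 * d" using e d by (intro mult_left_mono) (auto simp: algebra_simps)
        finally show ?thesis by simp
      qed
      moreover have "2 * (\<Sum>t\<in>sat. real (card (fst t))) <= e / 12 * d"
      proof -
        have "e * (3 * (\<Sum>t\<in>sat. real (card (fst t)))) <= e * (e / 8 * d)" using satb by (simp add: x_def power2_eq_square algebra_simps)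
        then have "3 * (\<Sum>t\<in>sat. real (card (fst t))) <= e / 8 * d" using e by simp
        then show ?thesis by simp
      qed
      ultimately show ?thesis using lt unfolding c_def distrib_left by linarith
    qed
    moreover have "8 * x * d <= e / 32 * d" using x4 d by (intro mult_right_mono) auto
    moreover have "0 < e * d" using e d by simp
    ultimately show False by (simp add: algebra_simps)
  qed
  \<comment> \<open>Both sides are cut to the smaller remaining size.\<close>
  define k where "k t = card (fst t) - max (cA s t) (cB s t)" for t
  have kc: "k t <= card (fst (s t))" "k t <= card (snd (s t))" if "t \<in> F0" for t using ceq[OF that] by (auto simp: k_def)
  have "\<forall>t\<in>F0. \<exists>A B. A \<subseteq> fst (s t) & B \<subseteq> snd (s t) & card A = k t & card B = k t"
    using kc by (meson obtain_subset_with_card_n)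
  then obtain A B where AB: "!!t. t \<in> F0 ==> A t \<subseteq> fst (s t) & B t \<subseteq> snd (s t) & card (A t) = k t & card (B t) = k t" by metis
  define tr where "tr t = (A t, B t, snd (snd t))" for t
  have tl: "2 * q * snd (snd t) <= card (fst t)" "g0 <= real (card (fst t))" if "t \<in> F0" for t
  proof -
    note I = istileD[OF F(2)[OF that]]
    show 1: "2 * q * snd (snd t) <= card (fst t)" by (rule I(5))
    have "1 * snd (snd t) <= 2 * q * snd (snd t)" using q by (intro mult_le_mono1) auto
    then have "snd (snd t) <= card (fst t)" using 1 by linarith
    then have "real (snd (snd t)) <= real (card (fst t))" by (simp only: of_nat_le_iff)
    then show "g0 <= real (card (fst t))" using I(7) by linarith
  qed
  have k2: "card (fst t) <= 2 * k t" if "t \<in> F0" for t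
  proof -
    have "e * real (card (fst t)) <= 1 * real (card (fst t))" using e by (intro mult_right_mono) auto
    then have "8 * real (max (cA s t) (cB s t)) <= real (card (fst t))" using S(3,4)[OF that] by (simp add: max_def)
    then have "8 * max (cA s t) (cB s t) <= card (fst t)" by linarith
    then show ?thesis by (simp add: k_def)
  qed
  have tr1: "istile E V \<rho> q (min g0 (real r)) (tr t)" if t: "t \<in> F0" for t
  proof -
    note I = istileD[OF F(2)[OF t]] and ab = AB[OF t] and s = S(1,2)[OF t]
    have sub: "A t \<subseteq> fst t" "B t \<subseteq> fst (snd t)" using ab s by auto
    have "q * snd (snd t) <= k t" using k2[OF t] tl(1)[OF t] by linarith
    then show ?thesis unfolding istile_def tr_def using I sub ab joined_subset[OF I(8) sub] by (auto simp: min_le_iff_disj)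
  qed
  have trs: "tsup (tr t) \<subseteq> osup s t" if "t \<in> F0" for t using AB[OF that] by (auto simp: tsup_def tr_def osup_def)
  have q1: "1 <= q" using q by simp
  define J where "J = F0 <+> N"
  define u where "u = case_sum tr (%n. n)"
  have fJ: "finite J" using F(1) Nf(1) by (simp add: J_def)
  have uJ: "istile E V \<rho> q (min g0 (real r)) (u j)" if "j \<in> J" for j
    proof (cases j)
    case (Inl t)
    then have "t \<in> F0" using that by (auto simp: J_def)
    then show ?thesis using Inl tr1 by (simp add: u_def)
  next
    case (Inr n)
    then have "n \<in> N" using that by (auto simp: J_def)
    then have "istile E V \<rho> q (min g0 (real r)) n" using Nf(2)[of n] by (simp add: istile_def min.coboundedI2 split: prod.splits)
    then show ?thesis using Inr by (simp add: u_def)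
  qed
  have ud: "tsup (u i) Int tsup (u j) = {}" if "i \<in> J" "j \<in> J" "i ~= j" for i j
  proof -
    have 1: "tsup (tr t) Int tsup (tr t') = {}" if "t \<in> F0" "t' \<in> F0" "t ~= t'" for t t'
      using F(3)[OF that] trs[OF that(1)] trs[OF that(2)] osub(1)[OF that(1)] osub(1)[OF that(2)] by blast
    have 2: "tsup (tr t) Int tsup n = {}" if "t \<in> F0" "n \<in> N" for t n using Nd[OF that(2,1)] trs[OF that(1)] by blast
    have 3: "tsup n Int tsup (tr t) = {}" if "t \<in> F0" "n \<in> N" for t n using 2[OF that] by (simp only: Int_commute)
    show ?thesis 
    proof -
      have e: "Inl t \<in> J \<longleftrightarrow> t \<in> F0" "Inr n \<in> J \<longleftrightarrow> n \<in> N" for t n by (auto simp: J_def)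
      show ?thesis using that 1 2 3 Nf(3) unfolding u_def by (cases i; cases j) (simp_all only: e sum.case sum.inject simp_thms)
    qed
  qed
  have "tfam E V \<rho> q (min g0 (real r)) (u ` J)" "cov (u ` J) = (\<Sum>j\<in>J. card (fst (u j)))"
    using tfam_image[OF fJ uJ ud q1] by auto
  \<comment> \<open>Equalising costs half of the vertices cut plus at most \<open>M / 2\<close> per
    tile, while the new tiles gain \<open>cov N\<close>. Old tiles have sides of at least
    \<open>g0\<close>, so there are at most \<open>d / g0\<close> of them and the
    \<open>M / 2\<close> terms sum to at most \<open>x * d / 2\<close>.\<close>
  moreover have "real (cov F0) + e ^ 2 / 512 * d <= real (\<Sum>j\<in>J. card (fst (u j)))"
  proof -
    have "(\<Sum>j\<in>J. card (fst (u j))) = (\<Sum>t\<in>F0. card (fst (tr t))) + (\<Sum>n\<in>N. card (fst n))"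
      unfolding J_def by (subst sum.Plus[OF F(1) Nf(1)]) (simp add: u_def)
    also have "(\<Sum>n\<in>N. card (fst n)) = cov N" by (simp add: cov_def)
    also have "(\<Sum>t\<in>F0. card (fst (tr t))) = (\<Sum>t\<in>F0. k t)" using AB by (intro sum.cong) (auto simp: tr_def)
    finally have eq: "real (\<Sum>j\<in>J. card (fst (u j))) = (\<Sum>t\<in>F0. real (k t)) + real (cov N)" by simp
    have "(\<Sum>t\<in>F0. 2 * real (card (fst t)) - real (cA s t + cB s t) - real M) <= (\<Sum>t\<in>F0. 2 * real (k t))"
    proof (rule sum_mono)
      fix t assume t: "t \<in> F0"
      have "card (fst t) = k t + max (cA s t) (cB s t)" using ceq[OF t] by (auto simp: k_def max_def)
      moreover have "2 * max (cA s t) (cB s t) <= cA s t + cB s t + M" using S(5,6)[OF t] by auto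
      ultimately have "2 * card (fst t) <= 2 * k t + (cA s t + cB s t) + M" by linarith
      then show "2 * real (card (fst t)) - real (cA s t + cB s t) - real M <= 2 * real (k t)" by linarith
    qed
    then have "2 * (\<Sum>t\<in>F0. real (card (fst t))) - (\<Sum>t\<in>F0. real (cA s t + cB s t)) - real (card F0) * real M <= 2 * (\<Sum>t\<in>F0. real (k t))"
      by (simp only: sum_subtractf sum_distrib_left sum_constant)
    moreover have "(\<Sum>t\<in>F0. real (card (fst t))) = real (cov F0)" by (simp add: cov_def)
    moreover have "(\<Sum>t\<in>F0. real (cA s t + cB s t)) <= real (cov N)" using cut by (metis of_nat_le_iff of_nat_sum)
    moreover have "real (card F0) * real M <= x * d"
    proof -
      have "real (card F0) * g0 <= (\<Sum>t\<in>F0. real (card (fst t)))" using sum_mono[of F0 "%_. g0" "%t. real (card (fst t))"] tl(2) by simp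
      also have "\<dots> = real (cov F0)" by (simp add: cov_def)
      also have "\<dots> <= d"
      proof -
        have "(1 - e) * d <= 1 * d" using e d by (intro mult_right_mono) auto
        then show ?thesis using F0(2) by linarith
      qed
      finally have "real (card F0) * g0 <= d" .
      then have "x * (real (card F0) * g0) <= x * d" using x0 by (intro mult_left_mono) auto
      moreover have "real M <= x * g0" using sz(5) d by (simp add: M_def x_def mult.commute mult.left_commute)
      then have "real (card F0) * real M <= real (card F0) * (x * g0)" by (intro mult_left_mono) auto
      ultimately show ?thesis by (simp add: mult.left_commute)
    qed
    moreover have "e ^ 2 / 512 * d = x * d / 2" by (simp add: x_def)
    ultimately show ?thesis using eq big x0 d by linarith
  qed
  ultimately show ?thesis by (intro exI[of _ "u ` J"]) simp
qed

text \<open>\<open>j\<close> rounds, each adding \<open>e ^ 2 / 256 * d\<close> covered vertices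
  until \<open>(1 - e) * d\<close> is reached. A round may halve the ratio of side to scale, so it
  starts from a family for \<open>2 * q\<close>; hence the quantifier over \<open>q\<close> inside
  the induction.\<close>

theorem tile_family:
  fixes e \<eta> a :: real
  assumes e: "0 < e" "e < 1" and \<eta>: "0 < \<eta>" and a: "0 < a"
  shows "\<forall>q\<ge>2. \<exists>\<gamma>>0. \<exists>d0. \<forall>V (E :: ('a \<times> 'a) set) d. sgr V E --> V ~= {} --> d0 <= d --> (1 - e / 8) * d * real (card V) <= real (card E) -->
    (\<forall>U. U \<subseteq> V --> U ~= {} --> e / 8 * d * real (card U) <= real (card (E Int U \<times> U)) --> ~ no_dense E U (a * d) \<eta>) -->
    (\<exists>F. tfam E V (min (e / 32) \<eta> / 2) q (\<gamma> * d) F & min ((1 - e) * d) (real j * (e ^ 2 / 256) * d) <= 2 * real (cov F))"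
proof (induction j)
  case 0
  show ?case
  proof (intro allI impI)
    fix q :: nat assume "2 <= q"
    show "\<exists>\<gamma>>0. \<exists>d0. \<forall>V (E :: ('a \<times> 'a) set) d. sgr V E --> V ~= {} --> d0 <= d --> (1 - e / 8) * d * real (card V) <= real (card E) -->
      (\<forall>U. U \<subseteq> V --> U ~= {} --> e / 8 * d * real (card U) <= real (card (E Int U \<times> U)) --> ~ no_dense E U (a * d) \<eta>) -->
      (\<exists>F. tfam E V (min (e / 32) \<eta> / 2) q (\<gamma> * d) F & min ((1 - e) * d) (real 0 * (e ^ 2 / 256) * d) <= 2 * real (cov F))"
      by (rule exI[of _ 1], simp, intro exI[of _ 0] allI impI exI[of _ "{}"]) (auto simp: tfam_def cov_def)
  qed
next
  case (Suc j)
  show ?case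
  proof (intro allI impI)
    fix q :: nat assume q: "2 <= q"
    define \<theta> where "\<theta> = min (e / 32) \<eta>"
    have \<theta>: "0 < \<theta>" "\<theta> <= e / 32" "\<theta> <= \<eta>" using e \<eta> by (auto simp: \<theta>_def)
    obtain \<gamma>0 d00 where IH: "0 < \<gamma>0" "!!V (E :: ('a \<times> 'a) set) d. sgr V E ==> V ~= {} ==> d00 <= d ==> (1 - e / 8) * d * real (card V) <= real (card E) ==>
      (\<forall>U. U \<subseteq> V --> U ~= {} --> e / 8 * d * real (card U) <= real (card (E Int U \<times> U)) --> ~ no_dense E U (a * d) \<eta>) ==>
      (\<exists>F. tfam E V (min (e / 32) \<eta> / 2) (2 * q) (\<gamma>0 * d) F & min ((1 - e) * d) (real j * (e ^ 2 / 256) * d) <= 2 * real (cov F))"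
    proof -
      have "2 <= 2 * q" using q by simp
      from Suc.IH[rule_format, OF this] show thesis by (elim exE conjE) (rule that, assumption, blast)
    qed
    obtain T where T: "!!(E :: ('a \<times> 'a) set) X Y r. sym E ==> 0 < r ==> finite X ==> finite Y ==> r * q ^ T <= card X ==> r * q ^ T <= card Y
      ==> \<theta> * real (card X) * real (card Y) <= real (ecard E X Y)
      ==> \<exists>X'\<subseteq>X. \<exists>Y'\<subseteq>Y. \<exists>m\<ge>r. card X' = q * m & card Y' = q * m & q * m <= r * q ^ T & joined E m (\<theta> / 2) X' Y'"
      by (rule dense_pair_joined[OF q \<theta>(1)]) blast
    \<comment> \<open>New tiles are chosen small compared with the scale of the old ones, as the
      last conditions of \<open>tile_round\<close> require.\<close>
    define c0 where "c0 = min (min a (e / 64)) (min (e / 32 * \<gamma>0) (e ^ 2 / 256 * \<gamma>0))"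
    have c00: "0 < c0" using a e IH(1) by (simp add: c0_def)
    have c01: "c0 <= a" "c0 <= e / 64" "c0 <= e / 32 * \<gamma>0" "c0 <= e ^ 2 / 256 * \<gamma>0" by (auto simp: c0_def)
    define Q where "Q = real (q ^ T)"
    have Q: "0 < Q" using q by (simp add: Q_def)
    define c where "c = c0 / Q"
    have c: "0 < c" using c00 Q by (simp add: c_def)
    define \<gamma> where "\<gamma> = min \<gamma>0 (c / 2)"
    define dd where "dd = max (max d00 1) (2 / c)"
    have main: "\<exists>F. tfam E V (min (e / 32) \<eta> / 2) q (\<gamma> * d) F & min ((1 - e) * d) (real (Suc j) * (e ^ 2 / 256) * d) <= 2 * real (cov F)"
      if G: "sgr V E" and Vne: "V ~= {}" and dd: "dd <= d" and dens: "(1 - e / 8) * d * real (card V) <= real (card E)"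
        and ndp: "\<forall>U. U \<subseteq> V --> U ~= {} --> e / 8 * d * real (card U) <= real (card (E Int U \<times> U)) --> ~ no_dense E U (a * d) \<eta>"
      for V and E :: "('a \<times> 'a) set" and d
    proof -
      have d1: "d00 <= d" "1 <= d" "2 / c <= d" using dd by (auto simp: dd_def)
      have d0: "0 < d" using d1 by simp
      have cd: "2 <= c * d" using d1(3) c by (simp add: divide_le_eq mult.commute)
      obtain F0 where F0: "tfam E V (\<theta> / 2) (2 * q) (\<gamma>0 * d) F0" "min ((1 - e) * d) (real j * (e ^ 2 / 256) * d) <= 2 * real (cov F0)"
        using IH(2)[OF G Vne d1(1) dens ndp] unfolding \<theta>_def[symmetric] by (elim exE conjE) (rule that)
      have \<gamma>d: "\<gamma> * d <= \<gamma>0 * d" "\<gamma> * d <= c / 2 * d" using d0 by (auto simp: \<gamma>_def)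
      show ?thesis
      proof (cases "2 * real (cov F0) < (1 - e) * d")
        case False
        then show ?thesis using tfam_mono[OF F0(1), of q "\<gamma> * d"] \<gamma>d(1) unfolding \<theta>_def by (intro exI[of _ F0]) auto
      next
        case True
        define r where "r = nat \<lfloor>c * d\<rfloor>"
        have r1: "real r <= c * d" "c * d < real r + 1" using cd by (auto simp: r_def)
        have r0: "0 < r" using r1 cd by linarith
        have rQ: "real (r * q ^ T) <= c0 * d"
        proof -
          have "real r * Q <= (c * d) * Q" using r1(1) Q by (intro mult_right_mono) auto
          moreover have "(c * d) * Q = c0 * d" using Q by (simp add: c_def)
          moreover have "real (r * q ^ T) = real r * Q" by (simp add: Q_def)
          ultimately show ?thesis by linarith
        qed
        have rb: "real (r * q ^ T) <= y * d" if "c0 <= y" for y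
          using rQ mult_right_mono[OF that, of d] d0 by linarith
        have "\<exists>F1. tfam E V (\<theta> / 2) q (min (\<gamma>0 * d) (real r)) F1 & real (cov F0) + e ^ 2 / 512 * d <= real (cov F1)"
        proof (rule tile_round[OF G Vne e \<theta> refl q r0 _ dens d0 _ F0(1) True, where a = a and ?T0.0 = T])
          show "real (r * q ^ T) <= a * d" "real (r * q ^ T) <= e / 64 * d" by (rule rb[OF c01(1)], rule rb[OF c01(2)])
          show "0 < \<gamma>0 * d" using IH(1) d0 by simp
          show "real (r * q ^ T) <= e / 32 * (\<gamma>0 * d)" using rb[OF c01(3)] by (simp add: mult.assoc)
          have "real (r * q ^ T) <= e ^ 2 / 256 * \<gamma>0 * d" by (rule rb[OF c01(4)])
          then have "d * real (r * q ^ T) <= d * (e ^ 2 / 256 * \<gamma>0 * d)" using d0 by (intro mult_left_mono) auto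
          also have "\<dots> = e ^ 2 / 256 * d * (\<gamma>0 * d)" by (simp only: mult.assoc mult.commute mult.left_commute)
          finally show "d * real (r * q ^ T) <= e ^ 2 / 256 * d * (\<gamma>0 * d)" .
          show "\<exists>X'\<subseteq>X. \<exists>Y'\<subseteq>Y. \<exists>m\<ge>r. card X' = q * m & card Y' = q * m & q * m <= r * q ^ T & joined E m (\<theta> / 2) X' Y'"
            if "finite X" "finite Y" "r * q ^ T <= card X" "r * q ^ T <= card Y" "\<theta> * real (card X) * real (card Y) <= real (ecard E X Y)" for X Y
            by (rule T[OF sgr_finite(3)[OF G] r0 that])
          show "~ no_dense E U (a * d) \<eta>" if "U \<subseteq> V" "U ~= {}" "e / 8 * d * real (card U) <= real (card (E Int U \<times> U))" for U
            using ndp that by simp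
        qed
        then obtain F1 where F1: "tfam E V (\<theta> / 2) q (min (\<gamma>0 * d) (real r)) F1" "real (cov F0) + e ^ 2 / 512 * d <= real (cov F1)"
          by (elim exE conjE) (rule that)
        have "c / 2 * d <= real r" using r1 cd by simp
        then have "\<gamma> * d <= min (\<gamma>0 * d) (real r)" using \<gamma>d by simp
        then have "tfam E V (\<theta> / 2) q (\<gamma> * d) F1" using tfam_mono[OF F1(1), of q "\<gamma> * d"] by simp
        moreover have "min ((1 - e) * d) (real (Suc j) * (e ^ 2 / 256) * d) <= 2 * real (cov F1)"
        proof -
          have "real j * (e ^ 2 / 256) * d <= 2 * real (cov F0)" using F0(2) True by (simp add: min_le_iff_disj)
          moreover have "real (Suc j) * (e ^ 2 / 256) * d = real j * (e ^ 2 / 256) * d + 2 * (e ^ 2 / 512 * d)" by (simp add: algebra_simps)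
          ultimately show ?thesis using F1(2) by linarith
        qed
        ultimately show ?thesis unfolding \<theta>_def by blast
      qed
    qed
    have \<gamma>0: "0 < \<gamma>" using IH(1) c by (simp add: \<gamma>_def)
    show "\<exists>\<gamma>>0. \<exists>d0. \<forall>V (E :: ('a \<times> 'a) set) d. sgr V E --> V ~= {} --> d0 <= d --> (1 - e / 8) * d * real (card V) <= real (card E) -->
      (\<forall>U. U \<subseteq> V --> U ~= {} --> e / 8 * d * real (card U) <= real (card (E Int U \<times> U)) --> ~ no_dense E U (a * d) \<eta>) -->
      (\<exists>F. tfam E V (min (e / 32) \<eta> / 2) q (\<gamma> * d) F & min ((1 - e) * d) (real (Suc j) * (e ^ 2 / 256) * d) <= 2 * real (cov F))"
    proof (rule exI[of _ \<gamma>], rule conjI, rule \<gamma>0, rule exI[of _ dd], intro allI impI)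
      fix V and E :: "('a \<times> 'a) set" and d
      assume "sgr V E" "V ~= {}" "dd <= d" "(1 - e / 8) * d * real (card V) <= real (card E)"
        "\<forall>U. U \<subseteq> V --> U ~= {} --> e / 8 * d * real (card U) <= real (card (E Int U \<times> U)) --> ~ no_dense E U (a * d) \<eta>"
      then show "\<exists>F. tfam E V (min (e / 32) \<eta> / 2) q (\<gamma> * d) F & min ((1 - e) * d) (real (Suc j) * (e ^ 2 / 256) * d) <= 2 * real (cov F)" by (rule main)
    qed
  qed
qed

section \<open>Assembling the subdivision\<close>

lemma hub_le: "hub E U Q f ==> f' <= f ==> hub E U Q f'"
  unfolding hub_def by (intro ballI allI impI) (simp add: order_trans)

text \<open>A linkage of minimum total size: rerouting it through the reserve of one tile cannot shorten it.\<close>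

lemma lean_links:
  fixes U Q :: "'t => 'a set" and D0 :: "'j => 'a set"
  assumes s: "sym E" and fV: "finite V" and fJ: "finite J"
    and hb: "!!t. t \<in> T ==> hub E (U t) (Q t) f & Q t \<subseteq> U t & U t \<subseteq> V" and f: "5 * card J <= f"
    and D0: "!!j. j \<in> J ==> conn E (D0 j) & D0 j \<subseteq> V & z j \<in> D0 j & D0 j Int Y ~= {}"
      "!!i j. i \<in> J ==> j \<in> J ==> i ~= j ==> D0 i Int D0 j = {}"
  shows "\<exists>D. (\<forall>j\<in>J. conn E (D j) & D j \<subseteq> V & z j \<in> D j & D j Int Y ~= {}) & (\<forall>i\<in>J. \<forall>j\<in>J. i ~= j --> D i Int D j = {}) &
    (\<forall>t\<in>T. card ((\<Union>j\<in>J. D j) Int U t) <= 5 * card J)"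
proof -
  define ok where "ok D \<longleftrightarrow> (\<forall>j\<in>J. conn E (D j) & D j \<subseteq> V & z j \<in> D j & D j Int Y ~= {}) & (\<forall>i\<in>J. \<forall>j\<in>J. i ~= j --> D i Int D j = {})" for D
  have "ok D0" using D0 by (simp add: ok_def)
  from ex_has_least_nat[of ok D0 "%D. \<Sum>j\<in>J. card (D j)", OF this]
  obtain D where D: "ok D" "!!D'. ok D' ==> (\<Sum>j\<in>J. card (D j)) <= (\<Sum>j\<in>J. card (D' j))" by auto
  have Dj: "conn E (D j)" "D j \<subseteq> V" "z j \<in> D j" "D j Int Y ~= {}" "finite (D j)" if "j \<in> J" for j
    using D(1) that fV by (auto simp: ok_def intro: finite_subset)
  have Dd: "D i Int D j = {}" if "i \<in> J" "j \<in> J" "i ~= j" for i j using D(1) that by (simp add: ok_def)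
  have "card ((\<Union>j\<in>J. D j) Int U t) <= 5 * card J" if t: "t \<in> T" for t
  proof (rule ccontr)
    assume "~ ?thesis"
    then have big: "5 * card J < card ((\<Union>j\<in>J. D j) Int U t)" by simp
    note h = hb[OF t]
    define J' where "J' = {j \<in> J. D j Int U t ~= {}}"
    have fJ': "finite J'" "J' \<subseteq> J" using fJ by (auto simp: J'_def)
    \<comment> \<open>\<open>D1\<close> and \<open>D2\<close> stand for the parts of a path before
      its first and after its last visit to the tile.\<close>
    define R where "R j D1 D2 a b \<longleftrightarrow> D1 \<subseteq> D j & conn E D1 & z j \<in> D1 & D1 Int U t = {a} & D2 \<subseteq> D j & conn E D2 & D2 Int Y ~= {} & D2 Int U t = {b}" for j D1 D2 a b
    have "\<forall>j\<in>J'. \<exists>D1 D2 a b. R j D1 D2 a b"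
    proof
      fix j assume "j \<in> J'"
      then have j: "j \<in> J" "D j Int U t ~= {}" by (auto simp: J'_def)
      have zz: "D j Int {z j} ~= {}" using Dj(3)[OF j(1)] by auto
      obtain D1 x a where 1: "D1 \<subseteq> D j" "conn E D1" "D1 Int {z j} = {x}" "D1 Int U t = {a}"
        using conn_trim[OF s Dj(5)[OF j(1)] Dj(1)[OF j(1)] zz j(2)] by (elim exE conjE) (rule that)
      obtain D2 y b where 2: "D2 \<subseteq> D j" "conn E D2" "D2 Int Y = {y}" "D2 Int U t = {b}"
        using conn_trim[OF s Dj(5)[OF j(1)] Dj(1)[OF j(1)] Dj(4)[OF j(1)] j(2)] by (elim exE conjE) (rule that)
      have "R j D1 D2 a b" unfolding R_def using 1 2 by auto
      then show "\<exists>D1 D2 a b. R j D1 D2 a b" by (intro exI)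
    qed
    from bchoice[OF this] obtain D1 where "\<forall>j\<in>J'. \<exists>D2 a b. R j (D1 j) D2 a b" ..
    from bchoice[OF this] obtain D2 where "\<forall>j\<in>J'. \<exists>a b. R j (D1 j) (D2 j) a b" ..
    from bchoice[OF this] obtain a where "\<forall>j\<in>J'. \<exists>b. R j (D1 j) (D2 j) (a j) b" ..
    from bchoice[OF this] obtain b where "\<forall>j\<in>J'. R j (D1 j) (D2 j) (a j) (b j)" ..
    then have R: "D1 j \<subseteq> D j" "conn E (D1 j)" "z j \<in> D1 j" "D1 j Int U t = {a j}" "D2 j \<subseteq> D j" "conn E (D2 j)" "D2 j Int Y ~= {}" "D2 j Int U t = {b j}"
      if "j \<in> J'" for j using that by (auto simp: R_def)
    have ab: "a j \<in> D1 j" "a j \<in> U t" "b j \<in> D2 j" "b j \<in> U t" if "j \<in> J'" for j using R(4,8)[OF that] by auto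
    \<comment> \<open>Blocking all contact vertices keeps the connectors disjoint from the retained
      parts of every path.\<close>
    define F0 where "F0 = a ` J' Un b ` J'"
    have "card F0 <= card (a ` J') + card (b ` J')" unfolding F0_def by (rule card_Un_le)
    also have "\<dots> <= 2 * card J'" using card_image_le[OF fJ'(1), of a] card_image_le[OF fJ'(1), of b] by simp
    finally have "card F0 + 3 * card J' <= 5 * card J" using card_mono[OF fJ fJ'(2)] by simp
    then have cF: "card F0 + 3 * card J' <= f" using f by simp
    have fF0: "finite F0" using fJ' by (simp add: F0_def)
    have endp: "a j \<in> U t & b j \<in> U t" if "j \<in> J'" for j using ab[OF that] by simp
    have "\<exists>K. (\<forall>j\<in>J'. K j \<subseteq> Q t - F0 & finite (K j) & card (K j) <= 3 & conn E (K j) & (\<exists>u\<in>K j. (a j, u) \<in> E) & (\<exists>v\<in>K j. (b j, v) \<in> E)) &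
      (\<forall>i\<in>J'. \<forall>j\<in>J'. i ~= j --> K i Int K j = {})"
      by (rule hub_connectors[OF conjunct1[OF h] fJ'(1) fF0 cF]) (rule endp)
    then obtain K where K: "\<forall>j\<in>J'. K j \<subseteq> Q t - F0 & finite (K j) & card (K j) <= 3 & conn E (K j) & (\<exists>u\<in>K j. (a j, u) \<in> E) & (\<exists>v\<in>K j. (b j, v) \<in> E)"
      "\<forall>i\<in>J'. \<forall>j\<in>J'. i ~= j --> K i Int K j = {}"
      by (elim exE conjE) (rule that)
    define K' where "K' j = (if j \<in> J' then K j else {})" for j
    define base where "base j = (if j \<in> J' then D1 j Un D2 j else D j)" for j
    define D' where "D' j = base j Un K' j" for j
    have K'1: "K' j \<subseteq> U t - F0" "K' j \<subseteq> V" "finite (K' j)" "card (K' j) <= 3" for j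
      using K(1) h by (auto simp: K'_def)
    have K'd: "K' i Int K' j = {}" if "i ~= j" for i j using K(2) that by (simp add: K'_def)
    have bD: "base j \<subseteq> D j" if "j \<in> J" for j using R(1,5) by (auto simp: base_def)
    have bU: "base j Int U t \<subseteq> (if j \<in> J' then {a j, b j} else {})" if "j \<in> J" for j
    proof (cases "j \<in> J'")
      case True
      then show ?thesis using R(4,8)[OF True] by (auto simp: base_def)
    next
      case False
      then show ?thesis using that by (auto simp: base_def J'_def)
    qed
    have bF: "base j Int U t \<subseteq> F0" if "j \<in> J" for j using bU[OF that] by (auto simp: F0_def split: if_splits)
    have bK: "base j Int K' i = {}" if "j \<in> J" for i j using bF[OF that] K'1(1)[of i] by blast
    have "ok D'" unfolding ok_def
    proof (intro conjI ballI impI)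
      fix j assume j: "j \<in> J"
      show "D' j \<subseteq> V" using bD[OF j] Dj(2)[OF j] K'1(2)[of j] by (auto simp: D'_def)
      show "conn E (D' j)"
      proof (cases "j \<in> J'")
        case True
        obtain u v where uv: "u \<in> K j" "(a j, u) \<in> E" "v \<in> K j" "(b j, v) \<in> E" "conn E (K j)" using K(1) True by auto
        have "conn E (D1 j Un K j)" by (rule conn_Un_edge[OF s R(2)[OF True] uv(5) ab(1)[OF True] uv(1,2)])
        moreover have "v \<in> D1 j Un K j" "(v, b j) \<in> E" using uv symD[OF s] by auto
        ultimately have "conn E ((D1 j Un K j) Un D2 j)" by (intro conn_Un_edge[OF s _ R(6)[OF True] _ ab(3)[OF True]])
        moreover have "(D1 j Un K j) Un D2 j = D' j" using True by (auto simp: D'_def base_def K'_def)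
        ultimately show ?thesis by simp
      next
        case False
        then show ?thesis using Dj(1)[OF j] by (simp add: D'_def base_def K'_def)
      qed
      show "z j \<in> D' j" using R(3) Dj(3)[OF j] by (auto simp: D'_def base_def)
      show "D' j Int Y ~= {}"
      proof (cases "j \<in> J'")
        case True then show ?thesis using R(7)[OF True] by (auto simp: D'_def base_def)
      next
        case False then show ?thesis using Dj(4)[OF j] by (auto simp: D'_def base_def)
      qed
    next
      fix i j assume ij: "i \<in> J" "j \<in> J" "i ~= j"
      have "base i Int base j = {}" using bD[OF ij(1)] bD[OF ij(2)] Dd[OF ij] by blast
      then show "D' i Int D' j = {}" using bK[OF ij(1), of j] bK[OF ij(2), of i] K'd[OF ij(3)] unfolding D'_def by blast
    qed
    from D(2)[OF this] have le: "(\<Sum>j\<in>J. card (D j)) <= (\<Sum>j\<in>J. card (D' j))" .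
    \<comment> \<open>Inside the tile each path keeps at most two contact vertices and a connector
      of three.\<close>
    have "(\<Sum>j\<in>J. card (D' j)) <= (\<Sum>j\<in>J. card (D j - U t) + 5)"
    proof (rule sum_mono)
      fix j assume j: "j \<in> J"
      have "D' j \<subseteq> (D j - U t) Un ((base j Int U t) Un K' j)" using bD[OF j] by (auto simp: D'_def)
      moreover have fb: "finite (base j Int U t)" using bF[OF j] fF0 finite_subset by auto
      ultimately have "card (D' j) <= card ((D j - U t) Un ((base j Int U t) Un K' j))" using Dj(5)[OF j] K'1(3) by (intro card_mono) auto
      also have "\<dots> <= card (D j - U t) + (card (base j Int U t) + card (K' j))" using card_Un_le[of "D j - U t" "(base j Int U t) Un K' j"] card_Un_le[of "base j Int U t" "K' j"] by linarith
      also have "card (base j Int U t) <= 2"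
      proof -
        have "base j Int U t \<subseteq> set [a j, b j]" using bU[OF j] by (auto split: if_splits)
        then have "card (base j Int U t) <= card (set [a j, b j])" by (intro card_mono) auto
        also have "\<dots> <= 2" using card_length[of "[a j, b j]"] by simp
        finally show ?thesis .
      qed
      finally show "card (D' j) <= card (D j - U t) + 5" using K'1(4)[of j] by linarith
    qed
    also have "\<dots> = (\<Sum>j\<in>J. card (D j - U t)) + 5 * card J" by (simp add: sum.distrib)
    also have "\<dots> < (\<Sum>j\<in>J. card (D j - U t)) + (\<Sum>j\<in>J. card (D j Int U t))"
    proof -
      have "(\<Union>j\<in>J. D j) Int U t = (\<Union>j\<in>J. D j Int U t)" by auto
      then have "card ((\<Union>j\<in>J. D j) Int U t) <= (\<Sum>j\<in>J. card (D j Int U t))" using card_UN_le[OF fJ, of "%j. D j Int U t"] by simp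
      then show ?thesis using big by linarith
    qed
    also have "\<dots> = (\<Sum>j\<in>J. card (D j))" unfolding sum.distrib[symmetric]
    proof (rule sum.cong[OF refl])
      fix j assume "j \<in> J"
      then show "card (D j - U t) + card (D j Int U t) = card (D j)" using Dj(5)[of j] by (metis Diff_disjoint Int_Diff_disjoint Un_Diff_Int add.commute card_Un_disjoint finite_Diff finite_Int inf_commute Int_Diff_Un)
    qed
    finally show False using le by simp
  qed
  then show ?thesis using D(1) unfolding ok_def by (intro exI[of _ D]) auto
qed

text \<open>Connectors in different tiles are disjoint anyway, so only those of the same tile must
  be chosen one after another.\<close>

lemma tile_connectors:
  fixes U Q :: "'t => 'a set" and a b :: "'i => 'a"
  assumes hb: "!!t. t \<in> T ==> hub E (U t) (Q t) f & Q t \<subseteq> U t"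
    and dis: "!!t t'. t \<in> T ==> t' \<in> T ==> t ~= t' ==> U t Int U t' = {}"
    and I: "finite I" "!!i. i \<in> I ==> \<tau> i \<in> T & a i \<in> U (\<tau> i) & b i \<in> U (\<tau> i)"
    and W: "finite W" "!!t. t \<in> T ==> card (W Int U t) + 3 * card I <= f"
  shows "\<exists>K. (\<forall>i\<in>I. K i \<subseteq> Q (\<tau> i) - W & conn E (K i) & (\<exists>u\<in>K i. (a i, u) \<in> E) & (\<exists>v\<in>K i. (b i, v) \<in> E)) &
    (\<forall>i\<in>I. \<forall>j\<in>I. i ~= j --> K i Int K j = {})"
proof -
  define It where "It t = {i \<in> I. \<tau> i = t}" for t
  define R where "R t K \<longleftrightarrow> (\<forall>i\<in>It t. K i \<subseteq> Q t - (W Int U t) & finite (K i) & card (K i) <= 3 & conn E (K i) & (\<exists>u\<in>K i. (a i, u) \<in> E) & (\<exists>v\<in>K i. (b i, v) \<in> E))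
    & (\<forall>i\<in>It t. \<forall>j\<in>It t. i ~= j --> K i Int K j = {})" for t and K :: "'i => 'a set"
  have "\<forall>t\<in>T. \<exists>K. R t K"
  proof
    fix t assume t: "t \<in> T"
    have fI: "finite (It t)" "card (It t) <= card I" using I(1) by (auto simp: It_def intro!: card_mono)
    have c: "card (W Int U t) + 3 * card (It t) <= f" using W(2)[OF t] fI(2) by linarith
    have e: "a i \<in> U t & b i \<in> U t" if "i \<in> It t" for i using I(2)[of i] that by (auto simp: It_def)
    have fW: "finite (W Int U t)" using W(1) by simp
    show "\<exists>K. R t K" unfolding R_def by (rule hub_connectors[OF conjunct1[OF hb[OF t]] fI(1) fW c e])
  qed
  from bchoice[OF this] obtain K where K: "\<forall>t\<in>T. R t (K t)" ..
  define L where "L i = K (\<tau> i) i" for i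
  have Li: "L i \<subseteq> Q (\<tau> i) - W & conn E (L i) & (\<exists>u\<in>L i. (a i, u) \<in> E) & (\<exists>v\<in>L i. (b i, v) \<in> E)" if i: "i \<in> I" for i
  proof -
    have t: "\<tau> i \<in> T" "i \<in> It (\<tau> i)" using I(2)[OF i] i by (auto simp: It_def)
    have "R (\<tau> i) (K (\<tau> i))" using K t(1) by simp
    then have "L i \<subseteq> Q (\<tau> i) - (W Int U (\<tau> i)) & conn E (L i) & (\<exists>u\<in>L i. (a i, u) \<in> E) & (\<exists>v\<in>L i. (b i, v) \<in> E)" using t(2) by (simp add: R_def L_def)
    moreover have "Q (\<tau> i) - (W Int U (\<tau> i)) \<subseteq> Q (\<tau> i) - W" using hb[OF t(1)] by auto
    ultimately show ?thesis by auto
  qed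
  have Ld: "L i Int L j = {}" if ij: "i \<in> I" "j \<in> I" "i ~= j" for i j
  proof (cases "\<tau> i = \<tau> j")
    case True
    have "R (\<tau> i) (K (\<tau> i))" using K I(2)[OF ij(1)] by simp
    moreover have "i \<in> It (\<tau> i)" "j \<in> It (\<tau> i)" using ij True by (auto simp: It_def)
    ultimately show ?thesis using ij(3) True by (simp add: R_def L_def)
  next
    case False
    have "L i \<subseteq> U (\<tau> i)" "L j \<subseteq> U (\<tau> j)" using Li ij hb I(2) by blast+
    then show ?thesis using dis[OF _ _ False] I(2) ij by blast
  qed
  show ?thesis using Li Ld by (intro exI[of _ L]) auto
qed

text \<open>\<open>L t\<close> is the free space that \<open>bipartite_embed\<close> needs on each
  side. Since the used parts of the two sides differ by at most \<open>s0\<close>, a tile without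
  this space has all but \<open>2 * L t + s0\<close> of its guaranteed \<open>2 * n t\<close>
  vertices used. So as long as \<open>H\<close> is not exhausted, the total count leaves a tile with
  room.\<close>

lemma greedy_embed:
  fixes A B :: "'t => 'a set" and EH :: "('w \<times> 'w) set"
  assumes s: "sym E" and T: "finite T" "t0 \<in> T"
    and AB: "!!t. t \<in> T ==> finite (A t) & finite (B t) & A t Int B t = {} & joined E (m t) \<rho> (A t) (B t)" "0 < \<rho>" "\<rho> <= 1"
    and dis: "!!t t'. t \<in> T ==> t' \<in> T ==> t ~= t' ==> (A t Un B t) Int (A t' Un B t') = {}"
    and H: "sgr VH EH" "VH \<subseteq> X1 Un X2" "X1 Int X2 = {}" "EH \<subseteq> X1 \<times> X2 Un X2 \<times> X1" "!!h. card (EH `` {h}) <= \<Delta>"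
    and S: "S \<subseteq> VH" "card S <= s0" "!!x. x \<in> VH - S ==> card (reach EH (VH - S) x) <= s0"
    and num: "!!t. t \<in> T ==> s0 <= m t & real ((\<Delta> + 2) * m t) <= \<rho> ^ \<Delta> * real (L t) & n t <= card (A t) & n t <= card (B t)"
      "s0 <= n t0" "card VH + (\<Sum>t\<in>T. 2 * L t + s0) < (\<Sum>t\<in>T. 2 * n t)"
  shows "\<exists>f \<tau>. inj_on f VH & (\<forall>v\<in>VH. \<tau> v \<in> T & f v \<in> A (\<tau> v) Un B (\<tau> v)) & (\<forall>v\<in>S. f v \<in> A t0 & \<tau> v = t0) &
    (\<forall>u v. (u, v) \<in> EH --> u \<notin> S --> v \<notin> S --> (f u, f v) \<in> E)"
proof -
  have fH: "finite VH" "finite EH" "sym EH" "irrefl EH" "EH \<subseteq> VH \<times> VH" using sgr_finite[OF H(1)] by auto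
  \<comment> \<open>Partial embeddings live on unions of \<open>S\<close> with whole components of
    \<open>H - S\<close>.\<close>
  define cl where "cl P \<longleftrightarrow> S \<subseteq> P & P \<subseteq> VH & (\<forall>u v. (u, v) \<in> EH --> u \<in> P - S --> v \<notin> S --> v \<in> P)" for P
  define st where "st P f \<tau> \<longleftrightarrow> cl P & inj_on f P & (\<forall>v\<in>P. \<tau> v \<in> T & f v \<in> A (\<tau> v) Un B (\<tau> v)) & (\<forall>v\<in>S. f v \<in> A t0 & \<tau> v = t0) &
    (\<forall>u v. (u, v) \<in> EH --> u \<in> P - S --> v \<in> P - S --> (f u, f v) \<in> E) &
    (\<forall>t\<in>T. card (f ` P Int A t) <= card (f ` P Int B t) + s0 & card (f ` P Int B t) <= card (f ` P Int A t) + s0)" for P f \<tau>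
  have grow: "\<exists>f \<tau>. st VH f \<tau>" if "st P f \<tau>" for P f \<tau>
    using that
  proof (induction "card (VH - P)" arbitrary: P f \<tau> rule: less_induct)
    case less
    show ?case
    proof (cases "P = VH")
      case True then show ?thesis using less.prems by auto
    next
      case False
      have P: "cl P" "inj_on f P" "!!v. v \<in> P ==> \<tau> v \<in> T & f v \<in> A (\<tau> v) Un B (\<tau> v)" "!!v. v \<in> S ==> f v \<in> A t0 & \<tau> v = t0"
        "!!u v. (u, v) \<in> EH ==> u \<in> P - S ==> v \<in> P - S ==> (f u, f v) \<in> E"
        "!!t. t \<in> T ==> card (f ` P Int A t) <= card (f ` P Int B t) + s0" "!!t. t \<in> T ==> card (f ` P Int B t) <= card (f ` P Int A t) + s0"
        using less.prems by (auto simp: st_def)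
      have Pc: "S \<subseteq> P" "P \<subseteq> VH" "!!u v. (u, v) \<in> EH ==> u \<in> P - S ==> v \<notin> S ==> v \<in> P" using P(1) by (auto simp: cl_def)
      have fP: "finite P" using Pc(2) fH(1) finite_subset by auto
      obtain x where x: "x \<in> VH" "x \<notin> P" using False Pc(2) by auto
      have xS: "x \<in> VH - S" using x Pc(1) by auto
      define c where "c = reach EH (VH - S) x"
      have cs: "c \<subseteq> VH - S" unfolding c_def by (rule reach_subset[OF xS])
      have xc: "x \<in> c" unfolding c_def by (rule reach_self)
      have fc: "finite c" using cs fH(1) finite_subset by auto
      have cc: "card c <= s0" unfolding c_def by (rule S(3)[OF xS])
      have cP: "c Int P = {}"
      proof (rule ccontr)
        assume "c Int P ~= {}"
        then obtain y where y: "y \<in> c" "y \<in> P" by auto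
        have "sym (EH Int (VH - S) \<times> (VH - S))" using fH(3) by (auto simp: sym_def)
        then have sy: "sym ((EH Int (VH - S) \<times> (VH - S))\<^sup>*)" by (rule sym_rtrancl)
        have "(x, y) \<in> (EH Int (VH - S) \<times> (VH - S))\<^sup>*" using y(1) by (simp add: c_def reach_def)
        then have "(y, x) \<in> (EH Int (VH - S) \<times> (VH - S))\<^sup>*" by (rule symD[OF sy])
        then have "x \<in> P"
        proof (induction rule: rtrancl_induct)
          case base show ?case by (rule y(2))
        next
          case (step u v) then show ?case using Pc(3)[of u v] by auto
        qed
        then show False using x(2) by simp
      qed
      have cclo: "v \<in> c" if "(u, v) \<in> EH" "u \<in> c" "v \<notin> S" for u v
      proof -
        have "v \<in> VH - S" using that fH(5) by auto
        then show ?thesis using reach_closed[of u EH "VH - S" x v] that xS by (simp add: c_def)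
      qed
      have "\<exists>t\<in>T. L t <= card (A t - f ` P) & L t <= card (B t - f ` P)"
      proof (rule ccontr)
        assume no: "~ ?thesis"
        have "(\<Sum>t\<in>T. 2 * n t) <= (\<Sum>t\<in>T. card (f ` P Int (A t Un B t)) + (2 * L t + s0))"
        proof (rule sum_mono)
          fix t assume t: "t \<in> T"
          have ft: "finite (A t)" "finite (B t)" "A t Int B t = {}" using AB(1)[OF t] by auto
          have "card (f ` P Int (A t Un B t)) = card (f ` P Int A t Un f ` P Int B t)" by (simp add: Int_Un_distrib)
          also have "\<dots> = card (f ` P Int A t) + card (f ` P Int B t)" using ft by (intro card_Un_disjoint) auto
          finally have u: "card (f ` P Int (A t Un B t)) = card (f ` P Int A t) + card (f ` P Int B t)" .
          have dA: "card (A t) = card (A t - f ` P) + card (f ` P Int A t)" using card_Diff_subset_Int[of "A t" "f ` P"] card_mono[OF ft(1), of "A t Int f ` P"] ft(1) by (simp add: Int_commute)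
          have dB: "card (B t) = card (B t - f ` P) + card (f ` P Int B t)" using card_Diff_subset_Int[of "B t" "f ` P"] card_mono[OF ft(2), of "B t Int f ` P"] ft(2) by (simp add: Int_commute)
          have "card (A t - f ` P) < L t | card (B t - f ` P) < L t" using no t by (meson not_less)
          then show "2 * n t <= card (f ` P Int (A t Un B t)) + (2 * L t + s0)" using u dA dB P(6,7)[OF t] num(1)[OF t] by linarith
        qed
        also have "\<dots> = (\<Sum>t\<in>T. card (f ` P Int (A t Un B t))) + (\<Sum>t\<in>T. 2 * L t + s0)" by (simp add: sum.distrib)
        also have "(\<Sum>t\<in>T. card (f ` P Int (A t Un B t))) = card (\<Union>t\<in>T. f ` P Int (A t Un B t))"
        proof (rule card_UN_disjoint[symmetric])
          show "\<forall>t\<in>T. \<forall>t'\<in>T. t ~= t' --> (f ` P Int (A t Un B t)) Int (f ` P Int (A t' Un B t')) = {}"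
          proof (intro ballI impI)
            fix t t' assume "t \<in> T" "t' \<in> T" "t ~= t'"
            from dis[OF this] show "(f ` P Int (A t Un B t)) Int (f ` P Int (A t' Un B t')) = {}" by blast
          qed
        qed (use T(1) fP in auto)
        also have "\<dots> <= card (f ` P)" using fP by (intro card_mono) auto
        also have "\<dots> <= card VH" using card_image_le[OF fP, of f] card_mono[OF fH(1) Pc(2)] by linarith
        finally show False using num(3) by simp
      qed
      then obtain t where t: "t \<in> T" "L t <= card (A t - f ` P)" "L t <= card (B t - f ` P)" by auto
      have ft: "finite (A t)" "finite (B t)" "A t Int B t = {}" "joined E (m t) \<rho> (A t) (B t)" using AB(1)[OF t(1)] by auto
      define uA where "uA = card (f ` P Int A t)"
      define uB where "uB = card (f ` P Int B t)"
      define EF where "EF = EH Int c \<times> c"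
      \<comment> \<open>The larger colour class goes to the side that is used less.\<close>
      obtain Wa Wb where W: "Wa Un Wb = c" "Wa Int Wb = {}" "EF \<subseteq> Wa \<times> Wb Un Wb \<times> Wa" "uA + card Wa <= uB + card Wb + s0" "uB + card Wb <= uA + card Wa + s0"
      proof -
        define W1 where "W1 = c Int X1"
        define W2 where "W2 = c Int X2"
        have c12: "W1 Un W2 = c" "W1 Int W2 = {}" "EF \<subseteq> W1 \<times> W2 Un W2 \<times> W1" using cs H(2,3,4) by (auto simp: W1_def W2_def EF_def)
        have "card W1 + card W2 = card c" using c12(1,2) fc by (metis card_Un_disjoint finite_Un)
        then have k: "card W1 + card W2 <= s0" using cc by simp
        have b: "uA <= uB + s0" "uB <= uA + s0" using P(6,7)[OF t(1)] by (auto simp: uA_def uB_def)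
        show thesis
        proof (cases "(uA <= uB) = (card W2 <= card W1)")
          case True
          show thesis by (rule that[of W1 W2]) (use c12 k b True in auto)
        next
          case False
          show thesis by (rule that[of W2 W1]) (use c12 k b False in auto)
        qed
      qed
      have fW: "finite Wa" "finite Wb" using W(1) fc by (auto intro: finite_subset)
      have "\<exists>\<phi>. inj_on \<phi> (Wa Un Wb) & \<phi> ` Wa \<subseteq> A t - f ` P & \<phi> ` Wb \<subseteq> B t - f ` P & (\<forall>(u, v)\<in>EF. (\<phi> u, \<phi> v) \<in> E)"
      proof (rule bipartite_embed[OF s])
        show "joined E (m t) \<rho> (A t - f ` P) (B t - f ` P)" by (rule joined_subset[OF ft(4)]) auto
        show "sym EF" using fH(3) by (auto simp: EF_def sym_def)
        show "card (EF `` {w}) <= \<Delta>" for w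
        proof -
          have "card (EF `` {w}) <= card (EH `` {w})" using fH(2) by (intro card_mono) (auto simp: EF_def)
          then show ?thesis using H(5)[of w] by simp
        qed
        show "card (Wa Un Wb) <= m t" using W(1) cc num(1)[OF t(1)] by simp
        have le: "\<rho> ^ \<Delta> * real (L t) <= \<rho> ^ \<Delta> * real y" if "L t <= y" for y using that AB(2) by (intro mult_left_mono) auto
        show "real ((\<Delta> + 2) * m t) <= \<rho> ^ \<Delta> * real (card (A t - f ` P))" using le[OF t(2)] num(1)[OF t(1)] by linarith
        show "real ((\<Delta> + 2) * m t) <= \<rho> ^ \<Delta> * real (card (B t - f ` P))" using le[OF t(3)] num(1)[OF t(1)] by linarith
      qed (use ft AB(2,3) fW W in auto)
      then obtain \<phi> where \<phi>: "inj_on \<phi> (Wa Un Wb)" "\<phi> ` Wa \<subseteq> A t - f ` P" "\<phi> ` Wb \<subseteq> B t - f ` P" "\<forall>(u, v)\<in>EF. (\<phi> u, \<phi> v) \<in> E"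
        by (elim exE conjE) (rule that)
      define f' where "f' v = (if v \<in> c then \<phi> v else f v)" for v
      define \<tau>' where "\<tau>' v = (if v \<in> c then t else \<tau> v)" for v
      have f'c: "f' ` c = \<phi> ` c" by (auto simp: f'_def)
      have f'P: "f' v = f v" "\<tau>' v = \<tau> v" if "v \<in> P" for v using that cP by (auto simp: f'_def \<tau>'_def)
      have f'Pi: "f' ` P = f ` P" using f'P(1) by (rule image_cong[OF refl])
      have \<phi>c: "\<phi> ` c \<subseteq> (A t Un B t) - f ` P" using \<phi>(2,3) W(1) by auto
      have Sc: "S Int c = {}" using cs by auto
      have "st (P Un c) f' \<tau>'" unfolding st_def
      proof (intro conjI ballI allI impI)
        show "cl (P Un c)" unfolding cl_def using Pc cs cclo by auto
        have "inj_on f' P" using P(2) inj_on_cong[of P f' f] f'P(1) by simp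
        moreover have "inj_on f' c" using \<phi>(1) W(1) by (simp add: f'_def inj_on_def)
        moreover have "f' ` P Int f' ` c = {}" using \<phi>c f'c f'Pi by auto
        ultimately show "inj_on f' (P Un c)" unfolding inj_on_Un by auto
        show "\<tau>' v \<in> T" if "v \<in> P Un c" for v using that P(3) t(1) by (auto simp: \<tau>'_def)
        show "f' v \<in> A (\<tau>' v) Un B (\<tau>' v)" if "v \<in> P Un c" for v
        proof (cases "v \<in> c")
          case True then show ?thesis using \<phi>c by (auto simp: \<tau>'_def f'_def)
        next
          case False then show ?thesis using P(3)[of v] that by (auto simp: \<tau>'_def f'_def)
        qed
        show "f' v \<in> A t0" "\<tau>' v = t0" if "v \<in> S" for v using that f'P[of v] P(4)[OF that] Pc(1) by auto
        fix u v assume e: "(u, v) \<in> EH" "u \<in> (P Un c) - S" "v \<in> (P Un c) - S"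
        show "(f' u, f' v) \<in> E"
        proof (cases "u \<in> c")
          case True
          then have "v \<in> c" using cclo e by auto
          then show ?thesis using True \<phi>(4) e(1) by (auto simp: f'_def EF_def)
        next
          case False
          have "v \<notin> c"
          proof
            assume "v \<in> c"
            then have "u \<in> c" using cclo[of v u] symD[OF fH(3) e(1)] e(2) by auto
            then show False using False by simp
          qed
          then show ?thesis using False P(5)[of u v] e by (auto simp: f'_def)
        qed
      next
        fix t' assume t': "t' \<in> T"
        have im: "f' ` (P Un c) = f ` P Un \<phi> ` c" using f'Pi f'c by auto
        have both: "card (f' ` (P Un c) Int A t') <= card (f' ` (P Un c) Int B t') + s0 & card (f' ` (P Un c) Int B t') <= card (f' ` (P Un c) Int A t') + s0"
        proof (cases "t' = t")
          case False
          have "(A t Un B t) Int (A t' Un B t') = {}" using dis[OF t(1) t'] False by auto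
          then have "f' ` (P Un c) Int A t' = f ` P Int A t'" "f' ` (P Un c) Int B t' = f ` P Int B t'" unfolding im using \<phi>c by auto
          then show ?thesis using P(6,7)[OF t'] by simp
        next
          case True
          have \<phi>W: "\<phi> ` c = \<phi> ` Wa Un \<phi> ` Wb" unfolding W(1)[symmetric] by (rule image_Un)
          have "f' ` (P Un c) Int A t = (f ` P Int A t) Un \<phi> ` Wa" "f' ` (P Un c) Int B t = (f ` P Int B t) Un \<phi> ` Wb"
            unfolding im \<phi>W using \<phi>(2,3) ft(3) by auto
          moreover have "card ((f ` P Int A t) Un \<phi> ` Wa) = uA + card Wa"
          proof -
            have "card ((f ` P Int A t) Un \<phi> ` Wa) = card (f ` P Int A t) + card (\<phi> ` Wa)" using \<phi>(2) fP fW by (intro card_Un_disjoint) auto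
            also have "card (\<phi> ` Wa) = card Wa" using \<phi>(1) by (intro card_image) (auto simp: inj_on_def)
            finally show ?thesis by (simp add: uA_def)
          qed
          moreover have "card ((f ` P Int B t) Un \<phi> ` Wb) = uB + card Wb"
          proof -
            have "card ((f ` P Int B t) Un \<phi> ` Wb) = card (f ` P Int B t) + card (\<phi> ` Wb)" using \<phi>(3) fP fW by (intro card_Un_disjoint) auto
            also have "card (\<phi> ` Wb) = card Wb" using \<phi>(1) by (intro card_image) (auto simp: inj_on_def)
            finally show ?thesis by (simp add: uB_def)
          qed
          ultimately show ?thesis using True W(4,5) by simp
        qed
        then show "card (f' ` (P Un c) Int A t') <= card (f' ` (P Un c) Int B t') + s0" "card (f' ` (P Un c) Int B t') <= card (f' ` (P Un c) Int A t') + s0" by auto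
      qed
      moreover have "card (VH - (P Un c)) < card (VH - P)" using x xc fH(1) by (intro psubset_card_mono) auto
      ultimately show ?thesis using less.hyps by blast
    qed
  qed
  have fS: "finite S" using S(1) fH(1) finite_subset by auto
  have fA0: "finite (A t0)" "finite (B t0)" "A t0 Int B t0 = {}" using AB(1)[OF T(2)] by auto
  have "card S <= card (A t0)" using S(2) num(2) num(1)[OF T(2)] by linarith
  then obtain f0 where f0: "inj_on f0 S" "f0 ` S \<subseteq> A t0" using inj_on_iff_card_le[OF fS fA0(1)] by auto
  \<comment> \<open>Placing \<open>S\<close> on one side of \<open>t0\<close> unbalances this tile
    by at most \<open>s0\<close>.\<close>
  have "st S f0 (%_. t0)" unfolding st_def
  proof (intro conjI ballI)
    fix t assume t: "t \<in> T"
    have c: "card (f0 ` S) <= s0" using card_image_le[OF fS, of f0] S(2) by linarith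
    have "card (f0 ` S Int A t) <= card (f0 ` S)" using fS by (intro card_mono) auto
    then show "card (f0 ` S Int A t) <= card (f0 ` S Int B t) + s0" using c by linarith
    have "card (f0 ` S Int B t) <= card (f0 ` S)" using fS by (intro card_mono) auto
    then show "card (f0 ` S Int B t) <= card (f0 ` S Int A t) + s0" using c by linarith
  qed (use f0 S(1) T(2) in \<open>auto simp: cl_def\<close>)
  from grow[OF this] obtain f \<tau> where "st VH f \<tau>" by auto
  then have r: "inj_on f VH" "\<forall>v\<in>VH. \<tau> v \<in> T & f v \<in> A (\<tau> v) Un B (\<tau> v)" "\<forall>v\<in>S. f v \<in> A t0 & \<tau> v = t0"
    "\<forall>u v. (u, v) \<in> EH --> u \<in> VH - S --> v \<in> VH - S --> (f u, f v) \<in> E" by (auto simp: st_def)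
  have "(f u, f v) \<in> E" if "(u, v) \<in> EH" "u \<notin> S" "v \<notin> S" for u v using r(4) that fH(5) by auto
  then show ?thesis using r(1-3) by (intro exI[of _ f] exI[of _ \<tau>]) auto
qed

text \<open>Every arc \<open>j\<close> at \<open>S\<close> and tile \<open>t\<close> get a root
  \<open>z (j, t)\<close> in the reserve of \<open>t\<close>; the connectivity joins all roots
  disjointly to the reserve of \<open>t0\<close>, where \<open>S\<close> will be placed. After the
  embedding, \<open>j\<close> uses the route of the tile that received its other end, completed by
  one connector at each end.\<close>

theorem tiles_topo:
  fixes \<rho> g :: real and EH :: "('w \<times> 'w) set"
  assumes G: "sgr V E" and sep: "!!P Q. sepn V E P Q ==> card (P Int Q) <= k ==> P - Q = {} | Q - P = {}"
    and F: "tfam E V \<rho> q g F" "0 < \<rho>" "\<rho> <= 1"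
    and H: "sgr VH EH" "VH \<subseteq> X1 Un X2" "X1 Int X2 = {}" "EH \<subseteq> X1 \<times> X2 Un X2 \<times> X1" "!!h. card (EH `` {h}) <= \<Delta>"
    and S: "S \<subseteq> VH" "card S <= s0" "!!x. x \<in> VH - S ==> card (reach EH (VH - S) x) <= s0"
    and cH: "3 <= \<rho> * real cH" and cL: "real (\<Delta> + 2) <= \<rho> ^ \<Delta> * real cL" and q: "cH + 3 <= q"
    and N: "\<Delta> * s0 * card F <= k" "real (20 * (\<Delta> * s0 * card F)) <= g" "real s0 <= g"
    and big: "q * card VH + (2 * cL + 2 * cH + 5) * cov F < 2 * q * cov F"
  shows "topo V E VH EH"
proof -
  have fV: "finite V" "finite E" "sym E" "irrefl E" "E \<subseteq> V \<times> V" using sgr_finite[OF G] by auto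
  have fH: "finite VH" "finite EH" "sym EH" "irrefl EH" "EH \<subseteq> VH \<times> VH" using sgr_finite[OF H(1)] by auto
  have Ft: "finite F" "!!t. t \<in> F ==> istile E V \<rho> q g t" "!!t t'. t \<in> F ==> t' \<in> F ==> t ~= t' ==> tsup t Int tsup t' = {}"
    using F(1) by (auto simp: tfam_def)
  define J where "J = {j \<in> EH. fst j \<in> S}"
  have fJ: "finite J" using fH(2) by (simp add: J_def)
  define n where "n = card (J \<times> F)"
  define m where "m t = snd (snd t)" for t :: "'a tile"
  have cJ: "card J <= \<Delta> * s0"
  proof -
    have fS: "finite S" using S(1) fH(1) finite_subset by auto
    have "J \<subseteq> Sigma S (%s. EH `` {s})" by (auto simp: J_def)
    then have "card J <= card (Sigma S (%s. EH `` {s}))" using fS fH(2) by (intro card_mono) auto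
    also have "\<dots> = (\<Sum>s\<in>S. card (EH `` {s}))" using fS fH(2) by (intro card_SigmaI) auto
    also have "\<dots> <= (\<Sum>s\<in>S. \<Delta>)" using H(5) by (intro sum_mono) auto
    also have "\<dots> = card S * \<Delta>" by simp
    also have "\<dots> <= s0 * \<Delta>" using S(2) by (rule mult_le_mono1)
    finally show ?thesis by (simp add: mult.commute)
  qed
  have nN: "n <= \<Delta> * s0 * card F" unfolding n_def card_cartesian_product using cJ by (rule mult_le_mono1)
  have nk: "n <= k" using nN N(1) by simp
  have m20: "20 * n <= m t" and s0m: "s0 <= m t" and m1: "1 <= m t" if t: "t \<in> F" for t
  proof -
    have g: "g <= real (m t)" unfolding m_def by (rule istileD(7)[OF Ft(2)[OF t]])
    have "real (20 * n) <= real (20 * (\<Delta> * s0 * card F))" unfolding of_nat_le_iff using nN by linarith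
    then have "real (20 * n) <= real (m t)" using N(2) g by linarith
    then show "20 * n <= m t" by (simp only: of_nat_le_iff)
    have "real s0 <= real (m t)" using N(3) g by linarith
    then show "s0 <= m t" by (simp only: of_nat_le_iff)
    show "1 <= m t" unfolding m_def by (rule istileD(6)[OF Ft(2)[OF t]])
  qed
  have ne: "F ~= {}" using big by (auto simp: cov_def)
  then obtain t0 where t0: "t0 \<in> F" by auto
  have Jn: "card J <= n" unfolding n_def card_cartesian_product using ne Ft(1) by (simp add: card_gt_0_iff Suc_leI)
  have cH3: "3 <= cH"
  proof -
    have "\<rho> * real cH <= 1 * real cH" using F(3) by (intro mult_right_mono) auto
    then show ?thesis using cH by linarith
  qed
  have qm: "q * m t <= card (fst t)" if "t \<in> F" for t unfolding m_def by (rule istileD(5)[OF Ft(2)[OF that]])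
  have fin: "finite (fst t)" "finite (fst (snd t))" if "t \<in> F" for t
    using istileD(1,2)[OF Ft(2)[OF that]] fV(1) by (auto intro: finite_subset)
  have cB: "card (fst (snd t)) = card (fst t)" if "t \<in> F" for t using istileD(4)[OF Ft(2)[OF that]] by simp
  define R where "R t A1 B1 A0 B0 \<longleftrightarrow> A1 \<subseteq> fst t & B1 \<subseteq> fst (snd t) & A0 \<subseteq> A1 & B0 \<subseteq> B1 & card A0 <= cH * m t & card B0 <= cH * m t &
    cH * m t <= card A0 + m t & card (fst t) <= card A1 + m t & card (fst (snd t)) <= card B1 + m t & hub E (A1 Un B1) (A0 Un B0) (m t)" for t A1 B1 A0 B0
  have "\<forall>t\<in>F. \<exists>A1 B1 A0 B0. R t A1 B1 A0 B0"
  proof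
    fix t assume t: "t \<in> F"
    have "cH * m t <= q * m t" using q by (intro mult_le_mono1) simp
    then have 1: "cH * m t <= card (fst t)" "cH * m t <= card (fst (snd t))" using qm[OF t] cB[OF t] by linarith+
    have "1 * m t <= cH * m t" using cH3 by (intro mult_le_mono1) simp
    then have 2: "m t <= cH * m t" by simp
    have "3 * real (m t) <= \<rho> * real cH * real (m t)" using cH by (intro mult_right_mono) auto
    then have 3: "real (2 * m t + m t) <= \<rho> * real (cH * m t)" by simp
    show "\<exists>A1 B1 A0 B0. R t A1 B1 A0 B0" unfolding R_def
      by (rule joined_clean[OF fV(3) fin[OF t] istileD(8)[OF Ft(2)[OF t], folded m_def] F(2) _ 1 2 3]) (use m1[OF t] in simp)
  qed
  from bchoice[OF this] obtain A1 where "\<forall>t\<in>F. \<exists>B1 A0 B0. R t (A1 t) B1 A0 B0" ..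
  from bchoice[OF this] obtain B1 where "\<forall>t\<in>F. \<exists>A0 B0. R t (A1 t) (B1 t) A0 B0" ..
  from bchoice[OF this] obtain A0 where "\<forall>t\<in>F. \<exists>B0. R t (A1 t) (B1 t) (A0 t) B0" ..
  from bchoice[OF this] obtain B0 where "\<forall>t\<in>F. R t (A1 t) (B1 t) (A0 t) (B0 t)" ..
  then have RR: "R t (A1 t) (B1 t) (A0 t) (B0 t)" if "t \<in> F" for t using that by simp
  note R = RR[unfolded R_def]
  define U where "U t = A1 t Un B1 t" for t
  define Q where "Q t = A0 t Un B0 t" for t
  have Us: "U t \<subseteq> tsup t" "tsup t \<subseteq> V" "Q t \<subseteq> U t" if t: "t \<in> F" for t
    using R[OF t] istileD(9)[OF Ft(2)[OF t]] by (auto simp: U_def Q_def tsup_def)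
  have Ud: "U t Int U t' = {}" if "t \<in> F" "t' \<in> F" "t ~= t'" for t t'
    using Ft(3)[OF that] Us(1)[OF that(1)] Us(1)[OF that(2)] by blast
  have fU: "finite (U t)" if "t \<in> F" for t using Us[OF that] fV(1) by (meson finite_subset)
  have hub: "hub E (U t) (Q t) (20 * n) & Q t \<subseteq> U t & U t \<subseteq> V" if t: "t \<in> F" for t
    using hub_le[of E "U t" "Q t" "m t"] m20[OF t] R[OF t] Us[OF t] by (auto simp: U_def Q_def)
  have Qn: "n <= card (Q t)" if t: "t \<in> F" for t
  proof -
    have "3 * m t <= cH * m t" using cH3 by (rule mult_le_mono1)
    then have "n <= card (A0 t)" using R[OF t] m20[OF t] by linarith
    also have "\<dots> <= card (Q t)" using fU[OF t] Us(3)[OF t] by (intro card_mono) (auto simp: Q_def intro: finite_subset)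
    finally show ?thesis .
  qed
  have "\<forall>t\<in>F. \<exists>z. inj_on z J & z ` J \<subseteq> Q t"
  proof
    fix t assume t: "t \<in> F"
    have "finite (Q t)" using fU[OF t] Us(3)[OF t] finite_subset by auto
    then show "\<exists>z. inj_on z J & z ` J \<subseteq> Q t" using inj_on_iff_card_le[OF fJ] Jn Qn[OF t] by (meson order_trans)
  qed
  from bchoice[OF this] obtain zz where zz: "\<forall>t\<in>F. inj_on (zz t) J & zz t ` J \<subseteq> Q t" ..
  define z where "z p = zz (snd p) (fst p)" for p
  have zQ: "z p \<in> Q (snd p)" if p: "p \<in> J \<times> F" for p
  proof -
    have "fst p \<in> J" "snd p \<in> F" using p by (simp_all add: mem_Times_iff)
    then show ?thesis using zz unfolding z_def by blast
  qed
  have zi: "inj_on z (J \<times> F)"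
  proof (rule inj_onI)
    fix p p' assume h: "p \<in> J \<times> F" "p' \<in> J \<times> F" "z p = z p'"
    have "snd p = snd p'"
    proof (rule ccontr)
      assume "snd p ~= snd p'"
      moreover have F2: "snd p \<in> F" "snd p' \<in> F" using h(1,2) by (simp_all add: mem_Times_iff)
      ultimately have "U (snd p) Int U (snd p') = {}" by (intro Ud)
      moreover have "z p \<in> U (snd p)" "z p' \<in> U (snd p')" using zQ[OF h(1)] zQ[OF h(2)] Us(3)[OF F2(1)] Us(3)[OF F2(2)] by blast+
      ultimately show False using h(3) by auto
    qed
    moreover have "fst p = fst p'"
    proof -
      have "inj_on (zz (snd p)) J" "zz (snd p) (fst p) = zz (snd p) (fst p')" "fst p \<in> J" "fst p' \<in> J" using zz h calculation by (simp_all add: z_def mem_Times_iff)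
      then show ?thesis by (auto dest: inj_onD)
    qed
    ultimately show "p = p'" by (simp add: prod_eq_iff)
  qed
  have fJF: "finite (J \<times> F)" using fJ Ft(1) by simp
  define X where "X = z ` (J \<times> F)"
  have cX: "card X = n" unfolding X_def n_def by (rule card_image[OF zi])
  have XV: "X \<subseteq> V"
  proof
    fix x assume "x \<in> X"
    then obtain p where p: "p \<in> J \<times> F" "x = z p" by (auto simp: X_def)
    then have "x \<in> Q (snd p)" "snd p \<in> F" using zQ[OF p(1)] by (simp_all add: mem_Times_iff)
    then show "x \<in> V" using hub by blast
  qed
  have QV: "Q t0 \<subseteq> V" using hub[OF t0] by blast
  \<comment> \<open>There are at most \<open>k\<close> roots, so for a smaller separator one side is
    contained in the other. The separator then contains all roots or all of \<open>Q t0\<close>,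
    both of size at least \<open>n\<close>.\<close>
  have sp: "card X <= card (P Int Q')" if h: "sepn V E P Q'" "X \<subseteq> P" "Q t0 \<subseteq> Q'" for P Q'
  proof (rule ccontr)
    assume a: "~ ?thesis"
    have fPQ: "finite (P Int Q')" using h(1) fV(1) by (auto simp: sepn_def intro: finite_subset)
    from sep[OF h(1)] a cX nk have "P - Q' = {} | Q' - P = {}" by simp
    then show False
    proof
      assume "P - Q' = {}"
      then have "card X <= card (P Int Q')" using h(2) fPQ by (intro card_mono) auto
      then show False using a by simp
    next
      assume "Q' - P = {}"
      then have "card (Q t0) <= card (P Int Q')" using h(3) fPQ by (intro card_mono) auto
      then show False using a Qn[OF t0] cX by simp
    qed
  qed
  obtain C gg where C: "!!x. x \<in> X ==> C x \<subseteq> V & conn E (C x) & C x Int X = {x} & C x Int Q t0 = {gg x}"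
    "!!x y. x \<in> X ==> y \<in> X ==> x ~= y ==> C x Int C y = {}"
  proof (rule menger_set[OF fV(1,3,4,5) XV QV sp])
    fix C gg assume "!!x. x \<in> X ==> C x \<subseteq> V & conn E (C x) & C x Int X = {x} & C x Int Q t0 = {gg x}"
      "!!x y. x \<in> X ==> y \<in> X ==> x ~= y ==> C x Int C y = {}"
    then show thesis by (rule that)
  qed
  have zX: "z p \<in> X" if "p \<in> J \<times> F" for p using that by (auto simp: X_def)
  have "\<exists>D. (\<forall>p\<in>J \<times> F. conn E (D p) & D p \<subseteq> V & z p \<in> D p & D p Int Q t0 ~= {}) & (\<forall>p\<in>J \<times> F. \<forall>p'\<in>J \<times> F. p ~= p' --> D p Int D p' = {}) &
    (\<forall>t\<in>F. card ((\<Union>p\<in>J \<times> F. D p) Int U t) <= 5 * card (J \<times> F))"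
  proof (rule lean_links[OF fV(3,1) fJF hub])
    show "5 * card (J \<times> F) <= 20 * n" by (simp add: n_def)
    show "conn E ((C \<circ> z) p) & (C \<circ> z) p \<subseteq> V & z p \<in> (C \<circ> z) p & (C \<circ> z) p Int Q t0 ~= {}" if "p \<in> J \<times> F" for p
      using C(1)[OF zX[OF that]] by auto
    show "(C \<circ> z) p Int (C \<circ> z) p' = {}" if "p \<in> J \<times> F" "p' \<in> J \<times> F" "p ~= p'" for p p'
      using C(2)[OF zX[OF that(1)] zX[OF that(2)]] inj_onD[OF zi _ that(1,2)] that(3) by auto
  qed
  then obtain D where D: "\<forall>p\<in>J \<times> F. conn E (D p) & D p \<subseteq> V & z p \<in> D p & D p Int Q t0 ~= {}" "\<forall>p\<in>J \<times> F. \<forall>p'\<in>J \<times> F. p ~= p' --> D p Int D p' = {}"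
    "\<forall>t\<in>F. card ((\<Union>p\<in>J \<times> F. D p) Int U t) <= 5 * card (J \<times> F)" by (elim exE conjE) (rule that)
  define W where "W = (\<Union>p\<in>J \<times> F. D p)"
  have WV: "W \<subseteq> V" using D(1) by (auto simp: W_def)
  have fW: "finite W" using WV fV(1) finite_subset by auto
  have Wn: "card (W Int U t) <= 5 * n" if "t \<in> F" for t using D(3) that by (simp add: W_def n_def)
  have DW: "D p \<subseteq> W" if "p \<in> J \<times> F" for p using that by (auto simp: W_def)
  have "\<forall>p\<in>J \<times> F. \<exists>y. y \<in> D p Int Q t0" using D(1) by blast
  from bchoice[OF this] obtain y where y: "\<forall>p\<in>J \<times> F. y p \<in> D p Int Q t0" ..
  define A where "A t = A1 t - A0 t - W" for t
  define B where "B t = B1 t - B0 t - W" for t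
  \<comment> \<open>What is left of a side for the embedding: \<open>cH * m\<close> is reserve,
    cleaning removed at most \<open>m\<close>, and routes take at most
    \<open>5 * n <= m\<close>.\<close>
  define nn where "nn t = card (fst t) - (cH + 2) * m t" for t
  have fAB: "finite (A1 t)" "finite (B1 t)" if "t \<in> F" for t using fU[OF that] by (auto simp: U_def)
  have nA: "nn t <= card (A t)" if t: "t \<in> F" for t
  proof -
    have "A1 t \<subseteq> A t Un (A0 t Un W Int U t)" by (auto simp: A_def U_def)
    then have "card (A1 t) <= card (A t Un (A0 t Un W Int U t))" using fAB[OF t] fW R[OF t] by (intro card_mono) (auto simp: A_def intro: finite_subset)
    also have "\<dots> <= card (A t) + (card (A0 t) + card (W Int U t))" using card_Un_le[of "A t" "A0 t Un W Int U t"] card_Un_le[of "A0 t" "W Int U t"] by linarith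
    finally have "card (fst t) <= card (A t) + cH * m t + 5 * n + m t" using R[OF t] Wn[OF t] by linarith
    then show ?thesis using m20[OF t] by (simp add: nn_def algebra_simps)
  qed
  have nB: "nn t <= card (B t)" if t: "t \<in> F" for t
  proof -
    have "B1 t \<subseteq> B t Un (B0 t Un W Int U t)" by (auto simp: B_def U_def)
    then have "card (B1 t) <= card (B t Un (B0 t Un W Int U t))" using fAB[OF t] fW R[OF t] by (intro card_mono) (auto simp: B_def intro: finite_subset)
    also have "\<dots> <= card (B t) + (card (B0 t) + card (W Int U t))" using card_Un_le[of "B t" "B0 t Un W Int U t"] card_Un_le[of "B0 t" "W Int U t"] by linarith
    finally have "card (fst (snd t)) <= card (B t) + cH * m t + 5 * n + m t" using R[OF t] Wn[OF t] by linarith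
    then show ?thesis using m20[OF t] cB[OF t] by (simp add: nn_def algebra_simps)
  qed
  have nn: "card (fst t) = nn t + (cH + 2) * m t" "m t <= nn t" if t: "t \<in> F" for t
  proof -
    have "(cH + 3) * m t <= q * m t" using q by (rule mult_le_mono1)
    then have "(cH + 3) * m t <= card (fst t)" using qm[OF t] by linarith
    moreover have "(cH + 3) * m t = (cH + 2) * m t + m t" by (simp add: algebra_simps)
    ultimately show "card (fst t) = nn t + (cH + 2) * m t" "m t <= nn t" unfolding nn_def by linarith+
  qed
  have ABs: "A t \<subseteq> fst t" "B t \<subseteq> fst (snd t)" "A t Un B t \<subseteq> U t" if t: "t \<in> F" for t using R[OF t] by (auto simp: A_def B_def U_def)
  have "\<exists>f \<tau>. inj_on f VH & (\<forall>v\<in>VH. \<tau> v \<in> F & f v \<in> A (\<tau> v) Un B (\<tau> v)) & (\<forall>v\<in>S. f v \<in> A t0 & \<tau> v = t0) &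
    (\<forall>u v. (u, v) \<in> EH --> u \<notin> S --> v \<notin> S --> (f u, f v) \<in> E)"
  proof (rule greedy_embed[OF fV(3) Ft(1) t0 _ F(2,3) _ H S, where m = m and n = nn and L = "%t. cL * m t"])
    show "finite (A t) & finite (B t) & A t Int B t = {} & joined E (m t) \<rho> (A t) (B t)" if t: "t \<in> F" for t
      using ABs[OF t] fin[OF t] istileD(3)[OF Ft(2)[OF t]] joined_subset[OF istileD(8)[OF Ft(2)[OF t]] ABs(1,2)[OF t]]
      by (auto simp: m_def intro: finite_subset)
    show "(A t Un B t) Int (A t' Un B t') = {}" if "t \<in> F" "t' \<in> F" "t ~= t'" for t t'
      using Ud[OF that] ABs(3)[OF that(1)] ABs(3)[OF that(2)] by blast
    show "s0 <= m t & real ((\<Delta> + 2) * m t) <= \<rho> ^ \<Delta> * real (cL * m t) & nn t <= card (A t) & nn t <= card (B t)" if t: "t \<in> F" for t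
    proof -
      have "real (\<Delta> + 2) * real (m t) <= \<rho> ^ \<Delta> * real cL * real (m t)" using cL by (intro mult_right_mono) auto
      then have "real ((\<Delta> + 2) * m t) <= \<rho> ^ \<Delta> * real (cL * m t)" by (simp only: of_nat_mult mult.assoc)
      then show ?thesis using s0m[OF t] nA[OF t] nB[OF t] by simp
    qed
    show "s0 <= nn t0" using s0m[OF t0] nn(2)[OF t0] by simp
    show "card VH + (\<Sum>t\<in>F. 2 * (cL * m t) + s0) < (\<Sum>t\<in>F. 2 * nn t)"
    proof -
      define c where "c = 2 * cL + 2 * cH + 5"
      define M where "M = (\<Sum>t\<in>F. m t)"
      have "q * M <= cov F" unfolding M_def cov_def sum_distrib_left by (rule sum_mono) (rule qm)
      then have "q * (c * M) <= c * cov F" by (metis mult.left_commute mult_le_mono2)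
      then have "q * (card VH + c * M) < q * (2 * cov F)" using big unfolding c_def[symmetric] distrib_left mult.left_commute[of q 2] mult.assoc by linarith
      then have 1: "card VH + c * M < 2 * cov F" by simp
      have "2 * cov F = (\<Sum>t\<in>F. 2 * nn t + (2 * cH + 4) * m t)" unfolding cov_def sum_distrib_left
        by (rule sum.cong[OF refl]) (simp add: nn(1) algebra_simps)
      then have 2: "2 * cov F = (\<Sum>t\<in>F. 2 * nn t) + (2 * cH + 4) * M" by (simp add: sum.distrib M_def sum_distrib_left)
      have "(\<Sum>t\<in>F. 2 * (cL * m t) + s0) <= (\<Sum>t\<in>F. (2 * cL + 1) * m t)" by (rule sum_mono) (use s0m in \<open>simp add: algebra_simps\<close>)
      then have 3: "(\<Sum>t\<in>F. 2 * (cL * m t) + s0) <= (2 * cL + 1) * M" by (simp add: M_def sum_distrib_left)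
      have "c * M = (2 * cL + 1) * M + (2 * cH + 4) * M" by (simp add: c_def algebra_simps)
      then show ?thesis using 1 2 3 by linarith
    qed
  qed
  then obtain f \<tau> where f: "inj_on f VH" "\<forall>v\<in>VH. \<tau> v \<in> F & f v \<in> A (\<tau> v) Un B (\<tau> v)" "\<forall>v\<in>S. f v \<in> A t0 & \<tau> v = t0"
    "\<forall>u v. (u, v) \<in> EH --> u \<notin> S --> v \<notin> S --> (f u, f v) \<in> E" by (elim exE conjE) (rule that)
  have Jd: "fst j \<in> S" "snd j \<in> VH" "\<tau> (snd j) \<in> F" "(j, \<tau> (snd j)) \<in> J \<times> F" "j \<in> EH" if "j \<in> J" for j
    using that f(2) fH(5) by (auto simp: J_def)
  \<comment> \<open>Index \<open>(j, True)\<close> is the connector at the end in \<open>S\<close>,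
    inside \<open>t0\<close>; \<open>(j, False)\<close> is the one at the other end, in the tile
    chosen by the embedding.\<close>
  define tt where "tt i = (if snd i then t0 else \<tau> (snd (fst i)))" for i :: "('w \<times> 'w) \<times> bool"
  define aa where "aa i = (if snd i then f (fst (fst i)) else f (snd (fst i)))" for i :: "('w \<times> 'w) \<times> bool"
  define bb where "bb i = (if snd i then y (fst i, \<tau> (snd (fst i))) else z (fst i, \<tau> (snd (fst i))))" for i :: "('w \<times> 'w) \<times> bool"
  have "\<exists>K. (\<forall>i\<in>J \<times> UNIV. K i \<subseteq> Q (tt i) - W & conn E (K i) & (\<exists>u\<in>K i. (aa i, u) \<in> E) & (\<exists>v\<in>K i. (bb i, v) \<in> E)) &
    (\<forall>i\<in>J \<times> UNIV. \<forall>j\<in>J \<times> UNIV. i ~= j --> K i Int K j = {})"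
  proof (rule tile_connectors[where T = F and U = U and f = "20 * n"])
    show "hub E (U t) (Q t) (20 * n) & Q t \<subseteq> U t" if "t \<in> F" for t using hub[OF that] by simp
    show "finite (J \<times> (UNIV :: bool set))" using fJ by simp
    show "tt i \<in> F & aa i \<in> U (tt i) & bb i \<in> U (tt i)" if i: "i \<in> J \<times> UNIV" for i
    proof -
      define j where "j = fst i"
      have j: "j \<in> J" using i by (auto simp: j_def)
      note d = Jd[OF j]
      show ?thesis
      proof (cases "snd i")
        case True
        have "f (fst j) \<in> U t0" using f(3) d(1) ABs(3)[OF t0] by blast
        moreover have "y (j, \<tau> (snd j)) \<in> U t0" using y d(4) Us(3)[OF t0] by blast
        ultimately show ?thesis using True t0 by (simp add: tt_def aa_def bb_def j_def)
      next
        case False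
        have "f (snd j) \<in> U (\<tau> (snd j))" using f(2) d(2) ABs(3)[OF d(3)] by blast
        moreover have "z (j, \<tau> (snd j)) \<in> U (\<tau> (snd j))" using zQ[OF d(4)] Us(3)[OF d(3)] by auto
        ultimately show ?thesis using False d(3) by (simp add: tt_def aa_def bb_def j_def)
      qed
    qed
    show "card (W Int U t) + 3 * card (J \<times> (UNIV :: bool set)) <= 20 * n" if "t \<in> F" for t
      using Wn[OF that] Jn by (simp add: card_cartesian_product)
  qed (use Ud fW in auto)
  then obtain K where K: "\<forall>i\<in>J \<times> UNIV. K i \<subseteq> Q (tt i) - W & conn E (K i) & (\<exists>u\<in>K i. (aa i, u) \<in> E) & (\<exists>v\<in>K i. (bb i, v) \<in> E)"
    "\<forall>i\<in>J \<times> UNIV. \<forall>j\<in>J \<times> UNIV. i ~= j --> K i Int K j = {}" by (elim exE conjE) (rule that)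
  define DD where "DD j = D (j, \<tau> (snd j))" for j
  define I where "I j = K (j, True) Un DD j Un K (j, False)" for j
  have Kj: "K (j, True) \<subseteq> Q t0 - W" "K (j, False) \<subseteq> Q (\<tau> (snd j)) - W" "conn E (K (j, c))" if "j \<in> J" for j c
  proof -
    have k: "(j, c) \<in> J \<times> UNIV" for c :: bool using that by simp
    show "K (j, True) \<subseteq> Q t0 - W" using bspec[OF K(1) k[of True]] by (simp add: tt_def)
    show "K (j, False) \<subseteq> Q (\<tau> (snd j)) - W" using bspec[OF K(1) k[of False]] by (simp add: tt_def)
    show "conn E (K (j, c))" using bspec[OF K(1) k[of c]] by simp
  qed
  have ttF: "tt (j, c) \<in> F" if "j \<in> J" for j c using Jd(3)[OF that] t0 by (simp add: tt_def)
  have fQ: "f v \<notin> Q t" if v: "v \<in> VH" and t: "t \<in> F" for v t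
  proof
    assume a: "f v \<in> Q t"
    have b: "\<tau> v \<in> F" "f v \<in> A (\<tau> v) Un B (\<tau> v)" using f(2) v by auto
    then have "f v \<in> U (\<tau> v)" using ABs(3) by blast
    then have "\<tau> v = t" using Ud[OF b(1) t] a Us(3)[OF t] by blast
    then have "f v \<in> A t Un B t" using b(2) by simp
    moreover have "A1 t Int B1 t = {}" using R[OF t] istileD(3)[OF Ft(2)[OF t]] by blast
    ultimately show False using a R[OF t] unfolding A_def B_def Q_def by blast
  qed
  have fWd: "f v \<notin> W" if v: "v \<in> VH" for v using f(2) v by (auto simp: A_def B_def)
  have fVV: "f ` VH \<subseteq> V"
  proof
    fix x assume "x \<in> f ` VH"
    then obtain v where v: "v \<in> VH" "x = f v" by auto
    then have "\<tau> v \<in> F" "x \<in> A (\<tau> v) Un B (\<tau> v)" using f(2) by auto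
    then show "x \<in> V" using ABs(3) hub by blast
  qed
  have IV: "I j \<subseteq> V - f ` VH" if j: "j \<in> J" for j
  proof -
    have "K (j, c) \<subseteq> V - f ` VH" for c
    proof
      fix x assume "x \<in> K (j, c)"
      then have "x \<in> Q (tt (j, c))" using K(1) j by blast
      then show "x \<in> V - f ` VH" using fQ[OF _ ttF[OF j, of c]] hub[OF ttF[OF j, of c]] by blast
    qed
    moreover have "DD j \<subseteq> V - f ` VH" using DW[OF Jd(4)[OF j]] WV fWd unfolding DD_def by blast
    ultimately show ?thesis by (simp add: I_def)
  qed
  have Id: "I i Int I j = {}" if ij: "i \<in> J" "j \<in> J" "i ~= j" for i j
  proof -
    have 1: "K (i, c) Int K (j, c') = {}" for c c' using K(2) ij by simp
    have 2: "DD i Int DD j = {}" using D(2) Jd(4)[OF ij(1)] Jd(4)[OF ij(2)] ij(3) unfolding DD_def by blast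
    have 3: "DD i \<subseteq> W" "DD j \<subseteq> W" using DW Jd(4) ij unfolding DD_def by blast+
    have 4: "K (i, c) Int W = {}" "K (j, c) Int W = {}" for c using K(1) ij by blast+
    show ?thesis unfolding I_def using 1 2 3 4[of True] 4[of False] by blast
  qed
  have Il: "lnk E (I j) (f (fst j)) (f (snd j))" if j: "j \<in> J" for j
  proof -
    have k: "(j, c) \<in> J \<times> UNIV" for c :: bool using j by simp
    obtain u1 v1 where 1: "u1 \<in> K (j, True)" "(f (fst j), u1) \<in> E" "v1 \<in> K (j, True)" "(y (j, \<tau> (snd j)), v1) \<in> E"
      using bspec[OF K(1) k[of True]] by (auto simp: aa_def bb_def)
    obtain u2 v2 where 2: "u2 \<in> K (j, False)" "(f (snd j), u2) \<in> E" "v2 \<in> K (j, False)" "(z (j, \<tau> (snd j)), v2) \<in> E"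
      using bspec[OF K(1) k[of False]] by (auto simp: aa_def bb_def)
    have d: "conn E (DD j)" "z (j, \<tau> (snd j)) \<in> DD j" "y (j, \<tau> (snd j)) \<in> DD j" using D(1) y Jd(4)[OF j] by (auto simp: DD_def)
    have "conn E (K (j, True) Un DD j)" by (rule conn_Un_edge[OF fV(3) Kj(3)[OF j] d(1) 1(3) d(3) symD[OF fV(3) 1(4)]])
    then have "conn E (I j)" unfolding I_def by (rule conn_Un_edge[OF fV(3) _ Kj(3)[OF j] _ 2(3,4)]) (use d in simp)
    then show ?thesis unfolding lnk_def using 1(1,2) 2(1,2) by (auto simp: I_def)
  qed
  \<comment> \<open>An edge with both ends in \<open>S\<close> is in \<open>J\<close> in both
    directions. Both routes are kept, since \<open>lnk\<close> only needs a connected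
    subset.\<close>
  define II where "II e = (\<Union>j\<in>{j \<in> J. {fst j, snd j} = e}. I j)" for e
  have main: "lnk E (II {u, v}) (f u) (f v)" if e: "(u, v) \<in> EH" for u v
  proof -
    have up: "lnk E (II {u, v}) x' y'" if "j \<in> J" "{fst j, snd j} = {u, v}" "lnk E (I j) x' y'" for j x' y'
    proof -
      have "I j \<subseteq> II {u, v}" using that(1,2) by (auto simp: II_def)
      then show ?thesis using that(3) unfolding lnk_def by blast
    qed
    have sy: "lnk E I' y' x'" if "lnk E I' x' y'" for I' x' y' using that symD[OF fV(3)] unfolding lnk_def by blast
    consider "u \<in> S" | "v \<in> S" | "u \<notin> S" "v \<notin> S" by blast
    then show ?thesis
    proof cases
      case 1
      then have j: "(u, v) \<in> J" using e by (simp add: J_def)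
      show ?thesis by (rule up[OF j _ Il[OF j, simplified]]) simp
    next
      case 2
      then have j: "(v, u) \<in> J" using e symD[OF fH(3)] by (simp add: J_def)
      show ?thesis by (rule sy, rule up[OF j _ Il[OF j, simplified]]) auto
    next
      case 3
      then show ?thesis using f(4) e unfolding lnk_def by blast
    qed
  qed
  show ?thesis unfolding topo_def
  proof (intro exI[of _ f] exI[of _ II] conjI allI impI)
    show "II {u, v} \<subseteq> V - f ` VH" if "(u, v) \<in> EH" for u v unfolding II_def using IV by (intro UN_least) auto
    show "II {u, v} Int II {x, y} = {}" if "{u, v} ~= {x, y}" for u v x y
    proof -
      have "I i Int I j = {}" if "i \<in> J" "j \<in> J" "{fst i, snd i} = {u, v}" "{fst j, snd j} = {x, y}" for i j
        using Id[OF that(1,2)] that(3,4) \<open>{u, v} ~= {x, y}\<close> by metis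
      then show ?thesis unfolding II_def by blast
    qed
  qed (use f(1) fVV main in auto)
qed

section \<open>The main theorem\<close>

lemma tfam_subset: "tfam E V \<rho> q g F ==> F' \<subseteq> F ==> tfam E V \<rho> q g F'"
  unfolding tfam_def by (meson finite_subset subsetD)

text \<open>With as few tiles as possible, leaving out any one of them drops the coverage below
  \<open>c\<close>, and each tile has sides of at least \<open>g\<close>. As \<open>g\<close> is
  proportional to \<open>d\<close>, the number of tiles becomes bounded.\<close>

lemma tfam_trim:
  fixes c g :: real
  assumes F: "tfam E V \<rho> q g F" "c <= 2 * real (cov F)" and g: "0 < g" and q: "1 <= q"
  obtains F' where "tfam E V \<rho> q g F'" "c <= 2 * real (cov F')" "2 * (real (card F') - 1) * g <= max c 0"
proof -
  from ex_has_least_nat[of "%F'. F' \<subseteq> F & c <= 2 * real (cov F')" F card] F(2)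
  obtain F' where F': "F' \<subseteq> F" "c <= 2 * real (cov F')" and mn: "!!G. G \<subseteq> F ==> c <= 2 * real (cov G) ==> card F' <= card G" by auto
  have T: "tfam E V \<rho> q g F'" by (rule tfam_subset[OF F(1) F'(1)])
  have fF': "finite F'" using T by (simp add: tfam_def)
  have "2 * (real (card F') - 1) * g <= max c 0"
  proof (cases "F' = {}")
    case True then show ?thesis using g by simp
  next
    case False
    then obtain t where t: "t \<in> F'" by auto
    have c1: "card (F' - {t}) = card F' - 1" "0 < card F'" using t fF' by (auto simp: card_gt_0_iff)
    have "~ c <= 2 * real (cov (F' - {t}))"
    proof
      assume "c <= 2 * real (cov (F' - {t}))"
      then have "card F' <= card (F' - {t})" using F'(1) by (intro mn) auto
      then show False using c1 by simp
    qed
    moreover have "real (card (F' - {t})) * g <= real (cov (F' - {t}))"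
    proof -
      have "g <= real (card (fst s))" if "s \<in> F' - {t}" for s
      proof -
        have s: "istile E V \<rho> q g s" using T that by (auto simp: tfam_def)
        have "1 * snd (snd s) <= q * snd (snd s)" using q by (rule mult_le_mono1)
        then have "snd (snd s) <= card (fst s)" using istileD(5)[OF s] by linarith
        then have "real (snd (snd s)) <= real (card (fst s))" by (simp only: of_nat_le_iff)
        then show ?thesis using istileD(7)[OF s] by linarith
      qed
      then have "(\<Sum>s\<in>F' - {t}. g) <= (\<Sum>s\<in>F' - {t}. real (card (fst s)))" by (rule sum_mono)
      then show ?thesis by (simp add: cov_def)
    qed
    moreover have "real (card (F' - {t})) = real (card F') - 1" using c1 by simp
    ultimately have "2 * ((real (card F') - 1) * g) <= c" by simp
    then show ?thesis unfolding mult.assoc by (rule max.coboundedI1)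
  qed
  then show thesis using T F'(2) by (intro that)
qed

theorem separable_topo:
  fixes \<epsilon> :: real and \<Delta> :: nat
  assumes \<epsilon>: "0 < \<epsilon>" "\<epsilon> < 1"
  shows "\<exists>\<alpha>0>0. \<exists>d0>0. \<forall>(\<alpha> :: real) (d :: real) V (E :: ('a \<times> 'a) set) (VH :: 'w set) EH X1 X2 S. 0 < \<alpha> --> \<alpha> < \<alpha>0 --> d0 <= d -->
    sgr V E --> V ~= {} --> d * real (card V) <= real (card E) -->
    sgr VH EH --> VH \<subseteq> X1 Un X2 --> X1 Int X2 = {} --> EH \<subseteq> X1 \<times> X2 Un X2 \<times> X1 --> (\<forall>h. card (EH `` {h}) <= \<Delta>) -->
    real (card VH) <= (1 - \<epsilon>) * d --> S \<subseteq> VH --> real (card S) <= \<alpha> * real (card VH) -->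
    (\<forall>x\<in>VH - S. real (card (reach EH (VH - S) x)) <= \<alpha> * real (card VH)) --> topo V E VH EH"
proof (rule massed_linked)
  fix K :: nat
  assume TW: "!!\<kappa> c V (E :: ('a \<times> 'a) set) X. sgr V E ==> X \<subseteq> V ==> card X <= \<kappa> ==> K * (\<kappa> + 1) <= c ==> massed c V E X ==> linked V E X"
  \<comment> \<open>Half of \<epsilon> is spent on incomplete covering, the other half on the
    unusable part of the tiles.\<close>
  define e where "e = \<epsilon> / 2"
  have e: "0 < e" "e < 1" using \<epsilon> by (auto simp: e_def)
  \<comment> \<open>The sparse case starts from a subgraph of average degree only
    \<open>e / 8 * d\<close>.\<close>
  define b0 where "b0 = nat \<lceil>8 / e\<rceil>"
  have b0: "8 / e <= real b0" unfolding b0_def by (rule real_nat_ceiling_ge)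
  have b01: "1 <= b0"
  proof -
    have "1 <= 8 / e" using e by simp
    then show ?thesis using b0 by linarith
  qed
  obtain a \<eta> :: real and ds :: nat where sp: "0 < a" "0 < \<eta>"
    "!!d V (E :: ('a \<times> 'a) set) (VH :: 'w set) EH. sgr V E ==> V ~= {} ==> d * card V <= b0 * card E ==> no_dense E V (a * real d) \<eta> ==>
      sgr VH EH ==> card VH <= d ==> (!!h. card (EH `` {h}) <= \<Delta>) ==> ds <= d ==> topo V E VH EH"
  proof (rule sparse_topo[OF TW b01])
    fix a \<eta> :: real and ds :: nat
    assume "0 < a" "0 < \<eta>" "!!d V (E :: ('a \<times> 'a) set) (VH :: 'w set) EH. sgr V E ==> V ~= {} ==> d * card V <= b0 * card E ==> no_dense E V (a * real d) \<eta> ==>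
      sgr VH EH ==> card VH <= d ==> (!!h. card (EH `` {h}) <= \<Delta>) ==> ds <= d ==> topo V E VH EH"
    then show thesis by (rule that)
  qed
  define \<rho> where "\<rho> = min (e / 32) \<eta> / 2"
  have \<rho>: "0 < \<rho>" "\<rho> <= 1" using e sp(2) by (auto simp: \<rho>_def)
  define cH where "cH = nat \<lceil>3 / \<rho>\<rceil>"
  define cL where "cL = nat \<lceil>real (\<Delta> + 2) / \<rho> ^ \<Delta>\<rceil>"
  have cH: "3 <= \<rho> * real cH"
  proof -
    have "3 / \<rho> <= real cH" unfolding cH_def by (rule real_nat_ceiling_ge)
    then show ?thesis using \<rho> by (simp add: divide_le_eq mult.commute)
  qed
  have cL: "real (\<Delta> + 2) <= \<rho> ^ \<Delta> * real cL"
  proof -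
    have "real (\<Delta> + 2) / \<rho> ^ \<Delta> <= real cL" unfolding cL_def by (rule real_nat_ceiling_ge)
    moreover have "0 < \<rho> ^ \<Delta>" using \<rho> by simp
    ultimately show ?thesis by (simp only: pos_divide_le_eq mult.commute)
  qed
  \<comment> \<open>Unusable part of a tile in units of its scale: free space \<open>cL\<close> and
    reserve \<open>cH\<close> on both sides, two per side for cleaning and routes, and one for the
    imbalance \<open>s0\<close>.\<close>
  define c where "c = 2 * cL + 2 * cH + 5"
  \<comment> \<open>Makes the unusable part, \<open>c\<close> out of \<open>2 * q\<close> scales, at
    most an \<epsilon>/2 part of a tile.\<close>
  define q where "q = nat \<lceil>real c / \<epsilon>\<rceil> + c"
  have q: "cH + 3 <= q" "2 <= q" "1 <= q" by (auto simp: q_def c_def)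
  have qe: "real c <= \<epsilon> * real q"
  proof -
    have "real c / \<epsilon> <= real (nat \<lceil>real c / \<epsilon>\<rceil>)" by (rule real_nat_ceiling_ge)
    then have "real c / \<epsilon> <= real q" by (simp add: q_def)
    then show ?thesis using \<epsilon> by (simp add: pos_divide_le_eq mult.commute)
  qed
  \<comment> \<open>Enough rounds for the minimum in \<open>tile_family\<close> to be
    \<open>(1 - e) * d\<close>.\<close>
  define j where "j = nat \<lceil>256 / e ^ 2\<rceil>"
  have j: "1 <= real j * (e ^ 2 / 256)"
  proof -
    have "256 / e ^ 2 <= real j" unfolding j_def by (rule real_nat_ceiling_ge)
    then show ?thesis using e by (simp add: pos_divide_le_eq)
  qed
  have a2: "0 < a / 2" using sp(1) by simp
  obtain \<gamma> dt where tf: "0 < \<gamma>" "!!V (E :: ('a \<times> 'a) set) d. sgr V E ==> V ~= {} ==> dt <= d ==> (1 - e / 8) * d * real (card V) <= real (card E) ==>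
    (\<forall>U. U \<subseteq> V --> U ~= {} --> e / 8 * d * real (card U) <= real (card (E Int U \<times> U)) --> ~ no_dense E U (a / 2 * d) \<eta>) ==>
    (\<exists>F. tfam E V \<rho> q (\<gamma> * d) F & min ((1 - e) * d) (real j * (e ^ 2 / 256) * d) <= 2 * real (cov F))"
  proof -
    from tile_family[OF e sp(2) a2, of j, rule_format, OF q(2), folded \<rho>_def]
    show thesis by (elim exE conjE) (rule that, assumption, blast)
  qed
  define tF where "tF = nat \<lceil>1 / \<gamma>\<rceil> + 1"
  \<comment> \<open>The number of routes must stay below both the connectivity, which is at least
    \<open>e / 32 * d\<close>, and a twentieth of the scale \<open>\<gamma> * d\<close>;
    \<open>tF\<close> bounds the number of tiles.\<close>
  define \<alpha>0 where "\<alpha>0 = min (e / 32) (\<gamma> / 20) / (real (\<Delta> + 1) * real tF)"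
  have tF0: "0 < real (\<Delta> + 1) * real tF" by (simp add: tF_def)
  have \<alpha>0: "0 < \<alpha>0" using e tf(1) tF0 by (simp add: \<alpha>0_def)
  define d0 where "d0 = max (max (32 / e) (real ds + 2)) dt"
  have d00: "0 < d0" by (auto simp: d0_def)
  have main: "topo V E VH EH" if \<alpha>: "0 < \<alpha>" "\<alpha> < \<alpha>0" and d0d: "d0 <= d" and G0: "sgr V E" "V ~= {}" "d * real (card V) <= real (card E)"
    and H: "sgr VH EH" "VH \<subseteq> X1 Un X2" "X1 Int X2 = {}" "EH \<subseteq> X1 \<times> X2 Un X2 \<times> X1" "\<forall>h. card (EH `` {h}) <= \<Delta>"
    and VH: "real (card VH) <= (1 - \<epsilon>) * d" and S: "S \<subseteq> VH" "real (card S) <= \<alpha> * real (card VH)"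
      "\<forall>x\<in>VH - S. real (card (reach EH (VH - S) x)) <= \<alpha> * real (card VH)"
    for \<alpha> d :: real and V and E :: "('a \<times> 'a) set" and VH :: "'w set" and EH X1 X2 S
  proof -
    have d: "32 / e <= d" "real ds + 2 <= d" "dt <= d" "0 < d" using d0d d00 by (auto simp: d0_def)
    have ed: "32 <= e * d" using d(1) e by (simp add: pos_divide_le_eq mult.commute)
    \<comment> \<open>This connectivity costs at most an \<open>e / 8\<close> part of the average
      degree, because \<open>W\<close> has at least \<open>d / 2\<close> vertices.\<close>
    define k where "k = nat \<lfloor>e / 16 * d\<rfloor>"
    have k: "real k <= e / 16 * d" "e / 32 * d <= real k" "1 <= k"
    proof -
      have "0 <= e / 16 * d" using ed by simp
      then show k1: "real k <= e / 16 * d" unfolding k_def by (rule of_nat_floor)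
      have "e / 16 * d < real k + 1" unfolding k_def by linarith
      then show k2: "e / 32 * d <= real k" using ed by (simp add: field_simps)
      have "1 <= real k" using k2 ed by simp
      then show "1 <= k" by simp
    qed
    have k4: "4 * real k <= d"
    proof -
      have "e * d <= 1 * d" using e d(4) by (intro mult_right_mono) auto
      then show ?thesis using k(1) by simp
    qed
    show ?thesis
    proof (rule mader[OF G0(1,2) k(3) k4 G0(3)])
      fix W assume W: "W \<subseteq> V" "W ~= {}" and deg: "!!v. v \<in> W ==> d / 2 < real (card (E `` {v} Int W))"
        and sep: "!!P Q. sepn W (E Int W \<times> W) P Q ==> card (P Int Q) <= k ==> P - Q = {} | Q - P = {}"
        and den: "d * real (card W) < real (card (E Int W \<times> W)) + d * real k"
      define E1 where "E1 = E Int W \<times> W"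
      have G1: "sgr W E1" unfolding E1_def by (rule sgr_restrict[OF G0(1) W(1)])
      have fW: "finite W" using sgr_finite(1)[OF G1] .
      have dens: "(1 - e / 8) * d * real (card W) <= real (card E1)"
      proof -
        obtain v where v: "v \<in> W" using W(2) by auto
        have "card (E `` {v} Int W) <= card W" using fW by (intro card_mono) auto
        then have "d / 2 <= real (card W)" using deg[OF v] by linarith
        then have "e / 8 * (d / 2) <= e / 8 * real (card W)" using e by (intro mult_left_mono) auto
        moreover have "e / 8 * (d / 2) = e / 16 * d" by simp
        ultimately have "real k <= e / 8 * real (card W)" using k(1) by linarith
        then have "d * real k <= d * (e / 8 * real (card W))" using d(4) by (intro mult_left_mono) auto
        then show ?thesis using den by (simp add: E1_def algebra_simps)
      qed
      have "topo W E1 VH EH"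
      proof (cases "\<forall>U. U \<subseteq> W --> U ~= {} --> e / 8 * d * real (card U) <= real (card (E1 Int U \<times> U)) --> ~ no_dense E1 U (a / 2 * d) \<eta>")
        case False
        then obtain U where U: "U \<subseteq> W" "U ~= {}" "e / 8 * d * real (card U) <= real (card (E1 Int U \<times> U))" "no_dense E1 U (a / 2 * d) \<eta>" by auto
        \<comment> \<open>The sparse case is stated for integers; using \<open>a / 2\<close> in
          place of \<open>a\<close> pays for the rounding.\<close>
        define dn where "dn = nat \<lfloor>d\<rfloor>"
        have dn: "real dn <= d" "d < real dn + 1" using d(4) by (auto simp: dn_def)
        have "topo U (E1 Int U \<times> U) VH EH"
        proof (rule sp(3))
          show "sgr U (E1 Int U \<times> U)" by (rule sgr_restrict[OF G1 U(1)])
          show "dn * card U <= b0 * card (E1 Int U \<times> U)"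
          proof -
            have "real dn * real (card U) <= d * real (card U)" using dn(1) by (intro mult_right_mono) auto
            also have "\<dots> = 8 / e * (e / 8 * d * real (card U))" using e by simp
            also have "\<dots> <= 8 / e * real (card (E1 Int U \<times> U))" using U(3) e by (intro mult_left_mono) auto
            also have "\<dots> <= real b0 * real (card (E1 Int U \<times> U))" using b0 by (intro mult_right_mono) auto
            finally have "real (dn * card U) <= real (b0 * card (E1 Int U \<times> U))" by simp
            then show ?thesis by (simp only: of_nat_le_iff)
          qed
          show "no_dense (E1 Int U \<times> U) U (a * real dn) \<eta>"
          proof (rule no_dense_mono[OF U(4)])
            have "a * (d / 2) <= a * real dn" using dn(2) d(2) sp(1) by (intro mult_left_mono) auto
            then show "a / 2 * d <= a * real dn" by simp
          qed (use finite_subset[OF U(1) fW] in auto)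
          have "(1 - \<epsilon>) * d <= 1 * d" using \<epsilon> d(4) by (intro mult_right_mono) auto
          then have "real (card VH) < real dn + 1" using VH dn(2) by linarith
          then show "card VH <= dn" by linarith
          show "ds <= dn" using d(2) dn(2) by linarith
        qed (use U H in auto)
        then show ?thesis using topo_mono[of U "E1 Int U \<times> U" VH EH W E1] U(1) by auto
      next
        case True
        obtain F0 where F0: "tfam E1 W \<rho> q (\<gamma> * d) F0" "min ((1 - e) * d) (real j * (e ^ 2 / 256) * d) <= 2 * real (cov F0)"
          using tf(2)[OF G1 W(2) d(3) dens True] by (elim exE conjE) (rule that)
        have "1 * d <= real j * (e ^ 2 / 256) * d" using j d(4) by (intro mult_right_mono) auto
        moreover have ed1: "(1 - e) * d <= 1 * d" using e d(4) by (intro mult_right_mono) auto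
        ultimately have c0: "(1 - e) * d <= 2 * real (cov F0)" using F0(2) by simp
        have \<gamma>d: "0 < \<gamma> * d" using tf(1) d(4) by simp
        obtain F where F: "tfam E1 W \<rho> q (\<gamma> * d) F" "(1 - e) * d <= 2 * real (cov F)" "2 * (real (card F) - 1) * (\<gamma> * d) <= max ((1 - e) * d) 0"
          by (rule tfam_trim[OF F0(1) c0 \<gamma>d q(3)])
        have cF: "card F <= tF"
        proof -
          have "max ((1 - e) * d) 0 <= d" using ed1 d(4) by simp
          with F(3) have "2 * (real (card F) - 1) * (\<gamma> * d) <= d" by (rule order_trans)
          then have "(2 * (real (card F) - 1) * \<gamma>) * d <= 1 * d" by (simp add: mult.assoc)
          then have "2 * (real (card F) - 1) * \<gamma> <= 1" using d(4) by (simp only: mult_le_cancel_right_pos)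
          moreover have "1 / \<gamma> <= real (nat \<lceil>1 / \<gamma>\<rceil>)" by (rule real_nat_ceiling_ge)
          then have "1 <= real (nat \<lceil>1 / \<gamma>\<rceil>) * \<gamma>" using tf(1) by (simp only: pos_divide_le_eq)
          ultimately have "2 * (real (card F) - 1) * \<gamma> <= real (nat \<lceil>1 / \<gamma>\<rceil>) * \<gamma>" by linarith
          then have "2 * (real (card F) - 1) <= real (nat \<lceil>1 / \<gamma>\<rceil>)" using tf(1) by (simp only: mult_le_cancel_right_pos)
          moreover have "x <= y + 1" if "2 * (x - 1) <= y" "0 <= y" for x y :: real
          proof -
            have "2 * x <= y + 2" using that(1) by (simp add: algebra_simps)
            then show ?thesis using that(2) by linarith
          qed
          ultimately have "real (card F) <= real (nat \<lceil>1 / \<gamma>\<rceil>) + 1" by simp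
          then have "real (card F) <= real tF" by (simp only: tF_def of_nat_add of_nat_1)
          then show ?thesis by (simp only: of_nat_le_iff)
        qed
        define s0 where "s0 = nat \<lfloor>\<alpha> * d\<rfloor>"
        have s0: "real s0 <= \<alpha>0 * d"
        proof -
          have "real s0 <= \<alpha> * d" using \<alpha>(1) d(4) by (simp add: s0_def)
          also have "\<dots> <= \<alpha>0 * d" using \<alpha>(2) d(4) by (intro mult_right_mono) auto
          finally show ?thesis .
        qed
        have up: "n <= s0" if "real n <= \<alpha> * real (card VH)" for n
        proof -
          have "(1 - \<epsilon>) * d <= 1 * d" using \<epsilon> d(4) by (intro mult_right_mono) auto
          then have "real (card VH) <= d" using VH by linarith
          then have "\<alpha> * real (card VH) <= \<alpha> * d" using \<alpha>(1) by (intro mult_left_mono) auto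
          then have "real n <= \<alpha> * d" using that by linarith
          then show ?thesis unfolding s0_def by (simp add: le_nat_floor)
        qed
        have sN: "real (\<Delta> * s0 * card F) <= min (e / 32) (\<gamma> / 20) * d"
        proof -
          have "\<Delta> * s0 * card F <= (\<Delta> + 1) * s0 * tF" using cF by (intro mult_le_mono) auto
          then have "real (\<Delta> * s0 * card F) <= real ((\<Delta> + 1) * s0 * tF)" by (simp only: of_nat_le_iff)
          also have "\<dots> = (real (\<Delta> + 1) * real tF) * real s0" by (simp only: of_nat_mult mult.assoc mult.commute mult.left_commute)
          also have "\<dots> <= (real (\<Delta> + 1) * real tF) * (\<alpha>0 * d)" using s0 tF0 by (intro mult_left_mono) auto
          also have "\<dots> = ((real (\<Delta> + 1) * real tF) * \<alpha>0) * d" by (simp only: mult.assoc)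
          also have "(real (\<Delta> + 1) * real tF) * \<alpha>0 = min (e / 32) (\<gamma> / 20)" unfolding \<alpha>0_def using tF0 by (simp only: times_divide_eq_right nonzero_mult_div_cancel_left[OF less_imp_neq[OF tF0, symmetric]])
          finally show ?thesis .
        qed
        have mm: "min (e / 32) (\<gamma> / 20) * d <= e / 32 * d" "min (e / 32) (\<gamma> / 20) * d <= \<gamma> / 20 * d" using d(4) by (auto intro!: mult_right_mono)
        show ?thesis
        proof (rule tiles_topo[OF G1 _ F(1) \<rho> H(1-4) _ S(1) _ _ cH cL q(1), where k = k and ?s0.0 = s0])
          show "P - Q = {} | Q - P = {}" if "sepn W E1 P Q" "card (P Int Q) <= k" for P Q using sep that by (simp add: E1_def)
          show "card S <= s0" using up S(2) by simp
          show "card (reach EH (VH - S) x) <= s0" if "x \<in> VH - S" for x using up S(3) that by simp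
          have "real (\<Delta> * s0 * card F) <= real k" using sN mm(1) k(2) by linarith
          then show "\<Delta> * s0 * card F <= k" by (simp only: of_nat_le_iff)
          show "real (20 * (\<Delta> * s0 * card F)) <= \<gamma> * d" using sN mm(2) by simp
          have "\<alpha>0 <= \<gamma>"
          proof -
            have "1 * 1 <= real (\<Delta> + 1) * real tF" by (intro mult_mono) (auto simp: tF_def)
            then have "min (e / 32) (\<gamma> / 20) / (real (\<Delta> + 1) * real tF) <= min (e / 32) (\<gamma> / 20) / 1" using e tf(1) by (intro divide_left_mono) auto
            then show ?thesis using tf(1) unfolding \<alpha>0_def by linarith
          qed
          then have "\<alpha>0 * d <= \<gamma> * d" using d(4) by (intro mult_right_mono) auto
          then show "real s0 <= \<gamma> * d" using s0 by linarith
          show "q * card VH + (2 * cL + 2 * cH + 5) * cov F < 2 * q * cov F"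
          proof -
            define x where "x = 2 * real (cov F)"
            have q0: "0 < real q" using q(3) by simp
            have x: "(1 - e) * d <= x" using F(2) by (simp add: x_def)
            have c5: "5 <= real c" by (simp add: c_def)
            have "e * real c <= 1 * real c" using e by (intro mult_right_mono) auto
            have cq: "real c / 2 <= real q"
            proof -
              have "c <= q" by (simp add: q_def)
              then show ?thesis by linarith
            qed
            have "real q * real (card VH) <= real q * ((1 - \<epsilon>) * d)" using VH q0 by (intro mult_left_mono) auto
            also have "\<dots> < (real q - real c / 2) * ((1 - e) * d)"
            proof -
              have "(real q - real c / 2) * (1 - e) - real q * (1 - \<epsilon>) = (\<epsilon> * real q - real c) / 2 + real c * e / 2" by (simp add: e_def field_simps)
              moreover have "0 < real c * e" using c5 e by simp
              then have "0 < (\<epsilon> * real q - real c) / 2 + real c * e / 2" using qe by (intro add_nonneg_pos) simp_all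
              ultimately have "0 < (real q - real c / 2) * (1 - e) - real q * (1 - \<epsilon>)" by (simp only:)
              then have "real q * (1 - \<epsilon>) < (real q - real c / 2) * (1 - e)" by (simp only: diff_gt_0_iff_gt)
              then have "(real q * (1 - \<epsilon>)) * d < ((real q - real c / 2) * (1 - e)) * d" using d(4) by (intro mult_strict_right_mono) auto
              then show ?thesis by (simp only: mult.assoc)
            qed
            also have "\<dots> <= (real q - real c / 2) * x" using x cq by (intro mult_left_mono) auto
            also have "\<dots> = 2 * real q * real (cov F) - real c * real (cov F)" by (simp add: x_def algebra_simps)
            finally have "real (q * card VH + c * cov F) < real (2 * q * cov F)" by simp
            then show ?thesis unfolding of_nat_less_iff by (simp only: c_def)
          qed
        qed (use H(5) in auto)
      qed
      then show ?thesis by (rule topo_mono[OF _ W(1)]) (auto simp: E1_def)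
    qed
  qed
  show ?thesis
    by (rule exI[of _ \<alpha>0], rule conjI, rule \<alpha>0, rule exI[of _ d0], rule conjI, rule d00, intro allI impI) (rule main)
qed

section \<open>Passage between arc relations and pair graphs\<close>

lemma sgr_pair_graph:
  assumes "pair_graph G"
  shows "sgr (pverts G) (parcs G)"
proof -
  interpret pair_graph G by fact
  have "sym (parcs G)" using pair_sym_arcs by (simp add: symmetric_def)
  then show ?thesis unfolding sgr_def using pair_finite_verts pair_no_loops wellformed' by (fastforce simp: irrefl_def)
qed

lemma pair_graph_of_sgr: "sgr V E ==> pair_graph \<lparr>pverts = V, parcs = E\<rparr>"
proof -
  assume s: "sgr V E"
  note f = sgr_finite[OF s]
  have "fst e \<in> V & snd e \<in> V & fst e ~= snd e" if "e \<in> E" for e using that f(4,5) by (cases e) (auto simp: irrefl_def)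
  then show ?thesis by unfold_locales (use f(1-3) in \<open>simp_all add: symmetric_def\<close>)
qed

lemma rtrancl_reachable:
  assumes "pair_wf_digraph K" "(u, v) \<in> r\<^sup>*" "r \<subseteq> parcs K" "u \<in> pverts K"
  shows "reachable (with_proj K) u v"
proof -
  interpret pair_wf_digraph K by fact
  show ?thesis using assms(2)
  proof (induction rule: rtrancl_induct)
    case base show ?case using assms(4) by simp
  next
    case (step y z)
    have "(y, z) \<in> parcs K" using step(2) assms(3) by auto
    from step(3) this show ?case by (rule reachable_adj_trans)
  qed
qed

lemma card_parcs_ge:
  assumes "pair_graph G"
  shows "2 * card (edges G) <= card (parcs G)"
proof -
  have s: "sgr (pverts G) (parcs G)" by (rule sgr_pair_graph[OF assms])
  note f = sgr_finite[OF s]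
  let ?h = "%(u, v). {u, v}"
  have "card (parcs G) = (\<Sum>e\<in>?h ` parcs G. card {x \<in> parcs G. ?h x = e})"
    using sum.image_gen[OF f(2), of "%_. 1 :: nat" ?h] by simp
  moreover have "(\<Sum>e\<in>edges G. 2) <= (\<Sum>e\<in>?h ` parcs G. card {x \<in> parcs G. ?h x = e})"
    unfolding edges_def
  proof (rule sum_mono)
    fix e assume "e \<in> ?h ` parcs G"
    then obtain u v where e: "e = {u, v}" "(u, v) \<in> parcs G" by auto
    have "{(u, v), (v, u)} \<subseteq> {x \<in> parcs G. ?h x = e}" using e symD[OF f(3) e(2)] by auto
    then have "card {(u, v), (v, u)} <= card {x \<in> parcs G. ?h x = e}" using f(2) by (intro card_mono) auto
    moreover have "u ~= v" using e(2) f(4) by (auto simp: irrefl_def)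
    ultimately show "2 <= card {x \<in> parcs G. ?h x = e}" by simp
  qed
  ultimately show ?thesis by simp
qed

lemma card_Image_le_max_degree:
  assumes "pair_graph H"
  shows "card (parcs H `` {h}) <= max_degree H"
proof -
  have s: "sgr (pverts H) (parcs H)" by (rule sgr_pair_graph[OF assms])
  note f = sgr_finite[OF s]
  show ?thesis
  proof (cases "h \<in> pverts H")
    case True
    have "parcs H `` {h} = snd ` out_arcs (with_proj H) h" by (force simp: out_arcs_def)
    then have "card (parcs H `` {h}) <= card (out_arcs (with_proj H) h)" using f(2) by (simp add: card_image_le out_arcs_def)
    also have "\<dots> = out_degree (with_proj H) h" by (simp add: out_degree_def)
    also have "\<dots> <= max_degree H" unfolding max_degree_def using f(1) True by (intro Max_ge) auto
    finally show ?thesis .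
  next
    case False
    then have "parcs H `` {h} = {}" using f(5) by auto
    then show ?thesis by (metis card.empty zero_le)
  qed
qed

text \<open>Transfers the component sizes in \<open>separable\<close> to the sets
  \<open>reach\<close> used in the embedding.\<close>

lemma reach_component:
  assumes H: "pair_graph H" and S: "S \<subseteq> pverts H" and x: "x \<in> pverts H - S"
  shows "\<exists>C\<in>pre_digraph.sccs (with_proj H \<restriction> (pverts H - S)). card (reach (parcs H) (pverts H - S) x) <= card (verts C)"
proof -
  have s: "sgr (pverts H) (parcs H)" by (rule sgr_pair_graph[OF H])
  define K where "K = \<lparr>pverts = pverts H - S, parcs = parcs H Int (pverts H - S) \<times> (pverts H - S)\<rparr>"
  have sK: "sgr (pverts H - S) (parcs H Int (pverts H - S) \<times> (pverts H - S))" by (rule sgr_restrict[OF s]) auto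
  have eq: "with_proj H \<restriction> (pverts H - S) = with_proj K" by (auto simp: K_def induce_subgraph_def with_proj_def)
  interpret K: pair_graph K unfolding K_def by (rule pair_graph_of_sgr[OF sK])
  have xK: "x \<in> pverts K" using x by (simp add: K_def)
  have "reach (parcs H) (pverts H - S) x \<subseteq> K.scc_of x"
  proof
    fix y assume "y \<in> reach (parcs H) (pverts H - S) x"
    then have "(x, y) \<in> (parcs K)\<^sup>*" by (simp add: reach_def K_def)
    then have "reachable (with_proj K) x y" using xK by (intro rtrancl_reachable[OF K.pair_wf_digraph_axioms]) auto
    then show "y \<in> K.scc_of x" by (rule K.scc_ofI_reachable')
  qed
  moreover have sv: "K.scc_of x \<in> K.sccs_verts" by (rule K.scc_of_in_sccs_verts[OF xK])
  then have "finite (K.scc_of x)" using K.sccs_verts_subsets[OF sv] K.pair_finite_verts by (auto intro: finite_subset)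
  ultimately have "card (reach (parcs H) (pverts H - S) x) <= card (K.scc_of x)" by (intro card_mono)
  moreover obtain C where "C \<in> K.sccs" "verts C = K.scc_of x" using sv unfolding K.sccs_verts_conv by auto
  ultimately show ?thesis unfolding eq by (intro bexI[of _ C]) simp_all
qed

lemma set_rev_path: "set (rev_path p) = (%e. (snd e, fst e)) ` set p"
  by (induction p) auto

lemma pawalk_verts_subset: "set (pawalk_verts u p) \<subseteq> insert u (fst ` set p Un snd ` set p)"
  by (induction p arbitrary: u) fastforce+

text \<open>The path is taken in the subgraph induced by \<open>I\<close> and the two ends, so its
  inner vertices are in \<open>I\<close>.\<close>

lemma lnk_apath:
  assumes G: "pair_graph G" and xy: "x \<in> pverts G" "y \<in> pverts G" and I: "I \<subseteq> pverts G" and l: "lnk (parcs G) I x y"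
  shows "\<exists>p. pre_digraph.apath (with_proj G) x p y & set (pre_digraph.inner_verts (with_proj G) p) \<subseteq> I"
proof -
  interpret G: pair_graph G by fact
  note s = sgr_pair_graph[OF G]
  define X where "X = insert x (insert y I)"
  have XV: "X \<subseteq> pverts G" using xy I by (auto simp: X_def)
  define K where "K = \<lparr>pverts = X, parcs = parcs G Int X \<times> X\<rparr>"
  interpret K: pair_graph K unfolding K_def by (rule pair_graph_of_sgr[OF sgr_restrict[OF s XV]])
  have "(x, y) \<in> (parcs K)\<^sup>*"
    using l unfolding lnk_def
  proof (elim disjE exE conjE bexE)
    assume "(x, y) \<in> parcs G"
    then have "(x, y) \<in> parcs K" by (auto simp: K_def X_def)
    then show ?thesis by auto
  next
    fix C u v assume c: "C \<subseteq> I" "conn (parcs G) C" "u \<in> C" "(x, u) \<in> parcs G" "v \<in> C" "(y, v) \<in> parcs G"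
    have "(u, v) \<in> (parcs G Int C \<times> C)\<^sup>*" using c by (simp add: conn_def)
    moreover have "parcs G Int C \<times> C \<subseteq> parcs K" using c(1) by (auto simp: K_def X_def)
    ultimately have "(u, v) \<in> (parcs K)\<^sup>*" using rtrancl_mono by blast
    moreover have "(x, u) \<in> parcs K" "(v, y) \<in> parcs K" using c symD[OF sgr_finite(3)[OF s]] by (auto simp: K_def X_def)
    ultimately show ?thesis by (meson converse_rtrancl_into_rtrancl rtrancl.rtrancl_into_rtrancl)
  qed
  then have "reachable (with_proj K) x y" by (intro rtrancl_reachable[OF K.pair_wf_digraph_axioms]) (auto simp: K_def X_def)
  then obtain p where p: "K.apath x p y" unfolding K.reachable_apath by auto
  then have p': "set p \<subseteq> parcs G Int X \<times> X" "pcas x p y" "distinct (pawalk_verts x p)"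
  proof -
    have "set p \<subseteq> parcs K" "pcas x p y" "distinct (pawalk_verts x p)" using p by (auto simp: K.apath_def K.awalk_def)
    then show "set p \<subseteq> parcs G Int X \<times> X" "pcas x p y" "distinct (pawalk_verts x p)" by (simp_all add: K_def)
  qed
  have ap: "G.apath x p y" using p' xy by (auto simp: G.apath_def G.awalk_def)
  have "set (pawalk_verts x p) \<subseteq> insert x (fst ` set p Un snd ` set p)" by (rule pawalk_verts_subset)
  also have "\<dots> \<subseteq> X" using p'(1) by (auto simp: X_def)
  finally have "set (G.inner_verts p) \<subseteq> I" unfolding G.set_inner_verts[OF ap] by (auto simp: X_def)
  then show ?thesis using ap by auto
qed

text \<open>The two arcs of an edge must carry the same path, so \<open>o'\<close> selects one
  orientation per edge and the other arc gets the reversed path.\<close>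

lemma topo_contains_subdivision:
  fixes G :: "'b pair_pre_digraph" and H :: "'a pair_pre_digraph"
  assumes G: "pair_graph G" and H: "pair_graph H" and t: "topo (pverts G) (parcs G) (pverts H) (parcs H)"
  shows "contains_subdivision G H"
proof -
  interpret G: pair_graph G by fact
  interpret H: pair_graph H by fact
  note sG = sgr_finite[OF sgr_pair_graph[OF G]] and sH = sgr_finite[OF sgr_pair_graph[OF H]]
  obtain f I where f: "inj_on f (pverts H)" "f ` pverts H \<subseteq> pverts G"
    and I: "\<forall>u v. (u, v) \<in> parcs H --> I {u, v} \<subseteq> pverts G - f ` pverts H & lnk (parcs G) (I {u, v}) (f u) (f v)"
    "\<forall>u v x y. (u, v) \<in> parcs H --> (x, y) \<in> parcs H --> {u, v} ~= {x, y} --> I {u, v} Int I {x, y} = {}"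
    using t unfolding topo_def by (elim exE conjE) (rule that)
  define inn where "inn p = set (tl (map fst p))" for p :: "('b \<times> 'b) list"
  have inn: "set (pre_digraph.inner_verts (with_proj K) p) = inn p" for K p by (simp only: inner_verts_with_proj_def inn_def)
  have "\<forall>a\<in>parcs H. \<exists>p. G.apath (f (fst a)) p (f (snd a)) & inn p \<subseteq> I {fst a, snd a}"
  proof
    fix a assume a: "a \<in> parcs H"
    obtain u v where uv: "a = (u, v)" by (cases a)
    have e: "(u, v) \<in> parcs H" using a uv by simp
    have V: "f u \<in> pverts G" "f v \<in> pverts G" using e sH(5) f(2) by auto
    show "\<exists>p. G.apath (f (fst a)) p (f (snd a)) & inn p \<subseteq> I {fst a, snd a}"
      using lnk_apath[OF G V, of "I {u, v}"] I(1) e uv by (auto simp: inn)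
  qed
  from bchoice[OF this] obtain p0 where p0: "\<forall>a\<in>parcs H. G.apath (f (fst a)) (p0 a) (f (snd a)) & inn (p0 a) \<subseteq> I {fst a, snd a}" ..
  define o' where "o' e = (SOME a. a \<in> parcs H & {fst a, snd a} = e)" for e
  define P where "P a = (if o' {fst a, snd a} = a then p0 a else rev_path (p0 (snd a, fst a)))" for a
  have oo: "o' {u, v} = (u, v) | o' {u, v} = (v, u)" if "(u, v) \<in> parcs H" for u v
  proof -
    have "o' {u, v} \<in> parcs H & {fst (o' {u, v}), snd (o' {u, v})} = {u, v}" unfolding o'_def by (rule someI[of _ "(u, v)"]) (use that in simp)
    then show ?thesis by (metis doubleton_eq_iff prod.collapse)
  qed
  have irr: "u ~= v" if "(u, v) \<in> parcs H" for u v using that sH(4) by (auto simp: irrefl_def)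
  have Prev: "P (v, u) = rev_path (P (u, v))" if e: "(u, v) \<in> parcs H" for u v
    using oo[OF e] irr[OF e] by (auto simp: P_def insert_commute)
  have Pap: "G.apath (f u) (P (u, v)) (f v)" "inn (P (u, v)) \<subseteq> I {u, v}" if e: "(u, v) \<in> parcs H" for u v
  proof -
    have e': "(v, u) \<in> parcs H" using symD[OF sH(3) e] .
    have 1: "G.apath (f u) (p0 (u, v)) (f v)" "inn (p0 (u, v)) \<subseteq> I {u, v}" using bspec[OF p0 e] by auto
    have 2: "G.apath (f v) (p0 (v, u)) (f u)" "inn (p0 (v, u)) \<subseteq> I {v, u}" using bspec[OF p0 e'] by auto
    have 3: "G.apath (f u) (rev_path (p0 (v, u))) (f v)" using 2(1) by simp
    have "G.inner_verts (rev_path (p0 (v, u))) = rev (G.inner_verts (p0 (v, u)))" by (rule G.inner_verts_rev_path[OF G.awalkI_apath[OF 2(1)]])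
    then have "set (G.inner_verts (rev_path (p0 (v, u)))) = set (G.inner_verts (p0 (v, u)))" by simp
    then have 4: "inn (rev_path (p0 (v, u))) \<subseteq> I {u, v}" using 2(2) unfolding inn by (simp add: insert_commute)
    show "G.apath (f u) (P (u, v)) (f v)" "inn (P (u, v)) \<subseteq> I {u, v}" using 1 3 4 by (auto simp: P_def)
  qed
  \<comment> \<open>Only the chosen paths enter \<open>K\<close>, since a subdivision may contain
    nothing else.\<close>
  define K where "K = \<lparr>pverts = f ` pverts H Un (\<Union>e\<in>parcs H. inn (P e)), parcs = (\<Union>e\<in>parcs H. set (P e))\<rparr>"
  have Ps: "set (P a) \<subseteq> parcs G" if "a \<in> parcs H" for a
  proof -
    obtain u v where uv: "a = (u, v)" by (cases a)
    show ?thesis using Pap(1)[of u v] that uv by (auto simp: G.apath_def G.awalk_def)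
  qed
  have ends: "fst b \<in> pverts K & snd b \<in> pverts K" if "b \<in> parcs K" for b
  proof -
    obtain u v where uv: "(u, v) \<in> parcs H" "b \<in> set (P (u, v))" using \<open>b \<in> parcs K\<close> by (auto simp: K_def)
    note ap = Pap(1)[OF uv(1)]
    have aw: "G.awalk (f u) (P (u, v)) (f v)" by (rule G.awalkI_apath[OF ap])
    have "fst b \<in> set (G.awalk_verts (f u) (P (u, v)))" "snd b \<in> set (G.awalk_verts (f u) (P (u, v)))"
      using G.awalk_verts_arc1[OF uv(2), of "f u"] G.awalk_verts_arc2[OF aw uv(2)] by simp_all
    moreover have "inn (P (u, v)) = set (G.awalk_verts (f u) (P (u, v))) - {f u, f v}" using G.set_inner_verts[OF ap] by (simp only: inn)
    ultimately have "fst b \<in> inn (P (u, v)) Un {f u, f v}" "snd b \<in> inn (P (u, v)) Un {f u, f v}" by blast+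
    moreover have "inn (P (u, v)) Un {f u, f v} \<subseteq> pverts K" using uv(1) sH(5) by (auto simp: K_def)
    ultimately show ?thesis by blast
  qed
  have sK: "sgr (pverts K) (parcs K)" unfolding sgr_def
  proof (intro conjI)
    show "finite (pverts K)" using sH by (simp add: K_def inn_def)
    show "sym (parcs K)"
    proof (rule symI)
      fix x y assume "(x, y) \<in> parcs K"
      then obtain u v where uv: "(u, v) \<in> parcs H" "(x, y) \<in> set (P (u, v))" by (auto simp: K_def)
      then have "(y, x) \<in> set (P (v, u))" unfolding Prev[OF uv(1)] set_rev_path by force
      moreover have "(v, u) \<in> parcs H" using symD[OF sH(3) uv(1)] .
      ultimately show "(y, x) \<in> parcs K" by (auto simp: K_def)
    qed
    have KG: "parcs K \<subseteq> parcs G" using Ps by (auto simp: K_def)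
    show "irrefl (parcs K)" using sG(4) KG by (auto simp: irrefl_def)
    show "parcs K \<subseteq> pverts K \<times> pverts K" using ends by auto
  qed
  have pK: "pair_graph K" using pair_graph_of_sgr[OF sK] by (simp add: K_def)
  interpret K: pair_graph K by (rule pK)
  have Kin: "inn (P (u, v)) Int f ` pverts H = {}" if "(u, v) \<in> parcs H" for u v using Pap(2)[OF that] I(1) that by blast
  have Kap: "K.apath (f u) (P (u, v)) (f v)" if e: "(u, v) \<in> parcs H" for u v
  proof -
    have "f u \<in> pverts K" using e sH(5) by (auto simp: K_def)
    moreover have "set (P (u, v)) \<subseteq> parcs K" using e by (auto simp: K_def)
    moreover have "pcas (f u) (P (u, v)) (f v)" "distinct (pawalk_verts (f u) (P (u, v)))" using Pap(1)[OF e] by (auto simp: G.apath_def G.awalk_def)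
    ultimately show ?thesis by (simp add: K.apath_def K.awalk_def)
  qed
  have "is_subdivision_of K H" unfolding is_subdivision_of_def inn
  proof (intro conjI exI[of _ f] exI[of _ P])
    show "pair_graph K" by (rule pK)
    show "\<forall>(u, v)\<in>parcs H. K.apath (f u) (P (u, v)) (f v) & P (v, u) = rev_path (P (u, v)) & inn (P (u, v)) Int f ` pverts H = {}"
    proof (clarify)
      fix u v assume e: "(u, v) \<in> parcs H"
      show "K.apath (f u) (P (u, v)) (f v) & P (v, u) = rev_path (P (u, v)) & inn (P (u, v)) Int f ` pverts H = {}"
        using Kap[OF e] Prev[OF e] Kin[OF e] by simp
    qed
    show "\<forall>(u, v)\<in>parcs H. \<forall>(x, y)\<in>parcs H. {u, v} ~= {x, y} --> inn (P (u, v)) Int inn (P (x, y)) = {}"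
    proof (clarify)
      fix u v x y assume h: "(u, v) \<in> parcs H" "(x, y) \<in> parcs H" "{u, v} ~= {x, y}"
      have "I {u, v} Int I {x, y} = {}" using I(2) h by simp
      then show "inn (P (u, v)) Int inn (P (x, y)) = {}" using Pap(2)[OF h(1)] Pap(2)[OF h(2)] by blast
    qed
  qed (use f(1) in \<open>simp_all add: K_def\<close>)
  moreover have "subgraph (with_proj K) (with_proj G)" unfolding subgraph_def
  proof (intro conjI)
    have "inn (P (u, v)) \<subseteq> pverts G" if "(u, v) \<in> parcs H" for u v using Pap(2)[OF that] I(1) that by blast
    then show "verts (with_proj K) \<subseteq> verts (with_proj G)" using f(2) by (auto simp: K_def)
    show "arcs (with_proj K) \<subseteq> arcs (with_proj G)" using Ps by (auto simp: K_def)
    show "wf_digraph (with_proj G)" "wf_digraph (with_proj K)" by unfold_locales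
    show "compatible (with_proj G) (with_proj K)" by (simp add: compatible_def)
  qed
  ultimately show ?thesis unfolding contains_subdivision_def by blast
qed

theorem theorem1p1:
  shows "\<forall>\<epsilon>::real. \<epsilon> > 0 \<longrightarrow> (\<forall>\<Delta>::nat. \<exists>\<alpha>\<^sub>0::real. \<alpha>\<^sub>0 > 0 \<and> (\<exists>d\<^sub>0::real.
    \<forall>\<alpha> d::real. 0 < \<alpha> \<and> \<alpha> < \<alpha>\<^sub>0 \<and> d \<ge> d\<^sub>0 \<longrightarrow>
      (\<forall>(H :: 'a pair_pre_digraph) (G :: 'b pair_pre_digraph).
        pair_graph H \<and> separable \<alpha> H \<and> bipartite H \<and>
        real (card (pverts H)) \<le> (1 - \<epsilon>) * d \<and> max_degree H \<le> \<Delta> \<and>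
        pair_graph G \<and> average_degree G \<ge> d \<longrightarrow>
        contains_subdivision G H)))"
proof (intro allI impI)
  fix \<epsilon> :: real and \<Delta> :: nat assume \<epsilon>: "0 < \<epsilon>"
  \<comment> \<open>The statement also admits \<epsilon> \<ge> 1; decreasing \<epsilon> only relaxes
    the bound on the order of \<open>H\<close>.\<close>
  define \<epsilon>' where "\<epsilon>' = min \<epsilon> (1 / 2)"
  have \<epsilon>': "0 < \<epsilon>'" "\<epsilon>' < 1" "\<epsilon>' <= \<epsilon>" using \<epsilon> by (auto simp: \<epsilon>'_def)
  obtain \<alpha>0 d0 :: real where \<alpha>0: "0 < \<alpha>0" "0 < d0" and main: "\<forall>(\<alpha> :: real) (d :: real) V (E :: ('b \<times> 'b) set) (VH :: 'a set) EH X1 X2 S. 0 < \<alpha> --> \<alpha> < \<alpha>0 --> d0 <= d -->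
    sgr V E --> V ~= {} --> d * real (card V) <= real (card E) -->
    sgr VH EH --> VH \<subseteq> X1 Un X2 --> X1 Int X2 = {} --> EH \<subseteq> X1 \<times> X2 Un X2 \<times> X1 --> (\<forall>h. card (EH `` {h}) <= \<Delta>) -->
    real (card VH) <= (1 - \<epsilon>') * d --> S \<subseteq> VH --> real (card S) <= \<alpha> * real (card VH) -->
    (\<forall>x\<in>VH - S. real (card (reach EH (VH - S) x)) <= \<alpha> * real (card VH)) --> topo V E VH EH"
    using separable_topo[OF \<epsilon>'(1,2), of \<Delta>] by (elim exE conjE) (rule that)
  have "contains_subdivision G H"
    if \<alpha>: "0 < \<alpha>" "\<alpha> < \<alpha>0" and d: "d0 <= d" and H: "pair_graph H" "separable \<alpha> H" "bipartite H" "real (card (pverts H)) <= (1 - \<epsilon>) * d" "max_degree H <= \<Delta>"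
      and G: "pair_graph G" "d <= average_degree G" for \<alpha> d and H :: "'a pair_pre_digraph" and G :: "'b pair_pre_digraph"
  proof (rule topo_contains_subdivision[OF G(1) H(1)])
    have sG: "sgr (pverts G) (parcs G)" and sH: "sgr (pverts H) (parcs H)" using sgr_pair_graph G(1) H(1) by auto
    have d1: "0 < d" using d \<alpha>0 by simp
    \<comment> \<open>A graph without vertices has average degree 0, by the convention for division
      by zero, and \<open>d\<close> is positive since \<open>d0\<close> is.\<close>
    have ne: "pverts G ~= {}"
    proof
      assume "pverts G = {}"
      then have "average_degree G = 0" by (simp add: average_degree_def)
      then show False using G(2) d1 by simp
    qed
    then have cV: "0 < real (card (pverts G))" using sgr_finite(1)[OF sG] by (simp add: card_gt_0_iff)
    have den: "d * real (card (pverts G)) <= real (card (parcs G))"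
    proof -
      have "d * real (card (pverts G)) <= 2 * real (card (edges G))" using G(2) cV by (simp add: average_degree_def pos_le_divide_eq)
      moreover have "real (2 * card (edges G)) <= real (card (parcs G))" using card_parcs_ge[OF G(1)] by (simp only: of_nat_le_iff)
      ultimately show ?thesis by simp
    qed
    have deg: "card (parcs H `` {h}) <= \<Delta>" for h using card_Image_le_max_degree[OF H(1), of h] H(5) by simp
    obtain X1 X2 where X: "pverts H = X1 Un X2" "X1 Int X2 = {}" "parcs H \<subseteq> X1 \<times> X2 Un X2 \<times> X1" using H(3) unfolding bipartite_def by (elim exE conjE) (rule that)
    obtain S where S: "S \<subseteq> pverts H" "real (card S) <= \<alpha> * real (card (pverts H))"
      "\<forall>C\<in>pre_digraph.sccs (with_proj H \<restriction> (pverts H - S)). real (card (verts C)) <= \<alpha> * real (card (pverts H))"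
      using H(2) unfolding separable_def by (elim exE conjE) (rule that)
    have comp: "real (card (reach (parcs H) (pverts H - S) x)) <= \<alpha> * real (card (pverts H))" if x: "x \<in> pverts H - S" for x
    proof -
      obtain C where C: "C \<in> pre_digraph.sccs (with_proj H \<restriction> (pverts H - S))" "card (reach (parcs H) (pverts H - S) x) <= card (verts C)"
        using reach_component[OF H(1) S(1) x] by (elim bexE) (rule that)
      have "real (card (reach (parcs H) (pverts H - S) x)) <= real (card (verts C))" using C(2) by (simp only: of_nat_le_iff)
      then show ?thesis using bspec[OF S(3) C(1)] by linarith
    qed
    have "(1 - \<epsilon>) * d <= (1 - \<epsilon>') * d" using \<epsilon>'(3) d1 by (intro mult_right_mono) auto
    then have VH: "real (card (pverts H)) <= (1 - \<epsilon>') * d" using H(4) by linarith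
    show "topo (pverts G) (parcs G) (pverts H) (parcs H)"
      by (rule main[rule_format, OF \<alpha> d sG ne den sH _ X(2,3) deg VH S(1,2) comp]) (use X(1) in auto)
  qed
  then show "\<exists>\<alpha>\<^sub>0::real. \<alpha>\<^sub>0 > 0 & (\<exists>d\<^sub>0::real.
    \<forall>\<alpha> d::real. 0 < \<alpha> & \<alpha> < \<alpha>\<^sub>0 & d >= d\<^sub>0 -->
      (\<forall>(H :: 'a pair_pre_digraph) (G :: 'b pair_pre_digraph).
        pair_graph H & separable \<alpha> H & bipartite H &
        real (card (pverts H)) <= (1 - \<epsilon>) * d & max_degree H <= \<Delta> &
        pair_graph G & average_degree G >= d -->
        contains_subdivision G H))"
    using \<alpha>0(1) by (intro exI[of _ \<alpha>0] conjI exI[of _ d0]) auto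
qed

end
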